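(* Let $\alpha\in(0,\pi/2)$, $b=\cos\alpha$, and $\mathrm{D}_b=\{x\in\mathbb{R}^2:|x|<b\}$. Let $\mathcal{R}$ be the elliptical Radon transform and $\mathcal{R}^*$ its $L^2$ adjoint. Then the composition $\mathcal{R}^*\mathcal{R}$, when restricted as a transformation from $\mathcal{E}'(\mathrm{D}_b)$ to $\mathcal{D}'(\mathrm{D}_b)$, is an elliptic pseudodifferential operator of order $-1$.
   Context: Let $a=\sin\alpha$, $\gamma_T(s)=(\cos(s-\alpha),\sin(s-\alpha))$ and $\gamma_R(s)=(\cos(s+\alpha),\sin(s+\alpha))$ for $s\in[0,2\pi]$. Let $Y=\{(s,L): s\in[0,2\pi],\ L>2a\}$, where $[0,2\pi]$ is regarded as the unit circle (the endpoints are identified). For $(s,L)\in Y$ let $E(s,L)=\{x\in\mathbb{R}^2 : |x-\gamma_T(s)|+|x-\gamma_R(s)|=L\}$, an ellipse with foci $\gamma_T(s),\gamma_R(s)$. The elliptical Radon transform of a locally integrable function $f$ is $\mathcal{R}f(s,L)=\int_{x\in E(s,L)}f(x)\,dl(x)$, where $dl$ is arc length measure on $E(s,L)$; it is extended in the usual way to $\mathcal{E}'(\mathrm{D}_b)$, the space of compactly supported distributions supported in $\mathrm{D}_b$. $\mathcal{D}'(\mathrm{D}_b)$ is the space of distributions on $\mathrm{D}_b$. The backprojection transform is $\mathcal{R}^*g(x)=\int_{s\in[0,2\pi]} g\big(s,|x-\gamma_R(s)|+|x-\gamma_T(s)|\big)\,d\mu_x(s)$, where the measure $d\mu_x(s)$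 on the circle is smooth and positive (a smooth positive density, depending smoothly on $x$, times $ds$), chosen so that $\mathcal{R}^*$ is the $L^2$ adjoint of $\mathcal{R}$. Since $\mathcal{R}^*$ integrates over a compact set, it can be composed with $\mathcal{R}$. *)

theory Defs
  imports "HOL-Analysis.Analysis"
begin

section \<open>Smooth functions and distributions\<close>

definition dir_deriv :: "'a::real_normed_vector \<Rightarrow> ('a \<Rightarrow> 'b::real_normed_vector) \<Rightarrow> 'a \<Rightarrow> 'b" where
  "dir_deriv v f = (\<lambda>x. frechet_derivative f (at x) v)"

text \<open>For a list \<open>vs\<close> of basis vectors, \<open>iter_deriv vs\<close> is the partial derivative whose multi-index
  counts the occurrences of each basis vector in \<open>vs\<close>; its order is \<open>length vs\<close>.\<close>
definition iter_deriv :: "'a::real_normed_vector list \<Rightarrow> ('a \<Rightarrow> 'b::real_normed_vector) \<Rightarrow> 'a \<Rightarrow> 'b" where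
  "iter_deriv vs f = foldr dir_deriv vs f"

text \<open>\<open>C\<^sup>\<infinity>(S)\<close> for open \<open>S\<close>. Differentiability is Frechet differentiability, so all iterated partial
  derivatives are in particular continuous. Nothing is required outside \<open>S\<close>.\<close>
definition smooth_on :: "'a::euclidean_space set \<Rightarrow> ('a \<Rightarrow> 'b::real_normed_vector) \<Rightarrow> bool" where
  "smooth_on S f \<longleftrightarrow> (\<forall>vs\<in>lists Basis. \<forall>x\<in>S. iter_deriv vs f differentiable (at x))"

definition Ck_norm :: "nat \<Rightarrow> 'a::euclidean_space set \<Rightarrow> ('a \<Rightarrow> complex) \<Rightarrow> real" where
  "Ck_norm N K f = Sup (insert 0
     {norm (iter_deriv vs f x) | vs x. vs \<in> lists Basis \<and> length vs \<le> N \<and> x \<in> K})"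

definition test_functions_in :: "'a::euclidean_space set \<Rightarrow> ('a \<Rightarrow> complex) set" where
  "test_functions_in K = {\<phi>. smooth_on UNIV \<phi> \<and> (\<forall>x. x \<notin> K \<longrightarrow> \<phi> x = 0)}"

definition test_functions :: "'a::euclidean_space set \<Rightarrow> ('a \<Rightarrow> complex) set" where
  "test_functions \<Omega> = (\<Union>K\<in>{K. compact K \<and> K \<subseteq> \<Omega>}. test_functions_in K)"

definition linear_functional_on ::
    "('a \<Rightarrow> complex) set \<Rightarrow> (('a \<Rightarrow> complex) \<Rightarrow> complex) \<Rightarrow> bool" where
  "linear_functional_on V u \<longleftrightarrow>
     (\<forall>\<phi>\<in>V. \<forall>\<psi>\<in>V. u (\<lambda>x. \<phi> x + \<psi> x) = u \<phi> + u \<psi>) \<and>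
     (\<forall>c. \<forall>\<phi>\<in>V. u (\<lambda>x. c * \<phi> x) = c * u \<phi>)"

text \<open>\<open>\<D>'(\<Omega>)\<close>.\<close>
definition distributions :: "'a::euclidean_space set \<Rightarrow> (('a \<Rightarrow> complex) \<Rightarrow> complex) set" where
  "distributions \<Omega> = {u. linear_functional_on (test_functions \<Omega>) u \<and>
     (\<forall>K. compact K \<and> K \<subseteq> \<Omega> \<longrightarrow>
        (\<exists>C N. \<forall>\<phi>\<in>test_functions_in K. norm (u \<phi>) \<le> C * Ck_norm N K \<phi>))}"

text \<open>\<open>\<E>'(\<Omega>)\<close>, the compactly supported distributions in \<open>\<Omega>\<close>, as the continuous linear functionals on
  \<open>C\<^sup>\<infinity>(\<Omega>)\<close>. Since \<open>K \<subseteq> \<Omega>\<close>, the estimate also makes \<open>u \<phi>\<close> independent of the values of \<open>\<phi>\<close>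
  outside \<open>\<Omega>\<close>.\<close>
definition compact_distributions ::
    "'a::euclidean_space set \<Rightarrow> (('a \<Rightarrow> complex) \<Rightarrow> complex) set" where
  "compact_distributions \<Omega> = {u. linear_functional_on {\<phi>. smooth_on \<Omega> \<phi>} u \<and>
     (\<exists>K C N. compact K \<and> K \<subseteq> \<Omega> \<and>
        (\<forall>\<phi>. smooth_on \<Omega> \<phi> \<longrightarrow> norm (u \<phi>) \<le> C * Ck_norm N K \<phi>))}"


section \<open>Pseudodifferential operators\<close>

text \<open>The class \<open>S\<^sup>m(U \<times> \<real>\<^sup>N)\<close> (type \<open>1,0\<close>) of Hoermander, with estimates locally uniform in \<open>U\<close>.\<close>
definition symbol_class ::
    "real \<Rightarrow> 'z::euclidean_space set \<Rightarrow> ('z \<times> 'k::euclidean_space \<Rightarrow> complex) set" where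
  "symbol_class m U = {a. smooth_on (U \<times> UNIV) a \<and>
     (\<forall>K. compact K \<and> K \<subseteq> U \<longrightarrow>
       (\<forall>us\<in>lists Basis. \<forall>vs\<in>lists Basis. \<exists>C. \<forall>z\<in>K. \<forall>\<xi>.
          norm (iter_deriv (map (\<lambda>u. (u, 0)) us @ map (\<lambda>v. (0, v)) vs) a (z, \<xi>))
            \<le> C * (1 + norm \<xi>) powr (m - real (length vs))))}"

text \<open>\<open>Op(a)\<phi>(x) = (2\<pi>)\<^sup>-\<^sup>n \<integral>\<integral> e\<^sup>i\<^sup>(\<^sup>x\<^sup>-\<^sup>y\<^sup>)\<^sup>\<xi> a(x,y,\<xi>) \<phi>(y) dy d\<xi>\<close> for test functions \<open>\<phi>\<close>. The inner integral
  decays rapidly in \<open>\<xi>\<close>, so that the iterated integral converges absolutely.\<close>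
definition pseudodiff ::
    "(('a::euclidean_space \<times> 'a) \<times> 'a \<Rightarrow> complex) \<Rightarrow> ('a \<Rightarrow> complex) \<Rightarrow> 'a \<Rightarrow> complex" where
  "pseudodiff a \<phi> x = complex_of_real (1 / (2 * pi) ^ DIM('a)) *
     (LINT \<xi>|lborel. LINT y|lborel. cis ((x - y) \<bullet> \<xi>) * a ((x, y), \<xi>) * \<phi> y)"

text \<open>\<open>Op(transpose_amplitude a)\<close> is the transpose of \<open>Op(a)\<close> for the bilinear pairing
  \<open>\<integral> f(x) g(x) dx\<close>.\<close>
definition transpose_amplitude ::
    "(('a::euclidean_space \<times> 'a) \<times> 'a \<Rightarrow> complex) \<Rightarrow> ('a \<times> 'a) \<times> 'a \<Rightarrow> complex" where
  "transpose_amplitude a = (\<lambda>((x, y), \<xi>). a ((y, x), - \<xi>))"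

text \<open>\<open>Op(a)\<close> on \<open>\<E>'(\<Omega>)\<close>, by duality.\<close>
definition pseudodiff_dist ::
    "(('a::euclidean_space \<times> 'a) \<times> 'a \<Rightarrow> complex) \<Rightarrow>
     (('a \<Rightarrow> complex) \<Rightarrow> complex) \<Rightarrow> ('a \<Rightarrow> complex) \<Rightarrow> complex" where
  "pseudodiff_dist a u = (\<lambda>\<phi>. u (pseudodiff (transpose_amplitude a) \<phi>))"

text \<open>\<open>P\<close> is \<open>Op(a)\<close>, as an operator from \<open>\<E>'(\<Omega>)\<close> to \<open>\<D>'(\<Omega>)\<close>, for an amplitude \<open>a\<close> of order \<open>m\<close>.
  Operators with smooth kernel are of this form (with \<open>a\<close> of order \<open>-\<infinity>\<close>), so no separate smoothing
  remainder is needed.\<close>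
definition is_pseudodiff_with ::
    "'a::euclidean_space set \<Rightarrow> real \<Rightarrow> (('a \<times> 'a) \<times> 'a \<Rightarrow> complex) \<Rightarrow>
     ((('a \<Rightarrow> complex) \<Rightarrow> complex) \<Rightarrow> ('a \<Rightarrow> complex) \<Rightarrow> complex) \<Rightarrow> bool" where
  "is_pseudodiff_with \<Omega> m a P \<longleftrightarrow> a \<in> symbol_class m (\<Omega> \<times> \<Omega>) \<and>
     (\<forall>u\<in>compact_distributions \<Omega>. P u \<in> distributions \<Omega> \<and>
        (\<forall>\<phi>\<in>test_functions \<Omega>. P u \<phi> = pseudodiff_dist a u \<phi>))"

text \<open>The principal symbol of \<open>Op(a)\<close> is the class of \<open>(x,\<xi>) \<mapsto> a(x,x,\<xi>)\<close> in \<open>S\<^sup>m / S\<^sup>m\<^sup>-\<^sup>1\<close>. The lower bound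
  does not change when a symbol of order \<open>m - 1\<close> is added, and is thus a property of that class.\<close>
definition elliptic_symbol ::
    "real \<Rightarrow> 'z::euclidean_space set \<Rightarrow> ('z \<times> 'k::euclidean_space \<Rightarrow> complex) \<Rightarrow> bool" where
  "elliptic_symbol m U p \<longleftrightarrow>
     (\<forall>K. compact K \<and> K \<subseteq> U \<longrightarrow>
       (\<exists>c>0. \<exists>M. \<forall>z\<in>K. \<forall>\<xi>. norm \<xi> \<ge> M \<longrightarrow> norm (p (z, \<xi>)) \<ge> c * (1 + norm \<xi>) powr m))"

definition elliptic_pseudodiff_operator ::
    "'a::euclidean_space set \<Rightarrow> real \<Rightarrow>
     ((('a \<Rightarrow> complex) \<Rightarrow> complex) \<Rightarrow> ('a \<Rightarrow> complex) \<Rightarrow> complex) \<Rightarrow> bool" where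
  "elliptic_pseudodiff_operator \<Omega> m P \<longleftrightarrow>
     (\<exists>a. is_pseudodiff_with \<Omega> m a P \<and> elliptic_symbol m \<Omega> (\<lambda>(x, \<xi>). a ((x, x), \<xi>)))"


section \<open>The elliptical Radon transform\<close>

definition gamma_T :: "real \<Rightarrow> real \<Rightarrow> real^2" where
  "gamma_T \<alpha> s = vector [cos (s - \<alpha>), sin (s - \<alpha>)]"

definition gamma_R :: "real \<Rightarrow> real \<Rightarrow> real^2" where
  "gamma_R \<alpha> s = vector [cos (s + \<alpha>), sin (s + \<alpha>)]"

definition travel :: "real \<Rightarrow> real \<Rightarrow> real^2 \<Rightarrow> real" where
  "travel \<alpha> s x = norm (x - gamma_T \<alpha> s) + norm (x - gamma_R \<alpha> s)"

definition ellipse :: "real \<Rightarrow> real \<Rightarrow> real \<Rightarrow> (real^2) set" where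
  "ellipse \<alpha> s L = {x. travel \<alpha> s x = L}"

text \<open>Here \<open>a = sin \<alpha>\<close>. Center \<open>cos \<alpha> (cos s, sin s)\<close>, half-axes \<open>L/2\<close> along the line through the foci and
  \<open>sqrt (L\<^sup>2/4 - a\<^sup>2)\<close> orthogonal to it.\<close>
definition ellipse_param :: "real \<Rightarrow> real \<Rightarrow> real \<Rightarrow> real \<Rightarrow> real^2" where
  "ellipse_param \<alpha> s L t =
     cos \<alpha> *\<^sub>R vector [cos s, sin s] +
     (L / 2 * cos t) *\<^sub>R vector [- sin s, cos s] +
     (sqrt (L\<^sup>2 / 4 - (sin \<alpha>)\<^sup>2) * sin t) *\<^sub>R vector [cos s, sin s]"

lemma gamma_T_alt:
  "gamma_T \<alpha> s = cos \<alpha> *\<^sub>R vector [cos s, sin s] - sin \<alpha> *\<^sub>R vector [- sin s, cos s]"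
  by (simp add: gamma_T_def vec_eq_iff forall_2 cos_diff sin_diff algebra_simps)

lemma gamma_R_alt:
  "gamma_R \<alpha> s = cos \<alpha> *\<^sub>R vector [cos s, sin s] + sin \<alpha> *\<^sub>R vector [- sin s, cos s]"
  by (simp add: gamma_R_def vec_eq_iff forall_2 cos_add sin_add algebra_simps)

lemma norm_frame:
  "norm (p *\<^sub>R vector [- sin s, cos s] + q *\<^sub>R (vector [cos s, sin s] :: real^2)) = sqrt (p\<^sup>2 + q\<^sup>2)"
proof -
  have "(q * cos s - p * sin s)\<^sup>2 + (p * cos s + q * sin s)\<^sup>2
      = (p\<^sup>2 + q\<^sup>2) * ((sin s)\<^sup>2 + (cos s)\<^sup>2)"
    by algebra
  then show ?thesis
    by (simp add: norm_vec_def L2_set_def sum_2 algebra_simps)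
qed

lemma two_foci_iff:
  fixes a A p q :: real
  assumes a: "0 < a" "a < A"
  shows "sqrt ((p + a)\<^sup>2 + q\<^sup>2) + sqrt ((p - a)\<^sup>2 + q\<^sup>2) = 2 * A
    \<longleftrightarrow> (p / A)\<^sup>2 + (q / sqrt (A\<^sup>2 - a\<^sup>2))\<^sup>2 = 1"
proof -
  have B: "A\<^sup>2 - a\<^sup>2 > 0"
    using a by (simp add: power_strict_mono)
  define X where "X = sqrt ((p + a)\<^sup>2 + q\<^sup>2)"
  define Z where "Z = sqrt ((p - a)\<^sup>2 + q\<^sup>2)"
  have X: "X \<ge> 0" "X\<^sup>2 = (p + a)\<^sup>2 + q\<^sup>2" and Z: "Z \<ge> 0" "Z\<^sup>2 = (p - a)\<^sup>2 + q\<^sup>2"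
    by (simp_all add: X_def Z_def)
  have rhs: "(p / A)\<^sup>2 + (q / sqrt (A\<^sup>2 - a\<^sup>2))\<^sup>2 = 1 \<longleftrightarrow>
      p\<^sup>2 * (A\<^sup>2 - a\<^sup>2) + q\<^sup>2 * A\<^sup>2 = A\<^sup>2 * (A\<^sup>2 - a\<^sup>2)"
  proof -
    have "(p / A)\<^sup>2 + (q / sqrt (A\<^sup>2 - a\<^sup>2))\<^sup>2 = p\<^sup>2 / A\<^sup>2 + q\<^sup>2 / (A\<^sup>2 - a\<^sup>2)"
      using B by (simp add: power_divide)
    also have "\<dots> = (p\<^sup>2 * (A\<^sup>2 - a\<^sup>2) + q\<^sup>2 * A\<^sup>2) / (A\<^sup>2 * (A\<^sup>2 - a\<^sup>2))"
      using a B by (subst add_frac_eq) auto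
    finally show ?thesis
      using a B by (simp add: divide_eq_eq)
  qed
  show ?thesis
    unfolding rhs X_def[symmetric] Z_def[symmetric]
  proof
    assume sum: "X + Z = 2 * A"
    have "X\<^sup>2 - Z\<^sup>2 = 4 * a * p"
      using X Z by algebra
    then have "2 * A * (X - Z) = 4 * a * p"
      using sum by algebra
    then have "A * X = A\<^sup>2 + a * p"
      using sum by algebra
    then have "A\<^sup>2 * ((p + a)\<^sup>2 + q\<^sup>2) = (A\<^sup>2 + a * p)\<^sup>2"
      using X by algebra
    then show "p\<^sup>2 * (A\<^sup>2 - a\<^sup>2) + q\<^sup>2 * A\<^sup>2 = A\<^sup>2 * (A\<^sup>2 - a\<^sup>2)"
      by algebra
  next
    assume eq: "p\<^sup>2 * (A\<^sup>2 - a\<^sup>2) + q\<^sup>2 * A\<^sup>2 = A\<^sup>2 * (A\<^sup>2 - a\<^sup>2)"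
    have "p\<^sup>2 * (A\<^sup>2 - a\<^sup>2) \<le> A\<^sup>2 * (A\<^sup>2 - a\<^sup>2)"
    proof -
      have "0 \<le> q\<^sup>2 * A\<^sup>2" by simp
      with eq show ?thesis by linarith
    qed
    then have "p\<^sup>2 \<le> A\<^sup>2"
      using B by simp
    then have p: "\<bar>p\<bar> \<le> A"
      using a abs_le_square_iff[of p A] by simp
    have "\<bar>a * p\<bar> \<le> A * A"
      unfolding abs_mult using a p by (intro mult_mono) auto
    then have ap: "A\<^sup>2 + a * p \<ge> 0" "A\<^sup>2 - a * p \<ge> 0"
      by (auto simp: power2_eq_square)
    have "(A * X)\<^sup>2 = (A\<^sup>2 + a * p)\<^sup>2" "(A * Z)\<^sup>2 = (A\<^sup>2 - a * p)\<^sup>2"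
      using eq X Z by algebra+
    then have "A * X = A\<^sup>2 + a * p" "A * Z = A\<^sup>2 - a * p"
      using X(1) Z(1) a ap power2_eq_iff_nonneg[of "A * X" "A\<^sup>2 + a * p"]
        power2_eq_iff_nonneg[of "A * Z" "A\<^sup>2 - a * p"] by simp_all
    then have "A * (X + Z) = A * (2 * A)"
      by algebra
    then show "X + Z = 2 * A"
      using a by simp
  qed
qed

lemma ellipse_frame_iff:
  assumes "0 < sin \<alpha>" "2 * sin \<alpha> < L"
  shows "cos \<alpha> *\<^sub>R vector [cos s, sin s] + p *\<^sub>R vector [- sin s, cos s] + q *\<^sub>R vector [cos s, sin s]
      \<in> ellipse \<alpha> s L
    \<longleftrightarrow> (p / (L / 2))\<^sup>2 + (q / sqrt (L\<^sup>2 / 4 - (sin \<alpha>)\<^sup>2))\<^sup>2 = 1"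
proof -
  let ?c = "cos \<alpha> *\<^sub>R vector [cos s, sin s] :: real^2"
  let ?e = "vector [- sin s, cos s] :: real^2" and ?n = "vector [cos s, sin s] :: real^2"
  have eqs: "?c + p *\<^sub>R ?e + q *\<^sub>R ?n - gamma_T \<alpha> s = (p + sin \<alpha>) *\<^sub>R ?e + q *\<^sub>R ?n"
       "?c + p *\<^sub>R ?e + q *\<^sub>R ?n - gamma_R \<alpha> s = (p - sin \<alpha>) *\<^sub>R ?e + q *\<^sub>R ?n"
    by (simp_all add: gamma_T_alt gamma_R_alt scaleR_add_left scaleR_diff_left)
  show ?thesis
    unfolding ellipse_def travel_def mem_Collect_eq eqs norm_frame
    using two_foci_iff[of "sin \<alpha>" "L / 2" p q] assms by (simp add: power_divide)
qed

lemma frame_expand: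
  obtains p q where
    "x = cos \<alpha> *\<^sub>R vector [cos s, sin s] + p *\<^sub>R vector [- sin s, cos s]
       + q *\<^sub>R (vector [cos s, sin s] :: real^2)"
proof
  define y :: "real^2" where "y = x - cos \<alpha> *\<^sub>R vector [cos s, sin s]"
  have "y = (- (y $ 1 * sin s) + y $ 2 * cos s) *\<^sub>R vector [- sin s, cos s]
       + (y $ 1 * cos s + y $ 2 * sin s) *\<^sub>R (vector [cos s, sin s] :: real^2)"
  proof -
    have sc: "(sin s)\<^sup>2 + (cos s)\<^sup>2 = 1" by simp
    have "y $ 1 = (- (y $ 1 * sin s) + y $ 2 * cos s) * (- sin s) + (y $ 1 * cos s + y $ 2 * sin s) * cos s"
         "y $ 2 = (- (y $ 1 * sin s) + y $ 2 * cos s) * cos s + (y $ 1 * cos s + y $ 2 * sin s) * sin s"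
      using sc by algebra+
    then show ?thesis
      by (simp add: vec_eq_iff forall_2)
  qed
  then have "cos \<alpha> *\<^sub>R vector [cos s, sin s] + y = cos \<alpha> *\<^sub>R vector [cos s, sin s]
       + ((- (y $ 1 * sin s) + y $ 2 * cos s) *\<^sub>R vector [- sin s, cos s]
       + (y $ 1 * cos s + y $ 2 * sin s) *\<^sub>R (vector [cos s, sin s] :: real^2))"
    by (rule arg_cong)
  then show "x = cos \<alpha> *\<^sub>R vector [cos s, sin s]
       + (- (y $ 1 * sin s) + y $ 2 * cos s) *\<^sub>R vector [- sin s, cos s]
       + (y $ 1 * cos s + y $ 2 * sin s) *\<^sub>R (vector [cos s, sin s] :: real^2)"
    by (simp only: y_def add_diff_cancel add.assoc add_diff_eq add_diff_cancel_left')
qed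

lemma ellipse_param_bij:
  assumes "0 < \<alpha>" "\<alpha> < pi / 2" "2 * sin \<alpha> < L"
  shows "bij_betw (ellipse_param \<alpha> s L) {0..<2 * pi} (ellipse \<alpha> s L)"
proof -
  have a: "0 < sin \<alpha>"
    using assms by (intro sin_gt_zero) auto
  define A where "A = L / 2"
  define B where "B = sqrt (L\<^sup>2 / 4 - (sin \<alpha>)\<^sup>2)"
  have A: "A > 0"
    using a assms by (simp add: A_def)
  have "(sin \<alpha>)\<^sup>2 < (L / 2)\<^sup>2"
    using a assms by (intro power_strict_mono) auto
  then have B: "B > 0"
    by (simp add: B_def power_divide)
  have mem: "ellipse_param \<alpha> s L t \<in> ellipse \<alpha> s L" for t
    unfolding ellipse_param_def ellipse_frame_iff[OF a assms(3)]
    using A B by (simp add: A_def[symmetric] B_def[symmetric])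
  have inj: "inj_on (ellipse_param \<alpha> s L) {0..<2 * pi}"
  proof (rule inj_onI)
    fix t t'
    assume t: "t \<in> {0..<2 * pi}" "t' \<in> {0..<2 * pi}"
      and eq: "ellipse_param \<alpha> s L t = ellipse_param \<alpha> s L t'"
    have "(A * cos t - A * cos t') *\<^sub>R vector [- sin s, cos s]
        + (B * sin t - B * sin t') *\<^sub>R (vector [cos s, sin s] :: real^2) = 0"
      using eq by (simp add: ellipse_param_def A_def[symmetric] B_def[symmetric] algebra_simps)
    then have "(A * cos t - A * cos t')\<^sup>2 + (B * sin t - B * sin t')\<^sup>2 = 0"
      using norm_frame[of "A * cos t - A * cos t'" s "B * sin t - B * sin t'"] by simp
    then have "cos t = cos t'" "sin t = sin t'"
      using A B by (simp_all add: sum_power2_eq_zero_iff)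
    then obtain n where n: "t = t' + 2 * pi * of_int n"
      using sin_cos_eq_iff[of t t'] by (auto simp: mult_ac)
    have "\<bar>2 * pi * of_int n\<bar> < 2 * pi"
      using t unfolding n by auto
    then have "\<bar>real_of_int n\<bar> < 1"
      by (simp add: abs_mult)
    then have "n = 0"
      by linarith
    then show "t = t'"
      using n by simp
  qed
  have "x \<in> ellipse_param \<alpha> s L ` {0..<2 * pi}" if x: "x \<in> ellipse \<alpha> s L" for x
  proof -
    obtain p q where pq: "x = cos \<alpha> *\<^sub>R vector [cos s, sin s] + p *\<^sub>R vector [- sin s, cos s]
       + q *\<^sub>R (vector [cos s, sin s] :: real^2)"
      by (rule frame_expand)
    have "(p / A)\<^sup>2 + (q / B)\<^sup>2 = 1"
      using x unfolding pq ellipse_frame_iff[OF a assms(3)] A_def B_def .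
    then obtain t where t: "0 \<le> t" "t < 2 * pi" "p / A = cos t" "q / B = sin t"
      using sincos_total_2pi[of "p / A" "q / B"] by metis
    then have "p = A * cos t" "q = B * sin t"
      using A B by (simp_all add: field_simps)
    then have "x = ellipse_param \<alpha> s L t"
      unfolding pq ellipse_param_def A_def B_def by simp
    then show ?thesis
      using t by auto
  qed
  then show ?thesis
    using inj mem by (auto simp: bij_betw_def)
qed

text \<open>Integration over \<open>ellipse \<alpha> s L\<close> with respect to arc length, through the parametrization above
  (see \<open>ellipse_param_bij\<close>). Functions on \<open>Y\<close> are extended by zero to \<open>L \<le> 2 sin \<alpha>\<close>.\<close>
definition elliptical_radon :: "real \<Rightarrow> (real^2 \<Rightarrow> complex) \<Rightarrow> real \<times> real \<Rightarrow> complex" where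
  "elliptical_radon \<alpha> f = (\<lambda>(s, L). if L > 2 * sin \<alpha> then
     (LINT t:{0..2 * pi}|lborel. f (ellipse_param \<alpha> s L t) *
        complex_of_real (norm (vector_derivative (ellipse_param \<alpha> s L) (at t)))) else 0)"

text \<open>\<open>C\<^sub>c\<^sup>\<infinity>(Y)\<close>, \<open>Y\<close> being the product of the circle and \<open>(2 sin \<alpha>, \<infinity>)\<close>: functions on the circle are
  \<open>2\<pi>\<close>-periodic functions on the line.\<close>
definition test_functions_Y :: "real \<Rightarrow> (real \<times> real \<Rightarrow> complex) set" where
  "test_functions_Y \<alpha> = {g. smooth_on UNIV g \<and> (\<forall>s L. g (s + 2 * pi, L) = g (s, L)) \<and>
     (\<exists>c d. 2 * sin \<alpha> < c \<and> (\<forall>s L. L \<notin> {c..d} \<longrightarrow> g (s, L) = 0))}"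

text \<open>The backprojection with respect to \<open>d\<mu>\<^sub>x(s) = w(x,s) ds\<close>.\<close>
definition backprojection ::
    "real \<Rightarrow> ((real^2) \<times> real \<Rightarrow> real) \<Rightarrow> (real \<times> real \<Rightarrow> complex) \<Rightarrow> real^2 \<Rightarrow> complex" where
  "backprojection \<alpha> w g x =
     (LINT s:{0..2 * pi}|lborel. g (s, travel \<alpha> s x) * complex_of_real (w (x, s)))"

text \<open>\<open>w\<close> is a smooth positive density for which the backprojection is the adjoint of the Radon
  transform for the inner products of \<open>L\<^sup>2(Y, ds dL)\<close> and \<open>L\<^sup>2(D\<^sub>b, dx)\<close>. By the coarea formula,
  \<open>w(x,s)\<close> is the norm of the gradient of \<open>travel \<alpha> s\<close> at \<open>x\<close>.\<close>
definition adjoint_density :: "real \<Rightarrow> (real^2) set \<Rightarrow> ((real^2) \<times> real \<Rightarrow> real) \<Rightarrow> bool" where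
  "adjoint_density \<alpha> D w \<longleftrightarrow>
     smooth_on (D \<times> UNIV) w \<and>
     (\<forall>x\<in>D. \<forall>s. w (x, s) > 0 \<and> w (x, s + 2 * pi) = w (x, s)) \<and>
     (\<forall>f\<in>test_functions D. \<forall>g\<in>test_functions_Y \<alpha>.
        (LINT s:{0..2 * pi}|lborel. LINT L:{2 * sin \<alpha><..}|lborel.
            elliptical_radon \<alpha> f (s, L) * cnj (g (s, L)))
        = (LINT x:D|lborel. f x * cnj (backprojection \<alpha> w g x)))"

text \<open>The extensions to distributions by duality. As \<open>w\<close> is real, the adjoint is also the transpose
  for the bilinear pairing.\<close>
definition radon_dist ::
    "real \<Rightarrow> ((real^2) \<times> real \<Rightarrow> real) \<Rightarrow>
     ((real^2 \<Rightarrow> complex) \<Rightarrow> complex) \<Rightarrow> (real \<times> real \<Rightarrow> complex) \<Rightarrow> complex" where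
  "radon_dist \<alpha> w u = (\<lambda>g. u (backprojection \<alpha> w g))"

definition backprojection_dist ::
    "real \<Rightarrow> ((real \<times> real \<Rightarrow> complex) \<Rightarrow> complex) \<Rightarrow> (real^2 \<Rightarrow> complex) \<Rightarrow> complex" where
  "backprojection_dist \<alpha> h = (\<lambda>\<phi>. h (elliptical_radon \<alpha> \<phi>))"

end

theory Submission
  imports Defs "HOL-Probability.Probability"
begin

text \<open>Parametrizing the ellipse through \<open>x\<close> with parameter \<open>s\<close> by the direction \<open>t\<close> of the chord from \<open>x\<close>,
  of signed length \<open>r(x,s,t)\<close>, gives
  \<open>R\<^sup>* R \<phi>(x) = \<integral>\<integral> c(x,s,t) \<phi>(x + r(x,s,t) dirv t) ds dt\<close> with a smooth positive weight \<open>c\<close>. By Fourier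
  inversion this is the transpose of \<open>Op(a)\<close> for an oscillatory integral
  \<open>a((x,y),\<xi>) = \<integral>\<integral> B((x,y),s,t) cis (- r(y,s,t) dirv t \<bullet> \<xi>) ds dt\<close>.

  The Bolker condition says that \<open>\<partial>r/\<partial>s \<noteq> 0\<close> whenever the chord ends in the closed disc. Integrations by
  parts in \<open>s\<close> and \<open>t\<close> then give \<open>|a| = O(1 / (1 + |\<xi>|))\<close>, and each derivative in \<open>\<xi>\<close> produces a factor
  \<open>r\<close> that gains another power of \<open>|\<xi>|\<close>, so \<open>a\<close> is a symbol of order \<open>-1\<close>.

  For ellipticity, no stationary phase expansion is needed: \<open>l Re a(l \<xi>)\<close> is almost decreasing in \<open>l\<close>, while the
  Fejer average of \<open>Re a(l \<xi>)\<close> over \<open>0 \<le> l \<le> L\<close> is at least of size \<open>ln L\<close>, since for every \<open>t\<close> the ellipse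
  with some \<open>s\<close> is tangent to \<open>dirv t\<close> at \<open>x\<close>, so that \<open>r\<close> has a zero.\<close>

subsection \<open>Smooth functions\<close>

text \<open>Distributions enter by duality only, so everything reduces to the action of the
  transpose on test functions. Transposition swaps the base points and reflects
  \<open>\<xi>\<close>, which is why the chord inside \<open>a\<close> starts at \<open>y\<close>
  and carries a minus sign. The obstacle is that the wave oscillates in \<open>s\<close> only at the
  rate \<open>\<tau> * r_s\<close> with \<open>\<tau> = dirv t \<bullet> \<xi>\<close>, which
  degenerates for directions orthogonal to \<open>\<xi>\<close>. The decay has to be recovered from
  the integral over \<open>t\<close>: the weight \<open>1 / (1 + \<tau>^2)\<close> left by two
  integrations by parts has mass of order \<open>1 / |\<xi>|\<close>, and this is the origin of the
  order -1. A base derivative that falls on the phase produces a growing factor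
  \<open>\<tau>\<close>. Dividing by \<open>r_s\<close> trades it for an \<open>s\<close>-derivative
  of the amplitude, but this must not destroy the powers of \<open>r\<close> gained from derivatives
  in \<open>\<xi>\<close>. The combination that respects them is differentiation along the vector
  field \<open>e - (r_e / r_s) * d/ds\<close>, which annihilates \<open>r\<close>. Chords that leave
  the closed disc are not covered by the Bolker condition, so amplitudes have to vanish there
  without changing the operator.\<close>

lemma dir_deriv_eqI:
  assumes "(f has_derivative f') (at x)"
  shows "dir_deriv v f x = f' v"
  using frechet_derivative_at[OF assms] by (simp add: dir_deriv_def)

lemma has_derivative_dir_deriv:
  assumes "f differentiable (at x)"
  shows "(f has_derivative (\<lambda>v. dir_deriv v f x)) (at x)"
  using assms frechet_derivative_works[of f "at x"] by (simp add: dir_deriv_def)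

lemma dir_deriv_cong:
  assumes "open S" "x \<in> S" "\<And>y. y \<in> S \<Longrightarrow> f y = g y" "f differentiable (at x)"
  shows "dir_deriv v f x = dir_deriv v g x"
  using frechet_derivative_transform_within_open[of f x S g] assms by (simp add: dir_deriv_def)

lemma differentiable_cong_open:
  assumes "open S" "x \<in> S" "\<And>y. y \<in> S \<Longrightarrow> f y = g y" "f differentiable (at x)"
  shows "g differentiable (at x)"
  using assms has_derivative_transform_within_open unfolding differentiable_def by blast

lemma dir_deriv_sum_Basis:
  fixes f :: "'a::euclidean_space \<Rightarrow> 'b::real_normed_vector"
  assumes "f differentiable (at x)"
  shows "dir_deriv v f x = (\<Sum>j\<in>Basis. (v \<bullet> j) *\<^sub>R dir_deriv j f x)"
proof -
  interpret bounded_linear "\<lambda>v. dir_deriv v f x"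
    using has_derivative_dir_deriv[OF assms] by (rule has_derivative_bounded_linear)
  have "dir_deriv v f x = dir_deriv (\<Sum>j\<in>Basis. (v \<bullet> j) *\<^sub>R j) f x"
    by (simp add: euclidean_representation)
  then show ?thesis
    by (simp add: sum scaleR)
qed

text \<open>\<open>n + 1\<close> times differentiable; peeling off the innermost derivative makes induction on \<open>n\<close> work.\<close>
primrec diff_upto :: "nat \<Rightarrow> 'a::euclidean_space set \<Rightarrow> ('a \<Rightarrow> 'b::real_normed_vector) \<Rightarrow> bool" where
  "diff_upto 0 S f = (\<forall>x\<in>S. f differentiable (at x))"
| "diff_upto (Suc n) S f = ((\<forall>x\<in>S. f differentiable (at x)) \<and> (\<forall>v\<in>Basis. diff_upto n S (dir_deriv v f)))"

lemma diff_upto_differentiable: "diff_upto n S f \<Longrightarrow> x \<in> S \<Longrightarrow> f differentiable (at x)"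
  by (cases n) auto

lemma diff_upto_Suc_D: "diff_upto (Suc n) S f \<Longrightarrow> diff_upto n S f"
  by (induction n arbitrary: f) auto

lemma diff_upto_cong:
  assumes "open S" "\<And>x. x \<in> S \<Longrightarrow> f x = g x" "diff_upto n S f"
  shows "diff_upto n S g"
  using assms(2,3)
proof (induction n arbitrary: f g)
  case 0
  then show ?case using differentiable_cong_open[OF assms(1)] by (metis diff_upto.simps(1))
next
  case (Suc n)
  have d: "\<forall>x\<in>S. f differentiable (at x)" using Suc.prems by auto
  have "diff_upto n S (dir_deriv v g)" if "v \<in> Basis" for v
    using Suc.IH[of "dir_deriv v f" "dir_deriv v g"] Suc.prems that d
      dir_deriv_cong[OF assms(1), of _ f g v] by auto
  then show ?case using d Suc.prems differentiable_cong_open[OF assms(1), of _ f g] by auto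
qed

lemma iter_deriv_simps [simp]:
  "iter_deriv [] f = f"
  "iter_deriv (v # vs) f = dir_deriv v (iter_deriv vs f)"
  by (simp_all add: iter_deriv_def)

lemma iter_deriv_append: "iter_deriv (us @ vs) f = iter_deriv us (iter_deriv vs f)"
  by (simp add: iter_deriv_def)

lemma diff_upto_iff:
  "diff_upto n S f \<longleftrightarrow> (\<forall>vs\<in>lists Basis. length vs \<le> n \<longrightarrow> (\<forall>x\<in>S. iter_deriv vs f differentiable (at x)))"
proof (induction n arbitrary: f)
  case (Suc n)
  show ?case
  proof
    assume f: "diff_upto (Suc n) S f"
    show "\<forall>vs\<in>lists Basis. length vs \<le> Suc n \<longrightarrow> (\<forall>x\<in>S. iter_deriv vs f differentiable (at x))"
    proof (intro ballI impI)
      fix vs :: "'a list" and x assume vs: "vs \<in> lists Basis" "length vs \<le> Suc n" "x \<in> S"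
      show "iter_deriv vs f differentiable (at x)"
      \<comment> \<open>The last entry of the list is the derivative applied first, and this is the
        one that \<open>diff_upto\<close> peels off.\<close>
      proof (cases vs rule: rev_cases)
        case Nil then show ?thesis using f vs by simp
      next
        case (snoc ws w)
        then have "w \<in> Basis" "ws \<in> lists Basis" "length ws \<le> n" using vs by auto
        then show ?thesis using f Suc.IH[of "dir_deriv w f"] vs snoc by (simp add: iter_deriv_append)
      qed
    qed
  next
    assume *: "\<forall>vs\<in>lists Basis. length vs \<le> Suc n \<longrightarrow> (\<forall>x\<in>S. iter_deriv vs f differentiable (at x))"
    have "diff_upto n S (dir_deriv v f)" if "v \<in> Basis" for v
      unfolding Suc.IH
    proof (intro ballI impI)
      fix vs :: "'a list" and x assume vs: "vs \<in> lists Basis" "length vs \<le> n" "x \<in> S"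
      have "vs @ [v] \<in> lists Basis" "length (vs @ [v]) \<le> Suc n" using vs that by auto
      then have "iter_deriv (vs @ [v]) f differentiable at x" using * vs(3) by blast
      then show "iter_deriv vs (dir_deriv v f) differentiable (at x)"
        by (simp add: iter_deriv_append)
    qed
    then show "diff_upto (Suc n) S f" using *[rule_format, of "[]"] by auto
  qed
qed auto

lemma smooth_on_iff_diff_upto: "smooth_on S f \<longleftrightarrow> (\<forall>n. diff_upto n S f)"
  unfolding smooth_on_def diff_upto_iff by auto

lemma smooth_on_differentiable: "smooth_on S f \<Longrightarrow> x \<in> S \<Longrightarrow> f differentiable (at x)"
  using smooth_on_iff_diff_upto diff_upto_differentiable by blast

lemma smooth_on_dir_deriv_Basis: "smooth_on S f \<Longrightarrow> v \<in> Basis \<Longrightarrow> smooth_on S (dir_deriv v f)"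
  unfolding smooth_on_iff_diff_upto by (metis diff_upto.simps(2))

lemma smooth_on_iter_deriv: "smooth_on S f \<Longrightarrow> vs \<in> lists Basis \<Longrightarrow> smooth_on S (iter_deriv vs f)"
  by (induction vs) (auto intro: smooth_on_dir_deriv_Basis)

lemma smooth_on_cong:
  assumes "open S" "\<And>x. x \<in> S \<Longrightarrow> f x = g x" "smooth_on S f"
  shows "smooth_on S g"
  using assms diff_upto_cong unfolding smooth_on_iff_diff_upto by blast

lemma smooth_on_subset: "smooth_on S f \<Longrightarrow> T \<subseteq> S \<Longrightarrow> smooth_on T f"
  unfolding smooth_on_def by blast

text \<open>Differentiability of the iterated derivatives is asked point by point with respect to
  full neighbourhoods, so the covering sets may be arbitrary.\<close>

lemma smooth_on_local:
  assumes "\<And>x. x \<in> S \<Longrightarrow> \<exists>T. x \<in> T \<and> smooth_on T f"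
  shows "smooth_on S f"
proof -
  have "iter_deriv vs f differentiable (at x)" if "vs \<in> lists Basis" "x \<in> S" for vs x
    using assms[OF that(2)] that(1) smooth_on_differentiable[OF smooth_on_iter_deriv[OF _ that(1)]] by blast
  then show ?thesis unfolding smooth_on_def by blast
qed

lemma smooth_on_continuous_on: "smooth_on S f \<Longrightarrow> continuous_on S f"
  by (meson continuous_at_imp_continuous_on differentiable_imp_continuous_within smooth_on_differentiable)

lemma iter_deriv_cong:
  assumes "open S" "smooth_on S f" "\<And>x. x \<in> S \<Longrightarrow> f x = g x" "vs \<in> lists Basis" "x \<in> S"
  shows "iter_deriv vs f x = iter_deriv vs g x"
  using assms(4,5)
proof (induction vs arbitrary: x)
  case (Cons v vs)
  have "vs \<in> lists Basis" using Cons.hyps by simp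
  then have "iter_deriv vs f differentiable (at x)"
    using smooth_on_differentiable[OF smooth_on_iter_deriv[OF assms(2)]] Cons.prems by blast
  then show ?case
    using dir_deriv_cong[OF assms(1), of x "iter_deriv vs f" "iter_deriv vs g" v] Cons by simp
qed (use assms in auto)

section \<open>Closure of differentiability under algebra and composition\<close>

lemma diff_upto_const: "diff_upto n S (\<lambda>x. c)"
proof (induction n arbitrary: c)
  case (Suc n)
  have "dir_deriv v (\<lambda>x::'a. c) = (\<lambda>x. 0)" for v :: 'a
    using dir_deriv_eqI[OF has_derivative_const] by blast
  then show ?case using Suc by (auto simp: differentiable_const)
qed (auto simp: differentiable_const)

lemma smooth_on_const [simp]: "smooth_on S (\<lambda>x. c)"
  by (simp add: diff_upto_const smooth_on_iff_diff_upto)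

lemma smooth_on_bounded_linear:
  assumes "bounded_linear f" shows "smooth_on S f"
proof -
  have d: "(f has_derivative f) (at x)" for x
    using assms by (simp add: bounded_linear_imp_has_derivative)
  then have "dir_deriv v f = (\<lambda>x. f v)" for v
    using dir_deriv_eqI by blast
  then have "diff_upto n S f" for n
    by (cases n) (use d in \<open>auto simp: diff_upto_const differentiable_def\<close>)
  then show ?thesis by (simp add: smooth_on_iff_diff_upto)
qed

lemma diff_upto_add:
  assumes "open S" "diff_upto n S f" "diff_upto n S g"
  shows "diff_upto n S (\<lambda>x. f x + g x)"
  using assms(2,3)
proof (induction n arbitrary: f g)
  case (Suc n)
  have d: "f differentiable (at x)" "g differentiable (at x)" if "x \<in> S" for x using Suc.prems that by auto
  have "dir_deriv v f x + dir_deriv v g x = dir_deriv v (\<lambda>x. f x + g x) x" if "x \<in> S" for v x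
    using dir_deriv_eqI[OF has_derivative_add[OF has_derivative_dir_deriv has_derivative_dir_deriv], of f x g v] d that
    by auto
  then have "diff_upto n S (dir_deriv v (\<lambda>x. f x + g x))" if "v \<in> Basis" for v
    using diff_upto_cong[OF assms(1), of "\<lambda>x. dir_deriv v f x + dir_deriv v g x"] Suc that by auto
  then show ?case using d by auto
qed auto

lemma bounded_linear_differentiable:
  assumes "bounded_linear h" "f differentiable (at x)"
  shows "(\<lambda>x. h (f x)) differentiable (at x)"
  using bounded_linear.has_derivative[OF assms(1)] assms(2) unfolding differentiable_def by blast

lemma bounded_bilinear_differentiable:
  assumes "bounded_bilinear p" "f differentiable (at x)" "g differentiable (at x)"
  shows "(\<lambda>x. p (f x) (g x)) differentiable (at x)"
  using bounded_bilinear.FDERIV[OF assms(1)] assms(2,3) unfolding differentiable_def by blast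

lemma diff_upto_bounded_linear:
  assumes "open S" "bounded_linear h" "diff_upto n S f"
  shows "diff_upto n S (\<lambda>x. h (f x))"
  using assms(3)
proof (induction n arbitrary: f)
  case 0
  then show ?case
    using bounded_linear_differentiable[OF assms(2)] by auto
next
  case (Suc n)
  have d: "f differentiable (at x)" if "x \<in> S" for x using Suc.prems that by auto
  have "h (dir_deriv v f x) = dir_deriv v (\<lambda>x. h (f x)) x" if "x \<in> S" for v x
    using dir_deriv_eqI[OF bounded_linear.has_derivative[OF assms(2) has_derivative_dir_deriv], of f x v] d that
    by auto
  then have "diff_upto n S (dir_deriv v (\<lambda>x. h (f x)))" if "v \<in> Basis" for v
    using diff_upto_cong[OF assms(1), of "\<lambda>x. h (dir_deriv v f x)"] Suc that by auto
  then show ?case using d bounded_linear_differentiable[OF assms(2)] by auto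
qed

lemma dir_deriv_prod:
  assumes "bounded_bilinear p" "f differentiable (at x)" "g differentiable (at x)"
  shows "dir_deriv v (\<lambda>x. p (f x) (g x)) x = p (f x) (dir_deriv v g x) + p (dir_deriv v f x) (g x)"
  using dir_deriv_eqI[OF bounded_bilinear.FDERIV[OF assms(1)] , OF has_derivative_dir_deriv has_derivative_dir_deriv] assms
  by blast

lemma diff_upto_bilinear:
  assumes "open S" "bounded_bilinear p" "diff_upto n S f" "diff_upto n S g"
  shows "diff_upto n S (\<lambda>x. p (f x) (g x))"
  using assms(3,4)
proof (induction n arbitrary: f g)
  case 0
  then show ?case
    using bounded_bilinear_differentiable[OF assms(2), of f _ g] by auto
next
  case (Suc n)
  have d: "f differentiable (at x)" "g differentiable (at x)" if "x \<in> S" for x using Suc.prems that by auto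
  have *: "diff_upto n S f" "diff_upto n S g" using Suc.prems diff_upto_Suc_D by blast+
  have "diff_upto n S (\<lambda>x. p (f x) (dir_deriv v g x) + p (dir_deriv v f x) (g x))" if "v \<in> Basis" for v
    using Suc * that by (intro diff_upto_add assms) auto
  moreover have "p (f x) (dir_deriv v g x) + p (dir_deriv v f x) (g x) = dir_deriv v (\<lambda>x. p (f x) (g x)) x"
    if "x \<in> S" for x v
    using dir_deriv_prod[OF assms(2) d[OF that]] by simp
  ultimately have "diff_upto n S (dir_deriv v (\<lambda>x. p (f x) (g x)))" if "v \<in> Basis" for v
    by (rule diff_upto_cong[OF assms(1), rotated]) (use that in auto)
  moreover have "(\<lambda>x. p (f x) (g x)) differentiable at x" if "x \<in> S" for x
    using bounded_bilinear_differentiable[OF assms(2) d[OF that]] .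
  ultimately show ?case by auto
qed

lemma diff_upto_sum:
  assumes "open S" "finite I" "\<And>i. i \<in> I \<Longrightarrow> diff_upto n S (f i)"
  shows "diff_upto n S (\<lambda>x. \<Sum>i\<in>I. f i x)"
  using assms(2,3) by (induction I) (auto simp: diff_upto_const intro: diff_upto_add[OF assms(1)])

lemma dir_deriv_compose:
  fixes g :: "'a::euclidean_space \<Rightarrow> 'b::euclidean_space"
  assumes "g differentiable (at x)" "f differentiable (at (g x))"
  shows "dir_deriv v (\<lambda>x. f (g x)) x = (\<Sum>j\<in>Basis. (dir_deriv v g x \<bullet> j) *\<^sub>R dir_deriv j f (g x))"
proof -
  have "((\<lambda>x. f (g x)) has_derivative (\<lambda>v. dir_deriv (dir_deriv v g x) f (g x))) (at x)"
    using diff_chain_at[OF has_derivative_dir_deriv[OF assms(1)] has_derivative_dir_deriv[OF assms(2)]]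
    by (simp add: o_def)
  then have "dir_deriv v (\<lambda>x. f (g x)) x = dir_deriv (dir_deriv v g x) f (g x)"
    by (rule dir_deriv_eqI)
  then show ?thesis using dir_deriv_sum_Basis[OF assms(2), of "dir_deriv v g x"] by (rule trans)
qed

text \<open>Each derivative of the composite is a sum of a derivative of \<open>g\<close>, which
  stays smooth, times a partial derivative of \<open>f\<close> composed with the same
  \<open>g\<close>. Only \<open>f\<close> loses an order, so the induction runs over
  \<open>f\<close> with \<open>g\<close> fixed.\<close>

lemma diff_upto_compose:
  fixes g :: "'a::euclidean_space \<Rightarrow> 'b::euclidean_space"
  assumes "open S" "open T" "g ` S \<subseteq> T" "diff_upto n T f" "smooth_on S g"
  shows "diff_upto n S (\<lambda>x. f (g x))"
  using assms(4)
proof (induction n arbitrary: f)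
  case 0
  have "(\<lambda>x. f (g x)) differentiable (at x)" if "x \<in> S" for x
    using differentiable_chain_at[of g x f] 0 assms smooth_on_differentiable[OF assms(5)] that
    by (auto simp: o_def)
  then show ?case by auto
next
  case (Suc n)
  have d: "f differentiable (at (g x))" "g differentiable (at x)" if "x \<in> S" for x
    using Suc.prems that assms smooth_on_differentiable[OF assms(5)] by auto
  have "diff_upto n S (\<lambda>x. \<Sum>j\<in>Basis. (dir_deriv v g x \<bullet> j) *\<^sub>R dir_deriv j f (g x))" if v: "v \<in> Basis" for v
  proof (intro diff_upto_sum diff_upto_bilinear[OF _ bounded_bilinear_scaleR] assms(1) finite_Basis)
    fix j :: 'b assume "j \<in> Basis"
    then show "diff_upto n S (\<lambda>x. dir_deriv j f (g x))" using Suc by auto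
    have "diff_upto n S (dir_deriv v g)"
      using smooth_on_dir_deriv_Basis[OF assms(5) v] smooth_on_iff_diff_upto by blast
    then show "diff_upto n S (\<lambda>x. dir_deriv v g x \<bullet> j)"
      by (intro diff_upto_bounded_linear[OF assms(1) bounded_linear_inner_left])
  qed
  then have "diff_upto n S (dir_deriv v (\<lambda>x. f (g x)))" if "v \<in> Basis" for v
    using diff_upto_cong[OF assms(1), of "\<lambda>x. \<Sum>j\<in>Basis. (dir_deriv v g x \<bullet> j) *\<^sub>R dir_deriv j f (g x)" _ n]
      dir_deriv_compose[OF d(2,1)] that by auto
  moreover have "(\<lambda>x. f (g x)) differentiable (at x)" if "x \<in> S" for x
    using differentiable_chain_at[of g x f] d that by (auto simp: o_def)
  ultimately show ?case by auto
qed

lemma smooth_on_compose: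
  fixes g :: "'a::euclidean_space \<Rightarrow> 'b::euclidean_space"
  assumes "open S" "open T" "g ` S \<subseteq> T" "smooth_on T f" "smooth_on S g"
  shows "smooth_on S (\<lambda>x. f (g x))"
proof -
  have "diff_upto n S (\<lambda>x. f (g x))" for n
    by (rule diff_upto_compose[OF assms(1-3) _ assms(5)]) (use assms(4) smooth_on_iff_diff_upto in blast)
  then show ?thesis by (simp add: smooth_on_iff_diff_upto)
qed

lemma smooth_on_compose_UNIV:
  fixes g :: "'a::euclidean_space \<Rightarrow> 'b::euclidean_space"
  assumes "open S" "smooth_on UNIV f" "smooth_on S g"
  shows "smooth_on S (\<lambda>x. f (g x))"
  using smooth_on_compose[OF assms(1) open_UNIV _ assms(2,3)] by auto

lemma smooth_on_add: "open S \<Longrightarrow> smooth_on S f \<Longrightarrow> smooth_on S g \<Longrightarrow> smooth_on S (\<lambda>x. f x + g x)"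
  by (simp add: diff_upto_add smooth_on_iff_diff_upto)

lemma smooth_on_sum:
  "open S \<Longrightarrow> finite I \<Longrightarrow> (\<And>i. i \<in> I \<Longrightarrow> smooth_on S (f i)) \<Longrightarrow> smooth_on S (\<lambda>x. \<Sum>i\<in>I. f i x)"
  by (simp add: diff_upto_sum smooth_on_iff_diff_upto)

lemma smooth_on_linear_comp:
  "open S \<Longrightarrow> bounded_linear h \<Longrightarrow> smooth_on S f \<Longrightarrow> smooth_on S (\<lambda>x. h (f x))"
  by (simp add: diff_upto_bounded_linear smooth_on_iff_diff_upto)

lemma smooth_on_bilinear:
  "open S \<Longrightarrow> bounded_bilinear p \<Longrightarrow> smooth_on S f \<Longrightarrow> smooth_on S g \<Longrightarrow> smooth_on S (\<lambda>x. p (f x) (g x))"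
  by (simp add: diff_upto_bilinear smooth_on_iff_diff_upto)

lemma smooth_on_minus: "open S \<Longrightarrow> smooth_on S f \<Longrightarrow> smooth_on S (\<lambda>x. - f x)"
  by (rule smooth_on_linear_comp[OF _ bounded_linear_minus[OF bounded_linear_ident]])

lemma smooth_on_diff: "open S \<Longrightarrow> smooth_on S f \<Longrightarrow> smooth_on S g \<Longrightarrow> smooth_on S (\<lambda>x. f x - g x)"
  using smooth_on_add[of S f "\<lambda>x. - g x"] smooth_on_minus[of S g] by simp

lemma smooth_on_mult:
  fixes f g :: "'a::euclidean_space \<Rightarrow> 'b::real_normed_algebra"
  shows "open S \<Longrightarrow> smooth_on S f \<Longrightarrow> smooth_on S g \<Longrightarrow> smooth_on S (\<lambda>x. f x * g x)"
  by (rule smooth_on_bilinear[OF _ bounded_bilinear_mult])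

lemma smooth_on_scaleR:
  "open S \<Longrightarrow> smooth_on S f \<Longrightarrow> smooth_on S g \<Longrightarrow> smooth_on S (\<lambda>x. f x *\<^sub>R g x)"
  by (rule smooth_on_bilinear[OF _ bounded_bilinear_scaleR])

lemma smooth_on_inner:
  "open S \<Longrightarrow> smooth_on S f \<Longrightarrow> smooth_on S g \<Longrightarrow> smooth_on S (\<lambda>x. f x \<bullet> g x)"
  by (rule smooth_on_bilinear[OF _ bounded_bilinear_inner])

lemma smooth_on_power:
  fixes f :: "'a::euclidean_space \<Rightarrow> 'b::real_normed_algebra_1"
  shows "open S \<Longrightarrow> smooth_on S f \<Longrightarrow> smooth_on S (\<lambda>x. f x ^ n)"
  by (induction n) (auto intro: smooth_on_mult)

lemma smooth_on_of_real:
  "open S \<Longrightarrow> smooth_on S f \<Longrightarrow> smooth_on S (\<lambda>x. of_real (f x) :: 'b :: {real_normed_algebra_1})"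
  by (rule smooth_on_linear_comp[OF _ bounded_linear_of_real])

lemma smooth_on_fst: "open S \<Longrightarrow> smooth_on S f \<Longrightarrow> smooth_on S (\<lambda>x. fst (f x))"
  by (rule smooth_on_linear_comp[OF _ bounded_linear_fst])

lemma smooth_on_snd: "open S \<Longrightarrow> smooth_on S f \<Longrightarrow> smooth_on S (\<lambda>x. snd (f x))"
  by (rule smooth_on_linear_comp[OF _ bounded_linear_snd])

lemma smooth_on_ident: "smooth_on S (\<lambda>x. x)"
  by (rule smooth_on_bounded_linear[OF bounded_linear_ident])

lemma smooth_on_Pair:
  assumes "open S" "smooth_on S f" "smooth_on S g"
  shows "smooth_on S (\<lambda>x. (f x, g x))"
proof -
  have "smooth_on S (\<lambda>x. (f x, 0) + (0, g x))"
  proof (intro smooth_on_add assms)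
    show "smooth_on S (\<lambda>x. (f x, 0::'c))"
      by (rule smooth_on_linear_comp[OF assms(1) _ assms(2)])
        (intro bounded_linear_Pair bounded_linear_ident bounded_linear_zero)
    show "smooth_on S (\<lambda>x. (0::'b, g x))"
      by (rule smooth_on_linear_comp[OF assms(1) _ assms(3)])
        (intro bounded_linear_Pair bounded_linear_ident bounded_linear_zero)
  qed
  then show ?thesis by simp
qed

section \<open>Smooth functions of one real variable and their composites\<close>

lemma dir_deriv_real:
  fixes f :: "real \<Rightarrow> 'b::real_normed_vector"
  assumes "(f has_vector_derivative f') (at x)"
  shows "dir_deriv 1 f x = f'"
  using dir_deriv_eqI[OF assms[unfolded has_vector_derivative_def]] by simp

lemma diff_upto_SucI_real:
  fixes f :: "real \<Rightarrow> 'b::real_normed_vector"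
  assumes "open S" "\<And>x. x \<in> S \<Longrightarrow> (f has_vector_derivative f' x) (at x)" "diff_upto n S f'"
  shows "diff_upto (Suc n) S f"
proof -
  have "diff_upto n S (dir_deriv 1 f)"
    by (rule diff_upto_cong[OF assms(1) _ assms(3)]) (use dir_deriv_real assms(2) in metis)
  moreover have "f differentiable (at x)" if "x \<in> S" for x
    using assms(2)[OF that] unfolding has_vector_derivative_def differentiable_def by blast
  ultimately show ?thesis by auto
qed

text \<open>Coinduction for a family closed under differentiation: if every derivative is as often
  differentiable as the family itself, the order can be raised forever. The index serves functions
  whose derivatives leave a single formula, as for \<open>flat\<close>.\<close>

lemma smooth_on_real_coinduct:
  fixes f :: "'i \<Rightarrow> real \<Rightarrow> 'b::real_normed_vector"
  assumes "open S"
    and "\<And>i x. x \<in> S \<Longrightarrow> (f i has_vector_derivative f' i x) (at x)"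
    and "\<And>n i. (\<And>j. diff_upto n S (f j)) \<Longrightarrow> diff_upto n S (f' i)"
  shows "smooth_on S (f i)"
proof -
  have "diff_upto n S (f i)" for n i
  proof (induction n arbitrary: i)
    case 0
    show ?case using assms(2)[of _ i] unfolding has_vector_derivative_def differentiable_def diff_upto.simps by blast
  next
    case (Suc n)
    then show ?case using diff_upto_SucI_real[OF assms(1) assms(2)] assms(3) by blast
  qed
  then show ?thesis by (simp add: smooth_on_iff_diff_upto)
qed

lemma has_vector_derivative_cis: "(cis has_vector_derivative \<i> * cis t) (at t)"
proof -
  have "((\<lambda>t. complex_of_real (cos t) + \<i> * complex_of_real (sin t)) has_vector_derivative
      complex_of_real (- sin t) + \<i> * complex_of_real (cos t)) (at t)"
    by (intro has_vector_derivative_add has_vector_derivative_mult_right has_vector_derivative_of_real)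
      (auto simp: has_real_derivative_iff_has_vector_derivative[symmetric] intro!: derivative_eq_intros)
  moreover have "(\<lambda>t. complex_of_real (cos t) + \<i> * complex_of_real (sin t)) = cis"
    by (auto simp: complex_eq_iff)
  moreover have "complex_of_real (- sin t) + \<i> * complex_of_real (cos t) = \<i> * cis t"
    by (auto simp: complex_eq_iff)
  ultimately show ?thesis by simp
qed

lemma smooth_on_cis: "smooth_on UNIV cis"
  by (rule smooth_on_real_coinduct[where f = "\<lambda>_::unit. cis" and f' = "\<lambda>_ t. \<i> * cis t"])
    (auto intro: has_vector_derivative_cis diff_upto_bounded_linear bounded_linear_mult_right)

lemma smooth_on_sin: "smooth_on UNIV (sin :: real \<Rightarrow> real)"
  and smooth_on_cos: "smooth_on UNIV (cos :: real \<Rightarrow> real)"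
proof -
  have "smooth_on UNIV (\<lambda>x. Im (cis x))" "smooth_on UNIV (\<lambda>x. Re (cis x))"
    by (rule smooth_on_linear_comp[OF open_UNIV bounded_linear_Im smooth_on_cis]
             smooth_on_linear_comp[OF open_UNIV bounded_linear_Re smooth_on_cis])+
  then show "smooth_on UNIV (sin :: real \<Rightarrow> real)" "smooth_on UNIV (cos :: real \<Rightarrow> real)" by simp_all
qed

lemma smooth_on_inverse_real: "smooth_on (- {0::real}) inverse"
  by (rule smooth_on_real_coinduct[where f = "\<lambda>_::unit. inverse" and f' = "\<lambda>_ t. - (inverse t * inverse t)"])
    (auto intro!: derivative_eq_intros diff_upto_bounded_linear[where h = uminus]
        diff_upto_bilinear[OF _ bounded_bilinear_mult] bounded_linear_minus bounded_linear_ident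
      simp: has_real_derivative_iff_has_vector_derivative[symmetric] open_Compl)

lemma smooth_on_inverse:
  fixes f :: "'a::euclidean_space \<Rightarrow> real"
  assumes "open S" "smooth_on S f" "\<And>x. x \<in> S \<Longrightarrow> f x \<noteq> 0"
  shows "smooth_on S (\<lambda>x. inverse (f x))"
  by (rule smooth_on_compose[OF assms(1) _ _ smooth_on_inverse_real assms(2)]) (use assms in \<open>auto simp: open_Compl\<close>)

lemma smooth_on_divide:
  fixes f g :: "'a::euclidean_space \<Rightarrow> real"
  assumes "open S" "smooth_on S f" "smooth_on S g" "\<And>x. x \<in> S \<Longrightarrow> g x \<noteq> 0"
  shows "smooth_on S (\<lambda>x. f x / g x)"
  unfolding divide_inverse by (intro smooth_on_mult smooth_on_inverse assms)

text \<open>The derivative is \<open>sqrt (inverse x) / 2\<close>, again the square root composed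
  with a smooth function, so the composition rule closes the induction on the order.\<close>

lemma smooth_on_sqrt_real: "smooth_on {0<..} sqrt"
proof -
  have "diff_upto n {0<..} sqrt" for n
  proof (induction n)
    case 0
    have "sqrt differentiable (at x)" if "x > 0" for x
      using DERIV_real_sqrt[OF that] real_differentiable_def by blast
    then show ?case by simp
  next
    case (Suc n)
    have inv: "diff_upto n {0<..} (inverse :: real \<Rightarrow> real)"
      using smooth_on_subset[OF smooth_on_inverse_real, of "{0<..}"] smooth_on_iff_diff_upto by force
    have "diff_upto n {0<..} (\<lambda>x. sqrt (inverse x))"
      by (rule diff_upto_compose[OF _ _ _ Suc smooth_on_subset[OF smooth_on_inverse_real]]) auto
    then have "diff_upto n {0<..} (\<lambda>x. sqrt (inverse x) / 2)"
      by (intro diff_upto_bounded_linear[where h = "\<lambda>x. x / 2"] bounded_linear_divide) auto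
    then show ?case
      by (intro diff_upto_SucI_real[where f' = "\<lambda>x. sqrt (inverse x) / 2"])
        (auto simp: has_real_derivative_iff_has_vector_derivative[symmetric] real_sqrt_inverse
          intro: DERIV_real_sqrt)
  qed
  then show ?thesis unfolding smooth_on_iff_diff_upto by blast
qed

lemma smooth_on_sqrt:
  fixes f :: "'a::euclidean_space \<Rightarrow> real"
  assumes "open S" "smooth_on S f" "\<And>x. x \<in> S \<Longrightarrow> f x > 0"
  shows "smooth_on S (\<lambda>x. sqrt (f x))"
proof -
  have "f ` S \<subseteq> {0<..}" using assms(3) by (auto simp: image_subset_iff)
  from smooth_on_compose[OF assms(1) open_greaterThan this smooth_on_sqrt_real assms(2)]
  show ?thesis .
qed

lemma smooth_on_norm:
  fixes f :: "'a::euclidean_space \<Rightarrow> 'b::euclidean_space"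
  assumes "open S" "smooth_on S f" "\<And>x. x \<in> S \<Longrightarrow> f x \<noteq> 0"
  shows "smooth_on S (\<lambda>x. norm (f x))"
  unfolding norm_eq_sqrt_inner by (intro smooth_on_sqrt smooth_on_inner assms) (use assms in auto)

lemma smooth_on_dir_deriv:
  assumes "open S" "smooth_on S f"
  shows "smooth_on S (dir_deriv v f)"
proof (rule smooth_on_cong[OF assms(1)])
  show "smooth_on S (\<lambda>x. \<Sum>j\<in>Basis. (v \<bullet> j) *\<^sub>R dir_deriv j f x)"
    by (intro smooth_on_sum assms smooth_on_scaleR smooth_on_const smooth_on_dir_deriv_Basis finite_Basis)
  show "(\<Sum>j\<in>Basis. (v \<bullet> j) *\<^sub>R dir_deriv j f x) = dir_deriv v f x" if "x \<in> S" for x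
    by (rule dir_deriv_sum_Basis[OF smooth_on_differentiable[OF assms(2) that], symmetric])
qed

section \<open>Rules for directional and iterated derivatives and for slices\<close>

lemma dir_deriv_add:
  "f differentiable (at x) \<Longrightarrow> g differentiable (at x) \<Longrightarrow>
    dir_deriv v (\<lambda>x. f x + g x) x = dir_deriv v f x + dir_deriv v g x"
  by (intro dir_deriv_eqI has_derivative_add has_derivative_dir_deriv)

lemma dir_deriv_mult:
  fixes f g :: "'a::real_normed_vector \<Rightarrow> 'b::{real_normed_algebra,comm_ring}"
  shows "f differentiable (at x) \<Longrightarrow> g differentiable (at x) \<Longrightarrow>
    dir_deriv v (\<lambda>x. f x * g x) x = f x * dir_deriv v g x + dir_deriv v f x * g x"
  by (rule dir_deriv_prod[OF bounded_bilinear_mult])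

lemma dir_deriv_linear_comp:
  "bounded_linear h \<Longrightarrow> f differentiable (at x) \<Longrightarrow> dir_deriv v (\<lambda>x. h (f x)) x = h (dir_deriv v f x)"
  by (rule dir_deriv_eqI[OF bounded_linear.has_derivative]) (auto intro: has_derivative_dir_deriv)

lemma iter_deriv_add:
  assumes "open S" "smooth_on S f" "smooth_on S g" "vs \<in> lists Basis" "x \<in> S"
  shows "iter_deriv vs (\<lambda>x. f x + g x) x = iter_deriv vs f x + iter_deriv vs g x"
  using assms(4,5)
proof (induction vs arbitrary: x)
  case (Cons v vs)
  have "vs \<in> lists Basis" using Cons.hyps by simp
  then have sm: "smooth_on S (iter_deriv vs f)" "smooth_on S (iter_deriv vs g)"
     "smooth_on S (iter_deriv vs (\<lambda>x. f x + g x))"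
    using assms by (simp_all add: smooth_on_iter_deriv smooth_on_add)
  note d = sm[THEN smooth_on_differentiable, OF Cons.prems]
  show ?case
    using dir_deriv_cong[OF assms(1) Cons.prems Cons.IH d(3), of v] dir_deriv_add[OF d(1,2), of v] by simp
qed simp

lemma iter_deriv_zero [simp]: "iter_deriv vs (\<lambda>x. 0) = (\<lambda>x. 0)"
proof (induction vs)
  case (Cons v vs)
  then show ?case using dir_deriv_eqI[OF has_derivative_const] by fastforce
qed simp

lemma iter_deriv_sum:
  assumes "open S" "finite I" "\<And>i. i \<in> I \<Longrightarrow> smooth_on S (f i)" "vs \<in> lists Basis" "x \<in> S"
  shows "iter_deriv vs (\<lambda>x. \<Sum>i\<in>I. f i x) x = (\<Sum>i\<in>I. iter_deriv vs (f i) x)"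
  using assms(2,3)
proof (induction I)
  case (insert i I)
  then show ?case
    using iter_deriv_add[OF assms(1), of "f i" "\<lambda>x. \<Sum>i\<in>I. f i x" vs x] assms by (auto intro: smooth_on_sum)
qed simp

lemma dir_deriv_fst_slice:
  assumes "f differentiable (at (x, y))"
  shows "(\<lambda>x. f (x, y)) differentiable (at x)" "dir_deriv v (\<lambda>x. f (x, y)) x = dir_deriv (v, 0) f (x, y)"
proof -
  have "((\<lambda>x. f (x, y)) has_derivative (\<lambda>v. dir_deriv (v, 0) f (x, y))) (at x)"
    using diff_chain_at[OF has_derivative_Pair[OF has_derivative_ident has_derivative_const]
        has_derivative_dir_deriv[OF assms]] by (simp add: o_def)
  then show "(\<lambda>x. f (x, y)) differentiable (at x)" "dir_deriv v (\<lambda>x. f (x, y)) x = dir_deriv (v, 0) f (x, y)"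
    using dir_deriv_eqI differentiable_def by blast+
qed

lemma dir_deriv_snd_slice:
  assumes "f differentiable (at (x, y))"
  shows "(\<lambda>y. f (x, y)) differentiable (at y)" "dir_deriv v (\<lambda>y. f (x, y)) y = dir_deriv (0, v) f (x, y)"
proof -
  have "((\<lambda>y. f (x, y)) has_derivative (\<lambda>v. dir_deriv (0, v) f (x, y))) (at y)"
    using diff_chain_at[OF has_derivative_Pair[OF has_derivative_const has_derivative_ident]
        has_derivative_dir_deriv[OF assms]] by (simp add: o_def)
  then show "(\<lambda>y. f (x, y)) differentiable (at y)" "dir_deriv v (\<lambda>y. f (x, y)) y = dir_deriv (0, v) f (x, y)"
    using dir_deriv_eqI differentiable_def by blast+
qed

section \<open>A smooth function that vanishes exactly on a half-line\<close>

definition flat :: "real \<Rightarrow> real" where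
  "flat t = (if t > 0 then exp (- inverse t) else 0)"

text \<open>The functions \<open>f k\<close>, equal to \<open>t^(-k) * exp (-1 / t)\<close> for
  positive \<open>t\<close>, form a family closed under differentiation up to linear combinations.
  At the origin the difference quotient of \<open>f k\<close> from the right is
  \<open>f (Suc k)\<close>, which tends to 0 because the exponential beats every power.\<close>

lemma smooth_on_flat: "smooth_on UNIV flat"
proof -
  define f :: "nat \<Rightarrow> real \<Rightarrow> real" where
    "f k t = (if t > 0 then inverse t ^ k * exp (- inverse t) else 0)" for k t
  have lim: "(f k \<longlongrightarrow> 0) (at_right 0)" for k
  proof -
    have "((\<lambda>t. inverse t ^ k / exp (inverse t)) \<longlongrightarrow> 0) (at_right (0::real))"
      using filterlim_compose[OF tendsto_power_div_exp_0 filterlim_inverse_at_top_right] .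
    then show ?thesis
      by (rule Lim_transform_eventually) (auto simp: f_def eventually_at_filter exp_minus divide_inverse)
  qed
  have der: "(f k has_real_derivative f (Suc (Suc k)) t - real k * f (Suc k) t) (at t)" for k t
  proof (cases t "0::real" rule: linorder_cases)
    case less
    have "((\<lambda>_. 0) has_real_derivative 0) (at t)" by simp
    then have "(f k has_real_derivative 0) (at t)"
      by (rule has_field_derivative_transform_within_open[where S = "{..<0}"]) (use less in \<open>auto simp: f_def\<close>)
    then show ?thesis using less by (simp add: f_def)
  next
    case greater
    have "((\<lambda>t. inverse t ^ k * exp (- inverse t)) has_real_derivative
        f (Suc (Suc k)) t - real k * f (Suc k) t) (at t)"
    proof -
      have "((\<lambda>t. inverse t ^ k) has_real_derivative - (real k * inverse t ^ Suc k)) (at t)"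
        using DERIV_power[OF DERIV_inverse[of t UNIV], of k] greater
        by (cases k) (simp_all add: mult_ac)
      moreover have "((\<lambda>t. exp (- inverse t)) has_real_derivative exp (- inverse t) * inverse t ^ 2) (at t)"
        using greater by (auto intro!: derivative_eq_intros simp: power2_eq_square)
      ultimately show ?thesis
        by (rule DERIV_cong[OF DERIV_mult]) (use greater in \<open>simp add: f_def power2_eq_square algebra_simps\<close>)
    qed
    then show ?thesis
      by (rule has_field_derivative_transform_within_open[where S = "{0<..}"]) (use greater in \<open>auto simp: f_def\<close>)
  next
    case equal
    have "((\<lambda>h. (f k (0 + h) - f k 0) / h) \<longlongrightarrow> 0) (at_right 0)"
      by (rule Lim_transform_eventually[OF lim[of "Suc k"]])
        (auto simp: f_def eventually_at_filter divide_inverse)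
    moreover have "((\<lambda>h. (f k (0 + h) - f k 0) / h) \<longlongrightarrow> 0) (at_left 0)"
      by (rule Lim_transform_eventually[OF tendsto_const]) (auto simp: f_def eventually_at_filter)
    ultimately have "(f k has_real_derivative 0) (at 0)"
      unfolding DERIV_def using filterlim_split_at by blast
    then show ?thesis using equal by (simp add: f_def)
  qed
  have "smooth_on UNIV (f k)" for k
  proof (rule smooth_on_real_coinduct)
    show "(f k has_vector_derivative f (Suc (Suc k)) t - real k * f (Suc k) t) (at t)" for k t
      using der by (simp add: has_real_derivative_iff_has_vector_derivative)
    fix n k assume IH: "\<And>j. diff_upto n UNIV (f j)"
    have "diff_upto n UNIV (\<lambda>t. f (Suc (Suc k)) t + (- real k) * f (Suc k) t)"
      by (rule diff_upto_add[OF open_UNIV IH diff_upto_bounded_linear[OF open_UNIV bounded_linear_mult_right IH]])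
    then show "diff_upto n UNIV (\<lambda>t. f (Suc (Suc k)) t - real k * f (Suc k) t)" by simp
  qed simp
  moreover have "f 0 = flat" by (auto simp: f_def flat_def)
  ultimately show ?thesis by metis
qed

lemma flat_pos_iff: "0 < flat t \<longleftrightarrow> 0 < t"
  by (simp add: flat_def)

lemma flat_nonneg: "0 \<le> flat t"
  by (simp add: flat_def)

subsection \<open>Integrals depending on parameters\<close>

text \<open>The Leibniz rule wants the derivative as a continuous family of bounded linear maps over
  a convex parameter set: hence \<open>D\<close> as a \<open>Blinfun\<close>, with continuity
  checked on basis vectors, and the restriction to a ball inside \<open>W\<close>.\<close>

lemma has_derivative_param_integral:
  fixes f :: "'w::euclidean_space \<times> 'q::euclidean_space \<Rightarrow> 'b::banach"
  assumes W: "open W" "w \<in> W" and f: "smooth_on (W \<times> UNIV) f"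
  shows "((\<lambda>w. integral (cbox a c) (\<lambda>q. f (w, q))) has_derivative
      (\<lambda>v. integral (cbox a c) (\<lambda>q. dir_deriv (v, 0) f (w, q)))) (at w)"
proof -
  obtain e where e: "e > 0" "ball w e \<subseteq> W" using W open_contains_ball by blast
  have df: "f differentiable at (x, q)" if "x \<in> W" for x q
    using smooth_on_differentiable[OF f] that by auto
  define D where "D x q = Blinfun (\<lambda>v. dir_deriv (v, 0) f (x, q))" for x q
  have D: "blinfun_apply (D x q) v = dir_deriv (v, 0) f (x, q)" if "x \<in> W" for x q v
  proof -
    have "bounded_linear (\<lambda>v. dir_deriv (v, 0) f (x, q))"
      using has_derivative_bounded_linear[OF has_derivative_dir_deriv[OF df[OF that]]]
      by (rule bounded_linear_compose) (intro bounded_linear_Pair bounded_linear_ident bounded_linear_zero)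
    then show ?thesis by (simp add: D_def bounded_linear_Blinfun_apply)
  qed
  have contD: "continuous_on (W \<times> UNIV) (\<lambda>(x, q). D x q)"
  proof (rule continuous_on_blinfun_componentwise)
    fix i :: 'w
    have "continuous_on (W \<times> UNIV) (dir_deriv (i, 0) f)"
      by (intro smooth_on_continuous_on smooth_on_dir_deriv f open_Times W open_UNIV)
    then show "continuous_on (W \<times> UNIV) (\<lambda>x. blinfun_apply (case x of (x, q) \<Rightarrow> D x q) i)"
      by (rule continuous_on_eq) (auto simp: D)
  qed
  have cf: "continuous_on (W \<times> UNIV) f" by (rule smooth_on_continuous_on[OF f])
  have slice: "continuous_on A (\<lambda>q. g (x, q))"
    if "x \<in> W" "continuous_on (W \<times> UNIV) g" for x A and g :: "'w \<times> 'q \<Rightarrow> 'd::real_normed_vector"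
    by (rule continuous_on_compose2[OF that(2)]) (use that(1) in \<open>auto intro!: continuous_intros\<close>)
  have w: "w \<in> ball w e" using e by simp
  have "((\<lambda>x. integral (cbox a c) (\<lambda>q. f (x, q))) has_derivative
      blinfun_apply (integral (cbox a c) (D w))) (at w within ball w e)"
  proof (rule leibniz_rule[where f = "\<lambda>x q. f (x, q)"])
    fix x q assume "x \<in> ball w e"
    then have x: "x \<in> W" using e by blast
    have "((\<lambda>x. f (x, q)) has_derivative (\<lambda>v. dir_deriv v (\<lambda>x. f (x, q)) x)) (at x)"
      by (rule has_derivative_dir_deriv[OF dir_deriv_fst_slice(1)[OF df[OF x]]])
    moreover have "blinfun_apply (D x q) = (\<lambda>v. dir_deriv v (\<lambda>x. f (x, q)) x)"
      by (simp add: fun_eq_iff D[OF x] dir_deriv_fst_slice(2)[OF df[OF x]])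
    ultimately have "((\<lambda>x. f (x, q)) has_derivative blinfun_apply (D x q)) (at x)" by simp
    then show "((\<lambda>x. f (x, q)) has_derivative blinfun_apply (D x q)) (at x within ball w e)"
      by (rule has_derivative_at_withinI)
    show "(\<lambda>q. f (x, q)) integrable_on cbox a c"
      by (intro integrable_continuous slice x cf)
  next
    show "continuous_on (ball w e \<times> cbox a c) (\<lambda>(x, q). D x q)"
      by (rule continuous_on_subset[OF contD]) (use e in auto)
  qed (use w in auto)
  then have "((\<lambda>x. integral (cbox a c) (\<lambda>q. f (x, q))) has_derivative
      blinfun_apply (integral (cbox a c) (D w))) (at w)"
    using w by (simp add: at_within_open[OF _ open_ball])
  moreover have "blinfun_apply (integral (cbox a c) (D w)) = (\<lambda>v. integral (cbox a c) (\<lambda>q. dir_deriv (v, 0) f (w, q)))"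
  proof
    fix v
    have "continuous_on (cbox a c) (D w)"
      using slice[OF W(2) contD] by simp
    then show "blinfun_apply (integral (cbox a c) (D w)) v = integral (cbox a c) (\<lambda>q. dir_deriv (v, 0) f (w, q))"
      using D[OF W(2)] by (simp add: blinfun_apply_integral integrable_continuous)
  qed
  ultimately show ?thesis by simp
qed

lemma dir_deriv_param_integral:
  fixes f :: "'w::euclidean_space \<times> 'q::euclidean_space \<Rightarrow> 'b::banach"
  assumes "open W" "w \<in> W" "smooth_on (W \<times> UNIV) f"
  shows "dir_deriv v (\<lambda>w. integral (cbox a c) (\<lambda>q. f (w, q))) w
    = integral (cbox a c) (\<lambda>q. dir_deriv (v, 0) f (w, q))"
  using has_derivative_param_integral[OF assms] by (rule dir_deriv_eqI)

lemma smooth_on_param_integral: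
  fixes f :: "'w::euclidean_space \<times> 'q::euclidean_space \<Rightarrow> 'b::banach"
  assumes W: "open W" and f: "smooth_on (W \<times> UNIV) f"
  shows "smooth_on W (\<lambda>w. integral (cbox a c) (\<lambda>q. f (w, q)))"
proof -
  have "diff_upto n W (\<lambda>w. integral (cbox a c) (\<lambda>q. f (w, q)))" for n
    using f
  proof (induction n arbitrary: f)
    case 0
    show ?case unfolding diff_upto.simps differentiable_def
      by (intro ballI exI, rule has_derivative_param_integral[OF W _ 0])
  next
    case (Suc n)
    have "diff_upto n W (dir_deriv v (\<lambda>w. integral (cbox a c) (\<lambda>q. f (w, q))))" for v
    proof (rule diff_upto_cong[OF W])
      show "diff_upto n W (\<lambda>w. integral (cbox a c) (\<lambda>q. dir_deriv (v, 0) f (w, q)))"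
        by (intro Suc.IH smooth_on_dir_deriv Suc.prems open_Times W open_UNIV)
    qed (simp add: dir_deriv_param_integral[OF W _ Suc.prems])
    moreover have "(\<lambda>w. integral (cbox a c) (\<lambda>q. f (w, q))) differentiable at w" if "w \<in> W" for w
      unfolding differentiable_def by (rule exI, rule has_derivative_param_integral[OF W that Suc.prems])
    ultimately show ?case by simp
  qed
  then show ?thesis by (simp add: smooth_on_iff_diff_upto)
qed

lemma continuous_on_slice:
  assumes "continuous_on (W \<times> UNIV) g" "x \<in> W"
  shows "continuous_on A (\<lambda>q. g (x, q))"
  by (rule continuous_on_compose2[OF assms(1)]) (use assms(2) in \<open>auto intro!: continuous_intros\<close>)

text \<open>The weight \<open>g\<close> depends on \<open>t\<close> alone, so it leaves the integral
  over \<open>s\<close>, and that integral vanishes by periodicity. This allows a factor such as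
  \<open>1 / (1 + (dirv t \<bullet> \<xi>)^2)\<close> to be carried through integrations by parts in
  \<open>s\<close>.\<close>

lemma integral_periodic_deriv_fst:
  fixes h :: "real \<times> real \<Rightarrow> complex" and g :: "real \<Rightarrow> complex"
  assumes h: "smooth_on UNIV h" and per: "\<And>s t. h (s + p, t) = h (s, t)" and "p \<ge> 0"
    and g: "continuous_on UNIV g"
  shows "integral (cbox (0, 0) (p, p')) (\<lambda>q. g (snd q) * dir_deriv (1, 0) h q) = 0"
proof -
  have ch: "continuous_on UNIV (dir_deriv (1, 0) h)"
    by (intro smooth_on_continuous_on smooth_on_dir_deriv h open_UNIV)
  have cg: "continuous_on A (\<lambda>q. g (snd q))" for A :: "(real \<times> real) set"
    by (rule continuous_on_compose2[OF g]) (auto intro!: continuous_intros)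
  have c: "continuous_on (cbox (0, 0) (p, p')) (\<lambda>q. g (snd q) * dir_deriv (1, 0) h q)"
    by (intro continuous_intros cg continuous_on_subset[OF ch]) auto
  have "integral (cbox (0, 0) (p, p')) (\<lambda>q. g (snd q) * dir_deriv (1, 0) h q)
      = integral (cbox 0 p) (\<lambda>s. integral (cbox 0 p') (\<lambda>t. g t * dir_deriv (1, 0) h (s, t)))"
    using integral_prod_continuous[OF c] by simp
  also have "\<dots> = integral (cbox 0 p') (\<lambda>t. integral (cbox 0 p) (\<lambda>s. g t * dir_deriv (1, 0) h (s, t)))"
    by (rule integral_swap_continuous) (use c in \<open>simp add: case_prod_unfold\<close>)
  also have "(\<lambda>t. integral (cbox 0 p) (\<lambda>s. g t * dir_deriv (1, 0) h (s, t))) = (\<lambda>t. 0)"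
  proof
    fix t
    have d: "h differentiable at (s, t)" for s using smooth_on_differentiable[OF h] by simp
    have "((\<lambda>s. h (s, t)) has_vector_derivative dir_deriv (1, 0) h (s, t)) (at s within {0..p})" for s
    proof -
      have "((\<lambda>s. h (s, t)) has_derivative (\<lambda>v. dir_deriv v (\<lambda>s. h (s, t)) s)) (at s)"
        by (rule has_derivative_dir_deriv[OF dir_deriv_fst_slice(1)[OF d]])
      moreover have "dir_deriv v (\<lambda>s. h (s, t)) s = v *\<^sub>R dir_deriv (1, 0) h (s, t)" for v
        using dir_deriv_sum_Basis[OF dir_deriv_fst_slice(1)[OF d], of v] dir_deriv_fst_slice(2)[OF d, of 1] by simp
      ultimately show ?thesis
        unfolding has_vector_derivative_def by (simp add: has_derivative_at_withinI)
    qed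
    from fundamental_theorem_of_calculus[OF \<open>p \<ge> 0\<close> this]
    have "integral {0..p} (\<lambda>s. dir_deriv (1, 0) h (s, t)) = h (p, t) - h (0, t)"
      by (simp add: integral_unique)
    also have "\<dots> = 0" using per[of 0 t] by simp
    finally show "integral (cbox 0 p) (\<lambda>s. g t * dir_deriv (1, 0) h (s, t)) = 0"
      by simp
  qed
  finally show ?thesis by simp
qed

lemma integral_periodic_deriv_snd:
  fixes h :: "real \<times> real \<Rightarrow> complex"
  assumes h: "smooth_on UNIV h" and per: "\<And>s t. h (s, t + p) = h (s, t)" and "p \<ge> 0"
  shows "integral (cbox (0, 0) (p', p)) (\<lambda>q. dir_deriv (0, 1) h q) = 0"
proof -
  have ch: "continuous_on UNIV (dir_deriv (0, 1) h)"
    by (intro smooth_on_continuous_on smooth_on_dir_deriv h open_UNIV)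
  have c: "continuous_on (cbox (0, 0) (p', p)) (dir_deriv (0, 1) h)"
    by (intro continuous_intros continuous_on_subset[OF ch]) auto
  have "integral (cbox (0, 0) (p', p)) (dir_deriv (0, 1) h)
      = integral (cbox 0 p') (\<lambda>s. integral (cbox 0 p) (\<lambda>t. dir_deriv (0, 1) h (s, t)))"
    using integral_prod_continuous[OF c] by simp
  also have "(\<lambda>s. integral (cbox 0 p) (\<lambda>t. dir_deriv (0, 1) h (s, t))) = (\<lambda>s. 0)"
  proof
    fix s
    have d: "h differentiable at (s, t)" for t using smooth_on_differentiable[OF h] by simp
    have "((\<lambda>t. h (s, t)) has_vector_derivative dir_deriv (0, 1) h (s, t)) (at t within {0..p})" for t
    proof -
      have "((\<lambda>t. h (s, t)) has_derivative (\<lambda>v. dir_deriv v (\<lambda>t. h (s, t)) t)) (at t)"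
        by (rule has_derivative_dir_deriv[OF dir_deriv_snd_slice(1)[OF d]])
      moreover have "dir_deriv v (\<lambda>t. h (s, t)) t = v *\<^sub>R dir_deriv (0, 1) h (s, t)" for v
        using dir_deriv_sum_Basis[OF dir_deriv_snd_slice(1)[OF d], of v] dir_deriv_snd_slice(2)[OF d, of 1] by simp
      ultimately show ?thesis
        unfolding has_vector_derivative_def by (simp add: has_derivative_at_withinI)
    qed
    from fundamental_theorem_of_calculus[OF \<open>p \<ge> 0\<close> this]
    have "integral {0..p} (\<lambda>t. dir_deriv (0, 1) h (s, t)) = h (s, p) - h (s, 0)"
      by (simp add: integral_unique)
    also have "\<dots> = 0" using per[of s 0] by simp
    finally show "integral (cbox 0 p) (\<lambda>t. dir_deriv (0, 1) h (s, t)) = 0" by simp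
  qed
  finally show ?thesis by simp
qed

subsection \<open>Oscillatory integrals\<close>

definition dirv :: "real \<Rightarrow> real^2" where "dirv t = vector [cos t, sin t]"
definition dirp :: "real \<Rightarrow> real^2" where "dirp t = vector [- sin t, cos t]"

lemma dirv_components [simp]: "dirv t $ 1 = cos t" "dirv t $ 2 = sin t"
  and dirp_components [simp]: "dirp t $ 1 = - sin t" "dirp t $ 2 = cos t"
  by (simp_all add: dirv_def dirp_def)

lemma inner_2: "x \<bullet> y = x $ 1 * y $ 1 + x $ 2 * y $ 2" for x y :: "real^2"
  by (simp add: inner_vec_def sum_2)

lemma norm_2_squared: "(norm x)\<^sup>2 = (x $ 1)\<^sup>2 + (x $ 2)\<^sup>2" for x :: "real^2"
  unfolding power2_norm_eq_inner inner_2 by (simp add: power2_eq_square)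

lemma dirv_alt: "dirv t = cos t *\<^sub>R vector [1, 0] + sin t *\<^sub>R vector [0, 1]"
  and dirp_alt: "dirp t = cos t *\<^sub>R vector [0, 1] - sin t *\<^sub>R vector [1, 0]"
  by (simp_all add: vec_eq_iff forall_2)

lemma norm_dirv [simp]: "norm (dirv t) = 1"
  by (rule power2_eq_imp_eq) (simp_all add: norm_2_squared)

lemma dirv_periodic [simp]: "dirv (t + 2 * pi) = dirv t" and dirp_periodic [simp]: "dirp (t + 2 * pi) = dirp t"
  by (simp_all add: vec_eq_iff forall_2)

lemma has_derivative_dirv: "(dirv has_derivative (\<lambda>h. h *\<^sub>R dirp t)) (at t)"
  unfolding dirv_alt[abs_def] dirp_alt
  by (auto intro!: derivative_eq_intros simp: algebra_simps)

lemma smooth_on_dirv: "open U \<Longrightarrow> smooth_on U f \<Longrightarrow> smooth_on U (\<lambda>x. dirv (f x))"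
  and smooth_on_dirp: "open U \<Longrightarrow> smooth_on U f \<Longrightarrow> smooth_on U (\<lambda>x. dirp (f x))"
  unfolding dirv_alt dirp_alt
  by (intro smooth_on_add smooth_on_diff smooth_on_scaleR smooth_on_const
      smooth_on_compose_UNIV[OF _ smooth_on_cos] smooth_on_compose_UNIV[OF _ smooth_on_sin]; assumption)+

lemma dirv_polar:
  obtains t where "0 \<le> t" "t < 2 * pi" "x = norm x *\<^sub>R dirv t"
proof (cases "x = 0")
  case True
  then show ?thesis using that[of 0] by simp
next
  case False
  have "(x $ 1 / norm x)\<^sup>2 + (x $ 2 / norm x)\<^sup>2 = 1"
    using False by (simp add: power_divide add_divide_distrib[symmetric] norm_2_squared[symmetric])
  then obtain t where "0 \<le> t" "t < 2 * pi" "x $ 1 / norm x = cos t" "x $ 2 / norm x = sin t"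
    by (rule sincos_total_2pi)
  moreover from this have "x $ 1 = norm x * cos t" "x $ 2 = norm x * sin t"
    using False by (simp_all add: divide_eq_eq mult_ac)
  then have "x = norm x *\<^sub>R dirv t" unfolding vec_eq_iff forall_2 by simp
  ultimately show ?thesis by (intro that)
qed

lemma inner_dirv_dirv: "dirv s \<bullet> dirv t = cos (s - t)"
  by (simp add: inner_2 cos_diff)

text \<open>The angle from \<open>(- sin u, cos u)\<close> to \<open>(- A sin u, B cos u)\<close>, which is always less than \<open>\<pi>/2\<close>.\<close>
definition stretch_angle :: "real \<Rightarrow> real \<Rightarrow> real \<Rightarrow> real" where
  "stretch_angle A B u = arctan ((A - B) * sin u * cos u / (A * (sin u)\<^sup>2 + B * (cos u)\<^sup>2))"

lemma stretch_angle_denominator_pos: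
  fixes A B u :: real
  assumes "A > 0" "B > 0" shows "A * (sin u)\<^sup>2 + B * (cos u)\<^sup>2 > 0"
proof (cases "sin u = 0")
  case True
  then have "(cos u)\<^sup>2 = 1" using sin_cos_squared_add[of u] by simp
  then show ?thesis using True assms by simp
next
  case False
  then have "A * (sin u)\<^sup>2 > 0" using assms by simp
  then show ?thesis using assms by (intro add_pos_nonneg) auto
qed

text \<open>\<open>D\<close> and \<open>N\<close> are the inner and the cross product of the unit
  vector with its stretched image, so \<open>N / D\<close> is the tangent of the angle and
  \<open>D^2 + N^2\<close> the squared length of the image. As \<open>D\<close> never vanishes, the
  arctangent has no jumps and gives an antiderivative valid over whole periods.\<close>

lemma stretch_angle_deriv:
  assumes "A > 0" "B > 0"
  shows "((\<lambda>u. u + stretch_angle A B u) has_real_derivative A * B / (A\<^sup>2 * (sin u)\<^sup>2 + B\<^sup>2 * (cos u)\<^sup>2)) (at u)"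
proof -
  define s c where "s = sin u" and "c = cos u"
  define D where "D = A * s\<^sup>2 + B * c\<^sup>2"
  define N where "N = (A - B) * s * c"
  have sc: "s\<^sup>2 + c\<^sup>2 = 1" by (simp add: s_def c_def)
  have D: "D > 0" using stretch_angle_denominator_pos[OF assms] by (simp add: D_def s_def c_def)
  have sum: "D\<^sup>2 + N\<^sup>2 = A\<^sup>2 * s\<^sup>2 + B\<^sup>2 * c\<^sup>2"
    using sc unfolding D_def N_def by algebra
  have pos: "A\<^sup>2 * s\<^sup>2 + B\<^sup>2 * c\<^sup>2 > 0"
    using D by (subst sum[symmetric]) (simp add: add_pos_nonneg)
  have "((\<lambda>u. (A - B) * sin u * cos u / (A * (sin u)\<^sup>2 + B * (cos u)\<^sup>2)) has_real_derivative
      ((A - B) * (c\<^sup>2 - s\<^sup>2) * D - N * (2 * (A - B) * s * c)) / D\<^sup>2) (at u)"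
    using D unfolding D_def N_def s_def c_def
    by (auto intro!: derivative_eq_intros simp: power2_eq_square algebra_simps)
  from DERIV_add[OF DERIV_ident DERIV_chain2[OF DERIV_arctan this]]
  have "((\<lambda>u. u + stretch_angle A B u) has_real_derivative
      1 + inverse (1 + (N / D)\<^sup>2) * (((A - B) * (c\<^sup>2 - s\<^sup>2) * D - N * (2 * (A - B) * s * c)) / D\<^sup>2)) (at u)"
    by (simp add: stretch_angle_def N_def D_def s_def c_def mult_ac)
  also have "inverse (1 + (N / D)\<^sup>2) * (((A - B) * (c\<^sup>2 - s\<^sup>2) * D - N * (2 * (A - B) * s * c)) / D\<^sup>2)
     = ((A - B) * (c\<^sup>2 - s\<^sup>2) * D - N * (2 * (A - B) * s * c)) / (D\<^sup>2 + N\<^sup>2)"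
    using D pos sum by (simp add: power_divide divide_simps)
  also have "1 + \<dots> = (D\<^sup>2 + N\<^sup>2 + ((A - B) * (c\<^sup>2 - s\<^sup>2) * D - N * (2 * (A - B) * s * c))) / (D\<^sup>2 + N\<^sup>2)"
    using pos sum by (simp add: add_divide_distrib)
  also have "D\<^sup>2 + N\<^sup>2 + ((A - B) * (c\<^sup>2 - s\<^sup>2) * D - N * (2 * (A - B) * s * c)) = A * B"
    using sc unfolding D_def N_def by algebra
  finally show ?thesis by (simp add: sum s_def c_def)
qed

text \<open>With half-axes 1 and \<open>B = sqrt (1 + |\<xi>|^2)\<close> the denominator
  \<open>sin^2 + B^2 * cos^2\<close>, taken at the angle to \<open>\<xi>\<close>, is
  \<open>1 + (dirv t \<bullet> \<xi>)^2\<close>. The stretch angle is periodic, so over a full turn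
  only the linear part of the antiderivative contributes.\<close>

lemma has_integral_angular_weight:
  fixes \<xi> :: "real^2"
  shows "((\<lambda>t. 1 / (1 + (dirv t \<bullet> \<xi>)\<^sup>2)) has_integral 2 * pi / sqrt (1 + (norm \<xi>)\<^sup>2)) {0..2 * pi}"
proof -
  obtain t0 where t0: "\<xi> = norm \<xi> *\<^sub>R dirv t0" using dirv_polar by metis
  define B where "B = sqrt (1 + (norm \<xi>)\<^sup>2)"
  have B: "B > 0" "B\<^sup>2 = 1 + (norm \<xi>)\<^sup>2" by (simp_all add: B_def add_pos_nonneg)
  define F where "F t = ((t - t0) + stretch_angle 1 B (t - t0)) / B" for t
  have "(F has_real_derivative 1 / (1 + (dirv t \<bullet> \<xi>)\<^sup>2)) (at t)" for t
  proof -
    have "(F has_real_derivative (1 * B / (1\<^sup>2 * (sin (t - t0))\<^sup>2 + B\<^sup>2 * (cos (t - t0))\<^sup>2)) / B) (at t)"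
      unfolding F_def
      using DERIV_cdivide[OF DERIV_chain2[OF stretch_angle_deriv[of 1 B "t - t0"] DERIV_diff[OF DERIV_ident DERIV_const]], of B]
        B by simp
    moreover have "1\<^sup>2 * (sin (t - t0))\<^sup>2 + B\<^sup>2 * (cos (t - t0))\<^sup>2 = 1 + (dirv t \<bullet> \<xi>)\<^sup>2"
    proof -
      have "dirv t \<bullet> \<xi> = norm \<xi> * cos (t - t0)" by (subst t0) (simp add: inner_dirv_dirv)
      moreover have "(sin (t - t0))\<^sup>2 = 1 - (cos (t - t0))\<^sup>2" using sin_cos_squared_add[of "t - t0"] by linarith
      ultimately show ?thesis using B(2) by (simp add: power_mult_distrib algebra_simps)
    qed
    ultimately show ?thesis using B by simp
  qed
  then have "((\<lambda>t. 1 / (1 + (dirv t \<bullet> \<xi>)\<^sup>2)) has_integral F (2 * pi) - F 0) {0..2 * pi}"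
    by (intro fundamental_theorem_of_calculus)
      (auto simp: has_real_derivative_iff_has_vector_derivative[symmetric] intro: has_field_derivative_at_within)
  moreover have "F (2 * pi) - F 0 = 2 * pi / B"
  proof -
    have "sin (2 * pi - t0) = sin (0 - t0)" "cos (2 * pi - t0) = cos (0 - t0)"
      by (simp_all add: sin_diff cos_diff)
    then show ?thesis by (simp add: F_def stretch_angle_def diff_divide_distrib[symmetric])
  qed
  ultimately show ?thesis by (simp add: B_def)
qed

section \<open>Amplitude calculus for phases linear in the covector\<close>

lemma dir_deriv_shift:
  assumes "open U" "x \<in> U" "x + h \<in> U" "\<And>y. y \<in> U \<Longrightarrow> f (y + h) = f y" "f differentiable (at (x + h))"
  shows "dir_deriv v f (x + h) = dir_deriv v f x"
proof -
  have "((\<lambda>y. f (y + h)) has_derivative (\<lambda>v. dir_deriv v f (x + h))) (at x)"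
    using diff_chain_at[OF has_derivative_add[OF has_derivative_ident has_derivative_const], of f _ x h]
      has_derivative_dir_deriv[OF assms(5)] by (simp add: o_def)
  from dir_deriv_eqI[OF this, of v] have "dir_deriv v f (x + h) = dir_deriv v (\<lambda>y. f (y + h)) x" ..
  also have "\<dots> = dir_deriv v f x"
    by (rule dir_deriv_cong[OF assms(1,2) assms(4)])
      (use \<open>((\<lambda>y. f (y + h)) has_derivative _) (at x)\<close> differentiable_def in blast)+
  finally show ?thesis .
qed

lemma has_derivative_cis:
  assumes "(g has_derivative g') (at x)"
  shows "((\<lambda>x. cis (g x)) has_derivative (\<lambda>v. g' v *\<^sub>R (\<i> * cis (g x)))) (at x)"
  using diff_chain_at[OF assms has_vector_derivative_cis[unfolded has_vector_derivative_def]]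
  by (simp add: o_def)

text \<open>The phase is \<open>r (z, s, t) * (dirv t \<bullet> \<xi>)\<close> over base points
  \<open>z\<close> in \<open>Z\<close>. On \<open>S\<close> the \<open>s\<close>-derivative of
  \<open>r\<close> may serve as a divisor; amplitudes will be supported there, and openness of the
  complement makes vanishing off \<open>S\<close> stable under differentiation.\<close>

locale oscillatory =
  fixes Z :: "'z::euclidean_space set" and r :: "'z \<times> real \<times> real \<Rightarrow> real"
    and S :: "('z \<times> real \<times> real) set"
  assumes open_Z: "open Z" and smooth_r: "smooth_on (Z \<times> UNIV) r"
    and periodic_r: "\<And>z s t. z \<in> Z \<Longrightarrow> r (z, s + 2 * pi, t) = r (z, s, t)"
      "\<And>z s t. z \<in> Z \<Longrightarrow> r (z, s, t + 2 * pi) = r (z, s, t)"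
    and open_S: "open (Z \<times> UNIV - S)"
    and noncritical: "\<And>p. p \<in> Z \<times> UNIV \<Longrightarrow> p \<in> S \<Longrightarrow> dir_deriv (0, 1, 0) r p \<noteq> 0"
begin

abbreviation dom where "dom \<equiv> Z \<times> (UNIV :: (real \<times> real) set)"

definition coef :: "('z \<times> real \<times> real \<Rightarrow> complex) set" where
  "coef = {B. smooth_on dom B \<and>
     (\<forall>z\<in>Z. \<forall>s t. B (z, s + 2 * pi, t) = B (z, s, t) \<and> B (z, s, t + 2 * pi) = B (z, s, t))}"

text \<open>The amplitudes that may be divided by \<open>r_s\<close>. The class is closed under
  derivatives, under products with \<open>coef\<close> and under that division, hence under all
  integrations by parts below.\<close>

definition amp :: "('z \<times> real \<times> real \<Rightarrow> complex) set" where
  "amp = {B \<in> coef. \<forall>p\<in>dom - S. B p = 0}"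

definition quo :: "('z \<times> real \<times> real \<Rightarrow> complex) \<Rightarrow> 'z \<times> real \<times> real \<Rightarrow> complex" where
  "quo B p = B p / complex_of_real (dir_deriv (0, 1, 0) r p)"

definition rc :: "'z \<times> real \<times> real \<Rightarrow> complex" where
  "rc p = complex_of_real (r p)"

definition rd :: "'z \<times> real \<times> real \<Rightarrow> 'z \<times> real \<times> real \<Rightarrow> complex" where
  "rd e p = complex_of_real (dir_deriv e r p)"

text \<open>The \<open>s\<close>-derivative of the wave is
  \<open>\<i> * (dirv t \<bullet> \<xi>) * r_s\<close> times the wave. Integration by parts
  therefore turns a factor \<open>\<i> * (dirv t \<bullet> \<xi>) * X\<close> in front of
  \<open>B\<close> into \<open>- sdiv X B\<close>.\<close>

definition sdiv :: "('z \<times> real \<times> real \<Rightarrow> complex) \<Rightarrow> ('z \<times> real \<times> real \<Rightarrow> complex) \<Rightarrow> 'z \<times> real \<times> real \<Rightarrow> complex" where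
  "sdiv X B = dir_deriv (0, 1, 0) (\<lambda>p. X p * quo B p)"

text \<open>The amplitude of the derivative: the factor that the phase contributes is integrated by parts in
  \<open>s\<close>. The result commutes with multiplication by \<open>r\<close>.\<close>
definition lift :: "'z \<times> real \<times> real \<Rightarrow> ('z \<times> real \<times> real \<Rightarrow> complex) \<Rightarrow> 'z \<times> real \<times> real \<Rightarrow> complex" where
  "lift e B p = dir_deriv e B p - sdiv (rd e) B p"

text \<open>The power of \<open>r\<close> is kept apart from the amplitude because it is what the
  decay estimate consumes: \<open>m\<close> visible factors yield decay of order
  \<open>m + 1\<close>.\<close>

definition rpow :: "nat \<Rightarrow> ('z \<times> real \<times> real \<Rightarrow> complex) \<Rightarrow> 'z \<times> real \<times> real \<Rightarrow> complex" where
  "rpow m B p = rc p ^ m * B p"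

lemma open_dom: "open dom"
  by (simp add: open_Times open_Z)

lemma coef_smooth: "B \<in> coef \<Longrightarrow> smooth_on dom B"
  by (simp add: coef_def)

lemma coef_differentiable: "B \<in> coef \<Longrightarrow> p \<in> dom \<Longrightarrow> B differentiable (at p)"
  using smooth_on_differentiable[OF coef_smooth] by blast

lemma amp_coef: "B \<in> amp \<Longrightarrow> B \<in> coef"
  by (simp add: amp_def)

lemma amp_zero: "B \<in> amp \<Longrightarrow> p \<in> dom \<Longrightarrow> p \<notin> S \<Longrightarrow> B p = 0"
  by (simp add: amp_def)

lemma coef_dir_deriv:
  assumes "B \<in> coef" shows "dir_deriv e B \<in> coef"
proof -
  have "dir_deriv e B (z, s + 2 * pi, t) = dir_deriv e B (z, s, t)"
       "dir_deriv e B (z, s, t + 2 * pi) = dir_deriv e B (z, s, t)" if "z \<in> Z" for z s t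
    using dir_deriv_shift[OF open_dom, of "(z, s, t)" "(0, 2 * pi, 0)" B e]
      dir_deriv_shift[OF open_dom, of "(z, s, t)" "(0, 0, 2 * pi)" B e]
      coef_differentiable[OF assms] assms that by (auto simp: coef_def)
  then show ?thesis using smooth_on_dir_deriv[OF open_dom coef_smooth[OF assms]] by (simp add: coef_def)
qed

lemma amp_dir_deriv:
  assumes "B \<in> amp" shows "dir_deriv e B \<in> amp"
proof -
  have "dir_deriv e B p = 0" if "p \<in> dom - S" for p
  proof -
    have "dir_deriv e B p = dir_deriv e (\<lambda>_. 0) p"
      using dir_deriv_cong[OF open_S that, of B "\<lambda>_. 0"] coef_differentiable[OF amp_coef[OF assms]] assms that
      by (auto simp: amp_def)
    then show ?thesis using dir_deriv_eqI[OF has_derivative_const] by metis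
  qed
  then show ?thesis using coef_dir_deriv[OF amp_coef[OF assms]] by (simp add: amp_def)
qed

lemma coef_const: "(\<lambda>p. c) \<in> coef"
  by (simp add: coef_def)

lemma coef_mult: "X \<in> coef \<Longrightarrow> Y \<in> coef \<Longrightarrow> (\<lambda>p. X p * Y p) \<in> coef"
  by (auto simp: coef_def intro: smooth_on_mult[OF open_dom])

lemma coef_add: "X \<in> coef \<Longrightarrow> Y \<in> coef \<Longrightarrow> (\<lambda>p. X p + Y p) \<in> coef"
  by (auto simp: coef_def intro: smooth_on_add[OF open_dom])

lemma coef_power: "X \<in> coef \<Longrightarrow> (\<lambda>p. X p ^ n) \<in> coef"
  by (auto simp: coef_def intro: smooth_on_power[OF open_dom])

lemma amp_mult: "X \<in> coef \<Longrightarrow> B \<in> amp \<Longrightarrow> (\<lambda>p. X p * B p) \<in> amp"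
  by (auto simp: amp_def intro: coef_mult)

lemma amp_add: "A \<in> amp \<Longrightarrow> B \<in> amp \<Longrightarrow> (\<lambda>p. A p + B p) \<in> amp"
  by (auto simp: amp_def intro: coef_add)

lemma amp_diff: "A \<in> amp \<Longrightarrow> B \<in> amp \<Longrightarrow> (\<lambda>p. A p - B p) \<in> amp"
  using amp_add[of A "\<lambda>p. (-1) * B p"] amp_mult[OF coef_const, of B "-1"] by simp

lemma rc_coef: "rc \<in> coef"
  unfolding coef_def rc_def using periodic_r by (auto intro: smooth_on_of_real open_dom smooth_r)

lemma dir_deriv_rc: "p \<in> dom \<Longrightarrow> dir_deriv e rc p = rd e p"
  unfolding rc_def[abs_def] rd_def
  by (rule dir_deriv_linear_comp[OF bounded_linear_of_real smooth_on_differentiable[OF smooth_r]])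

lemma rd_coef: "rd e \<in> coef"
proof -
  have "dir_deriv e rc \<in> coef" by (rule coef_dir_deriv[OF rc_coef])
  moreover have "smooth_on dom (rd e)"
    by (rule smooth_on_cong[OF open_dom dir_deriv_rc]) (use coef_smooth[OF coef_dir_deriv[OF rc_coef]] in auto)
  ultimately show ?thesis using dir_deriv_rc[of _ e] by (simp add: coef_def)
qed

lemma angle_coef: "(\<lambda>p. complex_of_real (dirv (snd (snd p)) \<bullet> v)) \<in> coef"
  "(\<lambda>p. complex_of_real (dirp (snd (snd p)) \<bullet> v)) \<in> coef"
  unfolding coef_def
  by (auto intro!: smooth_on_of_real smooth_on_inner smooth_on_dirv smooth_on_dirp smooth_on_snd
      smooth_on_ident smooth_on_const open_dom)

text \<open>Around a zero of \<open>r_s\<close> the point lies in the open complement of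
  \<open>S\<close>, where \<open>B\<close> and hence the quotient is identically 0; around any other
  point the divisor is nonzero and smooth.\<close>

lemma quo_amp:
  assumes "B \<in> amp" shows "quo B \<in> amp"
proof -
  let ?rs = "dir_deriv (0, 1, 0) r"
  have sm: "smooth_on dom ?rs" by (rule smooth_on_dir_deriv[OF open_dom smooth_r])
  have "smooth_on dom (quo B)"
  proof (rule smooth_on_local)
    fix p assume p: "p \<in> dom"
    show "\<exists>T. p \<in> T \<and> smooth_on T (quo B)"
    proof (cases "?rs p = 0")
      case True
      then have "p \<in> dom - S" using noncritical[OF p] p by blast
      moreover have "smooth_on (dom - S) (quo B)"
        by (rule smooth_on_cong[OF open_S _ smooth_on_const[of _ 0]]) (use assms in \<open>auto simp: amp_def quo_def\<close>)
      ultimately show ?thesis by (intro exI[of _ "dom - S"] conjI)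
    next
      case False
      define T where "T = dom \<inter> ?rs -` (- {0})"
      have T: "open T" unfolding T_def
        by (rule continuous_open_preimage[OF smooth_on_continuous_on[OF sm] open_dom]) (simp add: open_Compl)
      have sub: "T \<subseteq> dom" by (auto simp: T_def)
      have "smooth_on T (\<lambda>p. B p * complex_of_real (inverse (?rs p)))"
        by (intro smooth_on_mult smooth_on_of_real smooth_on_inverse T
            smooth_on_subset[OF coef_smooth[OF amp_coef[OF assms]] sub] smooth_on_subset[OF sm sub]) (auto simp: T_def)
      then have "smooth_on T (quo B)"
        by (rule smooth_on_cong[OF T, rotated]) (simp add: quo_def divide_inverse)
      then show ?thesis using p False by (intro exI[of _ T]) (auto simp: T_def)
    qed
  qed
  then show ?thesis using assms rd_coef[of "(0, 1, 0)"]
    by (auto simp: amp_def coef_def quo_def rd_def)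
qed

lemma quo_mult: "B \<in> amp \<Longrightarrow> p \<in> dom \<Longrightarrow> rd (0, 1, 0) p * quo B p = B p"
  using noncritical[of p] amp_zero[of B p] by (cases "p \<in> S") (auto simp: quo_def rd_def)

lemma sdiv_amp: "X \<in> coef \<Longrightarrow> B \<in> amp \<Longrightarrow> sdiv X B \<in> amp"
  unfolding sdiv_def by (intro amp_dir_deriv amp_mult quo_amp)

lemma lift_amp: "B \<in> amp \<Longrightarrow> lift e B \<in> amp"
  unfolding lift_def[abs_def] by (intro amp_diff amp_dir_deriv sdiv_amp rd_coef)

lemma rpow_amp: "B \<in> amp \<Longrightarrow> rpow m B \<in> amp"
  unfolding rpow_def[abs_def] by (intro amp_mult coef_power rc_coef)

lemma dir_deriv_rpow:
  assumes "B \<in> coef" "p \<in> dom"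
  shows "dir_deriv e (rpow m B) p = rc p ^ m * dir_deriv e B p + of_nat m * rc p ^ (m - 1) * rd e p * B p"
proof -
  have "(rc has_derivative (\<lambda>e. rd e p)) (at p)"
    using has_derivative_dir_deriv[OF coef_differentiable[OF rc_coef assms(2)]] dir_deriv_rc[OF assms(2)] by simp
  then have "((\<lambda>p. rc p ^ m * B p) has_derivative
     (\<lambda>e. rc p ^ m * dir_deriv e B p + of_nat m * rd e p * rc p ^ (m - 1) * B p)) (at p)"
    by (intro has_derivative_mult has_derivative_power has_derivative_dir_deriv coef_differentiable assms)
  then show ?thesis unfolding rpow_def[abs_def] by (simp add: dir_deriv_eqI mult_ac)
qed

text \<open>Differentiating \<open>r^m\<close> costs one power of \<open>r\<close>, but the factor
  \<open>r_s\<close> that it produces cancels the denominator of \<open>quo\<close>.\<close>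

lemma sdiv_rpow:
  assumes "X \<in> coef" "B \<in> amp" "p \<in> dom"
  shows "sdiv X (rpow m B) p = rc p ^ m * sdiv X B p + of_nat m * rc p ^ (m - 1) * X p * B p"
proof -
  have "sdiv X (rpow m B) p = dir_deriv (0, 1, 0) (rpow m (\<lambda>p. X p * quo B p)) p"
    by (simp add: sdiv_def quo_def rpow_def[abs_def] mult_ac)
  also have "\<dots> = rc p ^ m * sdiv X B p + of_nat m * rc p ^ (m - 1) * rd (0, 1, 0) p * (X p * quo B p)"
    unfolding sdiv_def by (intro dir_deriv_rpow coef_mult amp_coef quo_amp assms)
  finally show ?thesis unfolding quo_mult[OF assms(2,3), symmetric] by (simp add: mult_ac)
qed

text \<open>Up to a term of order zero, \<open>lift e\<close> is the derivative along
  \<open>e - (r_e / r_s) * d/ds\<close>, a vector field that annihilates \<open>r\<close>: the two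
  terms with \<open>r^(m - 1)\<close> cancel.\<close>

lemma lift_rpow:
  assumes "B \<in> amp" "p \<in> dom"
  shows "lift e (rpow m B) p = rpow m (lift e B) p"
  unfolding lift_def sdiv_rpow[OF rd_coef assms] dir_deriv_rpow[OF amp_coef[OF assms(1)] assms(2)] rpow_def
  by (simp add: algebra_simps)

text \<open>The factor \<open>X = r\<close> restores the power that differentiating
  \<open>r^m\<close> loses. The case split takes care of the truncated exponent \<open>m - 1\<close>
  at \<open>m = 0\<close>.\<close>

lemma sdiv_rc_rpow:
  assumes "B \<in> amp" "p \<in> dom"
  shows "sdiv rc (rpow m B) p = rpow m (\<lambda>p. sdiv rc B p + of_nat m * B p) p"
  unfolding sdiv_rpow[OF rc_coef assms] rpow_def by (cases m) (simp_all add: algebra_simps)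

section \<open>The oscillatory integral and its integrations by parts\<close>

abbreviation torus where "torus \<equiv> cbox (0, 0) (2 * pi, 2 * pi) :: (real \<times> real) set"

abbreviation wave where "wave z \<xi> q \<equiv> cis (r (z, q) * (dirv (snd q) \<bullet> \<xi>))"

definition kern :: "('z \<times> real \<times> real \<Rightarrow> complex) \<Rightarrow> ('z \<times> (real^2)) \<times> real \<times> real \<Rightarrow> complex" where
  "kern B = (\<lambda>p. B (fst (fst p), snd p) * wave (fst (fst p)) (snd (fst p)) (snd p))"

definition osc :: "('z \<times> real \<times> real \<Rightarrow> complex) \<Rightarrow> 'z \<times> (real^2) \<Rightarrow> complex" where
  "osc B w = integral torus (\<lambda>q. B (fst w, q) * wave (fst w) (snd w) q)"

lemma osc_kern: "osc B = (\<lambda>w. integral torus (\<lambda>q. kern B (w, q)))"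
  by (simp add: osc_def kern_def fun_eq_iff)

abbreviation dom' where "dom' \<equiv> (Z \<times> (UNIV :: (real^2) set)) \<times> (UNIV :: (real \<times> real) set)"

lemma open_dom': "open dom'"
  by (intro open_Times open_Z open_UNIV)

lemma kern_smooth:
  assumes "B \<in> coef" shows "smooth_on dom' (kern B)"
proof -
  have pr: "smooth_on dom' (\<lambda>p. (fst (fst p), snd p) :: 'z \<times> real \<times> real)"
    by (intro smooth_on_Pair smooth_on_fst smooth_on_snd smooth_on_ident open_dom')
  have "smooth_on dom' (\<lambda>p. B (fst (fst p), snd p))"
    using smooth_on_compose[OF open_dom' open_dom _ coef_smooth[OF assms] pr] by force
  moreover have "smooth_on dom' (\<lambda>p. r (fst (fst p), snd p))"
    using smooth_on_compose[OF open_dom' open_dom _ smooth_r pr] by force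
  ultimately show ?thesis unfolding kern_def
    by (intro smooth_on_mult smooth_on_compose_UNIV[OF _ smooth_on_cis] smooth_on_inner smooth_on_dirv
        smooth_on_fst smooth_on_snd smooth_on_ident open_dom')
qed

lemma dir_deriv_kern:
  assumes "B \<in> coef" "z \<in> Z"
  shows "dir_deriv ((a, v), c) (kern B) ((z, \<xi>), q) =
    (dir_deriv (a, c) B (z, q) + \<i> * (rd (a, c) (z, q) * (dirv (snd q) \<bullet> \<xi>)
      + rc (z, q) * (snd c * (dirp (snd q) \<bullet> \<xi>) + dirv (snd q) \<bullet> v)) * B (z, q)) * wave z \<xi> q"
proof -
  have dom: "(z, q) \<in> dom" using assms by simp
  let ?p = "((z, \<xi>), q)"
  have pr: "((\<lambda>p :: ('z \<times> (real^2)) \<times> real \<times> real. (fst (fst p), snd p)) has_derivative (\<lambda>h. (fst (fst h), snd h))) (at ?p)"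
    by (auto intro!: derivative_eq_intros)
  have B: "((\<lambda>p. B (fst (fst p), snd p)) has_derivative (\<lambda>h. dir_deriv (fst (fst h), snd h) B (z, q))) (at ?p)"
    using diff_chain_at[OF pr, of B] has_derivative_dir_deriv[OF coef_differentiable[OF assms(1) dom]]
    by (simp add: o_def)
  have r: "((\<lambda>p. r (fst (fst p), snd p)) has_derivative (\<lambda>h. dir_deriv (fst (fst h), snd h) r (z, q))) (at ?p)"
    using diff_chain_at[OF pr, of r] has_derivative_dir_deriv[OF smooth_on_differentiable[OF smooth_r dom]]
    by (simp add: o_def)
  have sn: "((\<lambda>p. snd (snd p)) has_derivative (\<lambda>h. snd (snd h))) (at ?p)"
    by (auto intro!: derivative_eq_intros)
  have d: "((\<lambda>p. dirv (snd (snd p))) has_derivative (\<lambda>h. snd (snd h) *\<^sub>R dirp (snd q))) (at ?p)"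
    using diff_chain_at[OF sn, of dirv] has_derivative_dirv[of "snd q"] by (simp add: o_def)
  have x: "((\<lambda>p :: ('z \<times> (real^2)) \<times> real \<times> real. snd (fst p)) has_derivative (\<lambda>h. snd (fst h))) (at ?p)"
    by (auto intro!: derivative_eq_intros)
  have "(kern B has_derivative (\<lambda>h. B (z, q) * ((r (z, q) * (dirv (snd q) \<bullet> snd (fst h) + (snd (snd h) *\<^sub>R dirp (snd q)) \<bullet> \<xi>)
      + dir_deriv (fst (fst h), snd h) r (z, q) * (dirv (snd q) \<bullet> \<xi>)) *\<^sub>R (\<i> * wave z \<xi> q))
      + dir_deriv (fst (fst h), snd h) B (z, q) * wave z \<xi> q)) (at ?p)"
    unfolding kern_def
    using has_derivative_mult[OF B has_derivative_cis[OF has_derivative_mult[OF r has_derivative_inner[OF d x]]]]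
    by simp
  from dir_deriv_eqI[OF this, of "((a, v), c)"] show ?thesis
    by (simp add: rd_def rc_def scaleR_conv_of_real[where 'a = complex] algebra_simps)
qed

lemma continuous_coef:
  assumes "B \<in> coef" "z \<in> Z" shows "continuous_on A (\<lambda>q. B (z, q))"
  using continuous_on_slice[OF smooth_on_continuous_on[OF coef_smooth[OF assms(1)]] assms(2)] .

lemma continuous_wave:
  assumes "z \<in> Z" shows "continuous_on A (wave z \<xi>)"
proof -
  have "continuous_on A (\<lambda>q. kern (\<lambda>_. 1) ((z, \<xi>), q))"
    by (rule continuous_on_slice[OF smooth_on_continuous_on[OF kern_smooth[OF coef_const]]]) (use assms in auto)
  then show ?thesis by (simp add: kern_def)
qed

lemma continuous_angle: "continuous_on A (\<lambda>t. dirv t \<bullet> \<xi>)" "continuous_on A (\<lambda>t. dirp t \<bullet> \<xi>)"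
  by (auto simp: inner_2 intro!: continuous_intros)

lemma continuous_angle': "continuous_on A (\<lambda>q. dirv (snd q) \<bullet> \<xi>)" "continuous_on A (\<lambda>q. dirp (snd q) \<bullet> \<xi>)"
  for A :: "(real \<times> real) set"
  by (auto simp: inner_2 intro!: continuous_intros)

lemma continuous_snd: "continuous_on UNIV g \<Longrightarrow> continuous_on A (\<lambda>q. g (snd q))"
  by (rule continuous_on_compose2[of UNIV g]) (auto intro!: continuous_intros)

lemma osc_cong: "(\<And>p. p \<in> dom \<Longrightarrow> B p = B' p) \<Longrightarrow> z \<in> Z \<Longrightarrow> osc B (z, \<xi>) = osc B' (z, \<xi>)"
  by (simp add: osc_def)

lemma osc_integrable:
  assumes "B \<in> coef" "z \<in> Z" shows "(\<lambda>q. B (z, q) * wave z \<xi> q) integrable_on torus"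
  by (intro integrable_continuous continuous_intros continuous_coef continuous_wave assms)

text \<open>Integration by parts in \<open>s\<close> for the wave with amplitude
  \<open>A = X * quo B\<close>: the \<open>r_s\<close> coming from the phase cancels the denominator
  in \<open>A\<close>, which reproduces the left integrand, and the other term of the product rule
  is \<open>sdiv X B\<close>. The weight \<open>g\<close> does not see \<open>s\<close>.\<close>

lemma integral_phase_factor:
  assumes "X \<in> coef" "B \<in> amp" "z \<in> Z" and g: "continuous_on UNIV g"
  shows "integral torus (\<lambda>q. g (snd q) * (\<i> * (dirv (snd q) \<bullet> \<xi>) * X (z, q) * B (z, q)) * wave z \<xi> q)
    = - integral torus (\<lambda>q. g (snd q) * sdiv X B (z, q) * wave z \<xi> q)"
proof -
  define A where "A p = X p * quo B p" for p
  have A: "A \<in> amp" unfolding A_def[abs_def] by (intro amp_mult quo_amp assms)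
  have rA: "rd (0, 1, 0) (z, q) * A (z, q) = X (z, q) * B (z, q)" for q
    using quo_mult[OF assms(2), of "(z, q)"] assms(3) unfolding A_def by (simp add: mult.left_commute)
  define h where "h q = kern A ((z, \<xi>), q)" for q
  have sm: "smooth_on dom' (kern A)" by (rule kern_smooth[OF amp_coef[OF A]])
  have h_smooth: "smooth_on UNIV h"
    unfolding h_def by (rule smooth_on_compose[OF open_UNIV open_dom' _ sm])
      (use assms(3) in \<open>auto intro!: smooth_on_Pair smooth_on_const smooth_on_ident\<close>)
  have h_per: "h (s + 2 * pi, t) = h (s, t)" for s t
    using amp_coef[OF A] assms(3) periodic_r by (simp add: h_def kern_def coef_def)
  have h_deriv: "dir_deriv (1, 0) h q = (sdiv X B (z, q) + \<i> * (dirv (snd q) \<bullet> \<xi>) * X (z, q) * B (z, q)) * wave z \<xi> q" for q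
  proof -
    have "dir_deriv (1, 0) h q = dir_deriv ((0, 0), 1, 0) (kern A) ((z, \<xi>), q)"
      unfolding h_def zero_prod_def[symmetric]
      by (rule dir_deriv_snd_slice(2)[OF smooth_on_differentiable[OF sm]]) (use assms(3) in auto)
    also have "\<dots> = (sdiv X B (z, q) + \<i> * (rd (0, 1, 0) (z, q) * A (z, q)) * (dirv (snd q) \<bullet> \<xi>)) * wave z \<xi> q"
      unfolding dir_deriv_kern[OF amp_coef[OF A] assms(3)] by (simp add: sdiv_def A_def[abs_def] mult_ac)
    finally show ?thesis unfolding rA by (simp add: mult_ac)
  qed
  have i1: "(\<lambda>q. g (snd q) * sdiv X B (z, q) * wave z \<xi> q) integrable_on torus"
    by (intro integrable_continuous continuous_intros continuous_coef continuous_wave amp_coef sdiv_amp assms continuous_snd)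
  have i2: "(\<lambda>q. g (snd q) * (\<i> * (dirv (snd q) \<bullet> \<xi>) * X (z, q) * B (z, q)) * wave z \<xi> q) integrable_on torus"
    by (intro integrable_continuous continuous_intros continuous_coef continuous_wave amp_coef assms continuous_snd
        continuous_on_of_real continuous_angle')
  have "0 = integral torus (\<lambda>q. g (snd q) * dir_deriv (1, 0) h q)"
    using integral_periodic_deriv_fst[OF h_smooth h_per _ g] by simp
  also have "\<dots> = integral torus (\<lambda>q. g (snd q) * sdiv X B (z, q) * wave z \<xi> q
      + g (snd q) * (\<i> * (dirv (snd q) \<bullet> \<xi>) * X (z, q) * B (z, q)) * wave z \<xi> q)"
    by (simp add: h_deriv algebra_simps)
  also have "\<dots> = integral torus (\<lambda>q. g (snd q) * sdiv X B (z, q) * wave z \<xi> q)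
      + integral torus (\<lambda>q. g (snd q) * (\<i> * (dirv (snd q) \<bullet> \<xi>) * X (z, q) * B (z, q)) * wave z \<xi> q)"
    by (rule Henstock_Kurzweil_Integration.integral_add[OF i1 i2])
  finally show ?thesis by (simp add: eq_neg_iff_add_eq_0 add.commute)
qed

lemma integral_phase_factor1:
  assumes "X \<in> coef" "B \<in> amp" "z \<in> Z"
  shows "integral torus (\<lambda>q. \<i> * (dirv (snd q) \<bullet> \<xi>) * X (z, q) * B (z, q) * wave z \<xi> q) = - osc (sdiv X B) (z, \<xi>)"
  using integral_phase_factor[OF assms, of "\<lambda>_. 1" \<xi>] by (simp add: osc_def)

lemma osc_smooth: "B \<in> coef \<Longrightarrow> smooth_on (Z \<times> UNIV) (osc B)"
  unfolding osc_kern by (intro smooth_on_param_integral kern_smooth open_Times open_Z open_UNIV)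

lemma dir_deriv_osc:
  assumes "B \<in> coef" "z \<in> Z"
  shows "dir_deriv (a, v) (osc B) (z, \<xi>) = integral torus (\<lambda>q.
    (dir_deriv (a, 0) B (z, q) + \<i> * (rd (a, 0) (z, q) * (dirv (snd q) \<bullet> \<xi>)
      + rc (z, q) * (dirv (snd q) \<bullet> v)) * B (z, q)) * wave z \<xi> q)"
proof -
  have "dir_deriv (a, v) (osc B) (z, \<xi>) = integral torus (\<lambda>q. dir_deriv ((a, v), 0) (kern B) ((z, \<xi>), q))"
    unfolding osc_kern
    by (rule dir_deriv_param_integral[OF _ _ kern_smooth[OF assms(1)]]) (use assms in \<open>auto intro!: open_Times open_Z\<close>)
  then show ?thesis unfolding dir_deriv_kern[OF assms] by simp
qed

text \<open>The phase is linear in \<open>\<xi>\<close> with slope \<open>r * dirv t\<close>, so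
  each derivative brings down a factor \<open>r\<close>, the one that \<open>osc_decay\<close>
  converts into decay.\<close>

lemma dir_deriv_osc_covector:
  assumes "B \<in> coef" "z \<in> Z"
  shows "dir_deriv (0, v) (osc B) (z, \<xi>) = osc (\<lambda>p. rc p * (\<i> * (dirv (snd (snd p)) \<bullet> v) * B p)) (z, \<xi>)"
proof -
  have "dir_deriv 0 B (z, q) = 0" "rd 0 (z, q) = 0" for q
    using has_derivative_bounded_linear[OF has_derivative_dir_deriv[OF coef_differentiable[OF assms(1)]], of "(z, q)"]
      has_derivative_bounded_linear[OF has_derivative_dir_deriv[OF smooth_on_differentiable[OF smooth_r]], of "(z, q)"]
      assms(2) by (auto simp: rd_def dest: linear_simps(3))
  then show ?thesis unfolding dir_deriv_osc[OF assms] osc_def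
    by (simp add: zero_prod_def[symmetric] mult_ac)
qed

text \<open>The factor \<open>\<i> * r_u * (dirv t \<bullet> \<xi>)\<close> from the phase grows
  with \<open>\<xi>\<close>. Removing it by parts in \<open>s\<close> leaves an amplitude of the
  same class, so base derivatives cost no decay.\<close>

lemma dir_deriv_osc_base:
  assumes "B \<in> amp" "z \<in> Z"
  shows "dir_deriv (u, 0) (osc B) (z, \<xi>) = osc (lift (u, 0) B) (z, \<xi>)"
proof -
  have i1: "(\<lambda>q. dir_deriv (u, 0) B (z, q) * wave z \<xi> q) integrable_on torus"
    by (intro osc_integrable coef_dir_deriv amp_coef assms)
  have i2: "(\<lambda>q. \<i> * (dirv (snd q) \<bullet> \<xi>) * rd (u, 0) (z, q) * B (z, q) * wave z \<xi> q) integrable_on torus"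
    by (intro integrable_continuous continuous_intros continuous_coef continuous_wave amp_coef assms rd_coef
        continuous_on_of_real continuous_angle')
  have i3: "(\<lambda>q. sdiv (rd (u, 0)) B (z, q) * wave z \<xi> q) integrable_on torus"
    by (intro osc_integrable sdiv_amp rd_coef amp_coef assms)
  have "dir_deriv (u, 0) (osc B) (z, \<xi>) = integral torus (\<lambda>q. dir_deriv (u, 0) B (z, q) * wave z \<xi> q
      + \<i> * (dirv (snd q) \<bullet> \<xi>) * rd (u, 0) (z, q) * B (z, q) * wave z \<xi> q)"
    unfolding dir_deriv_osc[OF amp_coef[OF assms(1)] assms(2)] by (simp add: algebra_simps)
  also have "\<dots> = integral torus (\<lambda>q. dir_deriv (u, 0) B (z, q) * wave z \<xi> q) - osc (sdiv (rd (u, 0)) B) (z, \<xi>)"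
    unfolding Henstock_Kurzweil_Integration.integral_add[OF i1 i2] integral_phase_factor1[OF rd_coef assms] by simp
  also have "\<dots> = osc (lift (u, 0) B) (z, \<xi>)"
    unfolding osc_def fst_conv snd_conv Henstock_Kurzweil_Integration.integral_diff[OF i1 i3, symmetric]
    by (simp add: lift_def algebra_simps)
  finally show ?thesis .
qed

text \<open>The \<open>t\<close>-derivative of the phase is \<open>r_t * (dirv t \<bullet> \<xi>) +
  r * (dirp t \<bullet> \<xi>)\<close>. The total derivative integrates to 0 and the first term is
  removed by parts in \<open>s\<close>, which isolates the second.\<close>

lemma integral_rotation_factor:
  assumes "B \<in> amp" "z \<in> Z"
  shows "integral torus (\<lambda>q. \<i> * rc (z, q) * (dirp (snd q) \<bullet> \<xi>) * B (z, q) * wave z \<xi> q)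
    = - osc (lift (0, 0, 1) B) (z, \<xi>)"
proof -
  let ?e = "(0, 0, 1) :: 'z \<times> real \<times> real"
  note Bc = amp_coef[OF assms(1)]
  define h where "h q = kern B ((z, \<xi>), q)" for q
  have sm: "smooth_on dom' (kern B)" by (rule kern_smooth[OF Bc])
  have h_smooth: "smooth_on UNIV h"
    unfolding h_def by (rule smooth_on_compose[OF open_UNIV open_dom' _ sm])
      (use assms(2) in \<open>auto intro!: smooth_on_Pair smooth_on_const smooth_on_ident\<close>)
  have h_per: "h (s, t + 2 * pi) = h (s, t)" for s t
    using Bc assms(2) periodic_r by (simp add: h_def kern_def coef_def)
  have i1: "(\<lambda>q. dir_deriv ?e B (z, q) * wave z \<xi> q) integrable_on torus"
    by (intro osc_integrable coef_dir_deriv Bc assms)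
  have i2: "(\<lambda>q. \<i> * (dirv (snd q) \<bullet> \<xi>) * rd ?e (z, q) * B (z, q) * wave z \<xi> q) integrable_on torus"
    by (intro integrable_continuous continuous_intros continuous_coef continuous_wave Bc assms rd_coef
        continuous_on_of_real continuous_angle')
  have i3: "(\<lambda>q. sdiv (rd ?e) B (z, q) * wave z \<xi> q) integrable_on torus"
    by (intro osc_integrable sdiv_amp rd_coef amp_coef assms)
  have i4: "(\<lambda>q. \<i> * rc (z, q) * (dirp (snd q) \<bullet> \<xi>) * B (z, q) * wave z \<xi> q) integrable_on torus"
    by (intro integrable_continuous continuous_intros continuous_coef continuous_wave Bc assms rc_coef
        continuous_on_of_real continuous_angle')
  have h_deriv: "dir_deriv (0, 1) h q = dir_deriv ?e B (z, q) * wave z \<xi> q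
      + \<i> * (dirv (snd q) \<bullet> \<xi>) * rd ?e (z, q) * B (z, q) * wave z \<xi> q
      + \<i> * rc (z, q) * (dirp (snd q) \<bullet> \<xi>) * B (z, q) * wave z \<xi> q" for q
  proof -
    have "dir_deriv (0, 1) h q = dir_deriv ((0, 0), 0, 1) (kern B) ((z, \<xi>), q)"
      unfolding h_def zero_prod_def[symmetric]
      by (rule dir_deriv_snd_slice(2)[OF smooth_on_differentiable[OF sm]]) (use assms(2) in auto)
    then show ?thesis
      unfolding dir_deriv_kern[OF Bc assms(2)] by (simp add: algebra_simps)
  qed
  have "0 = integral torus (dir_deriv (0, 1) h)"
    using integral_periodic_deriv_snd[OF h_smooth h_per] by simp
  also have "\<dots> = integral torus (\<lambda>q. dir_deriv ?e B (z, q) * wave z \<xi> q) - osc (sdiv (rd ?e) B) (z, \<xi>)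
      + integral torus (\<lambda>q. \<i> * rc (z, q) * (dirp (snd q) \<bullet> \<xi>) * B (z, q) * wave z \<xi> q)"
    unfolding h_deriv[abs_def] Henstock_Kurzweil_Integration.integral_add[OF integrable_add[OF i1 i2] i4]
      Henstock_Kurzweil_Integration.integral_add[OF i1 i2] integral_phase_factor1[OF rd_coef assms] by simp
  also have "integral torus (\<lambda>q. dir_deriv ?e B (z, q) * wave z \<xi> q) - osc (sdiv (rd ?e) B) (z, \<xi>)
      = osc (lift ?e B) (z, \<xi>)"
    unfolding osc_def fst_conv snd_conv Henstock_Kurzweil_Integration.integral_diff[OF i1 i3, symmetric]
    by (simp add: lift_def algebra_simps)
  finally show ?thesis by (simp add: eq_neg_iff_add_eq_0 add.commute)
qed


section \<open>Decay in the covector\<close>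

lemma coef_bounded:
  assumes "B \<in> coef" "compact K" "K \<subseteq> Z"
  shows "\<exists>M\<ge>0. \<forall>z\<in>K. \<forall>q\<in>torus. norm (B (z, q)) \<le> M"
proof -
  have "continuous_on (K \<times> torus) B"
    by (rule continuous_on_subset[OF smooth_on_continuous_on[OF coef_smooth[OF assms(1)]]]) (use assms(3) in auto)
  then have "compact (B ` (K \<times> torus))"
    by (intro compact_continuous_image compact_Times assms compact_cbox)
  then obtain M where "\<forall>y\<in>B ` (K \<times> torus). norm y \<le> M"
    using compact_imp_bounded bounded_iff by metis
  then show ?thesis by (intro exI[of _ "max M 0"]) force
qed

lemma integral_torus_angular_weight:
  "integral torus (\<lambda>q. 1 / (1 + (dirv (snd q) \<bullet> \<xi>)\<^sup>2)) = (2 * pi)\<^sup>2 / sqrt (1 + (norm \<xi>)\<^sup>2)"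
proof -
  have nz: "1 + (x::real)\<^sup>2 \<noteq> 0" for x using add_pos_nonneg[of 1 "x\<^sup>2"] by simp
  have c: "continuous_on torus (\<lambda>q. 1 / (1 + (dirv (snd q) \<bullet> \<xi>)\<^sup>2))"
    by (intro continuous_intros continuous_angle') (auto simp: nz)
  have "integral torus (\<lambda>q. 1 / (1 + (dirv (snd q) \<bullet> \<xi>)\<^sup>2))
      = integral (cbox 0 (2 * pi)) (\<lambda>s::real. integral (cbox 0 (2 * pi)) (\<lambda>t. 1 / (1 + (dirv t \<bullet> \<xi>)\<^sup>2)))"
    using integral_prod_continuous[OF c] by simp
  also have "integral (cbox 0 (2 * pi)) (\<lambda>t. 1 / (1 + (dirv t \<bullet> \<xi>)\<^sup>2)) = 2 * pi / sqrt (1 + (norm \<xi>)\<^sup>2)"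
    using integral_unique[OF has_integral_angular_weight] by simp
  finally show ?thesis by (simp add: power2_eq_square)
qed

text \<open>Two integrations by parts in \<open>s\<close> produce the weight \<open>1 / (1 + (dirv t \<bullet> \<xi>)\<^sup>2)\<close>, whose integral over
  \<open>t\<close> is \<open>2 \<pi> / sqrt (1 + |\<xi>|\<^sup>2)\<close>.\<close>
lemma osc_decay_base:
  assumes B: "B \<in> amp" and K: "compact K" "K \<subseteq> Z"
  shows "\<exists>C\<ge>0. \<forall>z\<in>K. \<forall>\<xi>. norm (osc B (z, \<xi>)) \<le> C / (1 + norm \<xi>)"
proof -
  define L where "L = sdiv (\<lambda>_. 1)"
  have L: "L A \<in> amp" if "A \<in> amp" for A unfolding L_def by (intro sdiv_amp coef_const that)
  \<comment> \<open>Each factor \<open>\<i> * \<tau>\<close> becomes \<open>- L\<close> by parts, so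
    \<open>\<tau>^2 * B = - (\<i> * \<tau>)^2 * B\<close> becomes \<open>- L (L B)\<close>.
    Inserting \<open>1 = g * (1 + \<tau>^2)\<close> in front of \<open>B\<close> thus leaves
    \<open>g * B2\<close>.\<close>
  define B2 where "B2 p = B p - L (L B) p" for p
  have B2: "B2 \<in> amp" unfolding B2_def[abs_def] by (intro amp_diff L B)
  obtain M where M: "M \<ge> 0" "\<And>z q. z \<in> K \<Longrightarrow> q \<in> torus \<Longrightarrow> norm (B2 (z, q)) \<le> M"
    using coef_bounded[OF amp_coef[OF B2] K] by blast
  have "norm (osc B (z, \<xi>)) \<le> (2 * M * (2 * pi)\<^sup>2) / (1 + norm \<xi>)" if z: "z \<in> K" for z \<xi>
  proof -
    have zZ: "z \<in> Z" using z K by blast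
    define \<tau> where "\<tau> t = dirv t \<bullet> \<xi>" for t
    define g where "g t = complex_of_real (1 / (1 + (\<tau> t)\<^sup>2))" for t
    have nz: "1 + (x::real)\<^sup>2 \<noteq> 0" for x using add_pos_nonneg[of 1 "x\<^sup>2"] by simp
    have c\<tau>: "continuous_on UNIV \<tau>" unfolding \<tau>_def by (rule continuous_angle)
    have cg: "continuous_on UNIV g" unfolding g_def
      by (intro continuous_intros c\<tau>) (auto simp: nz)
    have cg': "continuous_on UNIV (\<lambda>t. g t * (\<i> * complex_of_real (\<tau> t)))"
      by (intro continuous_intros cg c\<tau>)
    have g1: "g t * (1 + (complex_of_real (\<tau> t))\<^sup>2) = 1" for t
    proof -
      have "complex_of_real (1 / (1 + (\<tau> t)\<^sup>2) * (1 + (\<tau> t)\<^sup>2)) = 1" using nz[of "\<tau> t"] by simp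
      then show ?thesis unfolding g_def of_real_mult by simp
    qed
    have int: "(\<lambda>q. f (snd q) * A (z, q) * wave z \<xi> q) integrable_on torus"
      if "A \<in> amp" "continuous_on UNIV f" for A f
      by (intro integrable_continuous continuous_intros continuous_coef continuous_wave amp_coef that zZ continuous_snd)
    have "integral torus (\<lambda>q. g (snd q) * (\<tau> (snd q))\<^sup>2 * B (z, q) * wave z \<xi> q)
        = - integral torus (\<lambda>q. (g (snd q) * (\<i> * \<tau> (snd q))) * (\<i> * (dirv (snd q) \<bullet> \<xi>) * 1 * B (z, q)) * wave z \<xi> q)"
      unfolding integral_neg[symmetric] by (rule integral_cong) (simp add: \<tau>_def power2_eq_square algebra_simps)
    also have "\<dots> = integral torus (\<lambda>q. g (snd q) * (\<i> * (dirv (snd q) \<bullet> \<xi>) * 1 * L B (z, q)) * wave z \<xi> q)"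
      unfolding integral_phase_factor[OF coef_const B zZ cg'] L_def[symmetric]
      by (simp add: \<tau>_def mult_ac)
    also have "\<dots> = - integral torus (\<lambda>q. g (snd q) * L (L B) (z, q) * wave z \<xi> q)"
      unfolding integral_phase_factor[OF coef_const L[OF B] zZ cg] L_def[symmetric] ..
    finally have *: "integral torus (\<lambda>q. g (snd q) * (\<tau> (snd q))\<^sup>2 * B (z, q) * wave z \<xi> q)
      = - integral torus (\<lambda>q. g (snd q) * L (L B) (z, q) * wave z \<xi> q)" .
    have "osc B (z, \<xi>) = integral torus (\<lambda>q. g (snd q) * B (z, q) * wave z \<xi> q
        + (g (snd q) * (\<tau> (snd q))\<^sup>2) * B (z, q) * wave z \<xi> q)"
      unfolding osc_def fst_conv snd_conv
    proof (rule integral_cong)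
      fix q :: "real \<times> real"
      have "B (z, q) * wave z \<xi> q = (g (snd q) * (1 + (complex_of_real (\<tau> (snd q)))\<^sup>2)) * (B (z, q) * wave z \<xi> q)"
        unfolding g1 by simp
      also have "\<dots> = g (snd q) * B (z, q) * wave z \<xi> q + (g (snd q) * (\<tau> (snd q))\<^sup>2) * B (z, q) * wave z \<xi> q"
        by (simp add: algebra_simps)
      finally show "B (z, q) * wave z \<xi> q = g (snd q) * B (z, q) * wave z \<xi> q + (g (snd q) * (\<tau> (snd q))\<^sup>2) * B (z, q) * wave z \<xi> q" .
    qed
    also have "\<dots> = integral torus (\<lambda>q. g (snd q) * B (z, q) * wave z \<xi> q)
        + integral torus (\<lambda>q. g (snd q) * (\<tau> (snd q))\<^sup>2 * B (z, q) * wave z \<xi> q)"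
      by (rule Henstock_Kurzweil_Integration.integral_add[OF int[OF B cg] int[OF B]])
        (intro continuous_intros cg c\<tau>)
    also have "\<dots> = integral torus (\<lambda>q. g (snd q) * B2 (z, q) * wave z \<xi> q)"
      unfolding * using Henstock_Kurzweil_Integration.integral_diff[OF int[OF B cg] int[OF L[OF L[OF B]] cg]]
      by (simp add: B2_def algebra_simps)
    finally have "norm (osc B (z, \<xi>)) = norm (integral torus (\<lambda>q. g (snd q) * B2 (z, q) * wave z \<xi> q))"
      by simp
    also have "\<dots> \<le> integral torus (\<lambda>q. 1 / (1 + (dirv (snd q) \<bullet> \<xi>)\<^sup>2) * M)"
    proof (rule integral_norm_bound_integral[OF int[OF B2 cg]])
      show "(\<lambda>q. 1 / (1 + (dirv (snd q) \<bullet> \<xi>)\<^sup>2) * M) integrable_on torus"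
        by (intro integrable_continuous continuous_intros continuous_angle') (auto simp: nz)
      fix q assume "q \<in> torus"
      then have "norm (B2 (z, q)) \<le> M" by (rule M(2)[OF z])
      then have "1 / (1 + (dirv (snd q) \<bullet> \<xi>)\<^sup>2) * norm (B2 (z, q)) \<le> 1 / (1 + (dirv (snd q) \<bullet> \<xi>)\<^sup>2) * M"
        by (rule mult_left_mono) (simp add: add_nonneg_nonneg)
      moreover have "norm (g (snd q)) = 1 / (1 + (dirv (snd q) \<bullet> \<xi>)\<^sup>2)"
        unfolding g_def \<tau>_def norm_of_real by (rule abs_of_nonneg) (simp add: add_nonneg_nonneg)
      ultimately show "norm (g (snd q) * B2 (z, q) * wave z \<xi> q) \<le> 1 / (1 + (dirv (snd q) \<bullet> \<xi>)\<^sup>2) * M"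
        by (simp only: norm_mult norm_cis mult_1_right)
    qed
    also have "\<dots> = (2 * pi)\<^sup>2 / sqrt (1 + (norm \<xi>)\<^sup>2) * M"
      unfolding integral_mult_left integral_torus_angular_weight by simp
    also have "\<dots> \<le> (2 * M * (2 * pi)\<^sup>2) / (1 + norm \<xi>)"
    proof -
      have "(1 + norm \<xi>)\<^sup>2 \<le> (2 * sqrt (1 + (norm \<xi>)\<^sup>2))\<^sup>2"
        using zero_le_power2[of "1 - norm \<xi>"] zero_le_power2[of "norm \<xi>"]
        unfolding power_mult_distrib real_sqrt_pow2[OF add_nonneg_nonneg[OF zero_le_one zero_le_power2]]
        by (simp add: power2_sum power2_diff) (use zero_le_power2[of "norm \<xi>"] in linarith)
      then have "1 + norm \<xi> \<le> 2 * sqrt (1 + (norm \<xi>)\<^sup>2)"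
        by (rule power2_le_imp_le) simp
      then have "1 / sqrt (1 + (norm \<xi>)\<^sup>2) \<le> 2 / (1 + norm \<xi>)"
        by (simp add: divide_simps add_pos_nonneg)
      then have "(M * (2 * pi)\<^sup>2) * (1 / sqrt (1 + (norm \<xi>)\<^sup>2)) \<le> (M * (2 * pi)\<^sup>2) * (2 / (1 + norm \<xi>))"
        using M(1) by (intro mult_left_mono) auto
      then show ?thesis by (simp add: mult_ac)
    qed
    finally show ?thesis .
  qed
  then show ?thesis using M(1) by (intro exI[of _ "2 * M * (2 * pi)\<^sup>2"]) auto
qed

text \<open>For \<open>(X, Y) = (cos, - sin)\<close> and \<open>(sin, cos)\<close> the combination
  of \<open>dirv t \<bullet> \<xi>\<close> and \<open>dirp t \<bullet> \<xi>\<close> is the first or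
  second coordinate of \<open>\<xi>\<close>. The radial part goes through \<open>sdiv rc\<close> and
  the angular part through \<open>lift (0, 0, 1)\<close>; both keep the full power
  \<open>r^m\<close>, so only the one explicit factor \<open>r\<close> is spent.\<close>

lemma integral_gradient_factor:
  assumes "X \<in> coef" "Y \<in> coef" "B \<in> amp" "z \<in> Z"
  shows "(\<lambda>q. (\<i> * rc (z, q) * (dirv (snd q) \<bullet> \<xi>) * rpow m (\<lambda>p. X p * B p) (z, q)
       + \<i> * rc (z, q) * (dirp (snd q) \<bullet> \<xi>) * rpow m (\<lambda>p. Y p * B p) (z, q)) * wave z \<xi> q) integrable_on torus"
    and "integral torus (\<lambda>q. (\<i> * rc (z, q) * (dirv (snd q) \<bullet> \<xi>) * rpow m (\<lambda>p. X p * B p) (z, q)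
       + \<i> * rc (z, q) * (dirp (snd q) \<bullet> \<xi>) * rpow m (\<lambda>p. Y p * B p) (z, q)) * wave z \<xi> q)
    = - osc (rpow m (\<lambda>p. sdiv rc (\<lambda>p. X p * B p) p + of_nat m * (X p * B p) + lift (0, 0, 1) (\<lambda>p. Y p * B p) p)) (z, \<xi>)"
proof -
  define U where "U = (\<lambda>p. X p * B p)"
  define V where "V = (\<lambda>p. Y p * B p)"
  have U: "U \<in> amp" and V: "V \<in> amp" unfolding U_def V_def by (intro amp_mult assms)+
  define U' where "U' = (\<lambda>p. sdiv rc U p + of_nat m * U p)"
  have U': "U' \<in> amp" unfolding U'_def by (intro amp_add sdiv_amp rc_coef U amp_mult coef_const)
  have i1: "(\<lambda>q. \<i> * (dirv (snd q) \<bullet> \<xi>) * rc (z, q) * rpow m U (z, q) * wave z \<xi> q) integrable_on torus"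
    by (intro integrable_continuous continuous_intros continuous_coef continuous_wave amp_coef rpow_amp U V assms rc_coef
        continuous_on_of_real continuous_angle')
  have i2: "(\<lambda>q. \<i> * rc (z, q) * (dirp (snd q) \<bullet> \<xi>) * rpow m V (z, q) * wave z \<xi> q) integrable_on torus"
    by (intro integrable_continuous continuous_intros continuous_coef continuous_wave amp_coef rpow_amp U V assms rc_coef
        continuous_on_of_real continuous_angle')
  have i3: "(\<lambda>q. rpow m U' (z, q) * wave z \<xi> q) integrable_on torus"
    by (intro osc_integrable amp_coef rpow_amp U' assms)
  have i4: "(\<lambda>q. rpow m (lift (0, 0, 1) V) (z, q) * wave z \<xi> q) integrable_on torus"
    by (intro osc_integrable amp_coef rpow_amp lift_amp V assms)
  have "integral torus (\<lambda>q. (\<i> * rc (z, q) * (dirv (snd q) \<bullet> \<xi>) * rpow m U (z, q)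
       + \<i> * rc (z, q) * (dirp (snd q) \<bullet> \<xi>) * rpow m V (z, q)) * wave z \<xi> q)
    = integral torus (\<lambda>q. \<i> * (dirv (snd q) \<bullet> \<xi>) * rc (z, q) * rpow m U (z, q) * wave z \<xi> q
       + \<i> * rc (z, q) * (dirp (snd q) \<bullet> \<xi>) * rpow m V (z, q) * wave z \<xi> q)"
    by (simp add: algebra_simps)
  also have "\<dots> = - osc (sdiv rc (rpow m U)) (z, \<xi>) - osc (lift (0, 0, 1) (rpow m V)) (z, \<xi>)"
    unfolding Henstock_Kurzweil_Integration.integral_add[OF i1 i2]
      integral_phase_factor1[OF rc_coef rpow_amp[OF U] assms(4)] integral_rotation_factor[OF rpow_amp[OF V] assms(4)]
    by simp
  also have "osc (sdiv rc (rpow m U)) (z, \<xi>) = osc (rpow m U') (z, \<xi>)"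
    unfolding U'_def by (rule osc_cong[OF sdiv_rc_rpow[OF U] assms(4)])
  also have "osc (lift (0, 0, 1) (rpow m V)) (z, \<xi>) = osc (rpow m (lift (0, 0, 1) V)) (z, \<xi>)"
    by (rule osc_cong[OF lift_rpow[OF V] assms(4)])
  also have "- osc (rpow m U') (z, \<xi>) - osc (rpow m (lift (0, 0, 1) V)) (z, \<xi>)
      = - integral torus (\<lambda>q. rpow m U' (z, q) * wave z \<xi> q + rpow m (lift (0, 0, 1) V) (z, q) * wave z \<xi> q)"
    unfolding Henstock_Kurzweil_Integration.integral_add[OF i3 i4] osc_def by simp
  also have "\<dots> = - osc (rpow m (\<lambda>p. U' p + lift (0, 0, 1) V p)) (z, \<xi>)"
    unfolding osc_def by (simp add: rpow_def algebra_simps)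
  finally show "integral torus (\<lambda>q. (\<i> * rc (z, q) * (dirv (snd q) \<bullet> \<xi>) * rpow m (\<lambda>p. X p * B p) (z, q)
       + \<i> * rc (z, q) * (dirp (snd q) \<bullet> \<xi>) * rpow m (\<lambda>p. Y p * B p) (z, q)) * wave z \<xi> q)
    = - osc (rpow m (\<lambda>p. sdiv rc (\<lambda>p. X p * B p) p + of_nat m * (X p * B p) + lift (0, 0, 1) (\<lambda>p. Y p * B p) p)) (z, \<xi>)"
    unfolding U_def V_def U'_def .
  show "(\<lambda>q. (\<i> * rc (z, q) * (dirv (snd q) \<bullet> \<xi>) * rpow m (\<lambda>p. X p * B p) (z, q)
       + \<i> * rc (z, q) * (dirp (snd q) \<bullet> \<xi>) * rpow m (\<lambda>p. Y p * B p) (z, q)) * wave z \<xi> q) integrable_on torus"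
    using integrable_add[OF i1 i2] unfolding U_def V_def by (simp add: algebra_simps)
qed

text \<open>In polar coordinates \<open>(r, t)\<close>, \<open>\<xi>\<close> is the gradient of \<open>r dirv t \<bullet> \<xi>\<close>. Integrating both components by
  parts costs one factor \<open>r\<close> and gains one power of \<open>|\<xi>|\<close>.\<close>
lemma osc_decay:
  assumes B: "B \<in> amp" and K: "compact K" "K \<subseteq> Z"
  shows "\<exists>C\<ge>0. \<forall>z\<in>K. \<forall>\<xi>. norm (osc (rpow m B) (z, \<xi>)) \<le> C / (1 + norm \<xi>) ^ Suc m"
  using B
proof (induction m arbitrary: B)
  case 0
  have "rpow 0 B = B" by (simp add: rpow_def[abs_def])
  then show ?case using osc_decay_base[OF 0 K] by simp
next
  case (Suc m)
  define c s :: "'z \<times> real \<times> real \<Rightarrow> complex"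
    where "c p = complex_of_real (cos (snd (snd p)))" and "s p = complex_of_real (sin (snd (snd p)))" for p
  define s' where "s' p = - s p" for p
  have ax: "dirv t \<bullet> axis 1 1 = cos t" "dirv t \<bullet> axis 2 1 = sin t" for t
    by (simp_all add: inner_axis)
  have cs: "c \<in> coef" "s \<in> coef" unfolding c_def[abs_def] s_def[abs_def] ax[symmetric]
    by (rule angle_coef)+
  have s': "s' \<in> coef" using coef_mult[OF coef_const cs(2), of "-1"] by (simp add: s'_def[abs_def])
  define G where "G X Y = (\<lambda>p. sdiv rc (\<lambda>p. X p * B p) p + of_nat m * (X p * B p) + lift (0, 0, 1) (\<lambda>p. Y p * B p) p)"
    for X Y
  have G: "G X Y \<in> amp" if "X \<in> coef" "Y \<in> coef" for X Y
    unfolding G_def by (intro amp_add sdiv_amp rc_coef lift_amp amp_mult coef_const that Suc.prems)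
  obtain C1 where C1: "C1 \<ge> 0" "\<And>z \<xi>. z \<in> K \<Longrightarrow> norm (osc (rpow m (G c s')) (z, \<xi>)) \<le> C1 / (1 + norm \<xi>) ^ Suc m"
    using Suc.IH[OF G[OF cs(1) s']] by blast
  obtain C2 where C2: "C2 \<ge> 0" "\<And>z \<xi>. z \<in> K \<Longrightarrow> norm (osc (rpow m (G s c)) (z, \<xi>)) \<le> C2 / (1 + norm \<xi>) ^ Suc m"
    using Suc.IH[OF G[OF cs(2) cs(1)]] by blast
  obtain C0 where C0: "C0 \<ge> 0" "\<And>z \<xi>. z \<in> K \<Longrightarrow> norm (osc (rpow (Suc m) B) (z, \<xi>)) \<le> C0 / (1 + norm \<xi>)"
    using osc_decay_base[OF rpow_amp[OF Suc.prems] K] by blast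
  have large: "norm (osc (rpow (Suc m) B) (z, \<xi>)) \<le> (2 * (C1 + C2)) / (1 + norm \<xi>) ^ Suc (Suc m)"
    if z: "z \<in> K" and \<xi>: "norm \<xi> \<ge> 1" for z \<xi>
  proof -
    have zZ: "z \<in> Z" using z K by blast
    define F where "F X Y q = (\<i> * rc (z, q) * (dirv (snd q) \<bullet> \<xi>) * rpow m (\<lambda>p. X p * B p) (z, q)
       + \<i> * rc (z, q) * (dirp (snd q) \<bullet> \<xi>) * rpow m (\<lambda>p. Y p * B p) (z, q)) * wave z \<xi> q" for X Y q
    have F: "F X Y integrable_on torus" "integral torus (F X Y) = - osc (rpow m (G X Y)) (z, \<xi>)"
      if "X \<in> coef" "Y \<in> coef" for X Y
      unfolding F_def[abs_def] G_def by (rule integral_gradient_factor[OF that Suc.prems zZ])+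
    \<comment> \<open>In \<open>|\<xi>|^2 = \<xi>_1^2 + \<xi>_2^2\<close> one factor of each square
      is expanded in the rotating frame and integrated by parts, the other stays outside. Estimating
      the latter by \<open>|\<xi>|\<close> leaves a net gain of one power.\<close>
    have "\<i> * (norm \<xi>)\<^sup>2 * osc (rpow (Suc m) B) (z, \<xi>)
        = integral torus (\<lambda>q. of_real (\<xi> $ 1) * F c s' q + of_real (\<xi> $ 2) * F s c q)"
      unfolding osc_def fst_conv snd_conv integral_mult_right[symmetric]
    proof (rule integral_cong)
      fix q :: "real \<times> real"
      let ?c = "complex_of_real (cos (snd q))" and ?s = "complex_of_real (sin (snd q))"
        and ?x = "complex_of_real (\<xi> $ 1)" and ?y = "complex_of_real (\<xi> $ 2)"
      have 1: "?c\<^sup>2 + ?s\<^sup>2 = 1"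
        by (metis of_real_add of_real_power of_real_1 sin_cos_squared_add2)
      have "of_real ((norm \<xi>)\<^sup>2) = ?x\<^sup>2 + ?y\<^sup>2" by (simp add: norm_2_squared)
      also have "\<dots> = ?x * (?c * (?x * ?c + ?y * ?s) - ?s * (- (?x * ?s) + ?y * ?c))
        + ?y * (?s * (?x * ?c + ?y * ?s) + ?c * (- (?x * ?s) + ?y * ?c))"
        using 1 by algebra
      finally have 2: "of_real ((norm \<xi>)\<^sup>2) = \<dots>" .
      show "\<i> * (norm \<xi>)\<^sup>2 * (rpow (Suc m) B (z, q) * wave z \<xi> q)
          = of_real (\<xi> $ 1) * F c s' q + of_real (\<xi> $ 2) * F s c q"
        unfolding 2 F_def rpow_def c_def s_def s'_def
        by (simp add: inner_2 algebra_simps)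
    qed
    also have "\<dots> = of_real (\<xi> $ 1) * integral torus (F c s') + of_real (\<xi> $ 2) * integral torus (F s c)"
      by (subst Henstock_Kurzweil_Integration.integral_add)
        (auto intro!: integrable_on_mult_right F cs s')
    also have "\<dots> = - (of_real (\<xi> $ 1) * osc (rpow m (G c s')) (z, \<xi>) + of_real (\<xi> $ 2) * osc (rpow m (G s c)) (z, \<xi>))"
      by (simp add: F cs s')
    finally have "norm (\<i> * (norm \<xi>)\<^sup>2 * osc (rpow (Suc m) B) (z, \<xi>))
        = norm (of_real (\<xi> $ 1) * osc (rpow m (G c s')) (z, \<xi>) + of_real (\<xi> $ 2) * osc (rpow m (G s c)) (z, \<xi>))"
      by (simp only: norm_minus_cancel)
    also have "\<dots> \<le> \<bar>\<xi> $ 1\<bar> * norm (osc (rpow m (G c s')) (z, \<xi>)) + \<bar>\<xi> $ 2\<bar> * norm (osc (rpow m (G s c)) (z, \<xi>))"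
      by (rule order_trans[OF norm_triangle_ineq]) (simp add: norm_mult)
    also have "\<dots> \<le> norm \<xi> * (C1 / (1 + norm \<xi>) ^ Suc m) + norm \<xi> * (C2 / (1 + norm \<xi>) ^ Suc m)"
      by (intro add_mono mult_mono C1 C2 z component_le_norm_cart) auto
    finally have *: "norm \<xi> * (norm \<xi> * norm (osc (rpow (Suc m) B) (z, \<xi>))) \<le> norm \<xi> * ((C1 + C2) / (1 + norm \<xi>) ^ Suc m)"
      by (simp add: norm_mult power2_eq_square algebra_simps add_divide_distrib)
    have "norm \<xi> * norm (osc (rpow (Suc m) B) (z, \<xi>)) \<le> (C1 + C2) / (1 + norm \<xi>) ^ Suc m"
      by (rule mult_left_le_imp_le[OF *]) (use \<xi> in linarith)
    moreover have "(1 + norm \<xi>) * norm (osc (rpow (Suc m) B) (z, \<xi>)) \<le> (2 * norm \<xi>) * norm (osc (rpow (Suc m) B) (z, \<xi>))"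
      using \<xi> by (intro mult_right_mono) auto
    ultimately have "(1 + norm \<xi>) * norm (osc (rpow (Suc m) B) (z, \<xi>)) \<le> 2 * ((C1 + C2) / (1 + norm \<xi>) ^ Suc m)"
      by linarith
    then have "norm (osc (rpow (Suc m) B) (z, \<xi>)) \<le> 2 * ((C1 + C2) / (1 + norm \<xi>) ^ Suc m) / (1 + norm \<xi>)"
      by (subst pos_le_divide_eq) (use \<xi> in \<open>auto simp: mult.commute\<close>)
    then show ?thesis by (simp add: mult_ac)
  qed
  \<comment> \<open>For bounded \<open>\<xi>\<close> mere boundedness suffices, as
    \<open>(1 + |\<xi>|) ^ (m + 2)\<close> is at most \<open>2 ^ (m + 2)\<close>.\<close>
  have small: "norm (osc (rpow (Suc m) B) (z, \<xi>)) \<le> (C0 * 2 ^ Suc (Suc m)) / (1 + norm \<xi>) ^ Suc (Suc m)"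
    if z: "z \<in> K" and \<xi>: "norm \<xi> \<le> 1" for z \<xi>
  proof -
    have "norm (osc (rpow (Suc m) B) (z, \<xi>)) \<le> C0 / (1 + norm \<xi>)" by (rule C0(2)[OF z])
    also have "\<dots> \<le> C0" using C0(1) by (simp add: divide_le_eq add_pos_nonneg mult_le_cancel_left1 mult_left_mono algebra_simps)
    also have "C0 * (1 + norm \<xi>) ^ Suc (Suc m) \<le> C0 * 2 ^ Suc (Suc m)"
      using \<xi> C0(1) by (intro mult_left_mono power_mono) auto
    then have "C0 \<le> (C0 * 2 ^ Suc (Suc m)) / (1 + norm \<xi>) ^ Suc (Suc m)"
      by (subst pos_le_divide_eq) (intro zero_less_power add_pos_nonneg; simp)+
    finally show ?thesis .
  qed
  have mono: "x / (1 + norm \<xi>) ^ Suc (Suc m) \<le> (C0 * 2 ^ Suc (Suc m) + 2 * (C1 + C2)) / (1 + norm \<xi>) ^ Suc (Suc m)"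
    if "x \<le> C0 * 2 ^ Suc (Suc m) + 2 * (C1 + C2)" for x and \<xi> :: "real^2"
    using that by (intro divide_right_mono) auto
  have "norm (osc (rpow (Suc m) B) (z, \<xi>)) \<le> (C0 * 2 ^ Suc (Suc m) + 2 * (C1 + C2)) / (1 + norm \<xi>) ^ Suc (Suc m)"
    if "z \<in> K" for z \<xi>
  proof (cases "norm \<xi> \<ge> 1")
    case True
    show ?thesis by (rule order_trans[OF large[OF that True] mono]) (use C0 in simp)
  next
    case False
    show ?thesis by (rule order_trans[OF small[OF that] mono]) (use C1 C2 False in auto)
  qed
  then show ?case using C0(1) C1(1) C2(1)
    by (intro exI[of _ "C0 * 2 ^ Suc (Suc m) + 2 * (C1 + C2)"]) auto
qed

section \<open>Derivatives of the oscillatory integral and the symbol estimates\<close>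

lemma osc_iter_deriv_covector:
  assumes "B \<in> amp" "vs \<in> lists Basis"
  shows "\<exists>B'\<in>amp. \<forall>z\<in>Z. \<forall>\<xi>. iter_deriv (map (\<lambda>v. (0, v)) vs) (osc B) (z, \<xi>) = osc (rpow (length vs) B') (z, \<xi>)"
  using assms(2)
proof (induction vs)
  case Nil
  have "rpow 0 B = B" by (simp add: rpow_def[abs_def])
  then show ?case using assms(1) by (intro bexI[of _ B]) auto
next
  case (Cons v vs)
  then obtain B' where B': "B' \<in> amp"
    "\<And>z \<xi>. z \<in> Z \<Longrightarrow> iter_deriv (map (\<lambda>v. (0, v)) vs) (osc B) (z, \<xi>) = osc (rpow (length vs) B') (z, \<xi>)" by blast
  define B'' where "B'' p = \<i> * complex_of_real (dirv (snd (snd p)) \<bullet> v) * B' p" for p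
  have "B'' \<in> amp" unfolding B''_def[abs_def] by (intro amp_mult coef_mult coef_const angle_coef B')
  moreover have "iter_deriv (map (\<lambda>v. (0, v)) (v # vs)) (osc B) (z, \<xi>) = osc (rpow (length (v # vs)) B'') (z, \<xi>)"
    if z: "z \<in> Z" for z \<xi>
  proof -
    have o: "open (Z \<times> (UNIV :: (real^2) set))" by (intro open_Times open_Z open_UNIV)
    have "dir_deriv (0, v) (iter_deriv (map (\<lambda>v. (0, v)) vs) (osc B)) (z, \<xi>)
        = dir_deriv (0, v) (osc (rpow (length vs) B')) (z, \<xi>)"
      by (rule dir_deriv_cong[symmetric, OF o])
        (use z B' smooth_on_differentiable[OF osc_smooth[OF amp_coef[OF rpow_amp[OF B'(1)]]]] in auto)
    also have "\<dots> = osc (\<lambda>p. rc p * (\<i> * (dirv (snd (snd p)) \<bullet> v) * rpow (length vs) B' p)) (z, \<xi>)"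
      by (rule dir_deriv_osc_covector[OF amp_coef[OF rpow_amp[OF B'(1)]] z])
    also have "\<dots> = osc (rpow (length (v # vs)) B'') (z, \<xi>)"
      by (rule osc_cong[OF _ z]) (simp add: rpow_def B''_def)
    finally show ?thesis by simp
  qed
  ultimately show ?case by blast
qed

text \<open>The covector derivatives stand at the end of the list and act first, each leaving a
  factor \<open>r\<close>. The base derivatives then act through \<open>lift\<close>, which passes
  through the powers of \<open>r\<close>.\<close>

lemma osc_iter_deriv:
  assumes "B \<in> amp" "vs \<in> lists Basis" "us \<in> lists Basis"
  shows "\<exists>B'\<in>amp. \<forall>z\<in>Z. \<forall>\<xi>. iter_deriv (map (\<lambda>u. (u, 0)) us @ map (\<lambda>v. (0, v)) vs) (osc B) (z, \<xi>)
    = osc (rpow (length vs) B') (z, \<xi>)"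
  using assms(3)
proof (induction us)
  case Nil
  then show ?case using osc_iter_deriv_covector[OF assms(1,2)] by simp
next
  case (Cons u us)
  let ?ds = "map (\<lambda>u. (u, 0)) us @ map (\<lambda>v. (0, v)) vs :: ('z \<times> (real^2)) list"
  obtain B' where B': "B' \<in> amp"
    "\<And>z \<xi>. z \<in> Z \<Longrightarrow> iter_deriv ?ds (osc B) (z, \<xi>) = osc (rpow (length vs) B') (z, \<xi>)" using Cons.IH by blast
  have "iter_deriv (map (\<lambda>u. (u, 0)) (u # us) @ map (\<lambda>v. (0, v)) vs) (osc B) (z, \<xi>) = osc (rpow (length vs) (lift (u, 0) B')) (z, \<xi>)"
    if z: "z \<in> Z" for z \<xi>
  proof -
    have o: "open (Z \<times> (UNIV :: (real^2) set))" by (intro open_Times open_Z open_UNIV)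
    have "dir_deriv (u, 0) (iter_deriv ?ds (osc B)) (z, \<xi>) = dir_deriv (u, 0) (osc (rpow (length vs) B')) (z, \<xi>)"
      by (rule dir_deriv_cong[symmetric, OF o])
        (use z B' smooth_on_differentiable[OF osc_smooth[OF amp_coef[OF rpow_amp[OF B'(1)]]]] in auto)
    also have "\<dots> = osc (lift (u, 0) (rpow (length vs) B')) (z, \<xi>)"
      by (rule dir_deriv_osc_base[OF rpow_amp[OF B'(1)] z])
    also have "\<dots> = osc (rpow (length vs) (lift (u, 0) B')) (z, \<xi>)"
      by (rule osc_cong[OF lift_rpow[OF B'(1)] z])
    finally show ?thesis by simp
  qed
  then show ?case using lift_amp[OF B'(1)] by blast
qed

lemma osc_symbol_class:
  assumes "B \<in> amp" shows "osc B \<in> symbol_class (-1) Z"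
proof -
  have "\<exists>C. \<forall>z\<in>K. \<forall>\<xi>. norm (iter_deriv (map (\<lambda>u. (u, 0)) us @ map (\<lambda>v. (0, v)) vs) (osc B) (z, \<xi>))
      \<le> C * (1 + norm \<xi>) powr (- 1 - real (length vs))"
    if K: "compact K" "K \<subseteq> Z" and l: "us \<in> lists Basis" "vs \<in> lists Basis" for K us vs
  proof -
    obtain B' where B': "B' \<in> amp"
      "\<And>z \<xi>. z \<in> Z \<Longrightarrow> iter_deriv (map (\<lambda>u. (u, 0)) us @ map (\<lambda>v. (0, v)) vs) (osc B) (z, \<xi>) = osc (rpow (length vs) B') (z, \<xi>)"
      using osc_iter_deriv[OF assms l(2,1)] by blast
    obtain C where C: "\<And>z \<xi>. z \<in> K \<Longrightarrow> norm (osc (rpow (length vs) B') (z, \<xi>)) \<le> C / (1 + norm \<xi>) ^ Suc (length vs)"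
      using osc_decay[OF B'(1) K] by blast
    have "(1 + norm \<xi>) powr (- 1 - real (length vs)) = 1 / (1 + norm \<xi>) ^ Suc (length vs)" for \<xi> :: "real^2"
    proof -
      have "(1 + norm \<xi>) powr (- real (Suc (length vs))) = 1 / (1 + norm \<xi>) ^ Suc (length vs)"
        by (subst powr_minus_divide, subst powr_realpow) (auto simp: add_pos_nonneg)
      then show ?thesis by (simp add: algebra_simps)
    qed
    then show ?thesis using B'(2) C K by (intro exI[of _ C]) (auto simp: subset_iff)
  qed
  then show ?thesis using osc_smooth[OF amp_coef[OF assms]] by (simp add: symbol_class_def)
qed

end

section \<open>Periodic functions on the line\<close>

lemma periodic_int_multiple:
  fixes f :: "real \<Rightarrow> 'b"
  assumes "\<And>x. f (x + p) = f x"
  shows "f (x + of_int n * p) = f x"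
proof -
  have nat: "f (x + of_nat m * p) = f x" for x and m :: nat
  proof (induction m)
    case (Suc m)
    have "f (x + of_nat (Suc m) * p) = f ((x + of_nat m * p) + p)" by (simp add: algebra_simps)
    then show ?case using assms Suc by simp
  qed simp
  show ?thesis
  proof (cases n)
    case (nonneg m)
    then show ?thesis using nat[of x m] by simp
  next
    case (neg m)
    then have "real_of_int n = - of_nat (Suc m)" by simp
    then have e: "x + of_int n * p + of_nat (Suc m) * p = x" by (simp only:)
    show ?thesis using nat[of "x + of_int n * p" "Suc m"] unfolding e by (rule sym)
  qed
qed

lemma periodic_reduce:
  fixes f :: "real \<Rightarrow> 'b"
  assumes "\<And>x. f (x + p) = f x" "p > 0"
  obtains y where "0 \<le> y" "y < p" "f y = f x"
proof
  let ?y = "x + of_int (- \<lfloor>x / p\<rfloor>) * p"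
  show "f ?y = f x" using periodic_int_multiple[of f p x, OF assms(1)] .
  define k where "k = \<lfloor>x / p\<rfloor>"
  have "of_int k \<le> x / p" "x / p < of_int k + 1" unfolding k_def by linarith+
  then show "0 \<le> ?y" "?y < p" unfolding k_def[symmetric] using assms(2) by (simp_all add: field_simps)
qed

subsection \<open>Ellipticity\<close>

text \<open>Averaging against \<open>1 - l / L\<close>, as in the Fejer kernel, makes the kernel nonnegative.\<close>
definition fejer :: "real \<Rightarrow> real \<Rightarrow> real" where
  "fejer L k = integral {0..L} (\<lambda>l. (1 - l / L) * cos (l * k))"

lemma fejer_integrable: "(L::real) > 0 \<Longrightarrow> (\<lambda>l. (1 - l / L) * cos (l * k)) integrable_on {0..L}"
  by (intro integrable_continuous_real continuous_intros) auto

text \<open>For \<open>l * |k| <= 1 < pi / 3\<close> the cosine is at least 1/2, and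
  \<open>(1 - l / L) / 2\<close> has integral \<open>L / 4\<close>.\<close>

lemma fejer_ge:
  assumes "L > 0" "L * \<bar>k\<bar> \<le> 1" shows "fejer L k \<ge> L / 4"
proof -
  have "((\<lambda>l. (1 - l / L) * (1 / 2)) has_integral ((L / 2 - L\<^sup>2 / (4 * L)) - (0 / 2 - 0\<^sup>2 / (4 * L)))) {0..L}"
    using assms(1)
    by (intro fundamental_theorem_of_calculus)
      (auto intro!: derivative_eq_intros simp: has_real_derivative_iff_has_vector_derivative[symmetric] field_simps)
  then have int: "((\<lambda>l. (1 - l / L) * (1 / 2)) has_integral L / 4) {0..L}"
    using assms(1) by (simp add: power2_eq_square)
  have "L / 4 \<le> integral {0..L} (\<lambda>l. (1 - l / L) * cos (l * k))"
  proof (rule has_integral_le[OF int integrable_integral[OF fejer_integrable[OF assms(1)]]])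
    fix l assume l: "l \<in> {0..L}"
    have "\<bar>l * k\<bar> \<le> L * \<bar>k\<bar>" unfolding abs_mult using l by (intro mult_right_mono) auto
    then have "\<bar>l * k\<bar> \<le> pi / 3" using assms(2) pi_gt3 by linarith
    then have "cos (pi / 3) \<le> cos \<bar>l * k\<bar>"
      by (intro cos_monotone_0_pi_le) auto
    then have "1 / 2 \<le> cos (l * k)" by (simp add: cos_60)
    then show "(1 - l / L) * (1 / 2) \<le> (1 - l / L) * cos (l * k)"
      using l assms(1) by (intro mult_left_mono) auto
  qed
  then show ?thesis by (simp add: fejer_def)
qed

text \<open>The triangular weight gives the closed form \<open>(1 - cos (L * k)) / (L * k^2)\<close>
  away from \<open>k = 0\<close>.\<close>

lemma fejer_nonneg:
  assumes "L > 0" shows "fejer L k \<ge> 0"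
proof (cases "k = 0")
  case True
  then show ?thesis using fejer_ge[OF assms, of k] assms by simp
next
  case False
  have "((\<lambda>l. (1 - l / L) * cos (l * k)) has_integral
     (((1 - L / L) * sin (L * k) / k - cos (L * k) / (L * k\<^sup>2)) - ((1 - 0 / L) * sin (0 * k) / k - cos (0 * k) / (L * k\<^sup>2)))) {0..L}"
    using assms False
    by (intro fundamental_theorem_of_calculus)
      (auto intro!: derivative_eq_intros simp: has_real_derivative_iff_has_vector_derivative[symmetric]
        power2_eq_square field_simps)
  then have "fejer L k = (1 - cos (L * k)) / (L * k\<^sup>2)"
    using assms by (simp add: fejer_def integral_unique diff_divide_distrib)
  then show ?thesis using assms by simp
qed

lemma fejer_continuous:
  assumes "L > 0" shows "continuous_on UNIV (fejer L)"
proof -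
  have "continuous_on UNIV (\<lambda>k. integral (cbox 0 L) (\<lambda>l. (1 - l / L) * cos (l * k)))"
    by (rule integral_continuous_on_param) (use assms in \<open>auto intro!: continuous_intros simp: case_prod_unfold\<close>)
  then show ?thesis by (simp add: fejer_def[abs_def])
qed

text \<open>On a quarter period where the cosine \<open>c\<close> falls from 1 to 0, the lower bound
  \<open>a / (e + c)\<close> dominates the derivative of \<open>- (a / 4) * ln (e^2 + c^2)\<close>,
  because \<open>c * (e + c) <= 2 * (e^2 + c^2)\<close>. The increase of that function is at least
  \<open>(a / 2) * ln (1 / e)\<close>.\<close>

lemma integral_inverse_angle_ge:
  assumes e: "e > 0" and g: "continuous_on {0..2 * pi} g" and t1: "0 \<le> t1" "t1 < 2 * pi"
    and ge: "\<And>t. t \<in> {0..2 * pi} \<Longrightarrow> g t \<ge> a / (e + \<bar>cos (t - t1)\<bar>)" and a: "a > 0"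
  shows "integral {0..2 * pi} g \<ge> a / 2 * ln (1 / e)"
proof -
  \<comment> \<open>Only the absolute value of the cosine enters, which has period
    \<open>pi\<close>. With the angle moved into \<open>{0..pi}\<close> the quarter period to its
    right stays inside \<open>{0..2 * pi}\<close>.\<close>
  obtain t0 where t0: "0 \<le> t0" "t0 \<le> pi" "\<And>t. \<bar>cos (t - t1)\<bar> = \<bar>cos (t - t0)\<bar>"
  proof (cases "t1 \<le> pi")
    case True then show ?thesis using that[of t1] t1 by simp
  next
    case False
    have "\<bar>cos (t - t1)\<bar> = \<bar>cos (t - (t1 - pi))\<bar>" for t
      using cos_periodic_pi[of "t - t1"] by (simp add: algebra_simps)
    then show ?thesis using that[of "t1 - pi"] t1 False by simp
  qed
  define F where "F t = - (a / 4) * ln (e\<^sup>2 + (cos (t - t0))\<^sup>2)" for t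
  define f where "f t = a / 2 * (cos (t - t0) * sin (t - t0) / (e\<^sup>2 + (cos (t - t0))\<^sup>2))" for t
  have pos: "e\<^sup>2 + (cos x)\<^sup>2 > 0" for x using e by (simp add: add_pos_nonneg)
  have "(F has_real_derivative f t) (at t)" for t
    unfolding F_def f_def using pos[of "t - t0"]
    by (auto intro!: derivative_eq_intros simp: field_simps)
  then have F: "(f has_integral F (t0 + pi / 2) - F t0) {t0..t0 + pi / 2}"
    by (intro fundamental_theorem_of_calculus)
      (auto simp: has_real_derivative_iff_has_vector_derivative[symmetric] intro: has_field_derivative_at_within)
  have "0 \<le> ln (e\<^sup>2 + 1)" using e by simp
  moreover have "F (t0 + pi / 2) - F t0 = a / 2 * ln (1 / e) + a / 4 * ln (e\<^sup>2 + 1)"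
    using e by (simp add: F_def ln_div ln_realpow algebra_simps)
  ultimately have "a / 2 * ln (1 / e) \<le> F (t0 + pi / 2) - F t0" using a by simp
  also have "\<dots> \<le> integral {t0..t0 + pi / 2} g"
  proof (rule has_integral_le[OF F integrable_integral])
    show "g integrable_on {t0..t0 + pi / 2}"
      by (rule integrable_continuous_real[OF continuous_on_subset[OF g]]) (use t0 pi_gt_zero in \<open>auto\<close>)
    fix t assume t: "t \<in> {t0..t0 + pi / 2}"
    let ?c = "cos (t - t0)"
    have c: "?c \<ge> 0" by (rule cos_ge_zero) (use t in auto)
    have "2 * (e * ?c) \<le> e\<^sup>2 + ?c\<^sup>2" using zero_le_power2[of "e - ?c"] by (simp add: power2_diff)
    then have "e * ?c + ?c\<^sup>2 \<le> 2 * (e\<^sup>2 + ?c\<^sup>2)"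
      using zero_le_power2[of e] zero_le_power2[of ?c] unfolding distrib_left by linarith
    then have *: "?c * (e + ?c) \<le> 2 * (e\<^sup>2 + ?c\<^sup>2)"
      by (simp add: power2_eq_square algebra_simps)
    have "e + ?c > 0" using e c by linarith
    then have "?c / (e\<^sup>2 + ?c\<^sup>2) \<le> 2 / (e + ?c)"
      using pos[of "t - t0"] * by (simp add: pos_divide_le_eq pos_le_divide_eq mult.commute)
    moreover have "?c * sin (t - t0) / (e\<^sup>2 + ?c\<^sup>2) \<le> ?c / (e\<^sup>2 + ?c\<^sup>2)"
      using c pos[of "t - t0"] by (intro divide_right_mono) (auto simp: mult_left_le)
    ultimately have "?c * sin (t - t0) / (e\<^sup>2 + ?c\<^sup>2) \<le> 2 / (e + ?c)" by linarith
    then have "f t \<le> a / 2 * (2 / (e + ?c))" unfolding f_def using a by (intro mult_left_mono) auto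
    also have "\<dots> = a / (e + \<bar>cos (t - t1)\<bar>)" using c t0(3)[of t] by simp
    also have "\<dots> \<le> g t" by (rule ge) (use t t0 in auto)
    finally show "f t \<le> g t" .
  qed
  also have "\<dots> \<le> integral {0..2 * pi} g"
  proof (rule integral_subset_le)
    show "g integrable_on {t0..t0 + pi / 2}"
      by (rule integrable_continuous_real[OF continuous_on_subset[OF g]]) (use t0 pi_gt_zero in \<open>auto\<close>)
    show "g integrable_on {0..2 * pi}" by (rule integrable_continuous_real[OF g])
    show "\<forall>t\<in>{0..2 * pi}. 0 \<le> g t"
      by (intro ballI, rule order_trans[OF _ ge]) (use e a in auto)
  qed (use t0 in auto)
  finally show ?thesis .
qed

section \<open>Lower bounds for oscillatory integrals\<close>

context oscillatory
begin

lemma coef_lipschitz: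
  assumes "F \<in> coef" "compact K" "K \<subseteq> Z"
  shows "\<exists>M>0. \<forall>z\<in>K. \<forall>t\<in>{0..2 * pi}. \<forall>s\<in>{0..2 * pi}. \<forall>s'\<in>{0..2 * pi}.
    \<bar>Re (F (z, s, t)) - Re (F (z, s', t))\<bar> \<le> M * \<bar>s - s'\<bar>"
proof -
  obtain M where M: "M \<ge> 0" "\<And>z q. z \<in> K \<Longrightarrow> q \<in> torus \<Longrightarrow> norm (dir_deriv (0, 1, 0) F (z, q)) \<le> M"
    using coef_bounded[OF coef_dir_deriv[OF assms(1)] assms(2,3)] by blast
  \<comment> \<open>The constant \<open>M + 1\<close> instead of \<open>M\<close> is strictly
    positive, so it can be used as a divisor later.\<close>
  have "\<bar>Re (F (z, s, t)) - Re (F (z, s', t))\<bar> \<le> (M + 1) * \<bar>s - s'\<bar>"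
    if z: "z \<in> K" and t: "t \<in> {0..2 * pi}" and s: "s \<in> {0..2 * pi}" "s' \<in> {0..2 * pi}" for z t s s'
  proof -
    have d: "((\<lambda>s. Re (F (z, s, t))) has_real_derivative Re (dir_deriv (0, 1, 0) F (z, s, t))) (at s within A)" for s A
    proof -
      have "((\<lambda>s. (z, s, t)) has_derivative (\<lambda>h. h *\<^sub>R (0, 1, 0))) (at s)"
        by (auto intro!: derivative_eq_intros)
      from diff_chain_at[OF this has_derivative_dir_deriv[OF coef_differentiable[OF assms(1)]]]
      have "((\<lambda>s. F (z, s, t)) has_derivative (\<lambda>h. dir_deriv (h *\<^sub>R (0, 1, 0)) F (z, s, t))) (at s)"
        using z assms(3) by (auto simp: o_def)
      moreover have "dir_deriv (h *\<^sub>R (0, 1, 0)) F (z, s, t) = h *\<^sub>R dir_deriv (0, 1, 0) F (z, s, t)" for h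
        by (rule linear_simps(5)[OF has_derivative_bounded_linear[OF has_derivative_dir_deriv[OF coef_differentiable[OF assms(1)]]]])
          (use z assms(3) in auto)
      ultimately have "((\<lambda>s. F (z, s, t)) has_vector_derivative dir_deriv (0, 1, 0) F (z, s, t)) (at s)"
        unfolding has_vector_derivative_def by (simp only:)
      then have "((\<lambda>s. Re (F (z, s, t))) has_vector_derivative Re (dir_deriv (0, 1, 0) F (z, s, t))) (at s)"
        by (rule bounded_linear.has_vector_derivative[OF bounded_linear_Re])
      then show ?thesis
        by (simp add: has_real_derivative_iff_has_vector_derivative has_vector_derivative_at_within)
    qed
    have "norm (Re (F (z, s, t)) - Re (F (z, s', t))) \<le> (M + 1) * norm (s - s')"
    proof (rule field_differentiable_bound[OF convex_real_interval(5) d _ s])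
      fix u assume u: "u \<in> {0..2 * pi}"
      have "norm (dir_deriv (0, 1, 0) F (z, u, t)) \<le> M"
        by (rule M(2)[OF z]) (use u t in \<open>auto simp: cbox_Pair_eq\<close>)
      then show "norm (Re (dir_deriv (0, 1, 0) F (z, u, t))) \<le> M + 1"
        using abs_Re_le_cmod[of "dir_deriv (0, 1, 0) F (z, u, t)"] by simp
    qed
    then show ?thesis by simp
  qed
  then show ?thesis using M(1) by (intro exI[of _ "M + 1"]) auto
qed

text \<open>The derivative of \<open>l * osc B (l \<xi>)\<close> in \<open>l\<close> is
  \<open>osc B\<close> plus the Euler derivative, and by parts in \<open>s\<close> the latter is
  \<open>- osc (sdiv rc B)\<close>. Since \<open>sdiv rc B = r * B1 + B\<close>, the terms with
  \<open>B\<close> cancel, and \<open>osc (r * B1)\<close> decays like \<open>1 / l^2\<close>.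
  Adding \<open>C / l\<close> makes the function decreasing.\<close>

lemma osc_radial_almost_monotone:
  assumes B: "B \<in> amp" and K: "compact K" "K \<subseteq> Z"
  shows "\<exists>C\<ge>0. \<forall>z\<in>K. \<forall>\<xi>. norm \<xi> = 1 \<longrightarrow> (\<forall>l m. 0 < l \<and> l \<le> m \<longrightarrow>
    m * Re (osc B (z, m *\<^sub>R \<xi>)) \<le> l * Re (osc B (z, l *\<^sub>R \<xi>)) + C / l)"
proof -
  define B1 where "B1 = sdiv (\<lambda>_. 1) B"
  have B1: "B1 \<in> amp" unfolding B1_def by (intro sdiv_amp coef_const B)
  obtain C where C: "C \<ge> 0" "\<And>z \<xi>. z \<in> K \<Longrightarrow> norm (osc (rpow 1 B1) (z, \<xi>)) \<le> C / (1 + norm \<xi>)\<^sup>2"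
    using osc_decay[OF B1 K, of 1] by (auto simp: power2_eq_square)
  have "m * Re (osc B (z, m *\<^sub>R \<xi>)) \<le> l * Re (osc B (z, l *\<^sub>R \<xi>)) + C / l"
    if z: "z \<in> K" and \<xi>: "norm \<xi> = 1" and lm: "0 < l" "l \<le> m" for z \<xi> l m
  proof -
    have zZ: "z \<in> Z" using z K by blast
    define \<phi> where "\<phi> l = l * Re (osc B (z, l *\<^sub>R \<xi>)) + C / l" for l
    have d\<phi>: "\<exists>y. (\<phi> has_real_derivative y) (at x) \<and> y \<le> 0" if x: "l \<le> x" for x
    proof -
      have x0: "x > 0" using x lm by simp
      have df: "osc B differentiable (at (z, x *\<^sub>R \<xi>))"
        using smooth_on_differentiable[OF osc_smooth[OF amp_coef[OF B]]] zZ by auto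
      have "((\<lambda>x. (z, x *\<^sub>R \<xi>)) has_derivative (\<lambda>h. h *\<^sub>R (0, \<xi>))) (at x)"
        by (auto intro!: derivative_eq_intros)
      from diff_chain_at[OF this has_derivative_dir_deriv[OF df]]
      have "((\<lambda>x. osc B (z, x *\<^sub>R \<xi>)) has_derivative (\<lambda>h. dir_deriv (h *\<^sub>R (0, \<xi>)) (osc B) (z, x *\<^sub>R \<xi>))) (at x)"
        by (simp add: o_def)
      moreover have "dir_deriv (h *\<^sub>R (0, \<xi>)) (osc B) (z, x *\<^sub>R \<xi>) = h *\<^sub>R dir_deriv (0, \<xi>) (osc B) (z, x *\<^sub>R \<xi>)" for h
        by (rule linear_simps(5)[OF has_derivative_bounded_linear[OF has_derivative_dir_deriv[OF df]]])
      ultimately have "((\<lambda>x. osc B (z, x *\<^sub>R \<xi>)) has_vector_derivative dir_deriv (0, \<xi>) (osc B) (z, x *\<^sub>R \<xi>)) (at x)"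
        unfolding has_vector_derivative_def by (simp only:)
      then have d1: "((\<lambda>x. Re (osc B (z, x *\<^sub>R \<xi>))) has_real_derivative Re (dir_deriv (0, \<xi>) (osc B) (z, x *\<^sub>R \<xi>))) (at x)"
        unfolding has_real_derivative_iff_has_vector_derivative by (rule bounded_linear.has_vector_derivative[OF bounded_linear_Re])
      have "x *\<^sub>R dir_deriv (0, \<xi>) (osc B) (z, x *\<^sub>R \<xi>)
          = integral torus (\<lambda>q. \<i> * (dirv (snd q) \<bullet> (x *\<^sub>R \<xi>)) * rc (z, q) * B (z, q) * wave z (x *\<^sub>R \<xi>) q)"
        unfolding dir_deriv_osc_covector[OF amp_coef[OF B] zZ] osc_def scaleR_conv_of_real[where 'a = complex] integral_mult_right[symmetric]
        by (rule integral_cong) (simp add: mult_ac)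
      also have "\<dots> = - osc (sdiv rc B) (z, x *\<^sub>R \<xi>)"
        by (rule integral_phase_factor1[OF rc_coef B zZ])
      also have "osc (sdiv rc B) (z, x *\<^sub>R \<xi>) = osc (\<lambda>p. rpow 1 B1 p + B p) (z, x *\<^sub>R \<xi>)"
      proof (rule osc_cong[OF _ zZ])
        fix p assume p: "p \<in> dom"
        have "sdiv rc B = sdiv (\<lambda>_. 1) (rpow 1 B)" by (simp add: sdiv_def quo_def rpow_def[abs_def])
        then show "sdiv rc B p = rpow 1 B1 p + B p"
          using sdiv_rpow[OF coef_const[of 1] B p, of 1] by (simp add: rpow_def B1_def)
      qed
      also have "\<dots> = osc (rpow 1 B1) (z, x *\<^sub>R \<xi>) + osc B (z, x *\<^sub>R \<xi>)"
        unfolding osc_def distrib_right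
        by (rule Henstock_Kurzweil_Integration.integral_add; unfold fst_conv snd_conv; intro osc_integrable amp_coef rpow_amp B B1 zZ)
      finally have eq: "x *\<^sub>R dir_deriv (0, \<xi>) (osc B) (z, x *\<^sub>R \<xi>) + osc B (z, x *\<^sub>R \<xi>) = - osc (rpow 1 B1) (z, x *\<^sub>R \<xi>)"
        by simp
      have d2: "(\<phi> has_real_derivative Re (osc B (z, x *\<^sub>R \<xi>)) + x * Re (dir_deriv (0, \<xi>) (osc B) (z, x *\<^sub>R \<xi>)) - C / x\<^sup>2) (at x)"
      proof -
        have "((\<lambda>l. C / l) has_real_derivative - (C / x\<^sup>2)) (at x)"
          using x0 by (auto intro!: derivative_eq_intros simp: power2_eq_square)
        from DERIV_add[OF DERIV_mult[OF DERIV_ident d1] this] show ?thesis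
          unfolding \<phi>_def by (simp add: algebra_simps)
      qed
      have "Re (osc B (z, x *\<^sub>R \<xi>)) + x * Re (dir_deriv (0, \<xi>) (osc B) (z, x *\<^sub>R \<xi>)) = - Re (osc (rpow 1 B1) (z, x *\<^sub>R \<xi>))"
        using arg_cong[OF eq, of Re] by simp
      also have "\<dots> \<le> norm (osc (rpow 1 B1) (z, x *\<^sub>R \<xi>))"
        using abs_Re_le_cmod[of "osc (rpow 1 B1) (z, x *\<^sub>R \<xi>)"] by linarith
      also have "\<dots> \<le> C / (1 + x)\<^sup>2" using C(2)[OF z, of "x *\<^sub>R \<xi>"] \<xi> x0 by simp
      also have "\<dots> \<le> C / x\<^sup>2" using C(1) x0 by (intro divide_left_mono power_mono) auto
      finally show ?thesis using d2 by (intro exI conjI) auto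
    qed
    have "\<phi> m \<le> \<phi> l" by (rule DERIV_nonpos_imp_nonincreasing[OF lm(2)]) (rule d\<phi>)
    moreover have "C / m \<ge> 0" using C(1) lm by simp
    ultimately show ?thesis unfolding \<phi>_def by linarith
  qed
  then show ?thesis using C(1) by blast
qed

text \<open>For a real amplitude the real part of the wave is a cosine in \<open>l\<close>;
  exchanging the integrals puts its weighted average, the Fejer kernel at
  \<open>r * (dirv t \<bullet> \<xi>)\<close>, under the torus integral.\<close>

lemma osc_average:
  assumes B: "B \<in> coef" "z \<in> Z" and real: "\<And>q. Im (B (z, q)) = 0" and L: "L > 0"
  shows "integral {0..L} (\<lambda>l. (1 - l / L) * Re (osc B (z, l *\<^sub>R \<xi>)))
    = integral torus (\<lambda>q. Re (B (z, q)) * fejer L (r (z, q) * (dirv (snd q) \<bullet> \<xi>)))"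
proof -
  have cB: "continuous_on A (\<lambda>q. Re (B (z, q)))" for A by (intro continuous_intros continuous_coef B)
  have cr: "continuous_on A (\<lambda>q. r (z, q))" for A
    using continuous_on_slice[OF smooth_on_continuous_on[OF smooth_r] B(2)] .
  have Re: "Re (osc B (z, l *\<^sub>R \<xi>)) = integral torus (\<lambda>q. Re (B (z, q)) * cos (l * (r (z, q) * (dirv (snd q) \<bullet> \<xi>))))" for l
  proof -
    have "Re (osc B (z, l *\<^sub>R \<xi>)) = integral torus (\<lambda>q. Re (B (z, q) * wave z (l *\<^sub>R \<xi>) q))"
      unfolding osc_def using integral_linear[OF osc_integrable[OF B, of "l *\<^sub>R \<xi>"] bounded_linear_Re] by (simp add: o_def)
    then show ?thesis by (simp add: real mult_ac)
  qed
  define G where "G l q = (1 - l / L) * (Re (B (z, q)) * cos (l * (r (z, q) * (dirv (snd q) \<bullet> \<xi>))))" for l q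
  have c2: "continuous_on A (\<lambda>p. g (snd p))" if "\<And>A'. continuous_on A' g" for A :: "(real \<times> real \<times> real) set" and g :: "real \<times> real \<Rightarrow> real"
    by (rule continuous_on_compose2[OF that[of UNIV]]) (auto intro!: continuous_intros)
  have "continuous_on (cbox (0, (0, 0)) (L, (2 * pi, 2 * pi))) (\<lambda>(l, q). G l q)"
    unfolding G_def case_prod_unfold
    by (intro continuous_intros c2[OF cB] c2[OF cr] c2[OF continuous_angle'(1)]) (use L in auto)
  from integral_swap_continuous[OF this]
  have "integral (cbox 0 L) (\<lambda>l. integral torus (G l)) = integral torus (\<lambda>q. integral (cbox 0 L) (\<lambda>l. G l q))" .
  moreover have "integral torus (G l) = (1 - l / L) * Re (osc B (z, l *\<^sub>R \<xi>))" for l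
    unfolding Re G_def by simp
  moreover have "integral (cbox 0 L) (\<lambda>l. G l q) = Re (B (z, q)) * fejer L (r (z, q) * (dirv (snd q) \<bullet> \<xi>))" for q
    unfolding G_def fejer_def integral_mult_right[symmetric] by (simp add: mult_ac)
  ultimately show ?thesis by simp
qed


text \<open>The mass of the Fejer kernel near the zeros of \<open>r\<close> is of order \<open>1 / |dirv t \<bullet> \<xi>|\<close>, as long as this is
  at most \<open>L\<close>. Integration over \<open>t\<close> gives the logarithm.\<close>
lemma osc_average_ge:
  assumes B: "B \<in> amp" and K: "compact K" "K \<subseteq> Z"
    and nonneg: "\<And>z q. z \<in> K \<Longrightarrow> Re (B (z, q)) \<ge> 0"
    and zeros: "\<And>z t. z \<in> K \<Longrightarrow> t \<in> {0..2 * pi} \<Longrightarrow> \<exists>s\<in>{0..2 * pi}. r (z, s, t) = 0"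
    and pos: "\<And>z q. z \<in> K \<Longrightarrow> r (z, q) = 0 \<Longrightarrow> Re (B (z, q)) > 0"
  shows "\<exists>k>0. \<exists>D. \<forall>z\<in>K. \<forall>\<xi>. norm \<xi> = 1 \<longrightarrow> (\<forall>L\<ge>1.
    integral torus (\<lambda>q. Re (B (z, q)) * fejer L (r (z, q) * (dirv (snd q) \<bullet> \<xi>))) \<ge> k * ln L - D)"
proof -
  note Bc = amp_coef[OF B]
  have sub: "K \<times> torus \<subseteq> dom" using K by auto
  obtain M where M: "M > 0" "\<And>z t s s'. z \<in> K \<Longrightarrow> t \<in> {0..2 * pi} \<Longrightarrow> s \<in> {0..2 * pi} \<Longrightarrow> s' \<in> {0..2 * pi}
      \<Longrightarrow> \<bar>r (z, s, t) - r (z, s', t)\<bar> \<le> M * \<bar>s - s'\<bar>"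
    using coef_lipschitz[OF rc_coef K] by (auto simp: rc_def)
  obtain N where N: "N > 0" "\<And>z t s s'. z \<in> K \<Longrightarrow> t \<in> {0..2 * pi} \<Longrightarrow> s \<in> {0..2 * pi} \<Longrightarrow> s' \<in> {0..2 * pi}
      \<Longrightarrow> \<bar>Re (B (z, s, t)) - Re (B (z, s', t))\<bar> \<le> N * \<bar>s - s'\<bar>"
    using coef_lipschitz[OF Bc K] by blast
  \<comment> \<open>By compactness \<open>Re B\<close> has a positive minimum over the zeros of
    \<open>r\<close> above \<open>K\<close>, if there are any. Half of that minimum survives within
    distance \<open>c / N\<close> of a zero in the variable \<open>s\<close>.\<close>
  obtain c where c: "c > 0" "\<And>z q. z \<in> K \<Longrightarrow> q \<in> torus \<Longrightarrow> r (z, q) = 0 \<Longrightarrow> Re (B (z, q)) \<ge> 2 * c"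
  proof -
    define A where "A = (K \<times> torus) \<inter> r -` {0}"
    have cr: "continuous_on (K \<times> torus) r"
      by (rule continuous_on_subset[OF smooth_on_continuous_on[OF smooth_r] sub])
    have compK: "compact (K \<times> torus)" by (intro compact_Times K compact_cbox)
    have "closed {p \<in> K \<times> torus. r p = 0}"
      by (rule continuous_closed_preimage_constant[OF cr compact_imp_closed[OF compK]])
    moreover have "A = (K \<times> torus) \<inter> {p \<in> K \<times> torus. r p = 0}" by (auto simp: A_def)
    ultimately have compA: "compact A" using compK by (simp only: compact_Int_closed)
    show ?thesis
    proof (cases "A = {}")
      case True
      then show ?thesis by (intro that[of 1]) (auto simp: A_def)
    next
      case False
      have "continuous_on A (\<lambda>p. Re (B p))"
        by (intro continuous_intros continuous_on_subset[OF smooth_on_continuous_on[OF coef_smooth[OF Bc]]])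
          (use sub in \<open>auto simp: A_def\<close>)
      then obtain p where p: "p \<in> A" "\<And>p'. p' \<in> A \<Longrightarrow> Re (B p) \<le> Re (B p')"
        using continuous_attains_inf[OF compA False] by blast
      then have "Re (B p) > 0" using pos by (auto simp: A_def)
      then show ?thesis using p(2) by (intro that[of "Re (B p) / 2"]) (auto simp: A_def)
    qed
  qed
  \<comment> \<open>The bound by \<open>pi\<close> leaves room, on one side of the zero, for an
    interval of this length inside \<open>{0..2 * pi}\<close>.\<close>
  define \<delta> where "\<delta> = min (c / N) pi"
  have \<delta>: "\<delta> > 0" "\<delta> \<le> pi" "N * \<delta> \<le> c"
    using c(1) N(1) by (auto simp: \<delta>_def min_def field_simps)
  \<comment> \<open>Chosen so that \<open>d * (c * (L / 4))\<close>, interval length times lower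
    bound, is exactly \<open>a / (e + \<tau>)\<close> below.\<close>
  define a where "a = c / (4 * M)"
  have a: "a > 0" using c(1) M(1) by (simp add: a_def)
  have main: "integral torus (\<lambda>q. Re (B (z, q)) * fejer L (r (z, q) * (dirv (snd q) \<bullet> \<xi>)))
      \<ge> a / 2 * ln L + a / 2 * ln (\<delta> * M)"
    if z: "z \<in> K" and \<xi>: "norm \<xi> = 1" and L: "L \<ge> 1" for z \<xi> L
  proof -
    have zZ: "z \<in> Z" using z K by blast
    have L0: "L > 0" using L by simp
    define h where "h s t = Re (B (z, s, t)) * fejer L (r (z, s, t) * (dirv t \<bullet> \<xi>))" for s t
    have cB: "continuous_on A (\<lambda>q. Re (B (z, q)))" for A by (intro continuous_intros continuous_coef Bc zZ)
    have cr: "continuous_on A (\<lambda>q. r (z, q))" for A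
      using continuous_on_slice[OF smooth_on_continuous_on[OF smooth_r] zZ] .
    have ch: "continuous_on A (\<lambda>q. h (fst q) (snd q))" for A
      unfolding h_def prod.collapse
      by (intro continuous_intros cB continuous_on_compose2[OF fejer_continuous[OF L0]] cr continuous_angle') auto
    have hn: "h s t \<ge> 0" for s t unfolding h_def
      using fejer_nonneg[OF L0] nonneg[OF z] by simp
    have hs: "(\<lambda>s. h s t) integrable_on {u..v}" for t u v
      by (rule integrable_continuous_real, rule continuous_on_compose2[OF ch[of UNIV], of _ "\<lambda>s. (s, t)", simplified])
        (auto intro!: continuous_intros)
    obtain t1 where t1: "0 \<le> t1" "t1 < 2 * pi" "\<xi> = dirv t1" using dirv_polar[of \<xi>] \<xi> by auto
    define e where "e = 1 / (\<delta> * M * L)"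
    have e: "e > 0" using \<delta>(1) M(1) L0 by (simp add: e_def)
    have inner: "integral {0..2 * pi} (\<lambda>s. h s t) \<ge> a / (e + \<bar>cos (t - t1)\<bar>)" if t: "t \<in> {0..2 * pi}" for t
    proof -
      define \<tau> where "\<tau> = \<bar>cos (t - t1)\<bar>"
      have \<tau>: "\<tau> \<ge> 0" "\<bar>dirv t \<bullet> \<xi>\<bar> = \<tau>" by (simp_all add: \<tau>_def t1(3) inner_dirv_dirv)
      \<comment> \<open>The length of an \<open>s\<close>-interval next to the zero has to satisfy
        \<open>d <= \<delta>\<close>, which keeps \<open>Re B >= c\<close>, and
        \<open>M * L * \<tau> * d <= 1\<close>, which keeps the argument of the Fejer kernel below
        \<open>1 / L\<close>. The harmonic combination gives both at once and leads to a bound of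
        the form \<open>a / (e + \<tau>)\<close>.\<close>
      define d where "d = 1 / (1 / \<delta> + M * L * \<tau>)"
      have den: "1 / \<delta> + M * L * \<tau> > 0" using \<delta>(1) M(1) L0 \<tau>(1) by (simp add: add_pos_nonneg)
      have d: "d > 0" "d \<le> \<delta>" "M * L * \<tau> * d \<le> 1"
      proof -
        show "d > 0" using den by (simp add: d_def)
        have "1 / (1 / \<delta> + M * L * \<tau>) \<le> 1 / (1 / \<delta>)"
          using \<delta>(1) M(1) L0 \<tau>(1) by (intro divide_left_mono) (auto simp: den)
        then show "d \<le> \<delta>" by (simp add: d_def)
        show "M * L * \<tau> * d \<le> 1" unfolding d_def using den \<delta>(1) by simp
      qed
      obtain s0 where s0: "s0 \<in> {0..2 * pi}" "r (z, s0, t) = 0" using zeros[OF z t] by blast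
      obtain u where u: "{u..u + d} \<subseteq> {0..2 * pi}" "\<And>s. s \<in> {u..u + d} \<Longrightarrow> \<bar>s - s0\<bar> \<le> d"
      proof (cases "s0 \<le> pi")
        case True
        show ?thesis by (rule that[of s0]) (use True d \<delta> s0 in auto)
      next
        case False
        show ?thesis by (rule that[of "s0 - d"]) (use False d \<delta> s0 in auto)
      qed
      have low: "c * (L / 4) \<le> h s t" if s: "s \<in> {u..u + d}" for s
      proof -
        have s2: "s \<in> {0..2 * pi}" "\<bar>s - s0\<bar> \<le> d" using u s by blast+
        have "N * \<bar>s - s0\<bar> \<le> c"
          by (rule order_trans[OF mult_left_mono \<delta>(3)]) (use s2 d N(1) in auto)
        moreover have "Re (B (z, s0, t)) \<ge> 2 * c"
          by (rule c(2)[OF z _ s0(2)]) (use s0(1) t in \<open>auto simp: cbox_Pair_eq\<close>)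
        ultimately have b: "Re (B (z, s, t)) \<ge> c" using N(2)[OF z t s2(1) s0(1)] by linarith
        have "\<bar>r (z, s, t)\<bar> \<le> M * d"
        proof -
          have "M * \<bar>s - s0\<bar> \<le> M * d" using M(1) s2(2) by (intro mult_left_mono) auto
          then show ?thesis using M(2)[OF z t s2(1) s0(1)] s0(2) by simp
        qed
        then have "L * \<bar>r (z, s, t) * (dirv t \<bullet> \<xi>)\<bar> \<le> L * (M * d * \<tau>)"
          unfolding abs_mult \<tau>(2) using L0 \<tau>(1) by (intro mult_left_mono mult_right_mono) auto
        also have "\<dots> \<le> 1" using d(3) by (simp add: mult_ac)
        finally have "fejer L (r (z, s, t) * (dirv t \<bullet> \<xi>)) \<ge> L / 4" by (rule fejer_ge[OF L0])
        then show ?thesis unfolding h_def using b c(1) L0 by (intro mult_mono) auto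
      qed
      have "a / (e + \<tau>) = d * (c * (L / 4))"
      proof -
        define X where "X = 1 / \<delta> + M * L * \<tau>"
        have "e + \<tau> = X / (M * L)"
          using M(1) L0 \<delta>(1) by (simp add: e_def X_def field_simps)
        then have "a / (e + \<tau>) = a / (X / (M * L))" by simp
        also have "\<dots> = d * (c * (L / 4))"
          unfolding a_def d_def X_def[symmetric] using den M(1) L0 by (simp add: X_def[symmetric])
        finally show ?thesis .
      qed
      also have "\<dots> = integral {u..u + d} (\<lambda>_. c * (L / 4))" using d(1) by simp
      also have "\<dots> \<le> integral {u..u + d} (\<lambda>s. h s t)"
        by (rule integral_le[OF _ hs low]) auto
      also have "\<dots> \<le> integral {0..2 * pi} (\<lambda>s. h s t)"
        by (rule integral_subset_le[OF u(1) hs hs]) (simp add: hn)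
      finally show ?thesis by (simp add: \<tau>_def)
    qed
    have cg: "continuous_on {0..2 * pi} (\<lambda>t. integral (cbox 0 (2 * pi)) (\<lambda>s. h s t))"
    proof (rule integral_continuous_on_param)
      have "continuous_on UNIV (\<lambda>p::real \<times> real. (snd p, fst p))" by (intro continuous_intros)
      from continuous_on_compose2[OF ch[of UNIV] this]
      have "continuous_on UNIV (\<lambda>p. h (snd p) (fst p))" by simp
      then show "continuous_on ({0..2 * pi} \<times> cbox 0 (2 * pi)) (\<lambda>(t, s). h s t)"
        by (auto simp: case_prod_unfold intro: continuous_on_subset)
    qed
    have "a / 2 * ln L + a / 2 * ln (\<delta> * M) = a / 2 * ln (1 / e)"
      using \<delta>(1) M(1) L0 by (simp add: e_def ln_mult algebra_simps)
    also have "\<dots> \<le> integral {0..2 * pi} (\<lambda>t. integral (cbox 0 (2 * pi)) (\<lambda>s. h s t))"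
      by (rule integral_inverse_angle_ge[OF e cg t1(1,2) _ a]) (use inner in auto)
    also have "\<dots> = integral (cbox 0 (2 * pi)) (\<lambda>s. integral (cbox 0 (2 * pi)) (\<lambda>t. h s t))"
      using integral_swap_continuous[of 0 0 "2 * pi" "2 * pi" h] ch[of torus] by (simp add: case_prod_unfold)
    also have "\<dots> = integral torus (\<lambda>q. h (fst q) (snd q))"
      using integral_prod_continuous[OF ch[of torus]] by simp
    finally show ?thesis by (simp add: h_def)
  qed
  show ?thesis
    by (rule exI[of _ "a / 2"], rule conjI, use a in simp, rule exI[of _ "- (a / 2 * ln (\<delta> * M))"])
      (use main in auto)
qed

text \<open>If \<open>l0 * Re (osc B (l0 \<xi>)) + C / l0\<close> were below \<open>k\<close>,
  almost monotonicity would keep \<open>l * Re (osc B (l \<xi>))\<close> below some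
  \<open>m < k\<close> for all larger \<open>l\<close>. The Fejer average up to \<open>L\<close>
  would then be at most \<open>m * ln L\<close> plus a constant, against the lower bound
  \<open>k * ln L - D\<close>. The threshold \<open>k\<close> is the same for all \<open>l0\<close>
  and all directions.\<close>

theorem osc_elliptic:
  assumes B: "B \<in> amp" and K: "compact K" "K \<subseteq> Z"
    and real: "\<And>z q. z \<in> K \<Longrightarrow> Im (B (z, q)) = 0" and nonneg: "\<And>z q. z \<in> K \<Longrightarrow> Re (B (z, q)) \<ge> 0"
    and zeros: "\<And>z t. z \<in> K \<Longrightarrow> t \<in> {0..2 * pi} \<Longrightarrow> \<exists>s\<in>{0..2 * pi}. r (z, s, t) = 0"
    and pos: "\<And>z q. z \<in> K \<Longrightarrow> r (z, q) = 0 \<Longrightarrow> Re (B (z, q)) > 0"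
  shows "\<exists>c>0. \<exists>M. \<forall>z\<in>K. \<forall>\<xi>. norm \<xi> \<ge> M \<longrightarrow> norm (osc B (z, \<xi>)) \<ge> c * (1 + norm \<xi>) powr (-1)"
proof -
  obtain k D where k: "k > 0" and D': "\<forall>z\<in>K. \<forall>\<xi>. norm \<xi> = 1 \<longrightarrow> (\<forall>L\<ge>1.
    integral torus (\<lambda>q. Re (B (z, q)) * fejer L (r (z, q) * (dirv (snd q) \<bullet> \<xi>))) \<ge> k * ln L - D)"
    by (rule exE[OF osc_average_ge[OF B K]]) (use nonneg zeros pos in blast)+
  have D: "integral torus (\<lambda>q. Re (B (z, q)) * fejer L (r (z, q) * (dirv (snd q) \<bullet> \<xi>))) \<ge> k * ln L - D"
    if "z \<in> K" "norm \<xi> = 1" "L \<ge> 1" for z \<xi> L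
    using D' that by simp
  obtain C where C': "C \<ge> 0" "\<forall>z\<in>K. \<forall>\<xi>. norm \<xi> = 1 \<longrightarrow> (\<forall>l m. 0 < l \<and> l \<le> m \<longrightarrow>
    m * Re (osc B (z, m *\<^sub>R \<xi>)) \<le> l * Re (osc B (z, l *\<^sub>R \<xi>)) + C / l)"
    using osc_radial_almost_monotone[OF B K] by (elim exE conjE) rule
  have C: "m * Re (osc B (z, m *\<^sub>R \<xi>)) \<le> l * Re (osc B (z, l *\<^sub>R \<xi>)) + C / l"
    if "z \<in> K" "norm \<xi> = 1" "0 < l" "l \<le> m" for z \<xi> l m
    using C' that by simp
  obtain C0 where C0: "C0 \<ge> 0" "\<And>z \<xi>. z \<in> K \<Longrightarrow> norm (osc B (z, \<xi>)) \<le> C0 / (1 + norm \<xi>)"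
    using osc_decay_base[OF B K] by blast
  have key: "l0 * Re (osc B (z, l0 *\<^sub>R \<xi>)) + C / l0 \<ge> k"
    if z: "z \<in> K" and \<xi>: "norm \<xi> = 1" and l0: "l0 \<ge> 1" for z \<xi> l0
  proof (rule ccontr)
    assume less: "\<not> l0 * Re (osc B (z, l0 *\<^sub>R \<xi>)) + C / l0 \<ge> k"
    have zZ: "z \<in> Z" using z K by blast
    define f where "f l = Re (osc B (z, l *\<^sub>R \<xi>))" for l
    \<comment> \<open>The maximum with 0 makes \<open>m / l\<close> nonnegative, so that the weight
      \<open>1 - l / L\<close> may be dropped in the upper estimate.\<close>
    define m where "m = max 0 (l0 * f l0 + C / l0)"
    have m: "0 \<le> m" "m < k" "l0 * f l0 + C / l0 \<le> m" using less k by (auto simp: m_def f_def)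
    \<comment> \<open>Large enough for \<open>(k - m) * ln L\<close> to exceed
      \<open>C0 * l0 + D\<close>; it may depend on \<open>l0\<close>, as it only serves the
      contradiction.\<close>
    define L where "L = max l0 (exp ((C0 * l0 + D) / (k - m) + 1))"
    have L: "L \<ge> l0" "L \<ge> 1" using l0 by (auto simp: L_def)
    have "(C0 * l0 + D) / (k - m) + 1 \<le> ln L"
      using L ln_ge_iff[of L] by (simp add: L_def)
    then have lnL: "(C0 * l0 + D) < (k - m) * ln L"
      using m(2) by (simp add: pos_divide_le_eq[symmetric] pos_divide_less_eq[symmetric] mult.commute)
    have "continuous_on UNIV f"
    proof -
      have "continuous_on UNIV (\<lambda>l. osc B (z, l *\<^sub>R \<xi>))"
        by (rule continuous_on_compose2[OF smooth_on_continuous_on[OF osc_smooth[OF amp_coef[OF B]]]])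
          (use zZ in \<open>auto intro!: continuous_intros\<close>)
      then show ?thesis unfolding f_def by (intro continuous_intros)
    qed
    then have cf: "continuous_on A f" for A by (rule continuous_on_subset) simp
    have int: "(\<lambda>l. (1 - l / L) * f l) integrable_on {u..v}" for u v
      by (intro integrable_continuous_real continuous_intros cf) (use L in auto)
    have "k * ln L - D \<le> integral {0..L} (\<lambda>l. (1 - l / L) * f l)"
      unfolding f_def osc_average[OF amp_coef[OF B] zZ real[OF z] less_le_trans[OF zero_less_one L(2)]]
      by (rule D[OF z \<xi> L(2)])
    also have "\<dots> = integral {0..l0} (\<lambda>l. (1 - l / L) * f l) + integral {l0..L} (\<lambda>l. (1 - l / L) * f l)"
      by (rule Henstock_Kurzweil_Integration.integral_combine[symmetric]) (use L l0 int in auto)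
    \<comment> \<open>Below \<open>l0\<close> only boundedness is used; the cost does not depend on
      \<open>L\<close>.\<close>
    also have "integral {0..l0} (\<lambda>l. (1 - l / L) * f l) \<le> integral {0..l0} (\<lambda>_. C0)"
    proof (rule integral_le[OF int])
      fix l assume l: "l \<in> {0..l0}"
      have "norm (osc B (z, l *\<^sub>R \<xi>)) \<le> C0"
        by (rule order_trans[OF C0(2)[OF z]]) (use C0(1) in \<open>simp add: divide_le_eq add_pos_nonneg mult_le_cancel_left1\<close>)
      then have "\<bar>f l\<bar> \<le> C0" unfolding f_def using abs_Re_le_cmod order_trans by blast
      then have "\<bar>(1 - l / L) * f l\<bar> \<le> 1 * C0"
        unfolding abs_mult using l L l0 by (intro mult_mono) (auto simp: abs_le_iff)
      then show "(1 - l / L) * f l \<le> C0" by linarith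
    qed auto
    also have "integral {0..l0} (\<lambda>_. C0) = C0 * l0" using l0 by simp
    also have "integral {l0..L} (\<lambda>l. (1 - l / L) * f l) \<le> m * ln L - m * ln l0"
    proof (rule has_integral_le[OF integrable_integral[OF int]])
      show "((\<lambda>l. m / l) has_integral m * ln L - m * ln l0) {l0..L}"
        using L l0 by (intro fundamental_theorem_of_calculus)
          (auto intro!: derivative_eq_intros simp: has_real_derivative_iff_has_vector_derivative[symmetric])
      fix l assume l: "l \<in> {l0..L}"
      then have "l > 0" using l0 by simp
      have "l * f l \<le> l0 * f l0 + C / l0" unfolding f_def by (rule C[OF z \<xi>]) (use l l0 in auto)
      then have "l * f l \<le> m" using m(3) by linarith
      then have "f l \<le> m / l" using \<open>l > 0\<close> by (simp add: pos_le_divide_eq mult.commute)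
      moreover have "m / l \<ge> 0" using m(1) \<open>l > 0\<close> by simp
      moreover have "0 \<le> 1 - l / L" "1 - l / L \<le> 1" using l L l0 by auto
      ultimately have "(1 - l / L) * f l \<le> (1 - l / L) * (m / l)" "(1 - l / L) * (m / l) \<le> 1 * (m / l)"
        by (intro mult_left_mono mult_right_mono; simp)+
      then show "(1 - l / L) * f l \<le> m / l" by linarith
    qed
    finally have "k * ln L - D \<le> C0 * l0 + (m * ln L - m * ln l0)" by simp
    moreover have "m * ln l0 \<ge> 0" using m(1) l0 by simp
    ultimately show False using lnL by (simp add: algebra_simps)
  qed
  have "k / 2 * (1 + norm \<xi>) powr (-1) \<le> norm (osc B (z, \<xi>))"
    \<comment> \<open>This threshold makes the error \<open>C / l0\<close> at most half of
      \<open>k\<close>.\<close>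
    if z: "z \<in> K" and \<xi>: "norm \<xi> \<ge> max 1 (2 * C / k)" for z \<xi>
  proof -
    define l0 where "l0 = norm \<xi>"
    have "l0 \<ge> 1" using \<xi> by (simp add: l0_def)
    moreover have "2 * C \<le> k * l0" using \<xi> k by (simp add: pos_divide_le_eq mult.commute l0_def)
    ultimately have l0: "l0 \<ge> 1" "C / l0 \<le> k / 2" by (simp_all add: pos_divide_le_eq)
    have "l0 *\<^sub>R (\<xi> /\<^sub>R l0) = \<xi>" "norm (\<xi> /\<^sub>R l0) = 1"
    proof -
      have "norm \<xi> \<noteq> 0" using l0(1) by (auto simp: l0_def)
      then show "l0 *\<^sub>R (\<xi> /\<^sub>R l0) = \<xi>" "norm (\<xi> /\<^sub>R l0) = 1" by (simp_all add: l0_def)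
    qed
    then have "l0 * Re (osc B (z, \<xi>)) + C / l0 \<ge> k" using key[OF z _ l0(1), of "\<xi> /\<^sub>R l0"] by simp
    then have "k / 2 \<le> l0 * Re (osc B (z, \<xi>))" using l0 by linarith
    also have "\<dots> \<le> l0 * norm (osc B (z, \<xi>))"
      by (rule mult_left_mono[OF complex_Re_le_cmod]) (use l0(1) in simp)
    also have "\<dots> \<le> (1 + l0) * norm (osc B (z, \<xi>))"
      by (rule mult_right_mono) auto
    finally have "k / 2 / (1 + l0) \<le> norm (osc B (z, \<xi>))" using l0 by (simp add: pos_divide_le_eq algebra_simps)
    then show ?thesis using l0 by (simp add: powr_minus_divide l0_def)
  qed
  then show ?thesis using k by (intro exI[of _ "k / 2"] conjI exI[of _ "max 1 (2 * C / k)"]) auto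
qed

end

subsection \<open>Fourier inversion for test functions\<close>

lemma dir_deriv_zero: "dir_deriv v (\<lambda>x. 0) = (\<lambda>x. 0)"
  using dir_deriv_eqI[OF has_derivative_const] by fastforce

lemma test_functions_in_dir_deriv:
  assumes "\<phi> \<in> test_functions_in K" "compact K"
  shows "dir_deriv v \<phi> \<in> test_functions_in K"
proof -
  have "dir_deriv v \<phi> x = 0" if "x \<notin> K" for x
    using dir_deriv_cong[of "- K" x \<phi> "\<lambda>_. 0" v] assms that smooth_on_differentiable[of UNIV \<phi> x]
    by (auto simp: test_functions_in_def dir_deriv_zero compact_imp_closed open_Compl)
  then show ?thesis using assms smooth_on_dir_deriv[OF open_UNIV, of \<phi> v] by (simp add: test_functions_in_def)
qed

lemma test_functions_in_mult:
  assumes "\<phi> \<in> test_functions_in K" "smooth_on UNIV f"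
  shows "(\<lambda>x. f x * \<phi> x) \<in> test_functions_in K"
  using assms by (auto simp: test_functions_in_def intro: smooth_on_mult)

lemma test_functions_in_continuous: "\<phi> \<in> test_functions_in K \<Longrightarrow> continuous_on A \<phi>"
  using smooth_on_continuous_on[of UNIV \<phi>] continuous_on_subset by (auto simp: test_functions_in_def)

lemma test_functions_in_integrable:
  assumes "\<phi> \<in> test_functions_in K" "compact K"
  shows "integrable lborel \<phi>"
proof -
  have "integrable lborel (\<lambda>x. indicator K x *\<^sub>R \<phi> x)"
    by (rule borel_integrable_compact[OF assms(2) test_functions_in_continuous[OF assms(1)]])
  moreover have "(\<lambda>x. indicator K x *\<^sub>R \<phi> x) = \<phi>"
    using assms(1) by (auto simp: test_functions_in_def indicator_def fun_eq_iff)
  ultimately show ?thesis by simp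
qed

lemma test_functions_in_bounded:
  assumes "\<phi> \<in> test_functions_in K" "compact K"
  shows "\<exists>M\<ge>0. \<forall>x. norm (\<phi> x) \<le> M"
proof -
  have "bounded (\<phi> ` K)"
    by (intro compact_imp_bounded compact_continuous_image test_functions_in_continuous[OF assms(1)] assms(2))
  then obtain M where "\<forall>y\<in>\<phi> ` K. norm y \<le> M" using bounded_iff by metis
  then have "norm (\<phi> x) \<le> max M 0" for x
    using assms(1) by (cases "x \<in> K") (auto simp: test_functions_in_def intro: max.coboundedI1)
  then show ?thesis by (intro exI[of _ "max M 0"]) auto
qed

lemma test_function_lipschitz:
  assumes "\<phi> \<in> test_functions_in K" "compact K"
  shows "\<exists>M\<ge>0. \<forall>x t. norm (\<phi> (x + t *\<^sub>R v) - \<phi> x) \<le> M * \<bar>t\<bar>"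
proof -
  obtain M where M: "M \<ge> 0" "\<And>x. norm (dir_deriv v \<phi> x) \<le> M"
    using test_functions_in_bounded[OF test_functions_in_dir_deriv[OF assms] assms(2)] by metis
  have "norm (\<phi> (x + t *\<^sub>R v) - \<phi> x) \<le> M * \<bar>t\<bar>" for x t
  proof -
    have d: "((\<lambda>t. \<phi> (x + t *\<^sub>R v)) has_derivative (\<lambda>h. h *\<^sub>R dir_deriv v \<phi> (x + t *\<^sub>R v))) (at t)" for t
    proof -
      have df: "\<phi> differentiable (at (x + t *\<^sub>R v))"
        using assms(1) smooth_on_differentiable by (auto simp: test_functions_in_def)
      have "((\<lambda>t. x + t *\<^sub>R v) has_derivative (\<lambda>h. h *\<^sub>R v)) (at t)"
        by (auto intro!: derivative_eq_intros)
      from diff_chain_at[OF this has_derivative_dir_deriv[OF df]]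
      show ?thesis
        using linear_simps(5)[OF has_derivative_bounded_linear[OF has_derivative_dir_deriv[OF df]]]
        by (simp add: o_def)
    qed
    have "norm (\<phi> (x + t *\<^sub>R v) - \<phi> (x + 0 *\<^sub>R v)) \<le> M * norm (t - 0)"
    proof (rule differentiable_bound[where S = UNIV, OF convex_UNIV d[THEN has_derivative_at_withinI]])
      fix s
      show "onorm (\<lambda>h. h *\<^sub>R dir_deriv v \<phi> (x + s *\<^sub>R v)) \<le> M"
        by (rule onorm_bound) (use M in \<open>auto simp: mult.commute[of M] intro!: mult_left_mono\<close>)
    qed auto
    then show ?thesis by simp
  qed
  then show ?thesis using M(1) by blast
qed

lemma lborel_integral_scale:
  fixes f :: "'a::euclidean_space \<Rightarrow> complex"
  assumes "c \<noteq> 0" "f \<in> borel_measurable borel"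
  shows "(LINT x|lborel. f x) = \<bar>c\<bar> ^ DIM('a) *\<^sub>R (LINT x|lborel. f (t + c *\<^sub>R x))"
proof -
  have "(LINT x|lborel. f x) = (LINT x|density (distr lborel borel (\<lambda>x. t + c *\<^sub>R x)) (\<lambda>_. ennreal (\<bar>c\<bar> ^ DIM('a))). f x)"
    using lborel_affine[OF assms(1), of t] by (simp add: ennreal_power)
  also have "\<dots> = (LINT x|distr lborel borel (\<lambda>x. t + c *\<^sub>R x). \<bar>c\<bar> ^ DIM('a) *\<^sub>R f x)"
    using assms(2) by (subst integral_density) auto
  also have "\<dots> = (LINT x|lborel. \<bar>c\<bar> ^ DIM('a) *\<^sub>R f (t + c *\<^sub>R x))"
    using assms(2) by (subst integral_distr) auto
  finally show ?thesis by simp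
qed

text \<open>Every difference quotient has integral 0 by translation invariance of Lebesgue measure,
  and the quotients converge to the derivative under a common majorant. No iterated integrals along
  \<open>v\<close> are involved.\<close>

lemma test_function_integral_deriv:
  fixes \<phi> :: "'a::euclidean_space \<Rightarrow> complex"
  assumes \<phi>: "\<phi> \<in> test_functions_in K" "compact K"
  shows "(LINT x|lborel. dir_deriv v \<phi> x) = 0"
proof -
  obtain M where M: "M \<ge> 0" "\<And>x t. norm (\<phi> (x + t *\<^sub>R v) - \<phi> x) \<le> M * \<bar>t\<bar>"
    using test_function_lipschitz[OF assms] by metis
  have c\<phi>: "continuous_on UNIV \<phi>" by (rule test_functions_in_continuous[OF \<phi>(1)])
  have m\<phi>: "\<phi> \<in> borel_measurable borel" by (rule borel_measurable_continuous_onI[OF c\<phi>])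
  define t where "t n = 1 / real (Suc n)" for n
  have t: "0 < t n" "t n \<le> 1" for n by (auto simp: t_def)
  define f where "f n x = (\<phi> (x + t n *\<^sub>R v) - \<phi> x) /\<^sub>R t n" for n x
  have df: "\<phi> differentiable (at x)" for x
    using \<phi>(1) smooth_on_differentiable by (auto simp: test_functions_in_def)
  obtain R where R: "\<And>x. x \<in> K \<Longrightarrow> norm x \<le> R" using compact_imp_bounded[OF \<phi>(2)] bounded_iff by metis
  \<comment> \<open>Translates by \<open>t * v\<close> with \<open>0 <= t <= 1\<close> are supported
    in this ball, so one majorant serves all difference quotients.\<close>
  define B :: "'a set" where "B = cball 0 (R + norm v)"
  have outside: "\<phi> (x + s *\<^sub>R v) = 0" if "x \<notin> B" "0 \<le> s" "s \<le> 1" for x s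
  proof -
    have "norm x > R + norm v" using that by (simp add: B_def)
    moreover have "norm x \<le> norm (x + s *\<^sub>R v) + norm (s *\<^sub>R v)" using norm_triangle_ineq4[of "x + s *\<^sub>R v" "s *\<^sub>R v"] by simp
    moreover have "norm (s *\<^sub>R v) \<le> norm v" using that by (simp add: mult_left_le_one_le)
    ultimately have "norm (x + s *\<^sub>R v) > R" by linarith
    then show ?thesis using R \<phi>(1) by (force simp: test_functions_in_def)
  qed
  have "(\<lambda>n. LINT x|lborel. f n x) \<longlonglongrightarrow> (LINT x|lborel. dir_deriv v \<phi> x)"
  proof (rule integral_dominated_convergence[where w = "\<lambda>x. M * indicator B x"])
    show "dir_deriv v \<phi> \<in> borel_measurable lborel"
      using borel_measurable_continuous_onI[OF test_functions_in_continuous[OF test_functions_in_dir_deriv[OF \<phi>]]] by simp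
    show "f n \<in> borel_measurable lborel" for n
      unfolding f_def using m\<phi> by measurable
    show "integrable lborel (\<lambda>x. M * indicator B x)"
      by (intro integrable_mult_right integrable_real_indicator)
        (use emeasure_bounded_finite[OF bounded_cball, of 0 "R + norm v"] in \<open>auto simp: B_def\<close>)
    show "AE x in lborel. (\<lambda>n. f n x) \<longlonglongrightarrow> dir_deriv v \<phi> x"
    proof (rule AE_I2)
      fix x
      have "((\<lambda>h. x + h *\<^sub>R v) has_derivative (\<lambda>h. h *\<^sub>R v)) (at 0)"
        by (auto intro!: derivative_eq_intros)
      from diff_chain_at[OF this, of \<phi> "\<lambda>v. dir_deriv v \<phi> x"] has_derivative_dir_deriv[OF df[of x]]
      have "((\<lambda>h. \<phi> (x + h *\<^sub>R v)) has_derivative (\<lambda>h. dir_deriv (h *\<^sub>R v) \<phi> x)) (at 0)"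
        by (simp add: o_def)
      then have "((\<lambda>h. \<phi> (x + h *\<^sub>R v)) has_derivative (\<lambda>h. h *\<^sub>R dir_deriv v \<phi> x)) (at 0)"
        using linear_simps(5)[OF has_derivative_bounded_linear[OF has_derivative_dir_deriv[OF df]]] by simp
      then have "((\<lambda>h. norm (\<phi> (x + h *\<^sub>R v) - \<phi> x - h *\<^sub>R dir_deriv v \<phi> x) / norm h) \<longlongrightarrow> 0) (at 0)"
        unfolding has_derivative_at by simp
      then have "((\<lambda>h. norm ((\<phi> (x + h *\<^sub>R v) - \<phi> x) /\<^sub>R h - dir_deriv v \<phi> x)) \<longlongrightarrow> 0) (at 0)"
      proof (rule Lim_transform_eventually)
        have "norm (\<phi> (x + h *\<^sub>R v) - \<phi> x - h *\<^sub>R dir_deriv v \<phi> x) / norm h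
          = norm ((\<phi> (x + h *\<^sub>R v) - \<phi> x) /\<^sub>R h - dir_deriv v \<phi> x)" if "h \<noteq> 0" for h
        proof -
          have "(\<phi> (x + h *\<^sub>R v) - \<phi> x) /\<^sub>R h - dir_deriv v \<phi> x
            = (\<phi> (x + h *\<^sub>R v) - \<phi> x - h *\<^sub>R dir_deriv v \<phi> x) /\<^sub>R h"
            using that by (simp add: scaleR_diff_right)
          then show ?thesis by (simp add: divide_inverse mult.commute)
        qed
        then show "\<forall>\<^sub>F h in at 0. norm (\<phi> (x + h *\<^sub>R v) - \<phi> x - h *\<^sub>R dir_deriv v \<phi> x) / norm h
          = norm ((\<phi> (x + h *\<^sub>R v) - \<phi> x) /\<^sub>R h - dir_deriv v \<phi> x)"
          by (auto simp: eventually_at_filter)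
      qed
      then have "((\<lambda>h. (\<phi> (x + h *\<^sub>R v) - \<phi> x) /\<^sub>R h - dir_deriv v \<phi> x) \<longlongrightarrow> 0) (at 0)"
        by (subst (asm) tendsto_norm_zero_iff)
      then have "((\<lambda>h. (\<phi> (x + h *\<^sub>R v) - \<phi> x) /\<^sub>R h) \<longlongrightarrow> dir_deriv v \<phi> x) (at 0)"
        by (subst (asm) LIM_zero_iff)
      moreover have "filterlim t (at 0) sequentially"
        unfolding filterlim_at t_def using LIMSEQ_inverse_real_of_nat by (auto simp: inverse_eq_divide)
      ultimately show "(\<lambda>n. f n x) \<longlonglongrightarrow> dir_deriv v \<phi> x"
        unfolding f_def by (rule filterlim_compose)
    qed
    show "AE x in lborel. norm (f n x) \<le> M * indicator B x" for n
    proof (rule AE_I2)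
      fix x
      show "norm (f n x) \<le> M * indicator B x"
      proof (cases "x \<in> B")
        case True
        then show ?thesis using M(2)[of x "t n"] t(1)[of n] by (simp add: f_def divide_simps mult.commute)
      next
        case False
        then show ?thesis using outside[of x "t n"] outside[of x 0] t[of n] by (simp add: f_def)
      qed
    qed
  qed
  moreover have "(LINT x|lborel. f n x) = 0" for n
  proof -
    have i: "integrable lborel \<phi>" by (rule test_functions_in_integrable[OF \<phi>])
    have i2: "integrable lborel (\<lambda>x. \<phi> (x + t n *\<^sub>R v))"
    proof -
      have "integrable (distr lborel borel ((+) (t n *\<^sub>R v))) \<phi>" using i by (simp add: lborel_distr_plus)
      then show ?thesis using m\<phi> by (subst (asm) integrable_distr_eq) (auto simp: add.commute)
    qed
    have "(LINT x|lborel. \<phi> (x + t n *\<^sub>R v)) = (LINT x|lborel. \<phi> x)"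
      using lborel_integral_scale[of 1 \<phi> "t n *\<^sub>R v"] m\<phi> by (simp add: add.commute)
    then show ?thesis unfolding f_def using i i2 by simp
  qed
  ultimately show ?thesis by (simp add: LIMSEQ_const_iff)
qed

section \<open>Fourier transforms of test functions and their decay\<close>

definition fourier :: "('a::euclidean_space \<Rightarrow> complex) \<Rightarrow> 'a \<Rightarrow> complex" where
  "fourier \<psi> \<xi> = (LINT y|lborel. cis (- (y \<bullet> \<xi>)) * \<psi> y)"

lemma smooth_on_character: "smooth_on UNIV (\<lambda>y. cis (- (y \<bullet> \<xi>)))"
  by (intro smooth_on_compose_UNIV[OF open_UNIV smooth_on_cis] smooth_on_minus smooth_on_inner
      smooth_on_ident smooth_on_const open_UNIV)

lemma fourier_dir_deriv:
  assumes \<psi>: "\<psi> \<in> test_functions_in K" "compact K"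
  shows "fourier (dir_deriv v \<psi>) \<xi> = \<i> * (v \<bullet> \<xi>) * fourier \<psi> \<xi>"
proof -
  let ?e = "\<lambda>y. cis (- (y \<bullet> \<xi>))"
  have "dir_deriv v (\<lambda>y. ?e y * \<psi> y) y = ?e y * dir_deriv v \<psi> y - \<i> * (v \<bullet> \<xi>) * (?e y * \<psi> y)" for y
  proof -
    have "((\<lambda>y. - (y \<bullet> \<xi>)) has_derivative (\<lambda>v. - (v \<bullet> \<xi>))) (at y)"
      by (auto intro!: derivative_eq_intros)
    from diff_chain_at[OF this has_vector_derivative_cis[unfolded has_vector_derivative_def]]
    have "(?e has_derivative (\<lambda>v. (- (v \<bullet> \<xi>)) *\<^sub>R (\<i> * ?e y))) (at y)" by (simp add: o_def)
    then have "dir_deriv v ?e y = (- (v \<bullet> \<xi>)) *\<^sub>R (\<i> * ?e y)" "?e differentiable (at y)"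
      using dir_deriv_eqI differentiable_def by blast+
    moreover have "\<psi> differentiable (at y)"
      using \<psi>(1) smooth_on_differentiable by (auto simp: test_functions_in_def)
    ultimately show ?thesis by (simp add: dir_deriv_mult scaleR_conv_of_real mult_ac)
  qed
  moreover have "(LINT y|lborel. dir_deriv v (\<lambda>y. ?e y * \<psi> y) y) = 0"
    by (rule test_function_integral_deriv[OF test_functions_in_mult[OF \<psi>(1) smooth_on_character] \<psi>(2)])
  moreover have "integrable lborel (\<lambda>y. ?e y * dir_deriv v \<psi> y)"
    by (rule test_functions_in_integrable[OF test_functions_in_mult[OF test_functions_in_dir_deriv[OF \<psi>] smooth_on_character] \<psi>(2)])
  moreover have "integrable lborel (\<lambda>y. ?e y * \<psi> y)"
    by (rule test_functions_in_integrable[OF test_functions_in_mult[OF \<psi>(1) smooth_on_character] \<psi>(2)])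
  ultimately have "(LINT y|lborel. ?e y * dir_deriv v \<psi> y) - \<i> * (v \<bullet> \<xi>) * (LINT y|lborel. ?e y * \<psi> y) = 0"
    by simp
  then show ?thesis by (simp add: fourier_def)
qed

lemma norm_fourier_le:
  assumes "\<psi> \<in> test_functions_in K" "compact K"
  shows "norm (fourier \<psi> \<xi>) \<le> (LINT y|lborel. norm (\<psi> y))"
  unfolding fourier_def using integral_norm_bound[of lborel "\<lambda>y. cis (- (y \<bullet> \<xi>)) * \<psi> y"] by (simp add: norm_mult)

text \<open>Applying \<open>1 - d_b^2\<close> to the function multiplies its transform by
  \<open>1 + (\<xi> \<bullet> b)^2\<close>; doing so once per coordinate gives the bound. The
  product weight, rather than a power of the norm, makes integrability a matter of one
  variable.\<close>

lemma fourier_decay: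
  fixes \<psi> :: "'a::euclidean_space \<Rightarrow> complex"
  assumes \<psi>: "\<psi> \<in> test_functions_in K" "compact K"
  shows "\<exists>C\<ge>0. \<forall>\<xi>. norm (fourier \<psi> \<xi>) \<le> C * (\<Prod>b\<in>Basis. inverse (1 + (\<xi> \<bullet> b)\<^sup>2))"
proof -
  have pos: "1 + x\<^sup>2 > 0" for x :: real by (simp add: add_pos_nonneg)
  have "\<exists>C\<ge>0. \<forall>\<xi>. norm (fourier \<psi> \<xi>) * (\<Prod>b\<in>A. 1 + (\<xi> \<bullet> b)\<^sup>2) \<le> C"
    if "finite A" "A \<subseteq> Basis" for A :: "'a set"
    using that \<psi>(1)
  proof (induction A arbitrary: \<psi> rule: finite_induct)
    case empty
    have "norm (fourier \<psi> \<xi>) \<le> (LINT y|lborel. norm (\<psi> y))" for \<xi>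
      by (rule norm_fourier_le[OF empty(2) \<psi>(2)])
    then show ?case by (intro exI[of _ "LINT y|lborel. norm (\<psi> y)"]) auto
  next
    case (insert b A)
    define \<psi>' where "\<psi>' y = \<psi> y + (-1) * dir_deriv b (dir_deriv b \<psi>) y" for y
    have t2: "dir_deriv b (dir_deriv b \<psi>) \<in> test_functions_in K"
      by (intro test_functions_in_dir_deriv insert \<psi>)
    have \<psi>': "\<psi>' \<in> test_functions_in K"
      using insert.prems(2) t2 unfolding \<psi>'_def by (auto simp: test_functions_in_def intro!: smooth_on_diff)
    have "fourier \<psi>' \<xi> = (1 + (\<xi> \<bullet> b)\<^sup>2) * fourier \<psi> \<xi>" for \<xi>
    proof -
      have "integrable lborel (\<lambda>y. cis (- (y \<bullet> \<xi>)) * \<psi> y)"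
        by (rule test_functions_in_integrable[OF test_functions_in_mult[OF insert.prems(2) smooth_on_character] \<psi>(2)])
      moreover have "integrable lborel (\<lambda>y. cis (- (y \<bullet> \<xi>)) * dir_deriv b (dir_deriv b \<psi>) y)"
        by (rule test_functions_in_integrable[OF test_functions_in_mult[OF t2 smooth_on_character] \<psi>(2)])
      ultimately have "fourier \<psi>' \<xi> = fourier \<psi> \<xi> - fourier (dir_deriv b (dir_deriv b \<psi>)) \<xi>"
        by (simp add: fourier_def \<psi>'_def ring_distribs)
      also have "fourier (dir_deriv b (dir_deriv b \<psi>)) \<xi> = (\<i> * (b \<bullet> \<xi>)) * (\<i> * (b \<bullet> \<xi>)) * fourier \<psi> \<xi>"
        by (subst fourier_dir_deriv[OF test_functions_in_dir_deriv[OF insert.prems(2) \<psi>(2)] \<psi>(2)],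
            subst fourier_dir_deriv[OF insert.prems(2) \<psi>(2)]) simp
      finally show ?thesis by (simp add: power2_eq_square algebra_simps inner_commute)
    qed
    then have eq: "norm (fourier \<psi>' \<xi>) = (1 + (\<xi> \<bullet> b)\<^sup>2) * norm (fourier \<psi> \<xi>)" for \<xi>
      using pos[of "\<xi> \<bullet> b"] by (simp only: norm_mult norm_of_real abs_of_pos)
    obtain C where "C \<ge> 0" "\<And>\<xi>. norm (fourier \<psi>' \<xi>) * (\<Prod>b\<in>A. 1 + (\<xi> \<bullet> b)\<^sup>2) \<le> C"
      using insert.IH[OF _ \<psi>'] insert.prems by blast
    then show ?case using insert.hyps by (intro exI[of _ C]) (auto simp: eq mult_ac)
  qed
  then obtain C where C: "C \<ge> 0" "\<And>\<xi>. norm (fourier \<psi> \<xi>) * (\<Prod>b\<in>Basis. 1 + (\<xi> \<bullet> b)\<^sup>2) \<le> C"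
    by (metis finite_Basis subset_refl)
  have "norm (fourier \<psi> \<xi>) \<le> C * (\<Prod>b\<in>Basis. inverse (1 + (\<xi> \<bullet> b)\<^sup>2))" for \<xi>
  proof -
    have "(\<Prod>b\<in>Basis. 1 + (\<xi> \<bullet> b)\<^sup>2) > 0" by (intro prod_pos) (auto simp: pos)
    moreover have "(\<Prod>b\<in>Basis. inverse (1 + (\<xi> \<bullet> b)\<^sup>2)) = inverse (\<Prod>b\<in>Basis. 1 + (\<xi> \<bullet> b)\<^sup>2)"
      using prod_inversef[of "\<lambda>b. 1 + (\<xi> \<bullet> b)\<^sup>2" Basis] by (simp add: o_def)
    ultimately show ?thesis using C(2)[of \<xi>] by (simp add: pos_le_divide_eq divide_inverse[symmetric])
  qed
  then show ?thesis using C(1) by blast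
qed

lemma
  fixes f :: "'a::euclidean_space \<Rightarrow> real \<Rightarrow> complex"
  assumes "\<And>b. b \<in> Basis \<Longrightarrow> integrable lborel (f b)"
  shows integrable_lborel_prod: "integrable lborel (\<lambda>x. \<Prod>b\<in>Basis. f b (x \<bullet> b))"
    and integral_lborel_prod: "(LINT x|lborel. (\<Prod>b\<in>Basis. f b (x \<bullet> b))) = (\<Prod>b\<in>Basis. (LINT t|lborel. f b t))"
proof -
  interpret product_sigma_finite "\<lambda>_::'a. lborel :: real measure" ..
  \<comment> \<open>The extension by 0 is measurable for every index, not only for basis vectors, so
    measurability of the products can be proved without tracking index membership.\<close>
  define g where "g b t = (if b \<in> Basis then f b t else 0)" for b t
  have g[measurable]: "g b \<in> borel_measurable borel" for b
    using borel_measurable_integrable[OF assms] by (cases "b \<in> Basis") (auto simp: g_def[abs_def])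
  have m: "(\<lambda>x. \<Prod>b\<in>Basis. g b (x \<bullet> b)) \<in> borel_measurable borel" by measurable
  have m': "(\<lambda>f. \<Sum>b\<in>Basis. f b *\<^sub>R b) \<in> measurable (\<Pi>\<^sub>M b\<in>Basis. lborel) (borel :: 'a measure)" by measurable
  have eq: "(\<Prod>b\<in>Basis. g b ((\<Sum>b\<in>Basis. h b *\<^sub>R b) \<bullet> b)) = (\<Prod>b\<in>Basis. f b (h b))" for h
    by (rule prod.cong) (auto simp: g_def inner_sum_left inner_Basis if_distrib[where f = "\<lambda>x. _ * x"] cong: if_cong)
  have gf: "(\<Prod>b\<in>Basis. g b (h b)) = (\<Prod>b\<in>Basis. f b (h b))" for h :: "'a \<Rightarrow> real"
    by (rule prod.cong) (auto simp: g_def)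
  have fg: "(\<lambda>x. \<Prod>b\<in>Basis. g b (x \<bullet> b)) = (\<lambda>x. \<Prod>b\<in>Basis. f b (x \<bullet> b))"
    by (auto simp: g_def)
  have "integrable (\<Pi>\<^sub>M b\<in>Basis. lborel) (\<lambda>h. \<Prod>b\<in>Basis. f b (h b))"
    by (rule product_integrable_prod) (use assms in auto)
  then show "integrable lborel (\<lambda>x. \<Prod>b\<in>Basis. f b (x \<bullet> b))"
    unfolding fg[symmetric] using m m' by (subst lborel_eq, subst integrable_distr_eq) (auto simp: eq gf)
  have "(LINT x|lborel. (\<Prod>b\<in>Basis. g b (x \<bullet> b))) = (LINT h|(\<Pi>\<^sub>M b\<in>Basis. lborel). (\<Prod>b\<in>Basis. f b (h b)))"
    using m m' by (subst lborel_eq, subst integral_distr) (auto simp: eq gf)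
  also have "\<dots> = (\<Prod>b\<in>Basis. (LINT t|lborel. f b t))"
    by (rule product_integral_prod) (use assms in auto)
  finally show "(LINT x|lborel. (\<Prod>b\<in>Basis. f b (x \<bullet> b))) = (\<Prod>b\<in>Basis. (LINT t|lborel. f b t))"
    by (simp add: fg)
qed

lemma fourier_integrable:
  fixes \<psi> :: "'a::euclidean_space \<Rightarrow> complex"
  assumes \<psi>: "\<psi> \<in> test_functions_in K" "compact K"
  shows "integrable lborel (fourier \<psi>)"
proof -
  obtain C where C: "C \<ge> 0" "\<And>\<xi>. norm (fourier \<psi> \<xi>) \<le> C * (\<Prod>b\<in>Basis. inverse (1 + (\<xi> \<bullet> b)\<^sup>2))"
    using fourier_decay[OF \<psi>] by blast
  have "integrable lborel (\<lambda>x::real. inverse (1 + x\<^sup>2))"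
    using integrable_inverse_1_plus_square by (simp add: set_integrable_def)
  then have "integrable lborel (\<lambda>\<xi>::'a. \<Prod>b\<in>Basis. complex_of_real (inverse (1 + (\<xi> \<bullet> b)\<^sup>2)))"
    by (intro integrable_lborel_prod[where f = "\<lambda>_ x. complex_of_real (inverse (1 + x\<^sup>2))"] integrable_of_real)
  then have "integrable lborel (\<lambda>\<xi>::'a. complex_of_real C * (\<Prod>b\<in>Basis. complex_of_real (inverse (1 + (\<xi> \<bullet> b)\<^sup>2))))"
    by simp
  then show ?thesis
  proof (rule Bochner_Integration.integrable_bound)
    have [measurable]: "\<psi> \<in> borel_measurable borel"
      by (rule borel_measurable_continuous_onI[OF test_functions_in_continuous[OF \<psi>(1)]])
    have [measurable]: "cis \<in> borel_measurable borel"
      by (rule borel_measurable_continuous_onI[OF smooth_on_continuous_on[OF smooth_on_cis]])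
    show "fourier \<psi> \<in> borel_measurable lborel"
      unfolding fourier_def[abs_def] by measurable
    show "AE \<xi> in lborel. norm (fourier \<psi> \<xi>) \<le> norm (complex_of_real C * (\<Prod>b\<in>Basis. complex_of_real (inverse (1 + (\<xi> \<bullet> b)\<^sup>2))))"
    proof (rule AE_I2)
      fix \<xi> :: 'a
      have "norm (complex_of_real C * (\<Prod>b\<in>Basis. complex_of_real (inverse (1 + (\<xi> \<bullet> b)\<^sup>2))))
        = C * (\<Prod>b\<in>Basis. inverse (1 + (\<xi> \<bullet> b)\<^sup>2))"
      proof -
        have "(\<Prod>b\<in>Basis. inverse (1 + (\<xi> \<bullet> b)\<^sup>2)) \<ge> 0"
          by (intro prod_nonneg) (auto simp: add_nonneg_nonneg)
        then show ?thesis using C(1) by (simp only: norm_mult of_real_prod[symmetric] norm_of_real abs_of_nonneg)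
      qed
      then show "norm (fourier \<psi> \<xi>) \<le> norm (complex_of_real C * (\<Prod>b\<in>Basis. complex_of_real (inverse (1 + (\<xi> \<bullet> b)\<^sup>2))))"
        using C(2)[of \<xi>] by simp
    qed
  qed
qed

text \<open>The product of \<open>|f|\<close> and \<open>|g|\<close> is an integrable majorant. With
  a complex exponential as \<open>k\<close> this justifies the exchanges of integrals in the
  inversion formula.\<close>

lemma integrable_bounded_kernel:
  fixes f :: "'a::euclidean_space \<Rightarrow> complex" and g :: "'b::euclidean_space \<Rightarrow> complex"
  assumes f: "integrable lborel f" and g: "integrable lborel g"
    and k: "k \<in> borel_measurable borel" "\<And>p. norm (k p) \<le> 1"
  shows "integrable (lborel \<Otimes>\<^sub>M lborel) (\<lambda>(x, y). k (x, y) * f x * g y)"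
proof (rule lborel_pair.Fubini_integrable)
  have [measurable]: "f \<in> borel_measurable borel" "g \<in> borel_measurable borel"
    using f g by auto
  have [measurable]: "k \<in> borel_measurable (borel \<Otimes>\<^sub>M borel)" using k(1) by (simp add: borel_prod)
  show m: "(\<lambda>(x, y). k (x, y) * f x * g y) \<in> borel_measurable (lborel \<Otimes>\<^sub>M lborel)"
    by measurable
  have i: "integrable lborel (\<lambda>y. k (x, y) * f x * g y)" for x
  proof (rule Bochner_Integration.integrable_bound[where f = "\<lambda>y. f x * g y"])
    show "AE y in lborel. norm (k (x, y) * f x * g y) \<le> norm (f x * g y)"
      using mult_right_mono[OF k(2), of "norm (f x * g _)"] by (intro AE_I2) (simp add: norm_mult mult.assoc)
  qed (use g in auto)
  then show "AE x in lborel. integrable lborel (\<lambda>y. case (x, y) of (x, y) \<Rightarrow> k (x, y) * f x * g y)"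
    by simp
  show "integrable lborel (\<lambda>x. LINT y|lborel. norm (case (x, y) of (x, y) \<Rightarrow> k (x, y) * f x * g y))"
  proof (rule Bochner_Integration.integrable_bound[where f = "\<lambda>x. norm (f x) * (LINT y|lborel. norm (g y))"])
    show "integrable lborel (\<lambda>x. norm (f x) * (LINT y|lborel. norm (g y)))" using f by auto
    show "(\<lambda>x. LINT y|lborel. norm (case (x, y) of (x, y) \<Rightarrow> k (x, y) * f x * g y)) \<in> borel_measurable lborel"
      by measurable
    show "AE x in lborel. norm (LINT y|lborel. norm (case (x, y) of (x, y) \<Rightarrow> k (x, y) * f x * g y))
        \<le> norm (norm (f x) * (LINT y|lborel. norm (g y)))"
    proof (rule AE_I2)
      fix x
      have "(LINT y|lborel. norm (k (x, y) * f x * g y)) \<le> (LINT y|lborel. norm (f x) * norm (g y))"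
      proof (rule integral_mono[OF integrable_norm[OF i]])
        show "norm (k (x, y) * f x * g y) \<le> norm (f x) * norm (g y)" for y
          using mult_right_mono[OF k(2), of "norm (f x * g y)"] by (simp add: norm_mult mult.assoc)
      qed (use g in auto)
      then show "norm (LINT y|lborel. norm (case (x, y) of (x, y) \<Rightarrow> k (x, y) * f x * g y))
          \<le> norm (norm (f x) * (LINT y|lborel. norm (g y)))"
        by simp
    qed
  qed
qed

section \<open>Gaussian regularization and the inversion formula\<close>

definition gauss :: "'a::euclidean_space \<Rightarrow> real" where
  "gauss x = (\<Prod>b\<in>Basis. std_normal_density (x \<bullet> b))"

lemma gauss_continuous: "continuous_on A gauss"
  unfolding gauss_def[abs_def] std_normal_density_def by (intro continuous_intros) auto

lemma gauss_nonneg: "gauss x \<ge> 0"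
  by (simp add: gauss_def prod_nonneg)

lemma gauss_minus: "gauss (- x) = gauss x"
  by (simp add: gauss_def std_normal_density_def)

lemma gauss_0: "gauss (0 :: 'a::euclidean_space) = inverse (sqrt (2 * pi)) ^ DIM('a)"
  by (simp add: gauss_def std_normal_density_def inverse_eq_divide)

lemma gauss_le: "gauss x \<le> gauss (0 :: 'a)" for x :: "'a::euclidean_space"
  unfolding gauss_def by (rule prod_mono) (auto simp: std_normal_density_def divide_right_mono)

lemma integrable_std_normal: "integrable lborel (\<lambda>t. complex_of_real (std_normal_density t) * cis (a * t))"
proof (rule Bochner_Integration.integrable_bound[where f = "\<lambda>t. std_normal_density t"])
  have [measurable]: "cis \<in> borel_measurable borel"
    by (rule borel_measurable_continuous_onI[OF smooth_on_continuous_on[OF smooth_on_cis]])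
  show "(\<lambda>t. complex_of_real (std_normal_density t) * cis (a * t)) \<in> borel_measurable lborel"
    by measurable
qed (auto simp: norm_mult)

lemma fourier_std_normal:
  "(LINT t|lborel. complex_of_real (std_normal_density t) * cis (a * t)) = sqrt (2 * pi) * std_normal_density a"
proof -
  have "complex_of_real (exp (- (a\<^sup>2) / 2)) = (LINT t|std_normal_distribution. iexp (a * t))"
    using fun_cong[OF char_std_normal_distribution, of a] by (simp add: char_def)
  also have "\<dots> = (LINT t|lborel. std_normal_density t *\<^sub>R iexp (a * t))"
    by (subst integral_density) auto
  finally show ?thesis
    by (simp add: cis_conv_exp std_normal_density_def scaleR_conv_of_real mult.commute)
qed

lemma cis_inner: "cis (v \<bullet> x) = (\<Prod>b\<in>Basis. cis ((v \<bullet> b) * (x \<bullet> b)))"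
  unfolding cis_conv_exp exp_sum[OF finite_Basis, symmetric] by (subst euclidean_inner) (simp add: sum_distrib_left)

text \<open>Both the density and the character factor over the coordinates, so the transform reduces
  to the characteristic function of the standard normal distribution.\<close>

lemma
  fixes v :: "'a::euclidean_space"
  shows integrable_gauss_cis: "integrable lborel (\<lambda>x. complex_of_real (gauss x) * cis (v \<bullet> x))"
    and fourier_gauss: "(LINT x|lborel. complex_of_real (gauss x) * cis (v \<bullet> x)) = complex_of_real (sqrt (2 * pi) ^ DIM('a) * gauss v)"
proof -
  have eq: "complex_of_real (gauss x) * cis (v \<bullet> x) = (\<Prod>b\<in>Basis. complex_of_real (std_normal_density (x \<bullet> b)) * cis ((v \<bullet> b) * (x \<bullet> b)))" for x
    unfolding cis_inner[of v x] gauss_def by (simp add: prod.distrib)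
  show "integrable lborel (\<lambda>x. complex_of_real (gauss x) * cis (v \<bullet> x))"
    unfolding eq by (rule integrable_lborel_prod) (rule integrable_std_normal)
  show "(LINT x|lborel. complex_of_real (gauss x) * cis (v \<bullet> x)) = complex_of_real (sqrt (2 * pi) ^ DIM('a) * gauss v)"
    unfolding eq by (subst integral_lborel_prod) (auto simp: integrable_std_normal fourier_std_normal gauss_def prod.distrib)
qed

lemma integrable_gauss: "integrable lborel (\<lambda>x. complex_of_real (gauss (x :: 'a::euclidean_space)))"
  and integral_gauss: "(LINT x|lborel. complex_of_real (gauss (x :: 'a::euclidean_space))) = 1"
  using integrable_gauss_cis[of "0 :: 'a"] fourier_gauss[of "0 :: 'a"]
  by (simp_all add: gauss_0 power_mult_distrib[symmetric])

lemma borel_measurable_cis [measurable]: "cis \<in> borel_measurable borel"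
  by (rule borel_measurable_continuous_onI[OF smooth_on_continuous_on[OF smooth_on_cis]])

lemma borel_measurable_gauss [measurable]: "gauss \<in> borel_measurable borel"
  by (rule borel_measurable_continuous_onI[OF gauss_continuous])

text \<open>The Gaussian factor makes the double integral over \<open>\<xi>\<close> and
  \<open>y\<close> absolutely convergent. Integrating over \<open>\<xi>\<close> first produces a
  Gaussian of width \<open>e\<close> around \<open>z\<close>, and the substitution
  \<open>y = z + e * u\<close> fixes its shape.\<close>

lemma fourier_gauss_average:
  fixes \<psi> :: "'a::euclidean_space \<Rightarrow> complex"
  assumes \<psi>: "\<psi> \<in> test_functions_in K" "compact K" and e: "e > 0"
  shows "(LINT \<xi>|lborel. gauss (e *\<^sub>R \<xi>) * (cis (z \<bullet> \<xi>) * fourier \<psi> \<xi>))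
    = sqrt (2 * pi) ^ DIM('a) * (LINT u|lborel. \<psi> (z + e *\<^sub>R u) * gauss u)"
proof -
  have [measurable]: "\<psi> \<in> borel_measurable borel"
    by (rule borel_measurable_continuous_onI[OF test_functions_in_continuous[OF \<psi>(1)]])
  have ge: "integrable lborel (\<lambda>\<xi>::'a. complex_of_real (gauss (e *\<^sub>R \<xi>)))"
  proof -
    have "integrable (density (distr lborel borel (\<lambda>x. 0 + e *\<^sub>R x)) (\<lambda>_. ennreal (\<bar>e\<bar> ^ DIM('a)))) (\<lambda>\<xi>::'a. complex_of_real (gauss \<xi>))"
      using integrable_gauss lborel_affine[of e "0::'a"] e by (simp add: ennreal_power)
    then have "integrable lborel (\<lambda>\<xi>::'a. e ^ DIM('a) *\<^sub>R complex_of_real (gauss (e *\<^sub>R \<xi>)))"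
      using e by (simp add: integrable_density integrable_distr_eq)
    from integrable_scaleR_right[OF this, of "inverse (e ^ DIM('a))"] show ?thesis using e by simp
  qed
  have i: "integrable (lborel \<Otimes>\<^sub>M lborel) (\<lambda>(\<xi>, y). cis ((z - y) \<bullet> \<xi>) * gauss (e *\<^sub>R \<xi>) * \<psi> y)"
    using integrable_bounded_kernel[OF ge test_functions_in_integrable[OF \<psi>], of "\<lambda>p. cis ((z - snd p) \<bullet> fst p)"]
    by (simp add: borel_prod[symmetric])
  have "(LINT \<xi>|lborel. gauss (e *\<^sub>R \<xi>) * (cis (z \<bullet> \<xi>) * fourier \<psi> \<xi>))
      = (LINT \<xi>|lborel. (LINT y|lborel. cis ((z - y) \<bullet> \<xi>) * gauss (e *\<^sub>R \<xi>) * \<psi> y))"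
  proof (rule Bochner_Integration.integral_cong[OF refl])
    fix \<xi>
    have "cis ((z - y) \<bullet> \<xi>) * gauss (e *\<^sub>R \<xi>) * \<psi> y = (complex_of_real (gauss (e *\<^sub>R \<xi>)) * cis (z \<bullet> \<xi>)) * (cis (- (y \<bullet> \<xi>)) * \<psi> y)" for y
      by (simp add: inner_diff_left cis_mult)
    then show "gauss (e *\<^sub>R \<xi>) * (cis (z \<bullet> \<xi>) * fourier \<psi> \<xi>) = (LINT y|lborel. cis ((z - y) \<bullet> \<xi>) * gauss (e *\<^sub>R \<xi>) * \<psi> y)"
      by (simp only: fourier_def integral_mult_right_zero mult.assoc)
  qed
  also have "\<dots> = (LINT y|lborel. (LINT \<xi>|lborel. cis ((z - y) \<bullet> \<xi>) * gauss (e *\<^sub>R \<xi>) * \<psi> y))"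
    by (rule lborel_pair.Fubini_integral[OF i, symmetric])
  also have "\<dots> = (LINT y|lborel. complex_of_real (sqrt (2 * pi) ^ DIM('a) * inverse e ^ DIM('a) * gauss ((z - y) /\<^sub>R e)) * \<psi> y)"
  proof (rule Bochner_Integration.integral_cong[OF refl])
    fix y
    have "(LINT \<xi>|lborel. cis ((z - y) \<bullet> \<xi>) * gauss (e *\<^sub>R \<xi>))
        = \<bar>inverse e\<bar> ^ DIM('a) *\<^sub>R (LINT \<xi>|lborel. cis ((z - y) \<bullet> (0 + inverse e *\<^sub>R \<xi>)) * gauss (e *\<^sub>R (0 + inverse e *\<^sub>R \<xi>)))"
      by (rule lborel_integral_scale) (use e in auto)
    also have "\<dots> = inverse e ^ DIM('a) *\<^sub>R (LINT \<xi>|lborel. gauss \<xi> * cis (((z - y) /\<^sub>R e) \<bullet> \<xi>))"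
      using e by (simp add: mult.commute)
    also have "\<dots> = complex_of_real (sqrt (2 * pi) ^ DIM('a) * inverse e ^ DIM('a) * gauss ((z - y) /\<^sub>R e))"
      unfolding fourier_gauss by (simp add: scaleR_conv_of_real mult_ac)
    finally show "(LINT \<xi>|lborel. cis ((z - y) \<bullet> \<xi>) * gauss (e *\<^sub>R \<xi>) * \<psi> y)
        = complex_of_real (sqrt (2 * pi) ^ DIM('a) * inverse e ^ DIM('a) * gauss ((z - y) /\<^sub>R e)) * \<psi> y"
      by (simp only: integral_mult_left_zero)
  qed
  also have "\<dots> = \<bar>e\<bar> ^ DIM('a) *\<^sub>R (LINT u|lborel. complex_of_real (sqrt (2 * pi) ^ DIM('a) * inverse e ^ DIM('a) * gauss ((z - (z + e *\<^sub>R u)) /\<^sub>R e)) * \<psi> (z + e *\<^sub>R u))"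
    by (rule lborel_integral_scale) (use e in auto)
  also have "\<dots> = sqrt (2 * pi) ^ DIM('a) * (LINT u|lborel. \<psi> (z + e *\<^sub>R u) * gauss u)"
  proof -
    let ?s = "sqrt (2 * pi) ^ DIM('a)" and ?i = "inverse e ^ DIM('a)"
    have "(z - (z + e *\<^sub>R u)) /\<^sub>R e = - u" for u using e by simp
    then have "(LINT u|lborel. complex_of_real (?s * ?i * gauss ((z - (z + e *\<^sub>R u)) /\<^sub>R e)) * \<psi> (z + e *\<^sub>R u))
        = (LINT u|lborel. complex_of_real (?s * ?i) * (\<psi> (z + e *\<^sub>R u) * gauss u))"
      by (simp only: gauss_minus of_real_mult mult_ac)
    also have "\<dots> = complex_of_real (?s * ?i) * (LINT u|lborel. \<psi> (z + e *\<^sub>R u) * gauss u)"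
      by (rule integral_mult_right_zero)
    finally have "\<bar>e\<bar> ^ DIM('a) *\<^sub>R (LINT u|lborel. complex_of_real (?s * ?i * gauss ((z - (z + e *\<^sub>R u)) /\<^sub>R e)) * \<psi> (z + e *\<^sub>R u))
        = complex_of_real (\<bar>e\<bar> ^ DIM('a) * (?s * ?i)) * (LINT u|lborel. \<psi> (z + e *\<^sub>R u) * gauss u)"
      by (simp only: scaleR_conv_of_real of_real_mult mult.assoc)
    moreover have "\<bar>e\<bar> ^ DIM('a) * (?s * ?i) = ?s"
    proof -
      have "e ^ DIM('a) * ?i = 1" using e by (simp add: power_mult_distrib[symmetric])
      then show ?thesis using e by simp
    qed
    ultimately show ?thesis by (simp only: of_real_power)
  qed
  finally show ?thesis .
qed

text \<open>As \<open>e\<close> tends to 0 in the Gaussian identity, the left side tends to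
  \<open>gauss 0\<close> times the integral and the right side to
  \<open>sqrt (2 * pi) ^ n * \<psi> z\<close>, with \<open>n\<close> the dimension. Since
  \<open>gauss 0\<close> is the inverse of that power, the constant squares to
  \<open>(2 * pi) ^ n\<close>.\<close>

theorem fourier_inversion:
  fixes \<psi> :: "'a::euclidean_space \<Rightarrow> complex"
  assumes \<psi>: "\<psi> \<in> test_functions_in K" "compact K"
  shows "(LINT \<xi>|lborel. cis (z \<bullet> \<xi>) * fourier \<psi> \<xi>) = (2 * pi) ^ DIM('a) * \<psi> z"
proof -
  have c\<psi>: "continuous_on UNIV \<psi>" by (rule test_functions_in_continuous[OF \<psi>(1)])
  have [measurable]: "\<psi> \<in> borel_measurable borel" by (rule borel_measurable_continuous_onI[OF c\<psi>])
  note fi = fourier_integrable[OF \<psi>]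
  have [measurable]: "fourier \<psi> \<in> borel_measurable borel" using fi by auto
  define t where "t n = 1 / real (Suc n)" for n
  have t: "t n > 0" for n by (simp add: t_def)
  have t0: "t \<longlonglongrightarrow> 0" unfolding t_def using LIMSEQ_inverse_real_of_nat by (simp add: inverse_eq_divide)
  let ?s = "sqrt (2 * pi) ^ DIM('a)"
  have "(\<lambda>n. LINT \<xi>|lborel. gauss (t n *\<^sub>R \<xi>) * (cis (z \<bullet> \<xi>) * fourier \<psi> \<xi>))
      \<longlonglongrightarrow> (LINT \<xi>|lborel. gauss (0::'a) * (cis (z \<bullet> \<xi>) * fourier \<psi> \<xi>))"
  proof (rule integral_dominated_convergence[where w = "\<lambda>\<xi>. gauss (0::'a) * norm (fourier \<psi> \<xi>)"])
    show "AE \<xi> in lborel. (\<lambda>n. gauss (t n *\<^sub>R \<xi>) * (cis (z \<bullet> \<xi>) * fourier \<psi> \<xi>)) \<longlonglongrightarrow> gauss (0::'a) * (cis (z \<bullet> \<xi>) * fourier \<psi> \<xi>)"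
    proof (rule AE_I2)
      fix \<xi> :: 'a
      have "(\<lambda>n. t n *\<^sub>R \<xi>) \<longlonglongrightarrow> 0 *\<^sub>R \<xi>" by (intro tendsto_intros t0)
      then have "(\<lambda>n. gauss (t n *\<^sub>R \<xi>)) \<longlonglongrightarrow> gauss (0::'a)"
        using continuous_on_tendsto_compose[OF gauss_continuous[of UNIV], of "\<lambda>n. t n *\<^sub>R \<xi>" 0] by simp
      then show "(\<lambda>n. gauss (t n *\<^sub>R \<xi>) * (cis (z \<bullet> \<xi>) * fourier \<psi> \<xi>)) \<longlonglongrightarrow> gauss (0::'a) * (cis (z \<bullet> \<xi>) * fourier \<psi> \<xi>)"
        by (intro tendsto_intros)
    qed
    show "AE \<xi> in lborel. norm (gauss (t n *\<^sub>R \<xi>) * (cis (z \<bullet> \<xi>) * fourier \<psi> \<xi>)) \<le> gauss (0::'a) * norm (fourier \<psi> \<xi>)" for n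
      by (auto simp: norm_mult gauss_nonneg intro!: mult_right_mono gauss_le)
  qed (use fi in auto)
  moreover have "(\<lambda>n. LINT \<xi>|lborel. gauss (t n *\<^sub>R \<xi>) * (cis (z \<bullet> \<xi>) * fourier \<psi> \<xi>)) \<longlonglongrightarrow> ?s * (LINT u|lborel. \<psi> z * gauss (u::'a))"
    unfolding fourier_gauss_average[OF \<psi> t]
  proof (intro tendsto_mult tendsto_const)
    obtain M where M: "M \<ge> 0" "\<And>x. norm (\<psi> x) \<le> M" using test_functions_in_bounded[OF \<psi>] by blast
    show "(\<lambda>n. LINT u|lborel. \<psi> (z + t n *\<^sub>R u) * gauss u) \<longlonglongrightarrow> (LINT u|lborel. \<psi> z * gauss (u::'a))"
    proof (rule integral_dominated_convergence[where w = "\<lambda>u. M * gauss u"])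
      show "AE u in lborel. (\<lambda>n. \<psi> (z + t n *\<^sub>R u) * gauss u) \<longlonglongrightarrow> \<psi> z * gauss u"
      proof (rule AE_I2)
        fix u :: 'a
        have "(\<lambda>n. z + t n *\<^sub>R u) \<longlonglongrightarrow> z + 0 *\<^sub>R u" by (intro tendsto_intros t0)
        then have "(\<lambda>n. \<psi> (z + t n *\<^sub>R u)) \<longlonglongrightarrow> \<psi> z"
          using continuous_on_tendsto_compose[OF c\<psi>, of "\<lambda>n. z + t n *\<^sub>R u" z] by simp
        then show "(\<lambda>n. \<psi> (z + t n *\<^sub>R u) * gauss u) \<longlonglongrightarrow> \<psi> z * gauss u" by (intro tendsto_intros)
      qed
      show "integrable lborel (\<lambda>u::'a. M * gauss u)"
        using integrable_norm[OF integrable_gauss] by (auto simp: gauss_nonneg)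
      show "AE u in lborel. norm (\<psi> (z + t n *\<^sub>R u) * gauss u) \<le> M * gauss u" for n
        by (auto simp: norm_mult gauss_nonneg intro!: mult_right_mono M)
    qed auto
  qed
  ultimately have "(LINT \<xi>|lborel. gauss (0::'a) * (cis (z \<bullet> \<xi>) * fourier \<psi> \<xi>)) = ?s * (LINT u|lborel. \<psi> z * gauss (u::'a))"
    by (rule LIMSEQ_unique)
  then have eq: "gauss (0::'a) * (LINT \<xi>|lborel. cis (z \<bullet> \<xi>) * fourier \<psi> \<xi>) = ?s * \<psi> z"
    using integrable_gauss integral_gauss[where 'a = 'a] by simp
  have "?s * gauss (0::'a) = 1" by (simp add: gauss_0 power_mult_distrib[symmetric])
  then have "(LINT \<xi>|lborel. cis (z \<bullet> \<xi>) * fourier \<psi> \<xi>) = of_real (?s * gauss (0::'a)) * (LINT \<xi>|lborel. cis (z \<bullet> \<xi>) * fourier \<psi> \<xi>)"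
    by simp
  also have "\<dots> = of_real ?s * (of_real ?s * \<psi> z)" using eq by (simp add: mult_ac)
  also have "\<dots> = of_real (?s * ?s) * \<psi> z" by simp
  also have "?s * ?s = (2 * pi) ^ DIM('a)" unfolding power_mult_distrib[symmetric] by simp
  finally show ?thesis by simp
qed

text \<open>Inversion under a compact average over end points \<open>x q\<close>; integrability of
  the transform permits the exchange. This turns an operator with oscillatory amplitude into a
  weighted mean of values of \<open>\<psi>\<close>.\<close>

lemma fourier_inversion_average:
  fixes \<psi> :: "'a::euclidean_space \<Rightarrow> complex" and c :: "'q::euclidean_space \<Rightarrow> complex"
  assumes \<psi>: "\<psi> \<in> test_functions_in K" "compact K"
    and c: "continuous_on UNIV c" and x: "continuous_on UNIV x"
  shows "(LINT \<xi>|lborel. integral (cbox u v) (\<lambda>q. c q * cis (x q \<bullet> \<xi>)) * fourier \<psi> \<xi>)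
    = (2 * pi) ^ DIM('a) * integral (cbox u v) (\<lambda>q. c q * \<psi> (x q))"
proof -
  have int: "integral (cbox u v) f = (LINT q|lborel. indicator (cbox u v) q * f q)" "integrable lborel (\<lambda>q. indicator (cbox u v) q * f q)"
    if "continuous_on UNIV f" for f :: "'q \<Rightarrow> complex"
  proof -
    have "integrable lborel (\<lambda>q. indicator (cbox u v) q *\<^sub>R f q)"
      by (rule borel_integrable_compact[OF compact_cbox]) (use that continuous_on_subset in blast)
    moreover have eq: "indicator (cbox u v) q *\<^sub>R f q = indicator (cbox u v) q * f q" for q
      by (simp add: indicator_def)
    ultimately show "integrable lborel (\<lambda>q. indicator (cbox u v) q * f q)"
      "integral (cbox u v) f = (LINT q|lborel. indicator (cbox u v) q * f q)"
      using set_borel_integral_eq_integral(2)[of "cbox u v" f] by (simp_all add: set_integrable_def set_lebesgue_integral_def)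
  qed
  have ce: "continuous_on UNIV (\<lambda>q. c q * cis (x q \<bullet> \<xi>))" for \<xi>
    by (intro continuous_intros c x continuous_on_compose2[OF smooth_on_continuous_on[OF smooth_on_cis]]) auto
  have c\<psi>: "continuous_on UNIV (\<lambda>q. c q * \<psi> (x q))"
    by (intro continuous_intros c continuous_on_compose2[OF test_functions_in_continuous[OF \<psi>(1), of UNIV] x]) auto
  have [measurable]: "x \<in> borel_measurable borel" by (rule borel_measurable_continuous_onI[OF x])
  let ?g = "\<lambda>q. indicator (cbox u v) q * c q"
  have i: "integrable (lborel \<Otimes>\<^sub>M lborel) (\<lambda>(\<xi>, q). cis (x q \<bullet> \<xi>) * fourier \<psi> \<xi> * ?g q)"
    using integrable_bounded_kernel[OF fourier_integrable[OF \<psi>] int(2)[OF c], of "\<lambda>p. cis (x (snd p) \<bullet> fst p)"]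
    by (simp add: borel_prod[symmetric])
  have "(LINT \<xi>|lborel. integral (cbox u v) (\<lambda>q. c q * cis (x q \<bullet> \<xi>)) * fourier \<psi> \<xi>)
      = (LINT \<xi>|lborel. (LINT q|lborel. cis (x q \<bullet> \<xi>) * fourier \<psi> \<xi> * ?g q))"
    unfolding int(1)[OF ce] by (simp add: mult_ac flip: integral_mult_right_zero)
  also have "\<dots> = (LINT q|lborel. (LINT \<xi>|lborel. cis (x q \<bullet> \<xi>) * fourier \<psi> \<xi> * ?g q))"
    by (rule lborel_pair.Fubini_integral[OF i, symmetric])
  also have "\<dots> = (LINT q|lborel. (2 * pi) ^ DIM('a) * (indicator (cbox u v) q * (c q * \<psi> (x q))))"
    unfolding integral_mult_left_zero fourier_inversion[OF \<psi>] by (simp add: mult_ac)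
  also have "\<dots> = (2 * pi) ^ DIM('a) * integral (cbox u v) (\<lambda>q. c q * \<psi> (x q))"
    unfolding int(1)[OF c\<psi>] by simp
  finally show ?thesis .
qed

subsection \<open>Geometry of the ellipses\<close>

lemma norm_dirp_dirv: "norm (p *\<^sub>R dirp s + q *\<^sub>R dirv s) = sqrt (p\<^sup>2 + q\<^sup>2)"
  unfolding dirv_def dirp_def by (rule norm_frame)

lemma frame_repr: "x = (x \<bullet> dirp s) *\<^sub>R dirp s + (x \<bullet> dirv s) *\<^sub>R dirv s" for x :: "real^2"
proof -
  have sc: "(sin s)\<^sup>2 + (cos s)\<^sup>2 = 1" by simp
  have "x $ 1 = (x $ 1 * (- sin s) + x $ 2 * cos s) * (- sin s) + (x $ 1 * cos s + x $ 2 * sin s) * cos s"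
    "x $ 2 = (x $ 1 * (- sin s) + x $ 2 * cos s) * cos s + (x $ 1 * cos s + x $ 2 * sin s) * sin s"
    using sc by algebra+
  then show ?thesis unfolding vec_eq_iff forall_2 inner_2 by simp
qed

lemma frame_ends: "dirp s \<bullet> dirv s = 0" "dirv s \<bullet> dirp s = 0" "dirv s \<bullet> dirv s = 1" "dirp s \<bullet> dirp s = 1"
  by (simp_all add: inner_2 power2_eq_square[symmetric])

lemma inner_dirv_dirp: "dirv t \<bullet> dirp s = sin (t - s)"
  by (simp add: inner_2 sin_diff)

lemma has_derivative_dirp: "(dirp has_derivative (\<lambda>h. - (h *\<^sub>R dirv t))) (at t)"
  unfolding dirp_alt[abs_def] dirv_alt
  by (auto intro!: derivative_eq_intros simp: algebra_simps)

text \<open>Rotation by \<open>arctan (N / D)\<close> has cosine \<open>D / \<rho>\<close> and sine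
  \<open>N / \<rho>\<close>, and the addition formulas collapse. Thus \<open>u\<close> plus the
  stretch angle is the polar parameter of the stretched vector normalized by its length
  \<open>\<rho>\<close>.\<close>

lemma stretch_angle_direction:
  fixes A B u :: real
  assumes "A > 0" "B > 0"
  defines "\<rho> \<equiv> sqrt (A\<^sup>2 * (sin u)\<^sup>2 + B\<^sup>2 * (cos u)\<^sup>2)"
  shows "\<rho> > 0" "sin (u + stretch_angle A B u) = A * sin u / \<rho>" "cos (u + stretch_angle A B u) = B * cos u / \<rho>"
proof -
  define s c where "s = sin u" and "c = cos u"
  define D where "D = A * s\<^sup>2 + B * c\<^sup>2"
  define N where "N = (A - B) * s * c"
  have sc: "s\<^sup>2 + c\<^sup>2 = 1" by (simp add: s_def c_def)
  have D: "D > 0" using stretch_angle_denominator_pos[OF assms(1,2)] by (simp add: D_def s_def c_def)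
  have sum: "A\<^sup>2 * s\<^sup>2 + B\<^sup>2 * c\<^sup>2 = D\<^sup>2 + N\<^sup>2"
    using sc unfolding D_def N_def by algebra
  have \<rho>: "\<rho> = sqrt (D\<^sup>2 + N\<^sup>2)" by (simp add: \<rho>_def sum[symmetric] s_def c_def)
  have pos: "D\<^sup>2 + N\<^sup>2 > 0" using D by (simp add: add_pos_nonneg)
  then show "\<rho> > 0" by (simp add: \<rho>)
  have st: "stretch_angle A B u = arctan (N / D)" by (simp add: stretch_angle_def N_def D_def s_def c_def)
  have sq: "sqrt (1 + (N / D)\<^sup>2) = \<rho> / D"
  proof -
    have "1 + (N / D)\<^sup>2 = (D\<^sup>2 + N\<^sup>2) / D\<^sup>2" using D by (simp add: power_divide field_simps)
    then show ?thesis using D by (simp add: \<rho> real_sqrt_divide)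
  qed
  have ca: "cos (stretch_angle A B u) = D / \<rho>" unfolding st cos_arctan sq by simp
  have sa: "sin (stretch_angle A B u) = N / \<rho>" unfolding st sin_arctan sq using D by simp
  have "s * D + c * N = A * s" "c * D - s * N = B * c"
    using sc unfolding D_def N_def by algebra+
  then show "sin (u + stretch_angle A B u) = A * sin u / \<rho>" "cos (u + stretch_angle A B u) = B * cos u / \<rho>"
    unfolding sin_add cos_add ca sa s_def[symmetric] c_def[symmetric]
    by (simp_all add: add_divide_distrib[symmetric] diff_divide_distrib[symmetric])
qed

text \<open>The inequality behind the Bolker condition: in eccentric coordinates
  \<open>N = B\<^sup>2\<close>, \<open>n = a\<^sup>2 \<sigma>\<^sup>2\<close>, \<open>v = a\<^sup>2 (1 - \<sigma>\<^sup>2)\<close>, \<open>m = b B \<sigma>\<close>, and \<open>N + v \<le> 2 m\<close> says that the point lies in the closed disc.\<close>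
lemma disc_inequality:
  fixes N n v m :: real
  assumes "N > 0" "n \<ge> 0" "v \<ge> 0" "N + v \<le> 2 * m"
  shows "v * (N + n) < (m + n) * (N + n + 2 * v)"
proof -
  \<comment> \<open>The disc condition bounds \<open>2 * (m + n)\<close> from below by
    \<open>N + v + 2 * n\<close>. After this replacement the gap between the two sides is a positive
    square plus nonnegative terms.\<close>
  have "(N + v + 2 * n) * (N + n + 2 * v) \<le> (2 * (m + n)) * (N + n + 2 * v)"
    using assms by (intro mult_right_mono) auto
  then have "(N + v + 2 * n) * (N + n + 2 * v) \<le> 2 * ((m + n) * (N + n + 2 * v))"
    by (simp only: mult.assoc)
  moreover have "(N + v + 2 * n) * (N + n + 2 * v) - 2 * (v * (N + n)) = (N + n)\<^sup>2 + (v + n) * (N + n + 2 * v)"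
    by (simp add: power2_eq_square algebra_simps)
  moreover have "(N + n)\<^sup>2 > 0" "(v + n) * (N + n + 2 * v) \<ge> 0"
    using assms by auto
  ultimately show ?thesis by linarith
qed

text \<open>Up to the factor \<open>4 * B^2\<close>, \<open>H\<close> is the square of the
  \<open>s\<close>-derivative of the travel time as a function of the eccentric coordinate. Its
  derivative has the sign of \<open>v * (N + n) - (m + n) * (N + n + 2 * v)\<close>, which
  \<open>disc_inequality\<close> makes negative. The disc condition at \<open>s1\<close> persists
  for larger values, as \<open>v\<close> falls and \<open>m\<close> grows.\<close>

lemma eccentric_strict_mono:
  fixes a b B :: real
  assumes B: "B > 0" and a: "a > 0" and b: "b > 0" and s: "0 < s1" "s1 < s2" "s2 \<le> 1"
    and disc: "B\<^sup>2 + a\<^sup>2 * (1 - s1\<^sup>2) \<le> 2 * b * B * s1"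
  defines "H \<equiv> \<lambda>s. (1 - s\<^sup>2) * (b * B + a\<^sup>2 * s)\<^sup>2 / (B\<^sup>2 + a\<^sup>2 * s\<^sup>2)\<^sup>2"
  shows "H s2 < H s1"
proof (rule DERIV_neg_imp_decreasing[OF s(2)])
  fix s assume s': "s1 \<le> s" "s \<le> s2"
  then have s0: "s > 0" "s \<le> 1" using s by auto
  have den: "B\<^sup>2 + a\<^sup>2 * s\<^sup>2 > 0" using B by (simp add: add_pos_nonneg)
  define N n v m where "N = B\<^sup>2" and "n = a\<^sup>2 * s\<^sup>2" and "v = a\<^sup>2 * (1 - s\<^sup>2)" and "m = b * B * s"
  have "s1\<^sup>2 \<le> s\<^sup>2" using s s' by (intro power_mono) auto
  then have "a\<^sup>2 * (1 - s\<^sup>2) \<le> a\<^sup>2 * (1 - s1\<^sup>2)" by (intro mult_left_mono) auto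
  moreover have "b * B * s1 \<le> b * B * s" using B b s' by (intro mult_left_mono) auto
  ultimately have "N + v \<le> 2 * m" unfolding N_def v_def m_def using disc by linarith
  moreover have "v \<ge> 0" using s0 unfolding v_def by (intro mult_nonneg_nonneg) (auto simp: power_le_one)
  ultimately have ineq: "v * (N + n) < (m + n) * (N + n + 2 * v)"
    using B by (intro disc_inequality) (auto simp: N_def n_def)
  define H' where "H' = 2 * (b * B + a\<^sup>2 * s) * (v * (N + n) - (m + n) * (N + n + 2 * v)) / (B\<^sup>2 + a\<^sup>2 * s\<^sup>2) ^ 3"
  have "(H has_real_derivative (((- (2 * s)) * (b * B + a\<^sup>2 * s)\<^sup>2 + (1 - s\<^sup>2) * (2 * (b * B + a\<^sup>2 * s) * a\<^sup>2)) * (B\<^sup>2 + a\<^sup>2 * s\<^sup>2)\<^sup>2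
      - ((1 - s\<^sup>2) * (b * B + a\<^sup>2 * s)\<^sup>2) * (2 * (B\<^sup>2 + a\<^sup>2 * s\<^sup>2) * (a\<^sup>2 * (2 * s)))) / ((B\<^sup>2 + a\<^sup>2 * s\<^sup>2)\<^sup>2 * (B\<^sup>2 + a\<^sup>2 * s\<^sup>2)\<^sup>2)) (at s)"
    unfolding H_def
  proof (rule DERIV_divide)
    show "((\<lambda>s. (1 - s\<^sup>2) * (b * B + a\<^sup>2 * s)\<^sup>2) has_real_derivative
        (- (2 * s)) * (b * B + a\<^sup>2 * s)\<^sup>2 + (1 - s\<^sup>2) * (2 * (b * B + a\<^sup>2 * s) * a\<^sup>2)) (at s)"
      by (auto intro!: derivative_eq_intros)
    show "((\<lambda>s. (B\<^sup>2 + a\<^sup>2 * s\<^sup>2)\<^sup>2) has_real_derivative 2 * (B\<^sup>2 + a\<^sup>2 * s\<^sup>2) * (a\<^sup>2 * (2 * s))) (at s)"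
      by (auto intro!: derivative_eq_intros)
  qed (use den in auto)
  moreover have "(((- (2 * s)) * (b * B + a\<^sup>2 * s)\<^sup>2 + (1 - s\<^sup>2) * (2 * (b * B + a\<^sup>2 * s) * a\<^sup>2)) * (B\<^sup>2 + a\<^sup>2 * s\<^sup>2)\<^sup>2
      - ((1 - s\<^sup>2) * (b * B + a\<^sup>2 * s)\<^sup>2) * (2 * (B\<^sup>2 + a\<^sup>2 * s\<^sup>2) * (a\<^sup>2 * (2 * s))))
     = (B\<^sup>2 + a\<^sup>2 * s\<^sup>2) * (2 * (b * B + a\<^sup>2 * s) * (v * (N + n) - (m + n) * (N + n + 2 * v)))"
    unfolding N_def n_def v_def m_def by algebra
  moreover have "(B\<^sup>2 + a\<^sup>2 * s\<^sup>2) * X / ((B\<^sup>2 + a\<^sup>2 * s\<^sup>2)\<^sup>2 * (B\<^sup>2 + a\<^sup>2 * s\<^sup>2)\<^sup>2) = X / (B\<^sup>2 + a\<^sup>2 * s\<^sup>2) ^ 3" for X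
    using den by (simp add: power2_eq_square power3_eq_cube)
  ultimately have "(H has_real_derivative H') (at s)" by (simp add: H'_def)
  moreover have "H' < 0"
  proof -
    have "b * B + a\<^sup>2 * s > 0" using B a b s0 by (intro add_pos_pos) auto
    then show ?thesis unfolding H'_def using ineq den
      by (intro divide_neg_pos mult_pos_neg) auto
  qed
  ultimately show "\<exists>y. (H has_real_derivative y) (at s) \<and> y < 0" by blast
qed

section \<open>Travel times and eccentric coordinates\<close>

locale acquisition =
  fixes \<alpha> :: real
  assumes alpha: "0 < \<alpha>" "\<alpha> < pi / 2"
begin

abbreviation disc where "disc \<equiv> ball (0 :: real^2) (cos \<alpha>)"

lemma sin_alpha: "sin \<alpha> > 0" and cos_alpha: "cos \<alpha> > 0" and cos_alpha_less: "cos \<alpha> < 1"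
proof -
  show s: "sin \<alpha> > 0" using alpha by (intro sin_gt_zero) auto
  show "cos \<alpha> > 0" using alpha by (intro cos_gt_zero) auto
  have "(cos \<alpha>)\<^sup>2 < 1" using s sin_cos_squared_add[of \<alpha>] by (smt (verit) zero_less_power)
  then show "cos \<alpha> < 1" by (smt (verit) one_le_power)
qed

lemma gamma_T_dirv: "gamma_T \<alpha> s = dirv (s - \<alpha>)" and gamma_R_dirv: "gamma_R \<alpha> s = dirv (s + \<alpha>)"
  by (simp_all add: gamma_T_def gamma_R_def dirv_def)

lemma travel_frame:
  "travel \<alpha> s x = sqrt ((x \<bullet> dirp s + sin \<alpha>)\<^sup>2 + (x \<bullet> dirv s - cos \<alpha>)\<^sup>2)
     + sqrt ((x \<bullet> dirp s - sin \<alpha>)\<^sup>2 + (x \<bullet> dirv s - cos \<alpha>)\<^sup>2)"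
proof -
  have *: "x - gamma_T \<alpha> s = (x \<bullet> dirp s + sin \<alpha>) *\<^sub>R dirp s + (x \<bullet> dirv s - cos \<alpha>) *\<^sub>R dirv s"
    "x - gamma_R \<alpha> s = (x \<bullet> dirp s - sin \<alpha>) *\<^sub>R dirp s + (x \<bullet> dirv s - cos \<alpha>) *\<^sub>R dirv s"
    unfolding gamma_T_alt gamma_R_alt dirv_def[symmetric] dirp_def[symmetric]
    by (subst (1) frame_repr[of x s], simp add: algebra_simps)+
  show ?thesis unfolding travel_def * norm_dirp_dirv ..
qed

text \<open>The line through the foci is \<open>x \<bullet> dirv s = cos \<alpha>\<close>, at
  distance \<open>cos \<alpha>\<close> from the origin. The disc therefore lies strictly on one side
  of it, and ellipses through its points never degenerate to the focal segment.\<close>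

lemma disc_frame: "x \<in> disc \<Longrightarrow> x \<bullet> dirv s < cos \<alpha>"
  using norm_cauchy_schwarz[of x "dirv s"] by simp

lemma travel_gt:
  assumes "x \<bullet> dirv s \<noteq> cos \<alpha>" shows "travel \<alpha> s x > 2 * sin \<alpha>"
proof -
  let ?p = "x \<bullet> dirp s" and ?q = "x \<bullet> dirv s - cos \<alpha>"
  have "\<bar>y\<bar> < sqrt (y\<^sup>2 + ?q\<^sup>2)" for y
    by (rule real_less_rsqrt) (use assms in simp)
  from this[of "?p + sin \<alpha>"] this[of "?p - sin \<alpha>"] show ?thesis
    unfolding travel_frame by linarith
qed

lemma travel_disc: "x \<in> disc \<Longrightarrow> travel \<alpha> s x > 2 * sin \<alpha>"
  using travel_gt disc_frame by (metis less_irrefl)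

lemma travel_periodic: "travel \<alpha> (s + 2 * pi) x = travel \<alpha> s x"
  by (simp add: travel_frame)

text \<open>Smoothness holds up to the unit circle, where the foci lie. The larger ball is taken
  because chords may end on the boundary of the disc.\<close>

lemma smooth_on_travel: "smooth_on (ball 0 1 \<times> UNIV) (\<lambda>p. travel \<alpha> (snd p) (fst p))"
proof -
  have o: "open (ball (0::real^2) 1 \<times> (UNIV :: real set))" by (intro open_Times open_ball open_UNIV)
  have "fst p - dirv t \<noteq> 0" if "p \<in> ball 0 1 \<times> UNIV" for p :: "(real^2) \<times> real" and t
    using that norm_dirv[of t] by auto
  then show ?thesis unfolding travel_def gamma_T_dirv gamma_R_dirv
    by (intro smooth_on_add smooth_on_norm smooth_on_diff smooth_on_dirv smooth_on_fst smooth_on_snd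
        smooth_on_ident smooth_on_const o) auto
qed

text \<open>Eccentric coordinates \<open>(C, \<sigma>) = (cos t, - sin t)\<close> on the ellipse. The derivative of the travel time
  separates points of the part of the ellipse in the closed disc.\<close>
lemma eccentric_coords:
  assumes A: "travel \<alpha> s y = 2 * A" "A > sin \<alpha>" and y: "norm y \<le> cos \<alpha>"
  defines "B \<equiv> sqrt (A\<^sup>2 - (sin \<alpha>)\<^sup>2)"
  obtains C \<sigma> where "y \<bullet> dirp s = A * C" "y \<bullet> dirv s - cos \<alpha> = - B * \<sigma>" "C\<^sup>2 + \<sigma>\<^sup>2 = 1"
    "B\<^sup>2 + (sin \<alpha>)\<^sup>2 * C\<^sup>2 \<le> 2 * cos \<alpha> * B * \<sigma>" "\<sigma> > 0"
    "((\<lambda>s. travel \<alpha> s y) has_real_derivative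
      - 2 * B * C * (cos \<alpha> * B + (sin \<alpha>)\<^sup>2 * \<sigma>) / (B\<^sup>2 + (sin \<alpha>)\<^sup>2 * \<sigma>\<^sup>2)) (at s)"
proof -
  define a b where "a = sin \<alpha>" and "b = cos \<alpha>"
  have ab: "a > 0" "b > 0" "b < 1" "a\<^sup>2 + b\<^sup>2 = 1"
    using sin_alpha cos_alpha cos_alpha_less by (auto simp: a_def b_def)
  define p q where "p = y \<bullet> dirp s" and "q = y \<bullet> dirv s - b"
  have Aa: "A > a" "A > 0" using A(2) ab by (auto simp: a_def)
  have "a\<^sup>2 < A\<^sup>2" using Aa ab by (intro power_strict_mono) auto
  then have B: "B > 0" "B\<^sup>2 = A\<^sup>2 - a\<^sup>2" by (auto simp: B_def a_def)
  define C where "C = p / A"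
  define \<sigma> where "\<sigma> = - q / B"
  have p: "p = A * C" using Aa by (simp add: C_def)
  have q: "q = - B * \<sigma>" using B by (simp add: \<sigma>_def)
  have tr: "sqrt ((p + a)\<^sup>2 + q\<^sup>2) + sqrt ((p - a)\<^sup>2 + q\<^sup>2) = 2 * A"
    using A(1) by (simp add: travel_frame p_def q_def a_def b_def)
  then have "(p / A)\<^sup>2 + (q / B)\<^sup>2 = 1"
    using two_foci_iff[of a A p q] ab Aa by (simp add: B_def a_def)
  then have CS: "C\<^sup>2 + \<sigma>\<^sup>2 = 1" by (simp add: C_def \<sigma>_def power_divide)
  have "(norm y)\<^sup>2 = p\<^sup>2 + (q + b)\<^sup>2"
  proof -
    have "norm y = sqrt (p\<^sup>2 + (q + b)\<^sup>2)"
      by (subst frame_repr[of y s]) (simp add: norm_dirp_dirv p_def q_def)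
    then show ?thesis by simp
  qed
  moreover have "(norm y)\<^sup>2 \<le> b\<^sup>2" using y by (intro power_mono) (auto simp: b_def)
  \<comment> \<open>This is \<open>|y|^2 <= b^2\<close> in the frame centred at the midpoint of the
    foci; in eccentric coordinates it becomes the disc condition.\<close>
  ultimately have "p\<^sup>2 + q\<^sup>2 + 2 * b * q \<le> 0" by (simp add: power2_sum algebra_simps)
  moreover have "p\<^sup>2 + q\<^sup>2 + 2 * b * q = (B\<^sup>2 + a\<^sup>2 * C\<^sup>2) - 2 * b * B * \<sigma>"
    using CS B(2) unfolding p q by algebra
  ultimately have disc: "B\<^sup>2 + a\<^sup>2 * C\<^sup>2 \<le> 2 * b * B * \<sigma>" by linarith
  have "B\<^sup>2 + a\<^sup>2 * C\<^sup>2 > 0" using B(1) by (simp add: add_pos_nonneg)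
  then have "2 * b * B * \<sigma> > 0" using disc by linarith
  moreover have "2 * b * B > 0" using ab B(1) by simp
  ultimately have \<sigma>: "\<sigma> > 0" by (rule zero_less_mult_pos)
  define dT dR where "dT = norm (y - gamma_T \<alpha> s)" and "dR = norm (y - gamma_R \<alpha> s)"
  have sum: "dT + dR = 2 * A" using A(1) by (simp add: travel_def dT_def dR_def)
  have "y - gamma_T \<alpha> s = (p + a) *\<^sub>R dirp s + q *\<^sub>R dirv s" "y - gamma_R \<alpha> s = (p - a) *\<^sub>R dirp s + q *\<^sub>R dirv s"
    unfolding gamma_T_alt gamma_R_alt dirv_def[symmetric] dirp_def[symmetric] p_def q_def a_def b_def
    by (subst (1) frame_repr[of y s], simp add: algebra_simps)+
  then have dsq: "dT\<^sup>2 = (p + a)\<^sup>2 + q\<^sup>2" "dR\<^sup>2 = (p - a)\<^sup>2 + q\<^sup>2"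
    by (simp_all add: dT_def dR_def norm_dirp_dirv)
  have "A * (dT - dR) = 2 * a * p" using sum dsq by algebra
  then have "A * (dT - dR) = A * (2 * a * C)" unfolding p by (simp only: mult_ac)
  then have "dT - dR = 2 * a * C" using Aa(2) by (metis less_irrefl mult_left_cancel)
  \<comment> \<open>The focal distances of a point of an ellipse are affine in its coordinate along
    the major axis; sum and difference of the distances determine them.\<close>
  then have dT: "dT = A + a * C" and dR: "dR = A - a * C" using sum by auto
  have ny: "norm y < 1" using y ab by (simp add: b_def)
  then have nz: "y - gamma_T \<alpha> s \<noteq> 0" "y - gamma_R \<alpha> s \<noteq> 0"
    unfolding gamma_T_dirv gamma_R_dirv using norm_dirv[of "s - \<alpha>"] norm_dirv[of "s + \<alpha>"] by auto
  then have dpos: "dT > 0" "dR > 0" by (auto simp: dT_def dR_def)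
  have der: "((\<lambda>s. norm (y - dirv (s + c))) has_real_derivative - (dirp (s + c) \<bullet> y) / norm (y - dirv (s + c))) (at s)"
    if "y - dirv (s + c) \<noteq> 0" for c
  proof -
    have "((\<lambda>s. dirv (s + c)) has_derivative (\<lambda>h. h *\<^sub>R dirp (s + c))) (at s)"
      using diff_chain_at[OF has_derivative_add[OF has_derivative_ident has_derivative_const] has_derivative_dirv]
      by (simp add: o_def)
    from has_derivative_diff[OF has_derivative_const this]
    have "((\<lambda>s. y - dirv (s + c)) has_derivative (\<lambda>h. - (h *\<^sub>R dirp (s + c)))) (at s)" by simp
    from diff_chain_at[OF this has_derivative_norm[OF that]]
    have "((\<lambda>s. norm (y - dirv (s + c))) has_derivative (\<lambda>h. - (h *\<^sub>R dirp (s + c)) \<bullet> sgn (y - dirv (s + c)))) (at s)"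
      by (simp add: o_def)
    moreover have "- (h *\<^sub>R dirp (s + c)) \<bullet> sgn (y - dirv (s + c)) = - (dirp (s + c) \<bullet> y) / norm (y - dirv (s + c)) * h" for h
      by (simp add: sgn_div_norm inner_diff_right frame_ends divide_inverse)
    ultimately show ?thesis
      unfolding has_field_derivative_def by (auto elim!: has_derivative_eq_rhs simp: fun_eq_iff)
  qed
  have "dirp (s + - \<alpha>) \<bullet> y = b * p + a * (q + b)" "dirp (s + \<alpha>) \<bullet> y = b * p - a * (q + b)"
    unfolding p_def q_def a_def b_def by (simp_all add: inner_2 sin_diff cos_diff sin_add cos_add algebra_simps)
  then have d: "((\<lambda>s. travel \<alpha> s y) has_real_derivative - (b * p + a * (q + b)) / dT + - (b * p - a * (q + b)) / dR) (at s)"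
    using DERIV_add[OF der[of "- \<alpha>"] der[of \<alpha>]] nz
    unfolding travel_def gamma_T_dirv gamma_R_dirv dT_def dR_def by simp
  have den: "B\<^sup>2 + a\<^sup>2 * \<sigma>\<^sup>2 > 0" using B(1) by (simp add: add_pos_nonneg)
  have "- (b * p + a * (q + b)) / dT + - (b * p - a * (q + b)) / dR
    = (- (b * p + a * (q + b)) * dR + - (b * p - a * (q + b)) * dT) / (dT * dR)"
    using dpos by (simp add: add_frac_eq)
  also have "- (b * p + a * (q + b)) * dR + - (b * p - a * (q + b)) * dT = - 2 * B * C * (b * B + a\<^sup>2 * \<sigma>)"
    using B(2) unfolding dT dR p q by algebra
  also have "dT * dR = B\<^sup>2 + a\<^sup>2 * \<sigma>\<^sup>2"
    using CS B(2) unfolding dT dR by algebra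
  finally have "((\<lambda>s. travel \<alpha> s y) has_real_derivative - 2 * B * C * (b * B + a\<^sup>2 * \<sigma>) / (B\<^sup>2 + a\<^sup>2 * \<sigma>\<^sup>2)) (at s)"
    using d by simp
  then show thesis
    using that[of C \<sigma>] p q CS disc \<sigma> unfolding a_def b_def p_def q_def by blast
qed

end

lemma has_real_derivative_slice:
  fixes f :: "'a::euclidean_space \<times> real \<times> real \<Rightarrow> real"
  assumes "f differentiable (at (x, s, t))"
  shows "((\<lambda>s. f (x, s, t)) has_real_derivative dir_deriv (0, 1, 0) f (x, s, t)) (at s)"
    and "((\<lambda>t. f (x, s, t)) has_real_derivative dir_deriv (0, 0, 1) f (x, s, t)) (at t)"
proof -
  note D = has_derivative_dir_deriv[OF assms]
  note sc = linear_simps(5)[OF has_derivative_bounded_linear[OF D]]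
  have d1: "((\<lambda>s. (x, s, t)) has_derivative (\<lambda>h. h *\<^sub>R (0, 1, 0))) (at s)"
    and d2: "((\<lambda>t. (x, s, t)) has_derivative (\<lambda>h. h *\<^sub>R (0, 0, 1))) (at t)"
    by (auto intro!: derivative_eq_intros)
  from diff_chain_at[OF d1 D] diff_chain_at[OF d2 D]
  have "((\<lambda>s. f (x, s, t)) has_derivative (\<lambda>h. h *\<^sub>R dir_deriv (0, 1, 0) f (x, s, t))) (at s)"
    "((\<lambda>t. f (x, s, t)) has_derivative (\<lambda>h. h *\<^sub>R dir_deriv (0, 0, 1) f (x, s, t))) (at t)"
    unfolding o_def sc .
  then show "((\<lambda>s. f (x, s, t)) has_real_derivative dir_deriv (0, 1, 0) f (x, s, t)) (at s)"
    "((\<lambda>t. f (x, s, t)) has_real_derivative dir_deriv (0, 0, 1) f (x, s, t)) (at t)"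
    unfolding has_field_derivative_def by (auto elim!: has_derivative_eq_rhs simp: fun_eq_iff)
qed

section \<open>Chords of the ellipse through a point and the Bolker condition\<close>

context acquisition
begin

text \<open>The squared eccentricity of the ellipse through \<open>x\<close>.\<close>

definition kappa :: "real^2 \<Rightarrow> real \<Rightarrow> real" where
  "kappa x s = (2 * sin \<alpha> / travel \<alpha> s x)\<^sup>2"

text \<open>The line through \<open>x\<close> in direction \<open>dirv t\<close> meets the ellipse through \<open>x\<close> with parameter \<open>s\<close> in the
  second point \<open>x + rad (x, s, t) *\<^sub>R dirv t\<close>.\<close>
definition rad :: "(real^2) \<times> real \<times> real \<Rightarrow> real" where
  "rad = (\<lambda>(x, s, t). 2 * (kappa x s * (dirv t \<bullet> dirp s) * (x \<bullet> dirp s) - dirv t \<bullet> x + cos \<alpha> * (dirv t \<bullet> dirv s))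
     / (1 - kappa x s * (dirv t \<bullet> dirp s)\<^sup>2))"

definition chord :: "(real^2) \<times> real \<times> real \<Rightarrow> real^2" where
  "chord p = fst p + rad p *\<^sub>R dirv (snd (snd p))"

text \<open>The speed of the end of the chord as its direction turns: the velocity is
  \<open>r * dirp t + r_t * dirv t\<close>.\<close>

definition jac :: "(real^2) \<times> real \<times> real \<Rightarrow> real" where
  "jac p = sqrt ((rad p)\<^sup>2 + (dir_deriv (0, 0, 1) rad p)\<^sup>2)"

lemma kappa_bounds:
  assumes "x \<in> disc" shows "0 < kappa x s" "kappa x s < 1"
proof -
  have "0 < 2 * sin \<alpha> / travel \<alpha> s x" "2 * sin \<alpha> / travel \<alpha> s x < 1"
    using travel_disc[OF assms, of s] sin_alpha by simp_all
  then show "0 < kappa x s" "kappa x s < 1"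
    unfolding kappa_def using power_strict_mono[of "2 * sin \<alpha> / travel \<alpha> s x" 1 2]
    by (auto simp del: zero_less_divide_iff)
qed

lemma rad_denominator_pos:
  assumes "x \<in> disc" shows "1 - kappa x s * (dirv t \<bullet> dirp s)\<^sup>2 > 0"
proof -
  have "kappa x s * (dirv t \<bullet> dirp s)\<^sup>2 \<le> kappa x s * 1"
    using kappa_bounds[OF assms, of s] by (intro mult_left_mono) (auto simp: inner_dirv_dirp abs_square_le_1)
  then show ?thesis using kappa_bounds[OF assms, of s] by linarith
qed

lemma open_disc_UNIV: "open (disc \<times> (UNIV :: (real \<times> real) set))"
  by (intro open_Times open_ball open_UNIV)

lemma smooth_on_rad: "smooth_on (disc \<times> UNIV) rad"
proof -
  note o = open_disc_UNIV
  have "smooth_on (disc \<times> (UNIV :: (real \<times> real) set)) (\<lambda>p. (\<lambda>p. travel \<alpha> (snd p) (fst p)) (fst p, fst (snd p)))"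
    by (rule smooth_on_compose[OF o _ _ smooth_on_travel])
      (use cos_alpha_less in \<open>auto intro!: open_Times smooth_on_Pair smooth_on_fst smooth_on_snd smooth_on_ident o\<close>)
  then have t: "smooth_on (disc \<times> (UNIV :: (real \<times> real) set)) (\<lambda>p. travel \<alpha> (fst (snd p)) (fst p))" by simp
  have "travel \<alpha> (fst (snd p)) (fst p) \<noteq> 0" if "p \<in> disc \<times> UNIV" for p :: "(real^2) \<times> real \<times> real"
    using travel_disc[of "fst p" "fst (snd p)"] sin_alpha that by (auto simp: mem_Times_iff)
  then have k: "smooth_on (disc \<times> (UNIV :: (real \<times> real) set)) (\<lambda>p. kappa (fst p) (fst (snd p)))"
    unfolding kappa_def by (intro smooth_on_power smooth_on_divide smooth_on_const t o)
  have nz: "1 - kappa (fst p) (fst (snd p)) * (dirv (snd (snd p)) \<bullet> dirp (fst (snd p)))\<^sup>2 \<noteq> 0"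
    if "p \<in> disc \<times> UNIV" for p
    using rad_denominator_pos[of "fst p" "fst (snd p)" "snd (snd p)"] that by (auto simp: mem_Times_iff)
  show ?thesis unfolding rad_def case_prod_unfold
    by (intro smooth_on_divide smooth_on_mult smooth_on_add smooth_on_diff smooth_on_power smooth_on_const
        smooth_on_inner smooth_on_dirv smooth_on_dirp smooth_on_fst smooth_on_snd smooth_on_ident k o nz)
qed

lemma rad_differentiable: "x \<in> disc \<Longrightarrow> rad differentiable (at (x, s, t))"
  using smooth_on_differentiable[OF smooth_on_rad] by auto

lemma rad_periodic: "rad (x, s + 2 * pi, t) = rad (x, s, t)" "rad (x, s, t + 2 * pi) = rad (x, s, t)"
  by (simp_all add: rad_def kappa_def travel_periodic)

lemma smooth_on_chord: "smooth_on (disc \<times> UNIV) chord"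
  unfolding chord_def by (intro smooth_on_add smooth_on_scaleR smooth_on_dirv smooth_on_fst smooth_on_snd
      smooth_on_ident smooth_on_rad open_disc_UNIV)

lemma dir_deriv_rad_periodic:
  assumes "x \<in> disc"
  shows "dir_deriv v rad (x, s + 2 * pi, t) = dir_deriv v rad (x, s, t)"
    "dir_deriv v rad (x, s, t + 2 * pi) = dir_deriv v rad (x, s, t)"
  using dir_deriv_shift[OF open_disc_UNIV, of "(x, s, t)" "(0, 2 * pi, 0)" rad v]
    dir_deriv_shift[OF open_disc_UNIV, of "(x, s, t)" "(0, 0, 2 * pi)" rad v]
    rad_differentiable[OF assms] rad_periodic assms by auto

text \<open>\<open>A\<close> and \<open>B\<close> are the half-axes of the ellipse through \<open>x\<close>.\<close>
lemma frame_coords: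
  assumes x: "x \<in> disc"
  obtains A B p q where "travel \<alpha> s x = 2 * A" "A > sin \<alpha>" "B = sqrt (A\<^sup>2 - (sin \<alpha>)\<^sup>2)" "B > 0" "B\<^sup>2 = A\<^sup>2 - (sin \<alpha>)\<^sup>2"
    "p = x \<bullet> dirp s" "q = x \<bullet> dirv s - cos \<alpha>" "kappa x s = (sin \<alpha>)\<^sup>2 / A\<^sup>2" "(p / A)\<^sup>2 + (q / B)\<^sup>2 = 1"
    "\<And>t. rad (x, s, t) * (B\<^sup>2 * (dirv t \<bullet> dirp s)\<^sup>2 + A\<^sup>2 * (dirv t \<bullet> dirv s)\<^sup>2)
      = - 2 * (B\<^sup>2 * p * (dirv t \<bullet> dirp s) + A\<^sup>2 * q * (dirv t \<bullet> dirv s))"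
    "\<And>t. B\<^sup>2 * (dirv t \<bullet> dirp s)\<^sup>2 + A\<^sup>2 * (dirv t \<bullet> dirv s)\<^sup>2 > 0"
proof -
  define A where "A = travel \<alpha> s x / 2"
  define B where "B = sqrt (A\<^sup>2 - (sin \<alpha>)\<^sup>2)"
  define p q where "p = x \<bullet> dirp s" and "q = x \<bullet> dirv s - cos \<alpha>"
  have A: "A > sin \<alpha>" using travel_disc[OF x, of s] by (simp add: A_def)
  then have A0: "A > 0" using sin_alpha by simp
  have "(sin \<alpha>)\<^sup>2 < A\<^sup>2" using A sin_alpha by (intro power_strict_mono) auto
  then have B: "B > 0" "B\<^sup>2 = A\<^sup>2 - (sin \<alpha>)\<^sup>2" by (auto simp: B_def)
  have "travel \<alpha> s x = 2 * A" by (simp add: A_def)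
  then have ell: "(p / A)\<^sup>2 + (q / B)\<^sup>2 = 1"
    using two_foci_iff[of "sin \<alpha>" A p q] sin_alpha A by (simp add: travel_frame p_def q_def B_def)
  have k: "kappa x s = (sin \<alpha>)\<^sup>2 / A\<^sup>2" by (simp add: kappa_def A_def power_divide)
  have M: "B\<^sup>2 * (dirv t \<bullet> dirp s)\<^sup>2 + A\<^sup>2 * (dirv t \<bullet> dirv s)\<^sup>2 = A\<^sup>2 * (1 - kappa x s * (dirv t \<bullet> dirp s)\<^sup>2)" for t
  proof -
    have "(dirv t \<bullet> dirp s)\<^sup>2 + (dirv t \<bullet> dirv s)\<^sup>2 = 1" by (simp add: inner_dirv_dirp inner_dirv_dirv)
    then have "B\<^sup>2 * (dirv t \<bullet> dirp s)\<^sup>2 + A\<^sup>2 * (dirv t \<bullet> dirv s)\<^sup>2 = A\<^sup>2 - (sin \<alpha>)\<^sup>2 * (dirv t \<bullet> dirp s)\<^sup>2"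
      using B(2) by algebra
    then show ?thesis using A0 by (simp add: k right_diff_distrib)
  qed
  have r: "rad (x, s, t) * (B\<^sup>2 * (dirv t \<bullet> dirp s)\<^sup>2 + A\<^sup>2 * (dirv t \<bullet> dirv s)\<^sup>2)
      = - 2 * (B\<^sup>2 * p * (dirv t \<bullet> dirp s) + A\<^sup>2 * q * (dirv t \<bullet> dirv s))" for t
  proof -
    have x: "dirv t \<bullet> x = (dirv t \<bullet> dirp s) * p + (dirv t \<bullet> dirv s) * (q + cos \<alpha>)"
      by (subst frame_repr[of x s]) (simp add: inner_add_right p_def q_def mult.commute)
    have "rad (x, s, t) * (B\<^sup>2 * (dirv t \<bullet> dirp s)\<^sup>2 + A\<^sup>2 * (dirv t \<bullet> dirv s)\<^sup>2)
      = A\<^sup>2 * (2 * (kappa x s * (dirv t \<bullet> dirp s) * p - dirv t \<bullet> x + cos \<alpha> * (dirv t \<bullet> dirv s)))"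
      unfolding M using rad_denominator_pos[OF assms, of s t] by (simp add: rad_def p_def)
    also have "\<dots> = 2 * ((A\<^sup>2 * kappa x s) * (dirv t \<bullet> dirp s) * p - A\<^sup>2 * (dirv t \<bullet> dirp s) * p - A\<^sup>2 * (dirv t \<bullet> dirv s) * q)"
      unfolding x by (simp add: algebra_simps)
    also have "A\<^sup>2 * kappa x s = A\<^sup>2 - B\<^sup>2" using A0 B by (simp add: k)
    finally show ?thesis by (simp add: algebra_simps)
  qed
  show thesis
    by (rule that[OF _ A B_def B p_def q_def k ell r]) (use M A0 rad_denominator_pos[OF x] in \<open>auto simp: A_def\<close>)
qed

lemma frame_point: "x + r *\<^sub>R dirv t = cos \<alpha> *\<^sub>R vector [cos s, sin s]
    + (x \<bullet> dirp s + r * (dirv t \<bullet> dirp s)) *\<^sub>R vector [- sin s, cos s]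
    + ((x \<bullet> dirv s - cos \<alpha>) + r * (dirv t \<bullet> dirv s)) *\<^sub>R vector [cos s, sin s]"
  unfolding dirv_def[of s, symmetric] dirp_def[of s, symmetric]
  by (subst (1) frame_repr[of "x + r *\<^sub>R dirv t" s]) (simp add: inner_add_left algebra_simps)

text \<open>Inserting \<open>x + r * dirv t\<close> into the equation of the ellipse gives a
  quadratic in \<open>r\<close> without constant term, because \<open>x\<close> lies on the ellipse.
  \<open>rad\<close> is its other root.\<close>

lemma travel_chord:
  assumes x: "x \<in> disc" shows "travel \<alpha> s (chord (x, s, t)) = travel \<alpha> s x"
proof -
  obtain A B p q where *: "travel \<alpha> s x = 2 * A" "A > sin \<alpha>" "B = sqrt (A\<^sup>2 - (sin \<alpha>)\<^sup>2)" "B > 0" "B\<^sup>2 = A\<^sup>2 - (sin \<alpha>)\<^sup>2"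
    "p = x \<bullet> dirp s" "q = x \<bullet> dirv s - cos \<alpha>" "kappa x s = (sin \<alpha>)\<^sup>2 / A\<^sup>2" "(p / A)\<^sup>2 + (q / B)\<^sup>2 = 1"
    and r': "\<And>t. rad (x, s, t) * (B\<^sup>2 * (dirv t \<bullet> dirp s)\<^sup>2 + A\<^sup>2 * (dirv t \<bullet> dirv s)\<^sup>2)
      = - 2 * (B\<^sup>2 * p * (dirv t \<bullet> dirp s) + A\<^sup>2 * q * (dirv t \<bullet> dirv s))"
    and M': "\<And>t. B\<^sup>2 * (dirv t \<bullet> dirp s)\<^sup>2 + A\<^sup>2 * (dirv t \<bullet> dirv s)\<^sup>2 > 0"
    by (rule frame_coords[OF x, of s]) blast
  define r wp wq where "r = rad (x, s, t)" and "wp = dirv t \<bullet> dirp s" and "wq = dirv t \<bullet> dirv s"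
  note r = r'[of t, folded r_def wp_def wq_def]
  have A0: "A > 0" using *(2) sin_alpha by simp
  have "p\<^sup>2 * B\<^sup>2 + q\<^sup>2 * A\<^sup>2 = A\<^sup>2 * B\<^sup>2"
    using *(9) A0 *(4) by (simp add: power_divide field_simps)
  moreover have "(p + r * wp)\<^sup>2 * B\<^sup>2 + (q + r * wq)\<^sup>2 * A\<^sup>2
      = (p\<^sup>2 * B\<^sup>2 + q\<^sup>2 * A\<^sup>2) + r * (2 * (B\<^sup>2 * p * wp + A\<^sup>2 * q * wq) + r * (B\<^sup>2 * wp\<^sup>2 + A\<^sup>2 * wq\<^sup>2))"
    by algebra
  ultimately have "(p + r * wp)\<^sup>2 * B\<^sup>2 + (q + r * wq)\<^sup>2 * A\<^sup>2 = A\<^sup>2 * B\<^sup>2" using r by simp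
  then have "((p + r * wp) / A)\<^sup>2 + ((q + r * wq) / B)\<^sup>2 = 1"
    using A0 *(4) by (simp add: power_divide field_simps)
  then have "x + r *\<^sub>R dirv t \<in> ellipse \<alpha> s (2 * A)"
    unfolding frame_point[of x r t s] using ellipse_frame_iff[OF sin_alpha, of "2 * A" s "p + r * wp" "q + r * wq"] *(2,3)
    by (simp add: *(6,7) wp_def wq_def power_mult_distrib)
  then show ?thesis by (simp add: ellipse_def chord_def *(1) r_def)
qed

text \<open>Squaring the equation and using \<open>C^2 = 1 - s^2\<close> compares two values of the
  strictly monotone function of \<open>eccentric_strict_mono\<close>, so the
  \<open>s\<close>-coordinates agree. The unsquared equation then fixes \<open>C\<close> including
  its sign, since \<open>h\<close> is positive.\<close>

lemma eccentric_inj: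
  fixes B a b C1 C2 s1 s2 :: real
  assumes "B > 0" "a > 0" "b > 0" "C1\<^sup>2 + s1\<^sup>2 = 1" "C2\<^sup>2 + s2\<^sup>2 = 1" "s1 > 0" "s2 > 0"
    and "B\<^sup>2 + a\<^sup>2 * C1\<^sup>2 \<le> 2 * b * B * s1" "B\<^sup>2 + a\<^sup>2 * C2\<^sup>2 \<le> 2 * b * B * s2"
    and eq: "- 2 * B * C1 * (b * B + a\<^sup>2 * s1) / (B\<^sup>2 + a\<^sup>2 * s1\<^sup>2) = - 2 * B * C2 * (b * B + a\<^sup>2 * s2) / (B\<^sup>2 + a\<^sup>2 * s2\<^sup>2)"
  shows "C1 = C2 \<and> s1 = s2"
proof -
  define h where "h s = (b * B + a\<^sup>2 * s) / (B\<^sup>2 + a\<^sup>2 * s\<^sup>2)" for s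
  have h: "h s > 0" if "s > 0" for s
    unfolding h_def using assms(1-3) that by (intro divide_pos_pos add_pos_pos mult_pos_pos) auto
  have "- 2 * B * (C1 * h s1) = - 2 * B * (C2 * h s2)" using eq by (simp add: h_def)
  then have e: "C1 * h s1 = C2 * h s2" using assms(1) by simp
  have C: "C1\<^sup>2 = 1 - s1\<^sup>2" "C2\<^sup>2 = 1 - s2\<^sup>2" using assms(4,5) by auto
  have "s1\<^sup>2 \<le> 1" "s2\<^sup>2 \<le> 1" using C zero_le_power2[of C1] zero_le_power2[of C2] by linarith+
  then have s1: "s1 \<le> 1" "s2 \<le> 1" using assms(6,7) by (simp_all add: power_le_one_iff)
  have H: "(1 - s\<^sup>2) * (b * B + a\<^sup>2 * s)\<^sup>2 / (B\<^sup>2 + a\<^sup>2 * s\<^sup>2)\<^sup>2 = (1 - s\<^sup>2) * (h s)\<^sup>2" for s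
    by (simp add: h_def power_divide)
  have "(1 - s1\<^sup>2) * (h s1)\<^sup>2 = (1 - s2\<^sup>2) * (h s2)\<^sup>2"
    unfolding C[symmetric] power_mult_distrib[symmetric] e ..
  then have "s1 = s2"
    using eccentric_strict_mono[OF assms(1-3,6) _ s1(2)] eccentric_strict_mono[OF assms(1-3,7) _ s1(1)] assms(8,9)
    unfolding H C by (cases s1 s2 rule: linorder_cases) auto
  then show ?thesis using e h[OF assms(6)] by auto
qed

text \<open>For a proper chord, \<open>r_s = 0\<close> would make the \<open>s\<close>-derivatives
  of the travel time agree at both ends, and these separate points of the ellipse within the closed
  disc. When the chord shrinks to a tangent, this comparison is empty; the infinitesimal version is
  computed directly from the quotient defining \<open>rad\<close> and rests on the same
  inequality.\<close>

theorem bolker: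
  assumes x: "x \<in> disc" and z: "norm (chord (x, s, t)) \<le> cos \<alpha>"
  shows "dir_deriv (0, 1, 0) rad (x, s, t) \<noteq> 0"
proof
  assume rs: "dir_deriv (0, 1, 0) rad (x, s, t) = 0"
  obtain A B p q where *: "travel \<alpha> s x = 2 * A" "A > sin \<alpha>" "B = sqrt (A\<^sup>2 - (sin \<alpha>)\<^sup>2)" "B > 0" "B\<^sup>2 = A\<^sup>2 - (sin \<alpha>)\<^sup>2"
    "p = x \<bullet> dirp s" "q = x \<bullet> dirv s - cos \<alpha>" "kappa x s = (sin \<alpha>)\<^sup>2 / A\<^sup>2" "(p / A)\<^sup>2 + (q / B)\<^sup>2 = 1"
    and r': "\<And>t. rad (x, s, t) * (B\<^sup>2 * (dirv t \<bullet> dirp s)\<^sup>2 + A\<^sup>2 * (dirv t \<bullet> dirv s)\<^sup>2)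
      = - 2 * (B\<^sup>2 * p * (dirv t \<bullet> dirp s) + A\<^sup>2 * q * (dirv t \<bullet> dirv s))"
    and M': "\<And>t. B\<^sup>2 * (dirv t \<bullet> dirp s)\<^sup>2 + A\<^sup>2 * (dirv t \<bullet> dirv s)\<^sup>2 > 0"
    by (rule frame_coords[OF x, of s]) blast
  have A0: "A > 0" using *(2) sin_alpha by simp
  define a b where "a = sin \<alpha>" and "b = cos \<alpha>"
  have ab: "a > 0" "b > 0" using sin_alpha cos_alpha by (auto simp: a_def b_def)
  have nx: "norm x \<le> cos \<alpha>" using x by simp
  obtain C \<sigma> where x': "x \<bullet> dirp s = A * C" "x \<bullet> dirv s - cos \<alpha> = - B * \<sigma>" "C\<^sup>2 + \<sigma>\<^sup>2 = 1"
    "B\<^sup>2 + a\<^sup>2 * C\<^sup>2 \<le> 2 * b * B * \<sigma>" "\<sigma> > 0"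
    and dx: "((\<lambda>s. travel \<alpha> s x) has_real_derivative - 2 * B * C * (b * B + a\<^sup>2 * \<sigma>) / (B\<^sup>2 + a\<^sup>2 * \<sigma>\<^sup>2)) (at s)"
    using eccentric_coords[OF *(1,2) nx] unfolding *(3)[symmetric] a_def b_def by blast
  show False
  proof (cases "rad (x, s, t) = 0")
    case False
    define z where "z = chord (x, s, t)"
    obtain C2 \<sigma>2 where z': "z \<bullet> dirp s = A * C2" "z \<bullet> dirv s - cos \<alpha> = - B * \<sigma>2" "C2\<^sup>2 + \<sigma>2\<^sup>2 = 1"
      "B\<^sup>2 + a\<^sup>2 * C2\<^sup>2 \<le> 2 * b * B * \<sigma>2" "\<sigma>2 > 0"
      and dz: "((\<lambda>s. travel \<alpha> s z) has_real_derivative - 2 * B * C2 * (b * B + a\<^sup>2 * \<sigma>2) / (B\<^sup>2 + a\<^sup>2 * \<sigma>2\<^sup>2)) (at s)"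
      using eccentric_coords[OF _ *(2) assms(2), of s] travel_chord[OF x, of s t] *(1)
      unfolding *(3)[symmetric] a_def b_def z_def by auto
    let ?T = "\<lambda>p. travel \<alpha> (snd p) (fst p)"
    have T: "?T differentiable (at (z, s))"
      by (rule smooth_on_differentiable[OF smooth_on_travel]) (use z cos_alpha_less in \<open>auto simp: z_def\<close>)
    \<comment> \<open>The end of the chord stands still to first order, so differentiating the
      identity of \<open>travel_chord\<close> leaves on one side only the explicit
      \<open>s\<close>-derivative of the travel time at \<open>z\<close>.\<close>
    have "((\<lambda>s. chord (x, s, t)) has_derivative (\<lambda>h. 0)) (at s)"
    proof -
      have "((\<lambda>s. rad (x, s, t)) has_derivative (\<lambda>h. 0)) (at s)"
        using has_real_derivative_slice(1)[OF rad_differentiable[OF x], where s = s and t = t] unfolding rs has_field_derivative_def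
        by (auto elim!: has_derivative_eq_rhs simp: fun_eq_iff)
      from has_derivative_add[OF has_derivative_const has_derivative_scaleR_left[OF this]]
      show ?thesis unfolding chord_def by simp
    qed
    from has_derivative_Pair[OF this has_derivative_ident]
    have "((\<lambda>s. (chord (x, s, t), s)) has_derivative (\<lambda>h. (0, h))) (at s)" .
    from diff_chain_at[OF this, of ?T "\<lambda>v. dir_deriv v ?T (z, s)"] has_derivative_dir_deriv[OF T]
    have "((\<lambda>s. travel \<alpha> s (chord (x, s, t))) has_derivative (\<lambda>h. dir_deriv (0, h) ?T (z, s))) (at s)"
      by (simp add: o_def z_def)
    then have 1: "((\<lambda>s. travel \<alpha> s x) has_derivative (\<lambda>h. dir_deriv (0, h) ?T (z, s))) (at s)"
      by (simp add: travel_chord[OF x])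
    have 2: "((\<lambda>s. travel \<alpha> s z) has_derivative (\<lambda>h. dir_deriv (0, h) ?T (z, s))) (at s)"
      using has_derivative_dir_deriv[OF dir_deriv_snd_slice(1)[OF T]] dir_deriv_snd_slice(2)[OF T] by simp
    have "(*) (- 2 * B * C * (b * B + a\<^sup>2 * \<sigma>) / (B\<^sup>2 + a\<^sup>2 * \<sigma>\<^sup>2)) = (\<lambda>h. dir_deriv (0, h) ?T (z, s))"
      by (rule has_derivative_unique[OF dx[unfolded has_field_derivative_def] 1])
    moreover have "(*) (- 2 * B * C2 * (b * B + a\<^sup>2 * \<sigma>2) / (B\<^sup>2 + a\<^sup>2 * \<sigma>2\<^sup>2)) = (\<lambda>h. dir_deriv (0, h) ?T (z, s))"
      by (rule has_derivative_unique[OF dz[unfolded has_field_derivative_def] 2])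
    ultimately have "(*) (- 2 * B * C * (b * B + a\<^sup>2 * \<sigma>) / (B\<^sup>2 + a\<^sup>2 * \<sigma>\<^sup>2))
        = (*) (- 2 * B * C2 * (b * B + a\<^sup>2 * \<sigma>2) / (B\<^sup>2 + a\<^sup>2 * \<sigma>2\<^sup>2))" by simp
    from fun_cong[OF this, of 1]
    have "- 2 * B * C * (b * B + a\<^sup>2 * \<sigma>) / (B\<^sup>2 + a\<^sup>2 * \<sigma>\<^sup>2) = - 2 * B * C2 * (b * B + a\<^sup>2 * \<sigma>2) / (B\<^sup>2 + a\<^sup>2 * \<sigma>2\<^sup>2)"
      by simp
    from eccentric_inj[OF *(4) ab x'(3) z'(3) x'(5) z'(5) x'(4) z'(4) this]
    have "C = C2" "\<sigma> = \<sigma>2" by auto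
    then have "x \<bullet> dirp s = z \<bullet> dirp s" "x \<bullet> dirv s = z \<bullet> dirv s" using x'(1,2) z'(1,2) by auto
    then have "x = z" using frame_repr[of x s] frame_repr[of z s] by simp
    then have "rad (x, s, t) *\<^sub>R dirv t = 0" by (simp add: z_def chord_def)
    then show False using False norm_dirv[of t] by (metis norm_zero scaleR_eq_0_iff zero_neq_one)
  next
    case True
    define wp wq where "wp = dirv t \<bullet> dirp s" and "wq = dirv t \<bullet> dirv s"
    define K Q where "K = B\<^sup>2 + a\<^sup>2 * \<sigma>\<^sup>2" and "Q = b * B + a\<^sup>2 * \<sigma>"
    have K: "K > 0" unfolding K_def using *(4) by (simp add: add_pos_nonneg)
    define Num where "Num s = kappa x s * (dirv t \<bullet> dirp s) * (x \<bullet> dirp s) - dirv t \<bullet> x + cos \<alpha> * (dirv t \<bullet> dirv s)" for s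
    define Den where "Den s = 1 - kappa x s * (dirv t \<bullet> dirp s)\<^sup>2" for s
    have Den: "Den s > 0" for s unfolding Den_def by (rule rad_denominator_pos[OF x])
    have rad: "rad (x, s, t) = 2 * Num s / Den s" for s by (simp add: rad_def Num_def Den_def)
    have N0: "Num s = 0" using True Den[of s] by (simp add: rad)
    have dk: "((\<lambda>s. kappa x s) has_real_derivative 2 * a\<^sup>2 * B * C * Q / (A ^ 3 * K)) (at s)"
    proof -
      note dx' = dx[folded K_def Q_def]
      have nz: "travel \<alpha> s x \<noteq> 0" using *(1) A0 by simp
      have "2 * ((0 * travel \<alpha> s x - 2 * a * (- 2 * B * C * Q / K)) / (travel \<alpha> s x * travel \<alpha> s x) * (2 * a / travel \<alpha> s x))
          = 2 * a\<^sup>2 * B * C * Q / (A ^ 3 * K)"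
        unfolding *(1) using A0 K by (simp add: field_simps power2_eq_square power3_eq_cube)
      then show ?thesis
        using DERIV_power[OF DERIV_divide[OF DERIV_const dx' nz], of "2 * a" 2]
        unfolding kappa_def a_def[symmetric] by simp
    qed
    have de: "((\<lambda>s. v \<bullet> dirp s) has_real_derivative - (v \<bullet> dirv s)) (at s)" for v
      using has_derivative_inner_right[OF has_derivative_dirp, of v s]
      unfolding has_field_derivative_def by (auto elim!: has_derivative_eq_rhs simp: fun_eq_iff)
    have dn: "((\<lambda>s. v \<bullet> dirv s) has_real_derivative v \<bullet> dirp s) (at s)" for v
      using has_derivative_inner_right[OF has_derivative_dirv, of v s]
      unfolding has_field_derivative_def by (auto elim!: has_derivative_eq_rhs simp: fun_eq_iff)
    define Ns where "Ns = (2 * a\<^sup>2 * B * C * Q / (A ^ 3 * K) * wp + kappa x s * (- wq)) * (A * C) + kappa x s * wp * (- (b - B * \<sigma>)) + b * wp"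
    have xe: "x \<bullet> dirp s = A * C" "x \<bullet> dirv s = b - B * \<sigma>" using x'(1,2) by (auto simp: b_def)
    have dNum: "(Num has_real_derivative Ns) (at s)"
      unfolding Num_def[abs_def] Ns_def wp_def wq_def
      by (auto intro!: derivative_eq_intros dk de dn simp: xe b_def algebra_simps)
    have "\<exists>d. (Den has_real_derivative d) (at s)"
      unfolding Den_def[abs_def]
      by (rule exI, rule DERIV_diff[OF DERIV_const DERIV_mult[OF dk DERIV_power[OF de]]])
    then obtain d where dDen: "(Den has_real_derivative d) (at s)" by blast
    have "((\<lambda>s. 2 * Num s / Den s) has_real_derivative (2 * Ns * Den s - 2 * Num s * d) / (Den s * Den s)) (at s)"
      by (rule DERIV_divide[OF DERIV_cmult[OF dNum] dDen]) (use Den[of s] in auto)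
    then have "((\<lambda>s. rad (x, s, t)) has_real_derivative 2 * Ns / Den s) (at s)"
      using Den[of s] by (simp add: rad N0)
    from DERIV_unique[OF this has_real_derivative_slice(1)[OF rad_differentiable[OF x]]]
    have "2 * Ns / Den s = 0" unfolding rs .
    then have Ns0: "Ns = 0" using Den[of s] by simp
    have k: "kappa x s = a\<^sup>2 / A\<^sup>2" using *(8) by (simp add: a_def)
    have AB: "B\<^sup>2 = A\<^sup>2 - a\<^sup>2" using *(5) by (simp add: a_def)
    have unit: "wp\<^sup>2 + wq\<^sup>2 = 1" by (simp add: wp_def wq_def inner_dirv_dirp inner_dirv_dirv)
    \<comment> \<open>Tangency at \<open>x\<close>: the direction is orthogonal to the normal
      \<open>(C / A, - \<sigma> / B)\<close> of the ellipse at the point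
      \<open>(A * C, - B * \<sigma>)\<close>.\<close>
    have tang: "B * C * wp = A * \<sigma> * wq"
    proof -
      have "dirv t \<bullet> x = wp * (A * C) + wq * (b - B * \<sigma>)"
        by (subst frame_repr[of x s]) (simp add: inner_add_right xe wp_def wq_def mult.commute)
      then have "Num s = (a\<^sup>2 / A\<^sup>2) * wp * (A * C) - wp * (A * C) + wq * B * \<sigma>"
        by (simp add: Num_def k xe wp_def wq_def b_def algebra_simps)
      then have "0 = A\<^sup>2 * ((a\<^sup>2 / A\<^sup>2) * wp * (A * C) - wp * (A * C) + wq * B * \<sigma>)" using N0 by simp
      also have "\<dots> = a\<^sup>2 * wp * (A * C) - A\<^sup>2 * wp * (A * C) + A\<^sup>2 * wq * B * \<sigma>"
        using A0 by (simp add: algebra_simps)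
      also have "\<dots> = (A * B) * (A * \<sigma> * wq - B * C * wp)" using AB by algebra
      finally show ?thesis using A0 *(4) by simp
    qed
    define N n v m where "N = B\<^sup>2" and "n = a\<^sup>2 * \<sigma>\<^sup>2" and "v = a\<^sup>2 * C\<^sup>2" and "m = b * B * \<sigma>"
    have "N + v \<le> 2 * m" using x'(4) by (simp add: N_def v_def m_def)
    then have ineq: "v * (N + n) < (m + n) * (N + n + 2 * v)"
      by (intro disc_inequality) (use *(4) in \<open>auto simp: N_def n_def v_def\<close>)
    have "A\<^sup>2 * K * Ns = 2 * a\<^sup>2 * B * C\<^sup>2 * Q * wp + K * (a\<^sup>2 * (- wq * A * C - wp * (b - B * \<sigma>))) + A\<^sup>2 * K * b * wp"
      unfolding Ns_def k using A0 K by (simp add: field_simps power2_eq_square power3_eq_cube)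
    \<comment> \<open>The factor \<open>\<sigma>\<close> lets tangency replace \<open>wq\<close> by
      a multiple of \<open>wp\<close>. Then \<open>wp\<close> factors out, and the remaining bracket
      is the positive quantity of \<open>disc_inequality\<close>.\<close>
    then have "0 = \<sigma> * (2 * a\<^sup>2 * B * C\<^sup>2 * Q * wp + K * (a\<^sup>2 * (- wq * A * C - wp * (b - B * \<sigma>))) + A\<^sup>2 * K * b * wp)"
      using Ns0 by simp
    also have "\<dots> = wp * B * ((m + n) * (N + n + 2 * v) - v * (N + n))"
      using tang AB unfolding K_def Q_def N_def n_def v_def m_def by algebra
    finally have "wp = 0" using *(4) ineq by simp
    then have "wq = 0" using tang A0 x'(5) by simp
    with \<open>wp = 0\<close> unit show False by simp
  qed
qed

text \<open>At \<open>s = t\<close> and \<open>s = t + pi\<close> the direction is parallel to the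
  minor axis, and \<open>rad\<close> equals \<open>2 * (cos \<alpha> - dirv t \<bullet> x)\<close>
  and \<open>2 * (- cos \<alpha> - dirv t \<bullet> x)\<close>. In the disc these have opposite
  signs, so the intermediate value theorem gives a tangent ellipse; periodicity brings
  \<open>s\<close> into range.\<close>

lemma rad_zero_exists:
  assumes x: "x \<in> disc" shows "\<exists>s\<in>{0..2 * pi}. rad (x, s, t) = 0"
proof -
  have cont: "continuous_on {t..t + pi} (\<lambda>s. rad (x, s, t))"
    using has_real_derivative_slice(1)[OF rad_differentiable[OF x]] DERIV_isCont
    by (intro continuous_at_imp_continuous_on) blast
  have xt: "\<bar>dirv t \<bullet> x\<bar> < cos \<alpha>" using Cauchy_Schwarz_ineq2[of "dirv t" x] x by simp
  have "rad (x, t, t) \<ge> 0" "rad (x, t + pi, t) \<le> 0"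
  proof -
    have 0: "dirv t \<bullet> dirp t = 0" "dirv t \<bullet> dirp (t + pi) = 0" "dirv t \<bullet> dirv t = 1" "dirv t \<bullet> dirv (t + pi) = - 1"
      by (simp_all add: inner_dirv_dirp inner_dirv_dirv sin_diff cos_diff)
    show "rad (x, t, t) \<ge> 0" "rad (x, t + pi, t) \<le> 0" using xt by (simp_all add: rad_def 0)
  qed
  then obtain s where "rad (x, s, t) = 0"
    using IVT2'[of "\<lambda>s. rad (x, s, t)" "t + pi" 0 t] cont by auto
  moreover obtain y where "0 \<le> y" "y < 2 * pi" "rad (x, y, t) = rad (x, s, t)"
    using periodic_reduce[of "\<lambda>s. rad (x, s, t)" "2 * pi" s] rad_periodic by auto
  ultimately show ?thesis by (intro bexI[of _ y]) auto
qed

end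

section \<open>Change of variables from the ellipse to chord directions\<close>

lemma integral_period:
  fixes f :: "real \<Rightarrow> complex"
  assumes f: "continuous_on UNIV f" and per: "\<And>x. f (x + p) = f x" and p: "p > 0"
  shows "integral {u..u + p} f = integral {0..p} f"
proof -
  have int: "f integrable_on {a..b}" for a b
    by (rule integrable_continuous_real[OF continuous_on_subset[OF f]]) simp
  have cont: "continuous_on A f" for A by (rule continuous_on_subset[OF f]) simp
  define n where "n = \<lfloor>u / p\<rfloor>"
  define y where "y = u - of_int n * p"
  have "of_int n \<le> u / p" "u / p < of_int n + 1" unfolding n_def by linarith+
  then have y: "0 \<le> y" "y \<le> p" using p by (simp_all add: y_def field_simps)
  have "integral {u..u + p} f = integral {y..y + p} (\<lambda>x. f (x + of_int n * p))"
    using integral_shift[of y "of_int n * p" "y + p" f] cont by (simp add: y_def o_def algebra_simps)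
  also have "\<dots> = integral {y..y + p} f" using periodic_int_multiple[of f p, OF per] by simp
  also have "\<dots> = integral {y..p} f + integral {p..y + p} f"
    by (rule Henstock_Kurzweil_Integration.integral_combine[symmetric]) (use y int in auto)
  also have "integral {p..y + p} f = integral {0..y} (\<lambda>x. f (x + p))"
    using integral_shift[of 0 p y f] cont by (simp add: o_def)
  also have "\<dots> = integral {0..y} f" by (simp add: per)
  also have "integral {y..p} f + integral {0..y} f = integral {0..p} f"
    using Henstock_Kurzweil_Integration.integral_combine[of 0 y p f] y int by (simp add: add.commute)
  finally show ?thesis .
qed

text \<open>Substitution through an antiderivative of \<open>f\<close>. The parameter
  \<open>T\<close> runs backwards through two full periods, whence the factor -2.\<close>

lemma integral_double_cover:
  fixes f :: "real \<Rightarrow> complex"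
  assumes f: "continuous_on UNIV f" and per: "\<And>x. f (x + p) = f x" and p: "p > 0"
    and T: "\<And>y. (T has_real_derivative T' y) (at y)" and wind: "T p = T 0 - 2 * p"
  shows "integral {0..p} (\<lambda>y. T' y *\<^sub>R f (T y)) = - 2 * integral {0..p} f"
proof -
  have contT: "continuous_on {0..p} T" using T DERIV_isCont by (blast intro: continuous_at_imp_continuous_on)
  have int: "f integrable_on {a..b}" for a b
    by (rule integrable_continuous_real[OF continuous_on_subset[OF f]]) simp
  have "bounded (T ` {0..p})" by (intro compact_imp_bounded compact_continuous_image contT) simp
  then obtain R where "\<forall>z\<in>T ` {0..p}. norm z \<le> R" unfolding bounded_iff by blast
  then have R: "\<bar>T y\<bar> \<le> R" if "y \<in> {0..p}" for y using that by auto
  \<comment> \<open>\<open>R\<close> bounds \<open>T\<close> on the whole parameter interval, so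
    this antiderivative is defined at all values that \<open>T\<close> takes.\<close>
  define F where "F u = integral {-R..u} f" for u
  have F: "(F has_vector_derivative f u) (at u within {-R..R})" if "u \<in> {-R..R}" for u
    unfolding F_def by (rule integral_has_vector_derivative[OF continuous_on_subset[OF f] that]) simp
  have "((\<lambda>y. T' y *\<^sub>R f (T y)) has_integral (F \<circ> T) p - (F \<circ> T) 0) {0..p}"
  proof (rule fundamental_theorem_of_calculus)
    fix y assume y: "y \<in> {0..p}"
    have "(T has_vector_derivative T' y) (at y within {0..p})"
      using T[of y] by (simp add: has_real_derivative_iff_has_vector_derivative has_vector_derivative_at_within)
    moreover have "(F has_vector_derivative f (T y)) (at (T y) within T ` {0..p})"
    proof (rule has_vector_derivative_within_subset[OF F])
      show "T y \<in> {-R..R}" using R[OF y] by auto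
      show "T ` {0..p} \<subseteq> {-R..R}"
      proof
        fix z assume "z \<in> T ` {0..p}"
        then obtain y' where "y' \<in> {0..p}" "z = T y'" by blast
        then show "z \<in> {-R..R}" using R[of y'] by auto
      qed
    qed
    ultimately show "(F \<circ> T has_vector_derivative T' y *\<^sub>R f (T y)) (at y within {0..p})"
      by (rule vector_diff_chain_within)
  qed (use p in simp)
  then have eq: "integral {0..p} (\<lambda>y. T' y *\<^sub>R f (T y)) = F (T p) - F (T 0)" by (simp add: integral_unique)
  have lo: "- R \<le> T p" using R[of p] p by auto
  have "F (T 0) = integral {-R..T p} f + integral {T p..T 0} f"
    unfolding F_def by (rule Henstock_Kurzweil_Integration.integral_combine[symmetric]) (use lo wind p int in auto)
  also have "integral {T p..T 0} f = integral {T p..T p + p} f + integral {T p + p..(T p + p) + p} f"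
  proof -
    have "T 0 = (T p + p) + p" using wind by simp
    then show ?thesis
      using Henstock_Kurzweil_Integration.integral_combine[of "T p" "T p + p" "T 0" f] p int by simp
  qed
  finally have "F (T 0) = F (T p) + (integral {0..p} f + integral {0..p} f)"
    unfolding integral_period[OF f per p] F_def .
  then show ?thesis using eq by simp
qed

context acquisition
begin

lemma ellipse_param_frame:
  "ellipse_param \<alpha> s L t = cos \<alpha> *\<^sub>R dirv s + (L / 2 * cos t) *\<^sub>R dirp s + (sqrt (L\<^sup>2 / 4 - (sin \<alpha>)\<^sup>2) * sin t) *\<^sub>R dirv s"
  by (simp add: ellipse_param_def dirv_def dirp_def)

lemma ellipse_param_vector_derivative:
  "(ellipse_param \<alpha> s L has_vector_derivative
    (- (L / 2) * sin t) *\<^sub>R dirp s + (sqrt (L\<^sup>2 / 4 - (sin \<alpha>)\<^sup>2) * cos t) *\<^sub>R dirv s) (at t)"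
  unfolding ellipse_param_frame[abs_def]
  by (auto intro!: derivative_eq_intros simp: has_vector_derivative_def algebra_simps)

lemma norm_ellipse_param_deriv:
  "norm (vector_derivative (ellipse_param \<alpha> s L) (at t))
    = sqrt ((L / 2 * sin t)\<^sup>2 + (sqrt (L\<^sup>2 / 4 - (sin \<alpha>)\<^sup>2) * cos t)\<^sup>2)"
  unfolding vector_derivative_at[OF ellipse_param_vector_derivative[of s L t]] norm_dirp_dirv
  by (simp add: power_mult_distrib)

lemma dirv_frame: "dirv y = sin (y - s) *\<^sub>R dirp s + cos (y - s) *\<^sub>R dirv s"
  using frame_repr[of "dirv y" s] by (simp add: inner_dirv_dirp inner_dirv_dirv)

text \<open>Reparametrization of the ellipse through \<open>x\<close> by the direction of the chord from \<open>x\<close>: if \<open>x\<close> has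
  eccentric angle \<open>t\<^sub>0\<close>, the chord to the point with eccentric angle \<open>2 u - t\<^sub>0\<close> is parallel to
  \<open>(- A sin u, B cos u)\<close>. Every point is reached twice, from opposite directions.\<close>
lemma chord_parametrization:
  assumes x: "x \<in> disc"
  obtains T T' where "\<And>y. (T has_real_derivative T' y) (at y)" "\<And>y. T' y < 0" "T (2 * pi) = T 0 - 2 * (2 * pi)"
    "\<And>y. ellipse_param \<alpha> s (travel \<alpha> s x) (T y) = chord (x, s, y)"
    "\<And>t. norm (vector_derivative (ellipse_param \<alpha> s (travel \<alpha> s x)) (at t)) > 0"
proof -
  obtain A B p q where *: "travel \<alpha> s x = 2 * A" "A > sin \<alpha>" "B = sqrt (A\<^sup>2 - (sin \<alpha>)\<^sup>2)" "B > 0" "B\<^sup>2 = A\<^sup>2 - (sin \<alpha>)\<^sup>2"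
    "p = x \<bullet> dirp s" "q = x \<bullet> dirv s - cos \<alpha>" "kappa x s = (sin \<alpha>)\<^sup>2 / A\<^sup>2" "(p / A)\<^sup>2 + (q / B)\<^sup>2 = 1"
    and r': "\<And>t. rad (x, s, t) * (B\<^sup>2 * (dirv t \<bullet> dirp s)\<^sup>2 + A\<^sup>2 * (dirv t \<bullet> dirv s)\<^sup>2)
      = - 2 * (B\<^sup>2 * p * (dirv t \<bullet> dirp s) + A\<^sup>2 * q * (dirv t \<bullet> dirv s))"
    and M': "\<And>t. B\<^sup>2 * (dirv t \<bullet> dirp s)\<^sup>2 + A\<^sup>2 * (dirv t \<bullet> dirv s)\<^sup>2 > 0"
    by (rule frame_coords[OF x, of s]) blast
  have A0: "A > 0" using *(2) sin_alpha by simp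
  have E: "ellipse_param \<alpha> s (travel \<alpha> s x) t = cos \<alpha> *\<^sub>R dirv s + (A * cos t) *\<^sub>R dirp s + (B * sin t) *\<^sub>R dirv s" for t
    by (simp add: ellipse_param_frame *(1,3) power_mult_distrib)
  have "x \<in> ellipse \<alpha> s (travel \<alpha> s x)" by (simp add: ellipse_def)
  then obtain t0 where "x = ellipse_param \<alpha> s (travel \<alpha> s x) t0"
    using bij_betw_imp_surj_on[OF ellipse_param_bij[OF alpha travel_disc[OF x], of s s]] by blast
  then have x0: "x = cos \<alpha> *\<^sub>R dirv s + (A * cos t0) *\<^sub>R dirp s + (B * sin t0) *\<^sub>R dirv s" unfolding E .
  have p: "p = A * cos t0" and q: "q = B * sin t0"
    unfolding *(6,7) by (subst x0, simp add: inner_add_left frame_ends)+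
  \<comment> \<open>In the frame at \<open>s\<close> the direction \<open>dirv y\<close> has
    coordinates \<open>(sin (y - s), cos (y - s))\<close>. The angle \<open>u\<close> for which
    \<open>(- A * sin u, B * cos u)\<close> is parallel to it is minus the angle
    \<open>y - s\<close> stretched with half-axes \<open>B\<close> and \<open>A\<close> in this
    order, and \<open>T y = 2 * u - t0\<close>.\<close>
  define T where "T y = - 2 * ((y - s) + stretch_angle B A (y - s)) - t0" for y
  define T' where "T' y = - 2 * (B * A / (B\<^sup>2 * (sin (y - s))\<^sup>2 + A\<^sup>2 * (cos (y - s))\<^sup>2))" for y
  have den: "B\<^sup>2 * (sin y)\<^sup>2 + A\<^sup>2 * (cos y)\<^sup>2 > 0" for y
    using M'[of "y + s"] by (simp add: inner_dirv_dirp inner_dirv_dirv)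
  show thesis
  proof (rule that[of T T'])
    show "(T has_real_derivative T' y) (at y)" for y
      unfolding T_def T'_def
      using DERIV_diff[OF DERIV_cmult[OF DERIV_chain2[OF stretch_angle_deriv[OF *(4) A0, of "y - s"]
        DERIV_diff[OF DERIV_ident DERIV_const]], of "-2"] DERIV_const] by simp
    show "T' y < 0" for y unfolding T'_def using den[of "y - s"] A0 *(4) by simp
    have "sin (2 * pi - s) = sin (0 - s)" "cos (2 * pi - s) = cos (0 - s)" by (simp_all add: sin_diff cos_diff)
    then show "T (2 * pi) = T 0 - 2 * (2 * pi)" by (simp add: T_def stretch_angle_def)
    show "norm (vector_derivative (ellipse_param \<alpha> s (travel \<alpha> s x)) (at t)) > 0" for t
    proof -
      have "(A * sin t)\<^sup>2 + (B * cos t)\<^sup>2 > 0"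
        using stretch_angle_denominator_pos[of "A\<^sup>2" "B\<^sup>2" t] A0 *(4) by (simp add: power_mult_distrib)
      then show ?thesis unfolding norm_ellipse_param_deriv by (simp add: *(1,3) power_mult_distrib)
    qed
    show "ellipse_param \<alpha> s (travel \<alpha> s x) (T y) = chord (x, s, y)" for y
    proof -
      define \<psi> where "\<psi> = y - s"
      define u where "u = - (\<psi> + stretch_angle B A \<psi>)"
      define \<rho> where "\<rho> = sqrt (B\<^sup>2 * (sin \<psi>)\<^sup>2 + A\<^sup>2 * (cos \<psi>)\<^sup>2)"
      note dir = stretch_angle_direction[OF *(4) A0, of \<psi>, folded \<rho>_def]
      have su: "sin u = - (B * sin \<psi> / \<rho>)" and cu: "cos u = A * cos \<psi> / \<rho>"
        unfolding u_def sin_minus cos_minus dir(2,3) by simp_all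
      have Ty: "T y = 2 * u - t0" by (simp add: T_def u_def \<psi>_def)
      \<comment> \<open>By the sum-to-product formulas the points with eccentric angles
        \<open>2 * u - t0\<close> and \<open>t0\<close> differ by
        \<open>2 * w * (- A * sin u, B * cos u)\<close>.\<close>
      define w where "w = sin (u - t0)"
      have "cos (T y) - cos t0 = - 2 * sin u * w" "sin (T y) - sin t0 = 2 * cos u * w"
      proof -
        have "cos (u + v) - cos (u - v) = - 2 * sin u * sin v" "sin (u + v) - sin (u - v) = 2 * cos u * sin v" for v
          by (simp_all add: cos_add cos_diff sin_add sin_diff)
        from this[of "u - t0"] show "cos (T y) - cos t0 = - 2 * sin u * w" "sin (T y) - sin t0 = 2 * cos u * w"
          by (simp_all add: Ty w_def algebra_simps)
      qed
      then have cs: "A * cos (T y) = A * cos t0 + (2 * A * B * w / \<rho>) * sin \<psi>" "B * sin (T y) = B * sin t0 + (2 * A * B * w / \<rho>) * cos \<psi>"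
        using su cu by (simp_all add: algebra_simps)
      have "w = - (B * sin \<psi> * cos t0 + A * cos \<psi> * sin t0) / \<rho>"
        unfolding w_def sin_diff su cu using dir(1) by (simp add: field_simps)
      then have w: "w * \<rho> = - (B * sin \<psi> * cos t0 + A * cos \<psi> * sin t0)" using dir(1) by simp
      have \<rho>2: "\<rho>\<^sup>2 = B\<^sup>2 * (sin \<psi>)\<^sup>2 + A\<^sup>2 * (cos \<psi>)\<^sup>2" unfolding \<rho>_def using den[of \<psi>] by simp
      have "rad (x, s, y) * \<rho>\<^sup>2 = - 2 * (B\<^sup>2 * (A * cos t0) * sin \<psi> + A\<^sup>2 * (B * sin t0) * cos \<psi>)"
        using r'[of y] unfolding \<rho>2 p q \<psi>_def inner_dirv_dirp inner_dirv_dirv .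
      also have "\<dots> = 2 * A * B * (w * \<rho>)" unfolding w by (simp add: power2_eq_square algebra_simps)
      finally have "rad (x, s, y) * \<rho>\<^sup>2 = 2 * A * B * (w * \<rho>)" .
      then have r: "rad (x, s, y) = 2 * A * B * w / \<rho>" using dir(1) by (simp add: power2_eq_square field_simps)
      have "ellipse_param \<alpha> s (travel \<alpha> s x) (T y)
          = cos \<alpha> *\<^sub>R dirv s + (A * cos t0 + rad (x, s, y) * sin \<psi>) *\<^sub>R dirp s + (B * sin t0 + rad (x, s, y) * cos \<psi>) *\<^sub>R dirv s"
        unfolding E cs r ..
      also have "\<dots> = x + rad (x, s, y) *\<^sub>R dirv y"
      proof -
        have "x + rr *\<^sub>R dirv y = cos \<alpha> *\<^sub>R dirv s + (A * cos t0 + rr * sin \<psi>) *\<^sub>R dirp s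
            + (B * sin t0 + rr * cos \<psi>) *\<^sub>R dirv s" for rr
          by (subst x0, subst dirv_frame[of y s]) (simp add: \<psi>_def algebra_simps)
        then show ?thesis by simp
      qed
      finally show ?thesis by (simp add: chord_def)
    qed
  qed
qed

text \<open>The velocity of the end of the chord is computed twice, from polar coordinates around
  \<open>x\<close> and by the chain rule along the ellipse.\<close>

lemma jac_eq:
  assumes x: "x \<in> disc" and T: "(T has_real_derivative T') (at y)"
    and E: "\<And>y. ellipse_param \<alpha> s L (T y) = chord (x, s, y)"
  shows "jac (x, s, y) = \<bar>T'\<bar> * norm (vector_derivative (ellipse_param \<alpha> s L) (at (T y)))"
proof -
  let ?r = "rad (x, s, y)" and ?d = "dir_deriv (0, 0, 1) rad (x, s, y)"
  have dT: "(T has_vector_derivative T') (at y)" using T by (simp add: has_real_derivative_iff_has_vector_derivative)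
  have "((\<lambda>y. ellipse_param \<alpha> s L (T y)) has_vector_derivative T' *\<^sub>R vector_derivative (ellipse_param \<alpha> s L) (at (T y))) (at y)"
    using vector_diff_chain_at[OF dT, of "ellipse_param \<alpha> s L"] ellipse_param_vector_derivative[of s L "T y"]
    by (simp add: vector_derivative_at[OF ellipse_param_vector_derivative] o_def)
  then have 1: "((\<lambda>y. chord (x, s, y)) has_vector_derivative T' *\<^sub>R vector_derivative (ellipse_param \<alpha> s L) (at (T y))) (at y)"
    unfolding E .
  have "((\<lambda>y. rad (x, s, y)) has_vector_derivative ?d) (at y)"
    using has_real_derivative_slice(2)[OF rad_differentiable[OF x]]
    by (simp add: has_real_derivative_iff_has_vector_derivative)
  then have rd: "((\<lambda>y. rad (x, s, y)) has_derivative (\<lambda>h. h *\<^sub>R ?d)) (at y)" by (simp add: has_vector_derivative_def)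
  have "((\<lambda>y. chord (x, s, y)) has_derivative (\<lambda>h. 0 + (?r *\<^sub>R (h *\<^sub>R dirp y) + (h *\<^sub>R ?d) *\<^sub>R dirv y))) (at y)"
    unfolding chord_def fst_conv snd_conv
    by (intro has_derivative_add has_derivative_const has_derivative_scaleR rd has_derivative_dirv)
  then have 2: "((\<lambda>y. chord (x, s, y)) has_vector_derivative ?r *\<^sub>R dirp y + ?d *\<^sub>R dirv y) (at y)"
    unfolding has_vector_derivative_def by (rule has_derivative_eq_rhs) (simp add: fun_eq_iff algebra_simps)
  have "T' *\<^sub>R vector_derivative (ellipse_param \<alpha> s L) (at (T y)) = ?r *\<^sub>R dirp y + ?d *\<^sub>R dirv y"
    by (rule vector_derivative_unique_at[OF 1 2])
  then have "norm (T' *\<^sub>R vector_derivative (ellipse_param \<alpha> s L) (at (T y))) = jac (x, s, y)"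
    by (simp only: norm_dirp_dirv jac_def)
  then show ?thesis by simp
qed

text \<open>Where the chord degenerates, \<open>r = 0\<close>, positivity cannot be read off the
  definition. It holds because the reparametrization is regular and the ellipse has nonvanishing
  speed.\<close>

lemma jac_pos:
  assumes x: "x \<in> disc" shows "jac (x, s, y) > 0"
proof -
  obtain T T' where T: "\<And>y. (T has_real_derivative T' y) (at y)" "\<And>y. T' y < 0" "T (2 * pi) = T 0 - 2 * (2 * pi)"
    "\<And>y. ellipse_param \<alpha> s (travel \<alpha> s x) (T y) = chord (x, s, y)"
    "\<And>t. norm (vector_derivative (ellipse_param \<alpha> s (travel \<alpha> s x)) (at t)) > 0"
    by (rule chord_parametrization[OF x, of s]) blast
  show ?thesis unfolding jac_eq[OF x T(1,4)] using T(2)[of y] T(5) by (intro mult_pos_pos) auto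
qed

lemma smooth_on_jac: "smooth_on (disc \<times> UNIV) jac"
proof -
  have "(rad p)\<^sup>2 + (dir_deriv (0, 0, 1) rad p)\<^sup>2 > 0" if "p \<in> disc \<times> UNIV" for p
    using jac_pos[of "fst p" "fst (snd p)" "snd (snd p)"] that by (auto simp: jac_def)
  then show ?thesis unfolding jac_def[abs_def]
    by (intro smooth_on_sqrt smooth_on_add smooth_on_power smooth_on_dir_deriv smooth_on_rad open_disc_UNIV)
qed

text \<open>\<open>jac\<close> converts arc length into the direction angle; the factor 1/2
  compensates that each point of the ellipse is reached from two opposite directions. The sign of
  \<open>T'\<close> is absorbed by the -2 of the double cover.\<close>

lemma radon_chord:
  assumes x: "x \<in> disc" and \<phi>: "continuous_on UNIV \<phi>"
  shows "elliptical_radon \<alpha> \<phi> (s, travel \<alpha> s x)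
    = integral {0..2 * pi} (\<lambda>y. complex_of_real (jac (x, s, y) / 2) * \<phi> (chord (x, s, y)))"
proof -
  define L where "L = travel \<alpha> s x"
  obtain T T' where T': "\<And>y. (T has_real_derivative T' y) (at y)" "\<And>y. T' y < 0" "T (2 * pi) = T 0 - 2 * (2 * pi)"
    "\<And>y. ellipse_param \<alpha> s (travel \<alpha> s x) (T y) = chord (x, s, y)"
    "\<And>t. norm (vector_derivative (ellipse_param \<alpha> s (travel \<alpha> s x)) (at t)) > 0"
    by (rule chord_parametrization[OF x, of s]) blast
  note T = T'[folded L_def]
  define f where "f t = \<phi> (ellipse_param \<alpha> s L t) * complex_of_real (norm (vector_derivative (ellipse_param \<alpha> s L) (at t)))" for t
  have cE: "continuous_on UNIV (ellipse_param \<alpha> s L)"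
    unfolding ellipse_param_frame[abs_def] by (intro continuous_intros)
  have f: "continuous_on UNIV f"
    unfolding f_def norm_ellipse_param_deriv by (intro continuous_intros continuous_on_compose2[OF \<phi> cE]) auto
  have "elliptical_radon \<alpha> \<phi> (s, travel \<alpha> s x) = (LINT t:{0..2 * pi}|lborel. f t)"
    using travel_disc[OF x, of s] by (simp add: elliptical_radon_def L_def[symmetric] f_def)
  also have "\<dots> = integral {0..2 * pi} f"
    by (rule set_borel_integral_eq_integral(2)[OF borel_integrable_atLeastAtMost'[OF continuous_on_subset[OF f]]]) simp
  also have "\<dots> = - (1 / 2) * (- 2 * integral {0..2 * pi} f)" by simp
  also have "- 2 * integral {0..2 * pi} f = integral {0..2 * pi} (\<lambda>y. T' y *\<^sub>R f (T y))"
    by (rule integral_double_cover[OF f _ _ T(1,3), symmetric]) (simp_all add: f_def norm_ellipse_param_deriv ellipse_param_frame)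
  also have "- (1 / 2) * integral {0..2 * pi} (\<lambda>y. T' y *\<^sub>R f (T y)) = integral {0..2 * pi} (\<lambda>y. - (1 / 2) * (T' y *\<^sub>R f (T y)))"
    by (rule integral_mult_right[symmetric])
  also have "(\<lambda>y. - (1 / 2) * (T' y *\<^sub>R f (T y))) = (\<lambda>y. complex_of_real (jac (x, s, y) / 2) * \<phi> (chord (x, s, y)))"
  proof
    fix y
    show "- (1 / 2) * (T' y *\<^sub>R f (T y)) = complex_of_real (jac (x, s, y) / 2) * \<phi> (chord (x, s, y))"
      unfolding jac_eq[OF x T(1,4)] f_def T(4) using T(2)[of y] by (simp add: scaleR_conv_of_real)
  qed
  finally show ?thesis .
qed

lemma backprojection_radon:
  assumes x: "x \<in> disc" and \<phi>: "continuous_on UNIV \<phi>" and w: "continuous_on (disc \<times> UNIV) w"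
  shows "backprojection \<alpha> w (elliptical_radon \<alpha> \<phi>) x
    = integral (cbox (0, 0) (2 * pi, 2 * pi)) (\<lambda>q. complex_of_real (w (x, fst q) * jac (x, q) / 2) * \<phi> (chord (x, q)))"
proof -
  define g where "g q = complex_of_real (w (x, fst q) * jac (x, q) / 2) * \<phi> (chord (x, q))" for q
  have cw: "continuous_on A (\<lambda>s. w (x, s))" for A by (rule continuous_on_slice[OF w x])
  have cw': "continuous_on UNIV (\<lambda>q :: real \<times> real. w (x, fst q))"
    by (rule continuous_on_compose2[OF cw[of UNIV]]) (auto intro!: continuous_intros)
  have g: "continuous_on A g" for A
  proof -
    have "continuous_on UNIV g" unfolding g_def
      by (intro continuous_intros cw' continuous_on_slice[OF smooth_on_continuous_on[OF smooth_on_jac] x]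
          continuous_on_compose2[OF \<phi> continuous_on_slice[OF smooth_on_continuous_on[OF smooth_on_chord] x]]) auto
    then show ?thesis by (rule continuous_on_subset) simp
  qed
  have eq: "elliptical_radon \<alpha> \<phi> (s, travel \<alpha> s x) * complex_of_real (w (x, s)) = integral (cbox 0 (2 * pi)) (\<lambda>y. g (s, y))" for s
    unfolding radon_chord[OF x \<phi>] by (simp add: g_def integral_mult_left[symmetric] mult_ac)
  have "continuous_on {0..2 * pi} (\<lambda>s. integral (cbox 0 (2 * pi)) (\<lambda>y. g (s, y)))"
    by (rule integral_continuous_on_param) (simp add: g)
  then have "backprojection \<alpha> w (elliptical_radon \<alpha> \<phi>) x
      = integral {0..2 * pi} (\<lambda>s. integral (cbox 0 (2 * pi)) (\<lambda>y. g (s, y)))"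
    unfolding backprojection_def eq
    by (rule set_borel_integral_eq_integral(2)[OF borel_integrable_atLeastAtMost'])
  also have "\<dots> = integral (cbox (0, 0) (2 * pi, 2 * pi)) g"
    using integral_prod_continuous[OF g] by simp
  finally show ?thesis unfolding g_def[abs_def] .
qed

end

subsection \<open>The normal operator as a pseudodifferential operator\<close>

lemma test_functions_in_iter_deriv:
  assumes "\<phi> \<in> test_functions_in K" "compact K"
  shows "iter_deriv vs \<phi> \<in> test_functions_in K"
  by (induction vs) (use assms in \<open>auto intro: test_functions_in_dir_deriv\<close>)

text \<open>A real supremum is informative only for bounded sets. Here finitely many derivative
  lists occur, and each derivative is continuous on the compact set.\<close>

lemma Ck_norm_bdd:
  fixes f :: "'a::euclidean_space \<Rightarrow> complex"
  assumes f: "open U" "smooth_on U f" and K: "compact K" "K \<subseteq> U"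
  shows "bdd_above (insert 0 {norm (iter_deriv vs f x) | vs x. vs \<in> lists Basis \<and> length vs \<le> N \<and> x \<in> K})"
proof -
  define V where "V = {vs. set vs \<subseteq> (Basis :: 'a set) \<and> length vs \<le> N}"
  have fin: "finite V" unfolding V_def by (rule finite_lists_length_le[OF finite_Basis])
  have "\<exists>M\<ge>0. \<forall>x\<in>K. norm (iter_deriv vs f x) \<le> M" if "vs \<in> V" for vs
  proof -
    have "vs \<in> lists Basis" using that by (auto simp: V_def)
    then have "continuous_on K (iter_deriv vs f)"
      using smooth_on_continuous_on[OF smooth_on_iter_deriv[OF f(2)]] continuous_on_subset[OF _ K(2)] by blast
    then have "bounded (iter_deriv vs f ` K)" by (intro compact_imp_bounded compact_continuous_image K)
    then obtain M where "\<forall>y\<in>iter_deriv vs f ` K. norm y \<le> M" using bounded_iff by metis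
    then show ?thesis by (intro exI[of _ "max M 0"]) (auto intro: max.coboundedI1)
  qed
  then obtain M where M: "\<And>vs. vs \<in> V \<Longrightarrow> M vs \<ge> 0" "\<And>vs x. vs \<in> V \<Longrightarrow> x \<in> K \<Longrightarrow> norm (iter_deriv vs f x) \<le> M vs"
    by metis
  have "norm (iter_deriv vs f x) \<le> sum M V" if "vs \<in> V" "x \<in> K" for vs x
    by (rule order_trans[OF M(2)[OF that] member_le_sum[of vs V M]]) (use that M(1) fin in auto)
  moreover have "0 \<le> sum M V" by (intro sum_nonneg M(1))
  ultimately show ?thesis
    by (intro bdd_aboveI[where M = "sum M V"]) (auto simp: V_def lists_eq_set)
qed

lemma Ck_norm_nonneg:
  assumes "open U" "smooth_on U f" "compact K" "K \<subseteq> U" shows "0 \<le> Ck_norm N K f"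
  unfolding Ck_norm_def by (rule cSup_upper[OF insertI1 Ck_norm_bdd[OF assms]])

lemma iter_deriv_le_Ck_norm:
  assumes \<phi>: "\<phi> \<in> test_functions_in K" "compact K" and vs: "vs \<in> lists Basis" "length vs \<le> N"
  shows "norm (iter_deriv vs \<phi> x) \<le> Ck_norm N K \<phi>"
proof -
  have sm: "smooth_on UNIV \<phi>" using \<phi>(1) by (simp add: test_functions_in_def)
  show ?thesis
  proof (cases "x \<in> K")
    case True
    show ?thesis unfolding Ck_norm_def
      by (rule cSup_upper[OF _ Ck_norm_bdd[OF open_UNIV sm \<phi>(2) subset_UNIV]]) (use True vs in blast)
  next
    case False
    then show ?thesis
      using test_functions_in_iter_deriv[OF \<phi>, of vs] Ck_norm_nonneg[OF open_UNIV sm \<phi>(2) subset_UNIV]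
      by (simp add: test_functions_in_def)
  qed
qed

lemma Ck_norm_le:
  assumes "\<And>vs x. vs \<in> lists Basis \<Longrightarrow> length vs \<le> N \<Longrightarrow> x \<in> K \<Longrightarrow> norm (iter_deriv vs f x) \<le> M" "M \<ge> 0"
  shows "Ck_norm N K f \<le> M"
  unfolding Ck_norm_def by (rule cSup_least) (use assms in auto)

text \<open>The difference vanishes on the open set together with all its derivatives, so its
  seminorm over the compact set is 0. This is needed because the backprojection agrees with a smooth
  function on the disc only.\<close>

lemma compact_distribution_cong:
  assumes u: "u \<in> compact_distributions U" and U: "open U" and f: "smooth_on U f"
    and eq: "\<And>x. x \<in> U \<Longrightarrow> f x = g x"
  shows "u f = u g"
proof -
  have g: "smooth_on U g" by (rule smooth_on_cong[OF U eq f])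
  obtain K C N where K: "compact K" "K \<subseteq> U" "\<And>\<phi>. smooth_on U \<phi> \<Longrightarrow> norm (u \<phi>) \<le> C * Ck_norm N K \<phi>"
    using u unfolding compact_distributions_def by blast
  have lin: "u (\<lambda>x. \<phi> x + \<psi> x) = u \<phi> + u \<psi>" "u (\<lambda>x. c * \<phi> x) = c * u \<phi>"
    if "smooth_on U \<phi>" "smooth_on U \<psi>" for \<phi> \<psi> c
    using u that unfolding compact_distributions_def linear_functional_on_def by auto
  have m: "smooth_on U (\<lambda>x. (-1) * g x)" by (intro smooth_on_mult U smooth_on_const g)
  define h where "h x = f x + (-1) * g x" for x
  have h: "smooth_on U h" unfolding h_def by (rule smooth_on_add[OF U f m])
  have "u h = u f + (-1) * u g" unfolding h_def lin(1)[OF f m] lin(2)[OF g g] ..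
  moreover have "norm (u h) \<le> 0"
  proof -
    have z: "iter_deriv vs h x = 0" if "vs \<in> lists Basis" "x \<in> U" for vs x
      using iter_deriv_cong[OF U h, of "\<lambda>_. 0" vs x] eq that by (simp add: h_def)
    have "insert 0 {norm (iter_deriv vs h x) | vs x. vs \<in> lists Basis \<and> length vs \<le> N \<and> x \<in> K} = {0}"
      using z K(2) by fastforce
    then have "Ck_norm N K h = 0" by (simp only: Ck_norm_def cSup_singleton)
    then show ?thesis using K(3)[OF h] by simp
  qed
  ultimately show ?thesis by simp
qed

lemma dir_deriv_linear_arg:
  assumes "bounded_linear l" "f differentiable (at (l x))"
  shows "(\<lambda>x. f (l x)) differentiable (at x)" "dir_deriv v (\<lambda>x. f (l x)) x = dir_deriv (l v) f (l x)"
proof -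
  have "((\<lambda>x. f (l x)) has_derivative (\<lambda>v. dir_deriv (l v) f (l x))) (at x)"
    using diff_chain_at[OF bounded_linear_imp_has_derivative[OF assms(1)] has_derivative_dir_deriv[OF assms(2)]]
    by (simp add: o_def)
  then show "(\<lambda>x. f (l x)) differentiable (at x)" "dir_deriv v (\<lambda>x. f (l x)) x = dir_deriv (l v) f (l x)"
    using dir_deriv_eqI differentiable_def by blast+
qed

section \<open>Averages over chords\<close>

context acquisition
begin

abbreviation torus where "torus \<equiv> cbox (0, 0) (2 * pi, 2 * pi) :: (real \<times> real) set"

definition average :: "((real^2) \<times> real \<times> real \<Rightarrow> complex) \<Rightarrow> (real^2 \<Rightarrow> complex) \<Rightarrow> real^2 \<Rightarrow> complex" where
  "average c \<phi> x = integral torus (\<lambda>q. c (x, q) * \<phi> (chord (x, q)))"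

lemma average_integrand_smooth:
  fixes c :: "(real^2) \<times> real \<times> real \<Rightarrow> complex"
  assumes "smooth_on (disc \<times> UNIV) c" "smooth_on UNIV \<phi>"
  shows "smooth_on (disc \<times> UNIV) (\<lambda>p. c p * \<phi> (chord p))"
  by (intro smooth_on_mult open_disc_UNIV assms(1) smooth_on_compose_UNIV[OF open_disc_UNIV assms(2) smooth_on_chord])

lemma average_smooth:
  assumes "smooth_on (disc \<times> UNIV) c" "smooth_on UNIV \<phi>"
  shows "smooth_on disc (average c \<phi>)"
  unfolding average_def[abs_def]
  using smooth_on_param_integral[OF open_ball average_integrand_smooth[OF assms]] .

lemma average_integrable:
  fixes c :: "(real^2) \<times> real \<times> real \<Rightarrow> complex"
  assumes "smooth_on (disc \<times> UNIV) c" "smooth_on UNIV \<phi>" "x \<in> disc"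
  shows "(\<lambda>q. c (x, q) * \<phi> (chord (x, q))) integrable_on torus"
  by (rule integrable_continuous, rule continuous_on_slice[OF smooth_on_continuous_on[OF average_integrand_smooth[OF assms(1,2)]] assms(3)])

text \<open>Differentiation falls on the weight or, through the end of the chord, on
  \<open>\<phi>\<close>; both results are averages again, with new weights.\<close>

lemma dir_deriv_average:
  assumes c: "smooth_on (disc \<times> UNIV) c" and \<phi>: "smooth_on UNIV \<phi>" and x: "x \<in> disc"
  shows "dir_deriv u (average c \<phi>) x = average (dir_deriv (u, 0) c) \<phi> x
    + (\<Sum>j\<in>Basis. average (\<lambda>p. c p * complex_of_real (dir_deriv (u, 0) chord p \<bullet> j)) (dir_deriv j \<phi>) x)"
proof -
  note sm = average_integrand_smooth[OF c \<phi>]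
  have cj: "smooth_on (disc \<times> UNIV) (\<lambda>p. c p * complex_of_real (dir_deriv (u, 0) chord p \<bullet> j))" for j
    by (intro smooth_on_mult smooth_on_of_real smooth_on_inner smooth_on_dir_deriv smooth_on_chord smooth_on_const
        open_disc_UNIV c)
  have "dir_deriv u (average c \<phi>) x = integral torus (\<lambda>q. dir_deriv (u, 0) (\<lambda>p. c p * \<phi> (chord p)) (x, q))"
    unfolding average_def[abs_def] by (rule dir_deriv_param_integral[OF open_ball x sm])
  also have "\<dots> = integral torus (\<lambda>q. dir_deriv (u, 0) c (x, q) * \<phi> (chord (x, q))
      + (\<Sum>j\<in>Basis. (c (x, q) * complex_of_real (dir_deriv (u, 0) chord (x, q) \<bullet> j)) * dir_deriv j \<phi> (chord (x, q))))"
  proof (rule Henstock_Kurzweil_Integration.integral_cong)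
    fix q :: "real \<times> real"
    have p: "(x, q) \<in> disc \<times> UNIV" using x by simp
    have dc: "chord differentiable (at (x, q))" by (rule smooth_on_differentiable[OF smooth_on_chord p])
    have d\<phi>: "\<phi> differentiable (at (chord (x, q)))" by (rule smooth_on_differentiable[OF \<phi> UNIV_I])
    have "(\<lambda>p. \<phi> (chord p)) differentiable (at (x, q))"
      using differentiable_chain_at[OF dc d\<phi>] by (simp add: o_def)
    from dir_deriv_mult[OF smooth_on_differentiable[OF c p] this, of "(u, 0)"]
    show "dir_deriv (u, 0) (\<lambda>p. c p * \<phi> (chord p)) (x, q) = dir_deriv (u, 0) c (x, q) * \<phi> (chord (x, q))
      + (\<Sum>j\<in>Basis. (c (x, q) * complex_of_real (dir_deriv (u, 0) chord (x, q) \<bullet> j)) * dir_deriv j \<phi> (chord (x, q)))"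
      unfolding dir_deriv_compose[OF dc d\<phi>]
      by (simp add: scaleR_conv_of_real[where 'a = complex] sum_distrib_left mult.assoc add.commute)
  qed
  also have "\<dots> = average (dir_deriv (u, 0) c) \<phi> x
    + (\<Sum>j\<in>Basis. average (\<lambda>p. c p * complex_of_real (dir_deriv (u, 0) chord p \<bullet> j)) (dir_deriv j \<phi>) x)"
    unfolding average_def
    by (subst Henstock_Kurzweil_Integration.integral_add; (subst integral_sum)?)
      (auto intro!: average_integrable integrable_sum smooth_on_dir_deriv open_disc_UNIV c \<phi> x cj)
  finally show ?thesis .
qed

text \<open>Derivatives are removed from the inner end of \<open>us\<close> and moved onto the
  weight or onto \<open>\<phi>\<close>, where they join \<open>vs\<close>; the total order never
  exceeds \<open>N\<close>. The constant depends neither on \<open>\<phi>\<close> nor on its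
  support.\<close>

lemma average_iter_deriv_bound:
  assumes "us \<in> lists Basis" "vs \<in> lists Basis" "smooth_on (disc \<times> UNIV) c" "compact K'" "K' \<subseteq> disc"
    and "length us + length vs \<le> N"
  shows "\<exists>C\<ge>0. \<forall>K \<phi>. compact K \<and> \<phi> \<in> test_functions_in K \<longrightarrow>
    (\<forall>x\<in>K'. norm (iter_deriv us (average c (iter_deriv vs \<phi>)) x) \<le> C * Ck_norm N K \<phi>)"
proof -
  have lists: "us \<in> lists Basis \<longleftrightarrow> set us \<subseteq> Basis" for us :: "(real^2) list" by auto
  show ?thesis using assms(1,2,3,6) unfolding lists
  proof (induction us arbitrary: vs c rule: rev_induct)
    case Nil
    have cc: "continuous_on (K' \<times> torus) c"
      by (rule continuous_on_subset[OF smooth_on_continuous_on[OF Nil(3)]]) (use assms(5) in auto)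
    have "bounded (c ` (K' \<times> torus))"
      by (intro compact_imp_bounded compact_continuous_image cc compact_Times assms(4) compact_cbox)
    then obtain M where "\<forall>y\<in>c ` (K' \<times> torus). norm y \<le> M" unfolding bounded_iff by blast
    then have M: "norm (c (x, q)) \<le> max M 0" if "x \<in> K'" "q \<in> torus" for x q
      using that by (force intro: max.coboundedI1)
    have "norm (iter_deriv [] (average c (iter_deriv vs \<phi>)) x) \<le> (max M 0 * (2 * pi)\<^sup>2) * Ck_norm N K \<phi>"
      if K: "compact K" "\<phi> \<in> test_functions_in K" and x: "x \<in> K'" for K \<phi> x
    proof -
      have "norm (integral torus (\<lambda>q. c (x, q) * iter_deriv vs \<phi> (chord (x, q)))) \<le> integral torus (\<lambda>q. max M 0 * Ck_norm N K \<phi>)"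
      proof (rule integral_norm_bound_integral[OF average_integrable])
        show "smooth_on UNIV (iter_deriv vs \<phi>)"
          using test_functions_in_iter_deriv[OF K(2,1)] by (simp add: test_functions_in_def)
        show "norm (c (x, q) * iter_deriv vs \<phi> (chord (x, q))) \<le> max M 0 * Ck_norm N K \<phi>" if "q \<in> torus" for q
          unfolding norm_mult
          by (intro mult_mono M x that iter_deriv_le_Ck_norm K) (use Nil in auto)
      qed (use Nil x assms(5) in auto)
      also have "\<dots> = (max M 0 * (2 * pi)\<^sup>2) * Ck_norm N K \<phi>"
        by (simp add: integral_const_real content_Pair power2_eq_square)
      finally show ?thesis by (simp add: average_def)
    qed
    then show ?case by (intro exI[of _ "max M 0 * (2 * pi)\<^sup>2"]) auto
  next
    case (snoc u us)
    have us: "set us \<subseteq> Basis" "u \<in> Basis" using snoc.prems(1) by auto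
    define cj where "cj j p = c p * complex_of_real (dir_deriv (u, 0) chord p \<bullet> j)" for j p
    have cj: "smooth_on (disc \<times> UNIV) (cj j)" for j
      unfolding cj_def by (intro smooth_on_mult smooth_on_of_real smooth_on_inner smooth_on_dir_deriv smooth_on_chord smooth_on_const
        open_disc_UNIV snoc.prems)
    have c0: "smooth_on (disc \<times> UNIV) (dir_deriv (u, 0) c)"
      by (rule smooth_on_dir_deriv[OF open_disc_UNIV snoc.prems(3)])
    obtain C0 where C0: "C0 \<ge> 0" "\<And>K \<phi> x. compact K \<Longrightarrow> \<phi> \<in> test_functions_in K \<Longrightarrow> x \<in> K' \<Longrightarrow>
        norm (iter_deriv us (average (dir_deriv (u, 0) c) (iter_deriv vs \<phi>)) x) \<le> C0 * Ck_norm N K \<phi>"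
      using snoc.IH[OF us(1) snoc.prems(2) c0] snoc.prems(4) by auto
    have "\<forall>j\<in>Basis. \<exists>C\<ge>0. \<forall>K \<phi>. compact K \<and> \<phi> \<in> test_functions_in K \<longrightarrow>
        (\<forall>x\<in>K'. norm (iter_deriv us (average (cj j) (iter_deriv (j # vs) \<phi>)) x) \<le> C * Ck_norm N K \<phi>)"
    proof
      fix j :: "real^2" assume "j \<in> Basis"
      then show "\<exists>C\<ge>0. \<forall>K \<phi>. compact K \<and> \<phi> \<in> test_functions_in K \<longrightarrow>
        (\<forall>x\<in>K'. norm (iter_deriv us (average (cj j) (iter_deriv (j # vs) \<phi>)) x) \<le> C * Ck_norm N K \<phi>)"
        by (intro snoc.IH[OF us(1) _ cj]) (use snoc.prems(2,4) in auto)
    qed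
    then obtain C where C: "\<And>j. j \<in> Basis \<Longrightarrow> C j \<ge> 0" "\<And>j K \<phi> x. j \<in> Basis \<Longrightarrow> compact K \<Longrightarrow> \<phi> \<in> test_functions_in K \<Longrightarrow> x \<in> K' \<Longrightarrow>
        norm (iter_deriv us (average (cj j) (iter_deriv (j # vs) \<phi>)) x) \<le> C j * Ck_norm N K \<phi>"
      by metis
    have "norm (iter_deriv (us @ [u]) (average c (iter_deriv vs \<phi>)) x) \<le> (C0 + (\<Sum>j\<in>Basis. C j)) * Ck_norm N K \<phi>"
      if K: "compact K" "\<phi> \<in> test_functions_in K" and x: "x \<in> K'" for K \<phi> x
    proof -
      have xd: "x \<in> disc" using x assms(5) by blast
      have usl: "us \<in> lists Basis" using us(1) by auto
      have sm: "smooth_on UNIV (iter_deriv vs \<phi>)" for vs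
        using test_functions_in_iter_deriv[OF K(2,1)] by (simp add: test_functions_in_def)
      have s1: "smooth_on disc (average (dir_deriv (u, 0) c) (iter_deriv vs \<phi>))"
        by (rule average_smooth[OF c0 sm])
      have s2: "smooth_on disc (average (cj j) (iter_deriv (j # vs) \<phi>))" for j
        by (rule average_smooth[OF cj sm])
      have s3: "smooth_on disc (\<lambda>x. \<Sum>j\<in>Basis. average (cj j) (iter_deriv (j # vs) \<phi>) x)"
        by (rule smooth_on_sum[OF open_ball finite_Basis s2])
      have "iter_deriv (us @ [u]) (average c (iter_deriv vs \<phi>)) x
          = iter_deriv us (dir_deriv u (average c (iter_deriv vs \<phi>))) x"
        by (simp add: iter_deriv_append)
      also have "\<dots> = iter_deriv us (\<lambda>x. average (dir_deriv (u, 0) c) (iter_deriv vs \<phi>) x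
          + (\<Sum>j\<in>Basis. average (cj j) (iter_deriv (j # vs) \<phi>) x)) x"
        by (rule iter_deriv_cong[OF open_ball smooth_on_dir_deriv[OF open_ball average_smooth[OF snoc.prems(3) sm]] _ usl xd])
          (simp add: dir_deriv_average[OF snoc.prems(3) sm] cj_def[abs_def])
      also have "\<dots> = iter_deriv us (average (dir_deriv (u, 0) c) (iter_deriv vs \<phi>)) x
          + (\<Sum>j\<in>Basis. iter_deriv us (average (cj j) (iter_deriv (j # vs) \<phi>)) x)"
        by (subst iter_deriv_add[OF open_ball s1 s3 usl xd], subst iter_deriv_sum[OF open_ball finite_Basis s2 usl xd]) (rule refl)
      also have "norm \<dots> \<le> C0 * Ck_norm N K \<phi> + (\<Sum>j\<in>Basis. C j * Ck_norm N K \<phi>)"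
        by (intro order_trans[OF norm_triangle_ineq] add_mono C0 K x order_trans[OF norm_sum] sum_mono C)
      finally show ?thesis by (simp only: distrib_right sum_distrib_right)
    qed
    then show ?case using C0(1) C(1) by (intro exI[of _ "C0 + (\<Sum>j\<in>Basis. C j)"]) (auto intro!: add_nonneg_nonneg sum_nonneg)
  qed
qed


text \<open>Multiplying the amplitude at \<open>(y, x)\<close> by \<open>cutoff\<close> of the end of the chord and dividing it by
  \<open>cutoff y\<close> does not change the operator, as these cancel when \<open>y\<close> is the end of the chord. It makes the
  amplitude vanish smoothly where the chord ends outside of the disc and the phase may be critical.\<close>
definition cutoff :: "real^2 \<Rightarrow> real" where
  "cutoff z = flat ((cos \<alpha>)\<^sup>2 - z \<bullet> z)"

lemma cutoff_pos_iff: "cutoff z > 0 \<longleftrightarrow> z \<in> disc"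
proof -
  have "z \<bullet> z < (cos \<alpha>)\<^sup>2 \<longleftrightarrow> norm z < cos \<alpha>"
    unfolding power2_norm_eq_inner[symmetric] using cos_alpha by (auto intro: power_strict_mono power_less_imp_less_base)
  then show ?thesis unfolding cutoff_def flat_pos_iff by simp
qed

lemma cutoff_nonneg: "cutoff z \<ge> 0"
  by (simp add: cutoff_def flat_nonneg)

lemma cutoff_eq_0: "z \<notin> disc \<Longrightarrow> cutoff z = 0"
  using cutoff_pos_iff[of z] cutoff_nonneg[of z] by linarith

lemma smooth_on_cutoff: "smooth_on UNIV cutoff"
  unfolding cutoff_def
  by (intro smooth_on_compose_UNIV[OF open_UNIV smooth_on_flat] smooth_on_diff smooth_on_inner smooth_on_const
      smooth_on_ident open_UNIV)

text \<open>The chord is taken at the second base point and with reversed sign because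
  \<open>transpose_amplitude\<close> swaps the base points and reflects the covector; after
  transposition the phase is \<open>rad\<close> at \<open>x\<close>.\<close>

definition phase_fn :: "((real^2) \<times> (real^2)) \<times> real \<times> real \<Rightarrow> real" where
  "phase_fn p = - rad (snd (fst p), snd p)"

text \<open>The closed disc makes the complement open, and \<open>bolker\<close> reaches up to the
  boundary.\<close>

definition chord_in_disc :: "(((real^2) \<times> (real^2)) \<times> real \<times> real) set" where
  "chord_in_disc = {p. norm (chord (snd (fst p), snd p)) \<le> cos \<alpha>}"

lemma bounded_linear_forget: "bounded_linear (\<lambda>p :: ('a::real_normed_vector \<times> 'b::real_normed_vector) \<times> 'c::real_normed_vector. (snd (fst p), snd p))"
  by (intro bounded_linear_Pair bounded_linear_snd_comp bounded_linear_fst bounded_linear_snd)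

lemma smooth_on_forget:
  assumes "smooth_on (disc \<times> (UNIV :: (real \<times> real) set)) f"
  shows "smooth_on ((disc \<times> disc) \<times> UNIV) (\<lambda>p. f (snd (fst p), snd p))"
  by (rule smooth_on_compose[OF _ open_disc_UNIV _ assms smooth_on_bounded_linear[OF bounded_linear_forget]])
    (auto intro!: open_Times)

lemma phase_deriv:
  assumes "y \<in> disc"
  shows "dir_deriv (0, 1, 0) phase_fn ((x, y), s, t) = - dir_deriv (0, 1, 0) rad (y, s, t)"
proof -
  let ?l = "\<lambda>p :: ((real^2) \<times> (real^2)) \<times> real \<times> real. (snd (fst p), snd p)"
  have d: "rad differentiable (at (?l ((x, y), s, t)))" using rad_differentiable[OF assms] by simp
  note D = dir_deriv_linear_arg[OF bounded_linear_forget d]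
  show ?thesis
    unfolding phase_fn_def[abs_def] dir_deriv_linear_comp[OF bounded_linear_minus[OF bounded_linear_ident] D(1)] D(2)
    by simp
qed

sublocale phase: oscillatory "disc \<times> disc" phase_fn chord_in_disc
proof
  show "open (disc \<times> disc)" by (intro open_Times open_ball)
  show "smooth_on ((disc \<times> disc) \<times> UNIV) phase_fn"
    unfolding phase_fn_def[abs_def]
    by (intro smooth_on_minus smooth_on_forget smooth_on_rad open_Times open_ball open_UNIV)
  show "phase_fn (z, s + 2 * pi, t) = phase_fn (z, s, t)" "phase_fn (z, s, t + 2 * pi) = phase_fn (z, s, t)" for z s t
    by (simp_all add: phase_fn_def rad_periodic)
  have "open ((disc \<times> disc) \<times> UNIV \<inter> (\<lambda>p. norm (chord (snd (fst p), snd p))) -` {cos \<alpha><..})"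
    by (intro continuous_open_preimage continuous_on_norm smooth_on_continuous_on[OF smooth_on_forget[OF smooth_on_chord]]
        open_Times open_ball open_UNIV open_greaterThan)
  moreover have "(disc \<times> disc) \<times> UNIV \<inter> (\<lambda>p. norm (chord (snd (fst p), snd p))) -` {cos \<alpha><..}
    = (disc \<times> disc) \<times> UNIV - chord_in_disc" by (auto simp: chord_in_disc_def)
  ultimately show "open ((disc \<times> disc) \<times> UNIV - chord_in_disc)" by simp
  show "dir_deriv (0, 1, 0) phase_fn p \<noteq> 0" if "p \<in> (disc \<times> disc) \<times> UNIV" "p \<in> chord_in_disc" for p
    using that bolker by (auto simp: chord_in_disc_def phase_deriv)
qed

end

section \<open>The symbol of the normal operator\<close>

locale weighted_acquisition = acquisition +
  fixes w :: "(real^2) \<times> real \<Rightarrow> real"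
  assumes smooth_w: "smooth_on (disc \<times> UNIV) w"
    and w_pos: "\<And>x s. x \<in> disc \<Longrightarrow> w (x, s) > 0"
    and w_periodic: "\<And>x s. x \<in> disc \<Longrightarrow> w (x, s + 2 * pi) = w (x, s)"
begin

definition weight :: "(real^2) \<times> real \<times> real \<Rightarrow> real" where
  "weight p = w (fst p, fst (snd p)) * jac p / 2"

lemma smooth_on_weight: "smooth_on (disc \<times> UNIV) weight"
proof -
  have "smooth_on (disc \<times> (UNIV :: (real \<times> real) set)) (\<lambda>p. w (fst p, fst (snd p)))"
    by (rule smooth_on_compose[OF open_disc_UNIV _ _ smooth_w])
      (auto intro!: open_Times smooth_on_Pair smooth_on_fst smooth_on_snd smooth_on_ident open_disc_UNIV)
  then show ?thesis unfolding weight_def[abs_def]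
    by (intro smooth_on_divide smooth_on_mult smooth_on_jac smooth_on_const open_disc_UNIV) auto
qed

lemma weight_pos: "x \<in> disc \<Longrightarrow> weight (x, q) > 0"
  using w_pos[of x "fst q"] jac_pos[of x "fst q" "snd q"] by (simp add: weight_def)

lemma weight_periodic:
  assumes "x \<in> disc"
  shows "weight (x, s + 2 * pi, t) = weight (x, s, t)" "weight (x, s, t + 2 * pi) = weight (x, s, t)"
  using assms by (simp_all add: weight_def jac_def w_periodic rad_periodic dir_deriv_rad_periodic)

definition amplitude :: "((real^2) \<times> (real^2)) \<times> real \<times> real \<Rightarrow> complex" where
  "amplitude p = complex_of_real (weight (snd (fst p), snd p) * cutoff (chord (snd (fst p), snd p)) / cutoff (fst (fst p)))"

abbreviation normal_symbol where "normal_symbol \<equiv> phase.osc amplitude"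

lemma amplitude_amp: "amplitude \<in> phase.amp"
proof -
  have o: "open ((disc \<times> disc) \<times> (UNIV :: (real \<times> real) set))" by (intro open_Times open_ball open_UNIV)
  have "smooth_on ((disc \<times> disc) \<times> UNIV) amplitude"
    unfolding amplitude_def[abs_def]
  proof (intro smooth_on_of_real smooth_on_divide smooth_on_mult smooth_on_forget[OF smooth_on_weight] o
      smooth_on_compose_UNIV[OF o smooth_on_cutoff] smooth_on_forget[OF smooth_on_chord])
    show "smooth_on ((disc \<times> disc) \<times> (UNIV :: (real \<times> real) set)) (\<lambda>p. fst (fst p))"
      by (intro smooth_on_fst smooth_on_ident o)
    show "cutoff (fst (fst p)) \<noteq> 0" if "p \<in> (disc \<times> disc) \<times> UNIV" for p :: "((real^2) \<times> (real^2)) \<times> real \<times> real"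
      using that cutoff_pos_iff[of "fst (fst p)"] by auto
  qed
  moreover have "amplitude p = 0" if "p \<notin> chord_in_disc" for p
    using that cutoff_eq_0[of "chord (snd (fst p), snd p)"] by (simp add: amplitude_def chord_in_disc_def)
  moreover have "chord (x, s + 2 * pi, t) = chord (x, s, t)" "chord (x, s, t + 2 * pi) = chord (x, s, t)" for x s t
    by (simp_all add: chord_def rad_periodic dirv_def)
  ultimately show ?thesis
    by (auto simp: phase.amp_def phase.coef_def amplitude_def weight_periodic)
qed

lemma symbol_normal: "normal_symbol \<in> symbol_class (-1) (disc \<times> disc)"
  by (rule phase.osc_symbol_class[OF amplitude_amp])

text \<open>On the diagonal, where \<open>rad\<close> vanishes the chord ends at its starting point,
  so the two cutoffs cancel and the amplitude is the positive weight. Zeros of \<open>rad\<close>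
  exist in every direction by \<open>rad_zero_exists\<close>.\<close>

lemma elliptic_normal: "elliptic_symbol (-1) disc (\<lambda>(x, \<xi>). normal_symbol ((x, x), \<xi>))"
proof -
  have "\<exists>c>0. \<exists>M. \<forall>z\<in>K. \<forall>\<xi>. norm \<xi> \<ge> M \<longrightarrow> norm (normal_symbol ((z, z), \<xi>)) \<ge> c * (1 + norm \<xi>) powr (-1)"
    if K: "compact K" "K \<subseteq> disc" for K
  proof -
    let ?K = "(\<lambda>x. (x, x)) ` K"
    have "\<exists>c>0. \<exists>M. \<forall>z\<in>?K. \<forall>\<xi>. norm \<xi> \<ge> M \<longrightarrow> norm (normal_symbol (z, \<xi>)) \<ge> c * (1 + norm \<xi>) powr (-1)"
    proof (rule phase.osc_elliptic[OF amplitude_amp])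
      show "compact ?K" by (intro compact_continuous_image continuous_intros K)
      show "?K \<subseteq> disc \<times> disc" using K(2) by auto
      show "Im (amplitude (z, q)) = 0" for z q by (simp add: amplitude_def)
      show "Re (amplitude (z, q)) \<ge> 0" if "z \<in> ?K" for z q
      proof -
        have "weight (snd z, q) > 0" using that K(2) by (intro weight_pos) auto
        then show ?thesis by (simp add: amplitude_def cutoff_nonneg)
      qed
      show "\<exists>s\<in>{0..2 * pi}. phase_fn (z, s, t) = 0" if "z \<in> ?K" for z t
        using that K(2) rad_zero_exists by (auto simp: phase_fn_def)
      show "Re (amplitude (z, q)) > 0" if z: "z \<in> ?K" "phase_fn (z, q) = 0" for z q
      proof -
        obtain x where x: "x \<in> disc" "z = (x, x)" "rad (x, q) = 0"
          using z K(2) by (auto simp: phase_fn_def)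
        then have "chord (x, q) = x" "cutoff x > 0" "weight (x, q) > 0"
          using cutoff_pos_iff weight_pos by (auto simp: chord_def simp del: mem_ball_0)
        then show ?thesis by (simp add: amplitude_def x)
      qed
    qed
    then show ?thesis by auto
  qed
  then show ?thesis by (auto simp: elliptic_symbol_def)
qed

abbreviation normal_average where "normal_average \<equiv> average (\<lambda>p. complex_of_real (weight p))"

lemma smooth_on_complex_weight: "smooth_on (disc \<times> UNIV) (\<lambda>p. complex_of_real (weight p))"
  by (intro smooth_on_of_real smooth_on_weight open_disc_UNIV)

lemma backprojection_radon_average:
  assumes "smooth_on UNIV \<phi>" "x \<in> disc"
  shows "backprojection \<alpha> w (elliptical_radon \<alpha> \<phi>) x = normal_average \<phi> x"
  using backprojection_radon[OF assms(2) smooth_on_continuous_on[OF assms(1)] smooth_on_continuous_on[OF smooth_w]]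
  by (simp add: average_def weight_def)

text \<open>The transposed amplitude at \<open>(x, y)\<close> depends on \<open>y\<close> only
  through \<open>1 / cutoff y\<close>. The integral over \<open>y\<close> is therefore a Fourier
  transform, the character at \<open>x\<close> combines with the phase to the character at the end
  of the chord, and inversion evaluates the function there.\<close>

lemma pseudodiff_normal:
  assumes \<phi>: "\<phi> \<in> test_functions disc" and x: "x \<in> disc"
  shows "pseudodiff (transpose_amplitude normal_symbol) \<phi> x = normal_average \<phi> x"
proof -
  obtain K where K: "compact K" "K \<subseteq> disc" and \<phi>K: "\<phi> \<in> test_functions_in K"
    using \<phi> by (auto simp: test_functions_def)
  have \<phi>0: "\<phi> y = 0" if "y \<notin> disc" for y using \<phi>K K(2) that unfolding test_functions_in_def by blast
  \<comment> \<open>Takes over the factor \<open>1 / cutoff y\<close> of the amplitude; it stays a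
    test function because the cutoff is positive on the disc, which contains the support of
    \<open>\<phi>\<close>.\<close>
  define \<psi> where "\<psi> y = complex_of_real (inverse (cutoff y)) * \<phi> y" for y
  have \<psi>: "\<psi> \<in> test_functions_in K"
  proof -
    have sm: "smooth_on UNIV \<phi>" using \<phi>K by (simp add: test_functions_in_def)
    have z: "\<psi> y = 0" if "y \<notin> K" for y using \<phi>K that by (simp add: test_functions_in_def \<psi>_def)
    have "cutoff y \<noteq> 0" if "y \<in> disc" for y using that cutoff_pos_iff[of y] by linarith
    then have 1: "smooth_on disc \<psi>"
      unfolding \<psi>_def[abs_def]
      by (intro smooth_on_mult smooth_on_of_real smooth_on_inverse smooth_on_subset[OF smooth_on_cutoff]
          smooth_on_subset[OF sm] open_ball subset_UNIV)
    have 2: "smooth_on (- K) \<psi>"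
      by (rule smooth_on_cong[of _ "\<lambda>_. 0", OF _ _ smooth_on_const])
        (use z K(1) in \<open>simp_all add: compact_imp_closed open_Compl\<close>)
    have "smooth_on UNIV \<psi>"
      by (rule smooth_on_local) (use 1 2 K(2) in blast)
    with z show ?thesis unfolding test_functions_in_def by blast
  qed
  define c where "c q = complex_of_real (weight (x, q) * cutoff (chord (x, q)))" for q
  define P where "P \<xi> = integral torus (\<lambda>q. c q * cis (rad (x, q) * (dirv (snd q) \<bullet> \<xi>)))" for \<xi>
  have sc: "smooth_on (disc \<times> UNIV) (\<lambda>p. complex_of_real (weight p * cutoff (chord p)))"
    by (intro smooth_on_of_real smooth_on_mult smooth_on_weight open_disc_UNIV
        smooth_on_compose_UNIV[OF open_disc_UNIV smooth_on_cutoff smooth_on_chord])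
  have cc: "continuous_on UNIV c"
    unfolding c_def by (rule continuous_on_slice[OF smooth_on_continuous_on[OF sc] x])
  have cch: "continuous_on UNIV (\<lambda>q. chord (x, q))"
    by (rule continuous_on_slice[OF smooth_on_continuous_on[OF smooth_on_chord] x])
  have a: "transpose_amplitude normal_symbol ((x, y), \<xi>) * \<phi> y = P \<xi> * \<psi> y" for y \<xi>
  proof -
    have "transpose_amplitude normal_symbol ((x, y), \<xi>)
        = integral torus (\<lambda>q. complex_of_real (inverse (cutoff y)) * (c q * cis (rad (x, q) * (dirv (snd q) \<bullet> \<xi>))))"
      by (simp add: transpose_amplitude_def phase.osc_def amplitude_def phase_fn_def c_def field_simps)
    also have "\<dots> = complex_of_real (inverse (cutoff y)) * P \<xi>"
      unfolding P_def by (rule integral_mult_right)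
    finally show ?thesis by (simp add: \<psi>_def)
  qed
  have cP: "cis (x \<bullet> \<xi>) * P \<xi> = integral torus (\<lambda>q. c q * cis (chord (x, q) \<bullet> \<xi>))" for \<xi>
  proof -
    have "cis (x \<bullet> \<xi>) * P \<xi> = integral torus (\<lambda>q. cis (x \<bullet> \<xi>) * (c q * cis (rad (x, q) * (dirv (snd q) \<bullet> \<xi>))))"
      unfolding P_def by (rule integral_mult_right[symmetric])
    then show ?thesis by (simp add: chord_def inner_add_left cis_mult[symmetric] mult_ac)
  qed
  have "(LINT y|lborel. cis ((x - y) \<bullet> \<xi>) * transpose_amplitude normal_symbol ((x, y), \<xi>) * \<phi> y)
      = integral torus (\<lambda>q. c q * cis (chord (x, q) \<bullet> \<xi>)) * fourier \<psi> \<xi>" for \<xi>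
  proof -
    have "cis ((x - y) \<bullet> \<xi>) * transpose_amplitude normal_symbol ((x, y), \<xi>) * \<phi> y
        = (cis (x \<bullet> \<xi>) * P \<xi>) * (cis (- (y \<bullet> \<xi>)) * \<psi> y)" for y
      unfolding mult.assoc a
      by (simp add: inner_diff_left cis_mult[of "x \<bullet> \<xi>" "- (y \<bullet> \<xi>)", simplified, symmetric] mult_ac)
    then show ?thesis by (simp add: fourier_def cP)
  qed
  then have "pseudodiff (transpose_amplitude normal_symbol) \<phi> x
      = complex_of_real (1 / (2 * pi)\<^sup>2) * (LINT \<xi>|lborel. integral torus (\<lambda>q. c q * cis (chord (x, q) \<bullet> \<xi>)) * fourier \<psi> \<xi>)"
    by (simp add: pseudodiff_def)
  also have "\<dots> = integral torus (\<lambda>q. c q * \<psi> (chord (x, q)))"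
    unfolding fourier_inversion_average[OF \<psi> K(1) cc cch] by simp
  also have "\<dots> = normal_average \<phi> x"
  proof -
    have "c q * \<psi> (chord (x, q)) = complex_of_real (weight (x, q)) * \<phi> (chord (x, q))" for q
      using cutoff_pos_iff[of "chord (x, q)"] \<phi>0[of "chord (x, q)"] by (cases "chord (x, q) \<in> disc") (auto simp: c_def \<psi>_def)
    then show ?thesis by (simp add: average_def)
  qed
  finally show ?thesis .
qed

lemma normal_average_linear:
  assumes "smooth_on UNIV \<phi>" "smooth_on UNIV \<psi>" "x \<in> disc"
  shows "normal_average (\<lambda>y. \<phi> y + \<psi> y) x = normal_average \<phi> x + normal_average \<psi> x"
    and "normal_average (\<lambda>y. k * \<phi> y) x = k * normal_average \<phi> x"
proof -
  show "normal_average (\<lambda>y. \<phi> y + \<psi> y) x = normal_average \<phi> x + normal_average \<psi> x"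
    unfolding average_def distrib_left
    by (rule Henstock_Kurzweil_Integration.integral_add[OF average_integrable average_integrable])
      (use assms smooth_on_complex_weight in auto)
  show "normal_average (\<lambda>y. k * \<phi> y) x = k * normal_average \<phi> x"
    unfolding average_def by (subst integral_mult_right[symmetric]) (simp add: mult_ac)
qed

text \<open>On the disc the backprojection of the Radon transform, the chord average and the
  transposed operator coincide, which is all that \<open>u\<close> sees. Continuity follows since
  the average does not raise the order of the seminorms.\<close>

lemma normal_distribution:
  assumes u: "u \<in> compact_distributions disc"
  shows "(\<lambda>\<phi>. u (backprojection \<alpha> w (elliptical_radon \<alpha> \<phi>))) \<in> distributions disc"
    and "\<phi> \<in> test_functions disc \<Longrightarrow>
      u (backprojection \<alpha> w (elliptical_radon \<alpha> \<phi>)) = pseudodiff_dist normal_symbol u \<phi>"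
proof -
  have sm: "smooth_on disc (normal_average \<phi>)" if "smooth_on UNIV \<phi>" for \<phi>
    by (rule average_smooth[OF smooth_on_complex_weight that])
  have P: "u (backprojection \<alpha> w (elliptical_radon \<alpha> \<phi>)) = u (normal_average \<phi>)" if "smooth_on UNIV \<phi>" for \<phi>
    using compact_distribution_cong[OF u open_ball sm[OF that]] backprojection_radon_average[OF that] by metis
  have tf: "smooth_on UNIV \<phi>" if "\<phi> \<in> test_functions disc" for \<phi>
    using that by (auto simp: test_functions_def test_functions_in_def)
  show "u (backprojection \<alpha> w (elliptical_radon \<alpha> \<phi>)) = pseudodiff_dist normal_symbol u \<phi>"
    if "\<phi> \<in> test_functions disc"
    unfolding P[OF tf[OF that]] pseudodiff_dist_def
    using compact_distribution_cong[OF u open_ball sm[OF tf[OF that]]] pseudodiff_normal[OF that] by metis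
  obtain K C N where K: "compact K" "K \<subseteq> disc" and uK: "\<And>f. smooth_on disc f \<Longrightarrow> norm (u f) \<le> C * Ck_norm N K f"
    using u unfolding compact_distributions_def by blast
  have lin: "u (\<lambda>x. f x + g x) = u f + u g" "u (\<lambda>x. k * f x) = k * u f"
    if "smooth_on disc f" "smooth_on disc g" for f g k
    using u that unfolding compact_distributions_def linear_functional_on_def by auto
  have "linear_functional_on (test_functions disc) (\<lambda>\<phi>. u (backprojection \<alpha> w (elliptical_radon \<alpha> \<phi>)))"
    unfolding linear_functional_on_def
  proof (intro conjI ballI allI)
    fix \<phi> \<psi> :: "real^2 \<Rightarrow> complex" and k assume "\<phi> \<in> test_functions disc"
    note \<phi> = tf[OF this]
    show "u (backprojection \<alpha> w (elliptical_radon \<alpha> (\<lambda>x. k * \<phi> x))) = k * u (backprojection \<alpha> w (elliptical_radon \<alpha> \<phi>))"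
    proof -
      have s: "smooth_on UNIV (\<lambda>x. k * \<phi> x)" by (intro smooth_on_mult smooth_on_const \<phi> open_UNIV)
      have "u (normal_average (\<lambda>x. k * \<phi> x)) = u (\<lambda>x. k * normal_average \<phi> x)"
        by (rule compact_distribution_cong[OF u open_ball sm[OF s] normal_average_linear(2)[OF \<phi> \<phi>]])
      then show ?thesis unfolding P[OF s] P[OF \<phi>] lin(2)[OF sm[OF \<phi>] sm[OF \<phi>]] .
    qed
    assume "\<psi> \<in> test_functions disc"
    note \<psi> = tf[OF this]
    have s: "smooth_on UNIV (\<lambda>x. \<phi> x + \<psi> x)" by (intro smooth_on_add \<phi> \<psi> open_UNIV)
    have "u (normal_average (\<lambda>x. \<phi> x + \<psi> x)) = u (\<lambda>x. normal_average \<phi> x + normal_average \<psi> x)"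
      by (rule compact_distribution_cong[OF u open_ball sm[OF s] normal_average_linear(1)[OF \<phi> \<psi>]])
    then show "u (backprojection \<alpha> w (elliptical_radon \<alpha> (\<lambda>x. \<phi> x + \<psi> x)))
        = u (backprojection \<alpha> w (elliptical_radon \<alpha> \<phi>)) + u (backprojection \<alpha> w (elliptical_radon \<alpha> \<psi>))"
      unfolding P[OF s] P[OF \<phi>] P[OF \<psi>] lin(1)[OF sm[OF \<phi>] sm[OF \<psi>]] .
  qed
  moreover have "\<exists>C N. \<forall>\<phi>\<in>test_functions_in K'. norm (u (backprojection \<alpha> w (elliptical_radon \<alpha> \<phi>))) \<le> C * Ck_norm N K' \<phi>"
    if K': "compact K'" for K'
  proof -
    define V where "V = {vs. set vs \<subseteq> (Basis :: (real^2) set) \<and> length vs \<le> N}"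
    have fin: "finite V" unfolding V_def by (rule finite_lists_length_le[OF finite_Basis])
    have "\<forall>us\<in>V. \<exists>C\<ge>0. \<forall>K' \<phi>. compact K' \<and> \<phi> \<in> test_functions_in K' \<longrightarrow>
        (\<forall>x\<in>K. norm (iter_deriv us (normal_average (iter_deriv [] \<phi>)) x) \<le> C * Ck_norm N K' \<phi>)"
      by (intro ballI average_iter_deriv_bound smooth_on_complex_weight K) (auto simp: V_def)
    then obtain D where "\<forall>us\<in>V. D us \<ge> 0 \<and> (\<forall>K' \<phi>. compact K' \<and> \<phi> \<in> test_functions_in K' \<longrightarrow>
        (\<forall>x\<in>K. norm (iter_deriv us (normal_average (iter_deriv [] \<phi>)) x) \<le> D us * Ck_norm N K' \<phi>))"
      unfolding bchoice_iff by (rule exE) blast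
    with K' have D: "\<And>us. us \<in> V \<Longrightarrow> D us \<ge> 0" "\<And>us \<phi> x. us \<in> V \<Longrightarrow> \<phi> \<in> test_functions_in K' \<Longrightarrow> x \<in> K \<Longrightarrow>
        norm (iter_deriv us (normal_average \<phi>) x) \<le> D us * Ck_norm N K' \<phi>"
      by auto
    have "norm (u (backprojection \<alpha> w (elliptical_radon \<alpha> \<phi>))) \<le> (\<bar>C\<bar> * sum D V) * Ck_norm N K' \<phi>"
      if \<phi>: "\<phi> \<in> test_functions_in K'" for \<phi>
    proof -
      have s: "smooth_on UNIV \<phi>" using \<phi> by (simp add: test_functions_in_def)
      note nn = Ck_norm_nonneg[OF open_UNIV s K' subset_UNIV, of N]
      have le: "Ck_norm N K (normal_average \<phi>) \<le> sum D V * Ck_norm N K' \<phi>"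
      proof (rule Ck_norm_le)
        fix us :: "(real^2) list" and x assume *: "us \<in> lists Basis" "length us \<le> N" "x \<in> K"
        then have V: "us \<in> V" by (auto simp: V_def)
        have "D us * Ck_norm N K' \<phi> \<le> sum D V * Ck_norm N K' \<phi>"
          by (intro mult_right_mono nn member_le_sum V D fin) auto
        then show "norm (iter_deriv us (normal_average \<phi>) x) \<le> sum D V * Ck_norm N K' \<phi>"
          using D(2)[OF V \<phi> *(3)] by linarith
      qed (intro mult_nonneg_nonneg sum_nonneg nn D)
      have bdd: "0 \<le> Ck_norm N K (normal_average \<phi>)"
        by (rule Ck_norm_nonneg[OF open_ball sm[OF s] K])
      have "norm (u (backprojection \<alpha> w (elliptical_radon \<alpha> \<phi>))) \<le> C * Ck_norm N K (normal_average \<phi>)"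
        unfolding P[OF s] by (rule uK[OF sm[OF s]])
      also have "\<dots> \<le> \<bar>C\<bar> * Ck_norm N K (normal_average \<phi>)" by (intro mult_right_mono bdd) simp
      also have "\<dots> \<le> \<bar>C\<bar> * (sum D V * Ck_norm N K' \<phi>)" by (intro mult_left_mono le) simp
      finally show ?thesis by (simp only: mult.assoc)
    qed
    then show ?thesis by blast
  qed
  ultimately show "(\<lambda>\<phi>. u (backprojection \<alpha> w (elliptical_radon \<alpha> \<phi>))) \<in> distributions disc"
    by (simp add: distributions_def)
qed

end

theorem corollary3p1:
  fixes \<alpha> b :: real and w :: "(real^2) \<times> real \<Rightarrow> real"
  assumes "0 < \<alpha>" "\<alpha> < pi / 2"
    and "b = cos \<alpha>"
    and "adjoint_density \<alpha> (ball 0 b) w"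
  shows "elliptic_pseudodiff_operator (ball 0 b) (-1)
           (\<lambda>u. backprojection_dist \<alpha> (radon_dist \<alpha> w u))"
proof -
  interpret weighted_acquisition \<alpha> w
    by unfold_locales (use assms in \<open>auto simp: adjoint_density_def\<close>)
  have "is_pseudodiff_with disc (-1) normal_symbol (\<lambda>u. backprojection_dist \<alpha> (radon_dist \<alpha> w u))"
    unfolding is_pseudodiff_with_def backprojection_dist_def radon_dist_def
    using symbol_normal normal_distribution by blast
  then show ?thesis
    unfolding elliptic_pseudodiff_operator_def assms(3) using elliptic_normal by blast
qed

end
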